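(* Let $m\ge 1$ be an integer. There is an explicit $1$-parameter family of $U(2)$-invariant Bach-flat Kähler metrics on the total space of $\mathcal{O}(-m)\to\mathbb{CP}^1$. When such a metric is complete, it has either exponential volume growth, or quartic volume growth, or finite volume. On the other hand, if the metric is incomplete, it either extends as a metric on the Hirzebruch surface $\mathbb{H}_m=\mathbb{P}(\mathcal{O}\oplus\mathcal{O}(-m))$ with a cone angle along the $\mathbb{CP}^1$ at infinity, or it develops another singular behaviour. Furthermore, all such behaviours occur, and any $U(2)$-invariant Bach-flat Kähler metric on $\mathcal{O}(-m)$ is one of these.
   Context: The parameter count is up to scaling of the metric. "Another singular behaviour" means that the metric is incomplete and does not extend to $\mathbb{H}_m$ with a cone angle in the sense described below. Coordinates. Write $r=x_1+x_2$. Let $a>0$ and $\mathcal{P}_{\mathcal O}=\{x_1,x_2\ge 0,\ x_1+x_2\ge a\}$, and for $b>a$ let $\mathcal{P}_H=\{x_1,x_2\ge0,\ a\le x_1+x_2\le b\}$. Let $\Lambda\subset\mathbb{R}^2$ be the lattice generated by $(1,0),(0,1),(1/m,1/m)$. The total space of $\mathcal{O}(-m)$ (resp. $\mathbb{H}_m$) carries a Hamiltonian $\mathbb{T}^2$-action whose moment map, after a linear change of coordinates, has image $\mathcal{P}_{\mathcal O}$ (resp. $\mathcal{P}_H$); over the interior of this polygon the manifold is identified with (interior)$\times \mathbb{R}^2/2\pi\Lambda$ with coordinates $(x_1,x_2,\theta_1,\theta_2)$ and symplectic form $dx_1\wedge d\theta_1+dx_2\wedge d\theta_2$. The edge $r=a$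 corresponds to the zero section and, for $\mathbb{H}_m$, the edge $r=b$ to the divisor at infinity $S_b\cong\mathbb{CP}^1$. For any $b>a$ the region $a\le r<b$ is also identified with the total space of $\mathcal{O}(-m)$. A $U(2)$-invariant Kähler metric is a metric $g_u=\sum_{i,j}(u_{ij}\,dx_i\,dx_j+u^{ij}\,d\theta_i\,d\theta_j)$, where $(u_{ij})=\mathrm{Hess}(u)$ is positive definite, $(u^{ij})$ is its inverse, $u=\tfrac12\big(x_1\log x_1+x_2\log x_2+h(x_1+x_2)\big)$, and $h''(r)-\frac{1}{m(r-a)}$ is smooth up to $r=a$. Such a metric near the zero section is considered on its maximal domain of definition $a\le r<b^*\le\infty$. It extends to $\mathbb{H}_m$ with cone angle $2\pi/p$ ($p>0$) along $S_b$, $b=b^*<\infty$, if $h''(r)-\frac1m\big(\frac1{r-a}+\frac{p}{b-r}\big)$ is smooth on $[a,b]$. Bach-flat means that the Bach tensor $B_{ij}=\nabla^k\nabla^lW_{kijl}+\frac12R^{kl}W_{kijl}$ vanishes, where $W$ is the Weyl tensor and $R^{kl}$ the Ricci tensor. Let $B_R$ be the ball of radius $R$ about a fixed point: quartic volume growth means $\mathrm{Vol}(B_R)$ is bounded above and below by positive multiples of $R^4$ for large $R$; exponential volume growth means it is bounded above and below by positive multiples of exponentials $e^{cR}$ with constants $c>0$.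
   Formalization: "All such behaviours occur" fails for fixed m, so each is asserted for exactly the m where it occurs: exponential growth for m ≥ 3, complete finite volume for m = 1, cone-angle extension for m ≠ 2, quartic growth and other singular behaviour for every m. *)

theory Defs
  imports "HOL-Analysis.Analysis"
begin

section \<open>Riemannian geometry in a coordinate chart\<close>

definition coord_deriv :: "'n::finite \<Rightarrow> (real ^ 'n \<Rightarrow> real) \<Rightarrow> real ^ 'n \<Rightarrow> real" where
  "coord_deriv i f p = deriv (\<lambda>s. f (p + s *\<^sub>R axis i 1)) 0"

definition christoffel ::
  "(real ^ 'n \<Rightarrow> real ^ 'n ^ 'n) \<Rightarrow> 'n::finite \<Rightarrow> 'n \<Rightarrow> 'n \<Rightarrow> real ^ 'n \<Rightarrow> real" where
  "christoffel g k i j p =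
     (\<Sum>l\<in>UNIV. matrix_inv (g p) $ k $ l *
        (coord_deriv i (\<lambda>q. g q $ j $ l) p + coord_deriv j (\<lambda>q. g q $ i $ l) p
          - coord_deriv l (\<lambda>q. g q $ i $ j) p)) / 2"

text \<open>\<open>riemann_up g i j k l\<close> is the component of $R(\partial_i,\partial_j)\partial_k$ along
  $\partial_l$, with $R(X,Y) = [\nabla_X,\nabla_Y] - \nabla_{[X,Y]}$.  Hence
  $R_{ijkl} = g(R(\partial_i,\partial_j)\partial_k,\partial_l)$ and $R_{jk} = g^{il}R_{ijkl}$,
  which is positive on round spheres.\<close>

definition riemann_up ::
  "(real ^ 'n \<Rightarrow> real ^ 'n ^ 'n) \<Rightarrow> 'n::finite \<Rightarrow> 'n \<Rightarrow> 'n \<Rightarrow> 'n \<Rightarrow> real ^ 'n \<Rightarrow> real" where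
  "riemann_up g i j k l p =
     coord_deriv i (christoffel g l j k) p - coord_deriv j (christoffel g l i k) p
     + (\<Sum>s\<in>UNIV. christoffel g l i s p * christoffel g s j k p
                   - christoffel g l j s p * christoffel g s i k p)"

definition riemann ::
  "(real ^ 'n \<Rightarrow> real ^ 'n ^ 'n) \<Rightarrow> 'n::finite \<Rightarrow> 'n \<Rightarrow> 'n \<Rightarrow> 'n \<Rightarrow> real ^ 'n \<Rightarrow> real" where
  "riemann g i j k l p = (\<Sum>s\<in>UNIV. riemann_up g i j k s p * g p $ s $ l)"

definition ricci ::
  "(real ^ 'n \<Rightarrow> real ^ 'n ^ 'n) \<Rightarrow> 'n::finite \<Rightarrow> 'n \<Rightarrow> real ^ 'n \<Rightarrow> real" where
  "ricci g j k p = (\<Sum>i\<in>UNIV. riemann_up g i j k i p)"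

definition scal :: "(real ^ 'n \<Rightarrow> real ^ 'n ^ 'n) \<Rightarrow> real ^ ('n::finite) \<Rightarrow> real" where
  "scal g p = (\<Sum>i\<in>UNIV. \<Sum>j\<in>UNIV. matrix_inv (g p) $ i $ j * ricci g i j p)"

definition weyl ::
  "(real ^ 'n \<Rightarrow> real ^ 'n ^ 'n) \<Rightarrow> 'n::finite \<Rightarrow> 'n \<Rightarrow> 'n \<Rightarrow> 'n \<Rightarrow> real ^ 'n \<Rightarrow> real" where
  "weyl g i j k l p =
     riemann g i j k l p
     - (ricci g i l p * g p $ j $ k + ricci g j k p * g p $ i $ l
        - ricci g i k p * g p $ j $ l - ricci g j l p * g p $ i $ k) / (real CARD('n) - 2)
     + scal g p * (g p $ i $ l * g p $ j $ k - g p $ i $ k * g p $ j $ l)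
        / ((real CARD('n) - 1) * (real CARD('n) - 2))"

text \<open>A covariant tensor is a family of component functions indexed by lists of coordinate
  indices.  The covariant derivative puts the differentiation index in front.\<close>

type_synonym 'n tensor = "'n list \<Rightarrow> real ^ 'n \<Rightarrow> real"

definition cov_deriv :: "(real ^ 'n \<Rightarrow> real ^ 'n ^ 'n) \<Rightarrow> ('n::finite) tensor \<Rightarrow> 'n tensor" where
  "cov_deriv g T idx p =
     coord_deriv (hd idx) (T (tl idx)) p
     - (\<Sum>s<length (tl idx). \<Sum>k\<in>UNIV.
          christoffel g k (hd idx) (tl idx ! s) p * T ((tl idx)[s := k]) p)"

definition weyl_tensor :: "(real ^ 'n \<Rightarrow> real ^ 'n ^ 'n) \<Rightarrow> ('n::finite) tensor" where
  "weyl_tensor g idx = weyl g (idx ! 0) (idx ! 1) (idx ! 2) (idx ! 3)"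

text \<open>$B_{ij} = \nabla^k\nabla^l W_{kijl} + \frac12 R^{kl}W_{kijl}$.\<close>

definition bach ::
  "(real ^ 'n \<Rightarrow> real ^ 'n ^ 'n) \<Rightarrow> 'n::finite \<Rightarrow> 'n \<Rightarrow> real ^ 'n \<Rightarrow> real" where
  "bach g i j p =
     (\<Sum>k\<in>UNIV. \<Sum>l\<in>UNIV. \<Sum>q\<in>UNIV. \<Sum>s\<in>UNIV.
        matrix_inv (g p) $ k $ q * matrix_inv (g p) $ l $ s *
        (cov_deriv g (cov_deriv g (weyl_tensor g)) [q, s, k, i, j, l] p
         + ricci g q s p * weyl g k i j l p / 2))"

section \<open>Smooth functions of one variable\<close>

text \<open>The set \<open>U\<close> is meant to be open.\<close>

definition smooth_on :: "real set \<Rightarrow> (real \<Rightarrow> real) \<Rightarrow> bool" where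
  "smooth_on U f \<longleftrightarrow> (\<forall>k. \<forall>x\<in>U. (deriv ^^ k) f field_differentiable at x)"

text \<open>A function given on the interior of the interval \<open>I\<close> is smooth on \<open>I\<close>, i.e. up to those
  endpoints that belong to \<open>I\<close>; its own values at the endpoints are disregarded.\<close>

definition smooth_up_to :: "real set \<Rightarrow> (real \<Rightarrow> real) \<Rightarrow> bool" where
  "smooth_up_to I f \<longleftrightarrow>
     (\<exists>U G. open U \<and> I \<subseteq> U \<and> smooth_on U G \<and> (\<forall>r\<in>interior I. G r = f r))"

section \<open>$U(2)$-invariant metrics in action-angle coordinates\<close>

text \<open>A point \<open>p\<close> has action coordinates $x_i$ = \<open>p $ Inl i\<close> and angle coordinates
  $\theta_i$ = \<open>p $ Inr i\<close>.\<close>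

type_synonym action_angle = "real ^ (2 + 2)"

definition act :: "action_angle \<Rightarrow> real ^ 2" where
  "act p = (\<chi> i. p $ Inl i)"

definition ang :: "action_angle \<Rightarrow> real ^ 2" where
  "ang p = (\<chi> i. p $ Inr i)"

text \<open>The polygon $a \le r < b$, $b \le \infty$, and its interior.\<close>

definition polygon :: "real \<Rightarrow> ereal \<Rightarrow> (real ^ 2) set" where
  "polygon a b = {x. 0 \<le> x $ 1 \<and> 0 \<le> x $ 2 \<and> a \<le> x $ 1 + x $ 2 \<and> ereal (x $ 1 + x $ 2) < b}"

definition int_polygon :: "real \<Rightarrow> ereal \<Rightarrow> (real ^ 2) set" where
  "int_polygon a b = {x. 0 < x $ 1 \<and> 0 < x $ 2 \<and> a < x $ 1 + x $ 2 \<and> ereal (x $ 1 + x $ 2) < b}"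

definition sympl_pot :: "(real \<Rightarrow> real) \<Rightarrow> real ^ 2 \<Rightarrow> real" where
  "sympl_pot h x = (x $ 1 * ln (x $ 1) + x $ 2 * ln (x $ 2) + h (x $ 1 + x $ 2)) / 2"

definition hessian :: "(real ^ 'n \<Rightarrow> real) \<Rightarrow> real ^ 'n \<Rightarrow> real ^ 'n ^ ('n::finite)" where
  "hessian f x = (\<chi> i j. coord_deriv i (coord_deriv j f) x)"

definition pos_def :: "real ^ 'n ^ ('n::finite) \<Rightarrow> bool" where
  "pos_def A \<longleftrightarrow> (\<forall>v. v \<noteq> 0 \<longrightarrow> 0 < v \<bullet> (A *v v))"

definition toric_metric :: "(real \<Rightarrow> real) \<Rightarrow> action_angle \<Rightarrow> real ^ (2 + 2) ^ (2 + 2)" where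
  "toric_metric h p = (\<chi> I J. case (I, J) of
       (Inl i, Inl j) \<Rightarrow> hessian (sympl_pot h) (act p) $ i $ j
     | (Inr i, Inr j) \<Rightarrow> matrix_inv (hessian (sympl_pot h) (act p)) $ i $ j
     | _ \<Rightarrow> 0)"

definition u2_kaehler :: "nat \<Rightarrow> real \<Rightarrow> ereal \<Rightarrow> (real \<Rightarrow> real) \<Rightarrow> bool" where
  "u2_kaehler m a b h \<longleftrightarrow>
     ereal a < b \<and>
     smooth_on {r. a < r \<and> ereal r < b} h \<and>
     (\<forall>x\<in>int_polygon a b. pos_def (hessian (sympl_pot h) x)) \<and>
     smooth_up_to {r. a \<le> r \<and> ereal r < b}
       (\<lambda>r. (deriv ^^ 2) h r - 1 / (real m * (r - a)))"

definition u2_kaehler_maximal :: "nat \<Rightarrow> real \<Rightarrow> ereal \<Rightarrow> (real \<Rightarrow> real) \<Rightarrow> bool" where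
  "u2_kaehler_maximal m a b h \<longleftrightarrow>
     u2_kaehler m a b h \<and>
     \<not> (\<exists>b' h'. b < b' \<and> u2_kaehler m a b' h' \<and> (\<forall>r. a < r \<and> ereal r < b \<longrightarrow> h' r = h r))"

text \<open>The Bach tensor is continuous on the total space, so it vanishes as soon as it vanishes on
  the dense open set where the action-angle coordinates are defined.\<close>

definition bach_flat :: "real \<Rightarrow> ereal \<Rightarrow> (real \<Rightarrow> real) \<Rightarrow> bool" where
  "bach_flat a b h \<longleftrightarrow>
     (\<forall>p. act p \<in> int_polygon a b \<longrightarrow> (\<forall>i j. bach (toric_metric h) i j p = 0))"

definition cone_extension :: "nat \<Rightarrow> real \<Rightarrow> ereal \<Rightarrow> (real \<Rightarrow> real) \<Rightarrow> real \<Rightarrow> bool" where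
  "cone_extension m a b h p \<longleftrightarrow>
     (\<exists>c. b = ereal c \<and>
        smooth_up_to {a..c} (\<lambda>r. (deriv ^^ 2) h r - 1 / real m * (1 / (r - a) + p / (c - r))))"

section \<open>The total space as a metric measure space\<close>

text \<open>Points of the total space over $a \le r < b$ are represented by pairs $(x,\theta)$ with
  \<open>x \<in> polygon a b\<close>.  Two pairs represent the same point if they have the same \<open>x\<close> and their
  angles differ by an element of $2\pi\Lambda$ and of the Lie algebra of the stabiliser, which is
  spanned by $(1,0)$, $(0,1)$, $(1,1)$ on the edges $x_1 = 0$, $x_2 = 0$, $r = a$ respectively.\<close>

definition same_point :: "nat \<Rightarrow> real \<Rightarrow> action_angle \<Rightarrow> action_angle \<Rightarrow> bool" where
  "same_point m a p q \<longleftrightarrow>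
     act p = act q \<and>
     (\<exists>(k1::int) (k2::int) (k3::int) (c1::real) (c2::real) (c3::real).
        (c1 \<noteq> 0 \<longrightarrow> act p $ 1 = 0) \<and> (c2 \<noteq> 0 \<longrightarrow> act p $ 2 = 0) \<and>
        (c3 \<noteq> 0 \<longrightarrow> act p $ 1 + act p $ 2 = a) \<and>
        ang p $ 1 - ang q $ 1 = 2 * pi * (k1 + k3 / real m) + c1 + c3 \<and>
        ang p $ 2 - ang q $ 2 = 2 * pi * (k2 + k3 / real m) + c2 + c3)"

text \<open>\<open>arc_of_length a b h \<gamma> L\<close>: a curve of length \<open>L\<close> which, except possibly at its ends, is \<open>C\<^sup>1\<close> and stays in
  the region where the coordinates are defined.\<close>

definition arc_of_length ::
  "real \<Rightarrow> ereal \<Rightarrow> (real \<Rightarrow> real) \<Rightarrow> (real \<Rightarrow> action_angle) \<Rightarrow> real \<Rightarrow> bool" where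
  "arc_of_length a b h \<gamma> L \<longleftrightarrow>
     continuous_on {0..1} \<gamma> \<and> \<gamma> C1_differentiable_on {0<..<1} \<and>
     act (\<gamma> 0) \<in> polygon a b \<and> act (\<gamma> 1) \<in> polygon a b \<and>
     (\<forall>s\<in>{0<..<1}. act (\<gamma> s) \<in> int_polygon a b) \<and>
     ((\<lambda>s. sqrt (vector_derivative \<gamma> (at s) \<bullet>
              (toric_metric h (\<gamma> s) *v vector_derivative \<gamma> (at s)))) has_integral L) {0..1}"

text \<open>Piecewise \<open>C\<^sup>1\<close> curves in the total space are concatenations of such arcs.  Curves running
  inside the edges of the polygon are not needed to compute the Riemannian distance, since the
  edges correspond to submanifolds of codimension at least two.\<close>

inductive joined ::
  "nat \<Rightarrow> real \<Rightarrow> ereal \<Rightarrow> (real \<Rightarrow> real) \<Rightarrow> action_angle \<Rightarrow> action_angle \<Rightarrow> real \<Rightarrow> bool"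
  for m a b h where
  start: "same_point m a p q \<Longrightarrow> joined m a b h p q 0"
| glue: "joined m a b h p q L \<Longrightarrow> same_point m a q q' \<Longrightarrow> joined m a b h p q' L"
| append: "joined m a b h p (\<gamma> 0) L \<Longrightarrow> arc_of_length a b h \<gamma> L' \<Longrightarrow>
    joined m a b h p (\<gamma> 1) (L + L')"

definition riem_dist ::
  "nat \<Rightarrow> real \<Rightarrow> ereal \<Rightarrow> (real \<Rightarrow> real) \<Rightarrow> action_angle \<Rightarrow> action_angle \<Rightarrow> real" where
  "riem_dist m a b h p q = Inf {L. joined m a b h p q L}"

definition complete_metric :: "nat \<Rightarrow> real \<Rightarrow> ereal \<Rightarrow> (real \<Rightarrow> real) \<Rightarrow> bool" where
  "complete_metric m a b h \<longleftrightarrow>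
     (\<forall>\<sigma> :: nat \<Rightarrow> action_angle.
        (\<forall>n. act (\<sigma> n) \<in> polygon a b) \<and>
        (\<forall>\<epsilon>>0. \<exists>N. \<forall>n\<ge>N. \<forall>n'\<ge>N. riem_dist m a b h (\<sigma> n) (\<sigma> n') < \<epsilon>) \<longrightarrow>
        (\<exists>q. act q \<in> polygon a b \<and> (\<lambda>n. riem_dist m a b h (\<sigma> n) q) \<longlonglongrightarrow> 0))"

text \<open>A fundamental domain of $2\pi\Lambda$ for the basis $(1/m,1/m)$, $(0,1)$ of $\Lambda$.\<close>

definition fund_domain :: "nat \<Rightarrow> (real ^ 2) set" where
  "fund_domain m = {\<theta>. \<exists>s\<in>{0..<1}. \<exists>t\<in>{0..<1}.
     \<theta> $ 1 = 2 * pi * (s / real m) \<and> \<theta> $ 2 = 2 * pi * (t + s / real m)}"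

text \<open>The Riemannian volume of a set of points of the total space; the complement of the
  coordinate domain has measure zero.\<close>

definition riem_vol :: "nat \<Rightarrow> real \<Rightarrow> ereal \<Rightarrow> (real \<Rightarrow> real) \<Rightarrow> action_angle set \<Rightarrow> ennreal" where
  "riem_vol m a b h S =
     (\<integral>\<^sup>+ p \<in> {p \<in> S. act p \<in> int_polygon a b \<and> ang p \<in> fund_domain m}.
        ennreal (sqrt (det (toric_metric h p))) \<partial>lborel)"

definition riem_ball ::
  "nat \<Rightarrow> real \<Rightarrow> ereal \<Rightarrow> (real \<Rightarrow> real) \<Rightarrow> action_angle \<Rightarrow> real \<Rightarrow> action_angle set" where
  "riem_ball m a b h p R = {q. act q \<in> polygon a b \<and> riem_dist m a b h p q < R}"

definition quartic_volume_growth :: "nat \<Rightarrow> real \<Rightarrow> ereal \<Rightarrow> (real \<Rightarrow> real) \<Rightarrow> bool" where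
  "quartic_volume_growth m a b h \<longleftrightarrow>
     (\<forall>p. act p \<in> polygon a b \<longrightarrow>
       (\<exists>C1>0. \<exists>C2>0. \<exists>R0. \<forall>R\<ge>R0.
          ennreal (C1 * R ^ 4) \<le> riem_vol m a b h (riem_ball m a b h p R) \<and>
          riem_vol m a b h (riem_ball m a b h p R) \<le> ennreal (C2 * R ^ 4)))"

definition exponential_volume_growth :: "nat \<Rightarrow> real \<Rightarrow> ereal \<Rightarrow> (real \<Rightarrow> real) \<Rightarrow> bool" where
  "exponential_volume_growth m a b h \<longleftrightarrow>
     (\<forall>p. act p \<in> polygon a b \<longrightarrow>
       (\<exists>C1>0. \<exists>C2>0. \<exists>c1>0. \<exists>c2>0. \<exists>R0. \<forall>R\<ge>R0.
          ennreal (C1 * exp (c1 * R)) \<le> riem_vol m a b h (riem_ball m a b h p R) \<and>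
          riem_vol m a b h (riem_ball m a b h p R) \<le> ennreal (C2 * exp (c2 * R))))"

definition finite_volume :: "nat \<Rightarrow> real \<Rightarrow> ereal \<Rightarrow> (real \<Rightarrow> real) \<Rightarrow> bool" where
  "finite_volume m a b h \<longleftrightarrow> riem_vol m a b h {p. act p \<in> polygon a b} < \<infinity>"

definition other_singular_behaviour :: "nat \<Rightarrow> real \<Rightarrow> ereal \<Rightarrow> (real \<Rightarrow> real) \<Rightarrow> bool" where
  "other_singular_behaviour m a b h \<longleftrightarrow>
     \<not> complete_metric m a b h \<and> \<not> (\<exists>p>0. cone_extension m a b h p)"

section \<open>The explicit family\<close>

text \<open>
  Write $\rho = r/a$ and $1 + r h''(r) = \rho^2/P(\rho)$.  The metric is extremal iff
  $P = \alpha\rho^4 + \beta\rho^3 + \rho^2 + \gamma\rho + \delta$, with scalar curvature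
  $-12(2\alpha\rho + \beta)/a$, and it is then Bach-flat iff $\beta\gamma = 4\alpha\delta$.
  The pole of $h''$ at the zero section forces $P(1) = 0$ and $P'(1) = m$.  These three
  equations describe a parabola in the space of coefficients, parametrised by
  $t = 2\alpha + \beta$; so $-12t/a$ is the scalar curvature along the zero section.\<close>

definition fam_poly :: "nat \<Rightarrow> real \<Rightarrow> real \<Rightarrow> real" where
  "fam_poly m t \<rho> =
     (3 * t^2 - (real m - 2) * t) / (2 * real m) * \<rho> ^ 4
     + (2 * (real m - 1) * t - 3 * t^2) / real m * \<rho> ^ 3
     + \<rho> ^ 2
     + (real m - 2 + (3 * t^2 - (4 * real m - 2) * t) / real m) * \<rho>
     + (1 - real m + ((5 * real m - 2) * t - 3 * t^2) / (2 * real m))"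

definition fam_h2 :: "nat \<Rightarrow> real \<Rightarrow> real \<Rightarrow> real \<Rightarrow> real" where
  "fam_h2 m a t r = ((r / a)^2 / fam_poly m t (r / a) - 1) / r"

text \<open>The first zero of the denominator beyond the zero section, or $\infty$.\<close>

definition fam_end :: "nat \<Rightarrow> real \<Rightarrow> real \<Rightarrow> ereal" where
  "fam_end m a t = Inf {ereal r | r. a < r \<and> fam_poly m t (r / a) = 0}"

text \<open>The metric depends on \<open>h\<close> only through $h''$.\<close>

definition family_member :: "nat \<Rightarrow> real \<Rightarrow> real \<Rightarrow> (real \<Rightarrow> real) \<Rightarrow> bool" where
  "family_member m a t h \<longleftrightarrow>
     smooth_on {r. a < r \<and> ereal r < fam_end m a t} h \<and>
     (\<forall>r. a < r \<and> ereal r < fam_end m a t \<longrightarrow> (deriv ^^ 2) h r = fam_h2 m a t r)"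

text \<open>The dilation $(x,\theta) \mapsto (cx,\theta)$, a linear map in action-angle coordinates.\<close>

definition dilation :: "real \<Rightarrow> action_angle \<Rightarrow> action_angle" where
  "dilation c p = (\<chi> I. case I of Inl i \<Rightarrow> c * p $ Inl i | Inr i \<Rightarrow> p $ Inr i)"

end

theory Submission
  imports Defs
begin

text \<open>
  With $r = x_1 + x_2$, $z = x_1/r$ and the momentum profile $Q(r) = r^2/(1 + r h''(r))$, the metric
  is diagonal in an explicit coframe, in which the Bach-flat equation becomes two ordinary
  differential equations for $Q$.  One is linear and forces $Q$ to be a quartic polynomial with
  quadratic term $r^2$; the other one and the smoothness at the zero section leave one parameter.

  The radial length element is $\sqrt{r/2Q}\,dr$ and the volume element is $dx\,d\theta$.  Hence a
  function $T(r)$ with $|T'| \le \sqrt{r/2Q}$ bounds distances from below, while explicit paths,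
  composed of segments in $x$ and of segments in $\theta$, bound them from above.  So the behaviour at the
  end is decided by the vanishing order of $Q$ at a finite end (complete of finite volume for a double
  zero, a cone angle for a simple one), or by its degree at an infinite end: degree 2 gives
  quartic and degree 3 exponential volume growth, and degree 4 an incomplete metric.
\<close>

section \<open>Differentiation along the coordinate axes\<close>

text \<open>A direct expansion of the Bach tensor in the action-angle chart is out of reach: it
  involves four derivatives of the metric and sums over many indices. The coframe is kept orthogonal
  but not normalised, so that its squared norms stay rational in r and Q. Its connection
  coefficients are tabulated, not derived: the uniqueness of the Levi-Civita connection reduces
  their correctness to two first-order identities. All functions that occur depend on r and z alone,
  and the Weyl tensor is governed by two functions of r. In the global part the distance is an
  infimum over chains of curves that leave the chart at the edges, where the speed of a segment
  blows up like an inverse square root. No knowledge of geodesics enters; lengths are compared with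
  explicit primitives, from below by functions of r and from above along chosen paths.\<close>

definition cdiff :: "(real ^ 'n::finite \<Rightarrow> real) \<Rightarrow> real ^ 'n \<Rightarrow> bool" where
  "cdiff f p \<longleftrightarrow> (\<forall>i. (\<lambda>s. f (p + s *\<^sub>R axis i 1)) field_differentiable at 0)"

lemma cdiff_has_deriv:
  "cdiff f p \<Longrightarrow> ((\<lambda>s. f (p + s *\<^sub>R axis i 1)) has_field_derivative coord_deriv i f p) (at 0)"
  by (simp add: cdiff_def coord_deriv_def DERIV_deriv_iff_field_differentiable)

lemma cdiffI:
  assumes "\<And>i. ((\<lambda>s. f (p + s *\<^sub>R axis i 1)) has_field_derivative D i) (at 0)"
  shows "cdiff f p" "coord_deriv i f p = D i"
  using assms by (auto simp: cdiff_def coord_deriv_def field_differentiable_def intro: DERIV_imp_deriv)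

lemma eventually_axis:
  fixes p :: "real ^ 'n::finite"
  assumes "eventually P (nhds p)"
  shows "eventually (\<lambda>s. P (p + s *\<^sub>R axis i 1)) (nhds (0::real))"
proof -
  have "((\<lambda>s::real. p + s *\<^sub>R axis i 1) \<longlongrightarrow> p + 0 *\<^sub>R axis i 1) (nhds 0)"
    by (intro tendsto_intros filterlim_ident)
  then show ?thesis
    using assms by (simp add: filterlim_iff)
qed

lemma coord_deriv_cong:
  assumes "eventually (\<lambda>q. f q = g q) (nhds p)"
  shows "coord_deriv i f p = coord_deriv i g p"
  unfolding coord_deriv_def by (rule deriv_cong_ev[OF eventually_axis[OF assms] refl])

lemma cdiff_cong:
  assumes "eventually (\<lambda>q. f q = g q) (nhds p)" "cdiff g p"
  shows "cdiff f p"
  using assms(2) DERIV_cong_ev[OF refl eventually_axis[OF assms(1)] refl]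
  unfolding cdiff_def field_differentiable_def by metis

lemma cdiff_const [simp]: "cdiff (\<lambda>q. c) p" "coord_deriv i (\<lambda>q. c) p = 0"
  by (auto simp: cdiff_def coord_deriv_def)

text \<open>\<open>coord_deriv\<close> sees a function only along the axes, so differentiability
  along the axes is enough for the algebraic rules. As \<open>deriv\<close> has an unspecified value
  at points of non-differentiability, every rule carries \<open>cdiff\<close> for its
  arguments.\<close>

lemma
  assumes "cdiff f p" "cdiff g p"
  shows cdiff_add: "cdiff (\<lambda>q. f q + g q) p"
    and coord_deriv_add: "coord_deriv i (\<lambda>q. f q + g q) p = coord_deriv i f p + coord_deriv i g p"
    and cdiff_diff: "cdiff (\<lambda>q. f q - g q) p"
    and coord_deriv_diff: "coord_deriv i (\<lambda>q. f q - g q) p = coord_deriv i f p - coord_deriv i g p"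
    and cdiff_mult: "cdiff (\<lambda>q. f q * g q) p"
    and coord_deriv_mult:
      "coord_deriv i (\<lambda>q. f q * g q) p = coord_deriv i f p * g p + f p * coord_deriv i g p"
proof -
  note d = assms[THEN cdiff_has_deriv]
  show "cdiff (\<lambda>q. f q + g q) p" "coord_deriv i (\<lambda>q. f q + g q) p = coord_deriv i f p + coord_deriv i g p"
    using cdiffI[OF DERIV_add[OF d]] by auto
  show "cdiff (\<lambda>q. f q - g q) p" "coord_deriv i (\<lambda>q. f q - g q) p = coord_deriv i f p - coord_deriv i g p"
    using cdiffI[OF DERIV_diff[OF d]] by auto
  show "cdiff (\<lambda>q. f q * g q) p"
    "coord_deriv i (\<lambda>q. f q * g q) p = coord_deriv i f p * g p + f p * coord_deriv i g p"
    using cdiffI[OF DERIV_mult[OF d]] by (auto simp: mult.commute)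
qed

lemma
  assumes "cdiff f p"
  shows cdiff_minus: "cdiff (\<lambda>q. - f q) p"
    and coord_deriv_minus: "coord_deriv i (\<lambda>q. - f q) p = - coord_deriv i f p"
  using cdiffI[OF DERIV_minus[OF cdiff_has_deriv[OF assms]]] by auto

lemma
  assumes "\<And>k. k \<in> K \<Longrightarrow> cdiff (f k) p"
  shows cdiff_sum: "cdiff (\<lambda>q. \<Sum>k\<in>K. f k q) p"
    and coord_deriv_sum: "coord_deriv i (\<lambda>q. \<Sum>k\<in>K. f k q) p = (\<Sum>k\<in>K. coord_deriv i (f k) p)"
  using cdiffI[OF DERIV_sum[OF cdiff_has_deriv[OF assms]]] by auto

lemma cdiff_chain:
  assumes "cdiff f p" "(\<phi> has_field_derivative D) (at (f p))"
  shows "cdiff (\<lambda>q. \<phi> (f q)) p" "coord_deriv i (\<lambda>q. \<phi> (f q)) p = D * coord_deriv i f p"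
proof -
  have "((\<lambda>s. \<phi> (f (p + s *\<^sub>R axis j 1))) has_field_derivative D * coord_deriv j f p) (at 0)" for j
    by (rule DERIV_chain2[OF _ cdiff_has_deriv[OF assms(1)]]) (simp add: assms(2))
  from cdiffI[OF this] show "cdiff (\<lambda>q. \<phi> (f q)) p" "coord_deriv i (\<lambda>q. \<phi> (f q)) p = D * coord_deriv i f p"
    by auto
qed

section \<open>Tensors in a moving frame\<close>

text \<open>Passes from frame components to coordinate components of a covariant tensor. One coframe
  factor is contracted per index, and the remaining indices see \<open>\<tau>\<close> with its first
  slot frozen, which is the form that induction on the index list requires.\<close>

primrec expand :: "('f::finite \<Rightarrow> 'n::finite \<Rightarrow> real ^ 'n \<Rightarrow> real) \<Rightarrow> ('f list \<Rightarrow> real ^ 'n \<Rightarrow> real) \<Rightarrow>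
    'n list \<Rightarrow> real ^ 'n \<Rightarrow> real" where
  "expand \<theta> \<tau> [] p = \<tau> [] p"
| "expand \<theta> \<tau> (i # idx) p = (\<Sum>A\<in>UNIV. \<theta> A i p * expand \<theta> (\<lambda>B. \<tau> (A # B)) idx p)"

definition fderiv :: "('f::finite \<Rightarrow> 'n::finite \<Rightarrow> real ^ 'n \<Rightarrow> real) \<Rightarrow> 'f \<Rightarrow> (real ^ 'n \<Rightarrow> real) \<Rightarrow>
    real ^ 'n \<Rightarrow> real" where
  "fderiv e C f p = (\<Sum>c\<in>UNIV. e C c p * coord_deriv c f p)"

text \<open>Frame counterpart of \<open>cov_deriv\<close>: \<open>\<omega> D C B\<close> stands for
  the \<open>D\<close>-component of the covariant derivative of the frame vector \<open>B\<close> in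
  the direction \<open>C\<close>.\<close>

definition fnabla :: "('f::finite \<Rightarrow> 'n::finite \<Rightarrow> real ^ 'n \<Rightarrow> real) \<Rightarrow>
    ('f \<Rightarrow> 'f \<Rightarrow> 'f \<Rightarrow> real ^ 'n \<Rightarrow> real) \<Rightarrow>
    ('f list \<Rightarrow> real ^ 'n \<Rightarrow> real) \<Rightarrow> 'f list \<Rightarrow> real ^ 'n \<Rightarrow> real" where
  "fnabla e \<omega> \<tau> I p =
     fderiv e (hd I) (\<tau> (tl I)) p
     - (\<Sum>s<length (tl I). \<Sum>D\<in>UNIV. \<omega> D (hd I) (tl I ! s) p * \<tau> ((tl I)[s := D]) p)"

lemma expand_Nil: "expand \<theta> \<tau> [] = \<tau> []"
  by (rule ext) simp

lemma expand_Cons: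
  "expand \<theta> \<tau> (i # idx) = (\<lambda>p. \<Sum>A\<in>UNIV. \<theta> A i p * expand \<theta> (\<lambda>B. \<tau> (A # B)) idx p)"
  by (rule ext) simp

lemma expand_cong:
  assumes "\<And>A. length A = length idx \<Longrightarrow> \<tau> A p = \<tau>' A p"
  shows "expand \<theta> \<tau> idx p = expand \<theta> \<tau>' idx p"
  using assms
proof (induction idx arbitrary: \<tau> \<tau>')
  case (Cons i idx)
  have "expand \<theta> (\<lambda>B. \<tau> (A # B)) idx p = expand \<theta> (\<lambda>B. \<tau>' (A # B)) idx p" for A
    by (rule Cons.IH) (simp add: Cons.prems)
  then show ?case by simp
qed simp

lemma expand_diff:
  "expand \<theta> (\<lambda>A q. \<tau> A q - \<tau>' A q) idx p = expand \<theta> \<tau> idx p - expand \<theta> \<tau>' idx p"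
  by (induction idx arbitrary: \<tau> \<tau>') (auto simp: sum_subtractf right_diff_distrib)

lemma expand_mult:
  "expand \<theta> (\<lambda>A q. c q * \<tau> A q) idx p = c p * expand \<theta> \<tau> idx p"
  by (induction idx arbitrary: \<tau>) (auto simp: sum_distrib_left algebra_simps)

lemma expand_sum:
  "expand \<theta> (\<lambda>A q. \<Sum>k\<in>K. \<tau> k A q) idx p = (\<Sum>k\<in>K. expand \<theta> (\<tau> k) idx p)"
proof (induction idx arbitrary: \<tau>)
  case (Cons i idx)
  show ?case
    by (simp add: Cons sum_distrib_left) (rule sum.swap)
qed simp

lemma cdiff_expand:
  assumes "\<And>A i. cdiff (\<theta> A i) p" "\<And>A. length A = length idx \<Longrightarrow> cdiff (\<tau> A) p"
  shows "cdiff (expand \<theta> \<tau> idx) p"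
  using assms(2)
proof (induction idx arbitrary: \<tau>)
  case (Cons i idx)
  show ?case
    unfolding expand_Cons by (intro cdiff_sum cdiff_mult assms(1) Cons.IH Cons.prems) simp
qed (simp add: expand_Nil)

section \<open>Orthogonal moving frames and the Levi-Civita connection\<close>

lemma matrix_inv_eqI:
  fixes A B :: "real ^ 'n::finite ^ 'n"
  assumes "A ** B = mat 1"
  shows "matrix_inv A = B"
proof -
  have "A ** B = mat 1 \<and> B ** A = mat 1"
    using assms by (simp add: matrix_left_right_inverse)
  \<comment> \<open>\<open>matrix_inv\<close> is a choice operator, so its defining property is
    available only after some two-sided inverse has been exhibited.\<close>
  then have inv: "A ** matrix_inv A = mat 1" and BA: "B ** A = mat 1"
    using someI[of "\<lambda>C. A ** C = mat 1 \<and> C ** A = mat 1" B] by (simp_all add: matrix_inv_def)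
  have "B ** (A ** matrix_inv A) = matrix_inv A"
    unfolding matrix_mul_assoc BA by simp
  then show ?thesis
    by (simp add: inv)
qed

text \<open>The squared lengths \<open>N\<close> of the orthogonal frame are left unnormalised.
  \<open>torsion_free\<close> is Cartan's first structure equation, and \<open>compatible\<close>
  says that the connection preserves the diagonal metric. Together they characterise the Levi-Civita
  connection, so an instance may guess \<open>\<omega>\<close> and verify it.\<close>

locale moving_frame =
  fixes g :: "real ^ 'n::finite \<Rightarrow> real ^ 'n ^ 'n"
    and S :: "(real ^ 'n) set"
    and \<theta> e :: "'f::finite \<Rightarrow> 'n \<Rightarrow> real ^ 'n \<Rightarrow> real"
    and N :: "'f \<Rightarrow> real ^ 'n \<Rightarrow> real"
    and \<omega> :: "'f \<Rightarrow> 'f \<Rightarrow> 'f \<Rightarrow> real ^ 'n \<Rightarrow> real"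
  assumes open_S: "open S"
    and dual_frame: "\<And>p A B. p \<in> S \<Longrightarrow> (\<Sum>i\<in>UNIV. e A i p * \<theta> B i p) = (if A = B then 1 else 0)"
    and dual_coord: "\<And>p i j. p \<in> S \<Longrightarrow> (\<Sum>A\<in>UNIV. \<theta> A i p * e A j p) = (if i = j then 1 else 0)"
    and metric: "\<And>p i j. p \<in> S \<Longrightarrow> g p $ i $ j = (\<Sum>A\<in>UNIV. N A p * \<theta> A i p * \<theta> A j p)"
    and N_nonzero: "\<And>p A. p \<in> S \<Longrightarrow> N A p \<noteq> 0"
    and diff_\<theta>: "\<And>p A i. p \<in> S \<Longrightarrow> cdiff (\<theta> A i) p"
    and diff_d\<theta>: "\<And>p A i j. p \<in> S \<Longrightarrow> cdiff (coord_deriv j (\<theta> A i)) p"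
    and diff_e: "\<And>p A i. p \<in> S \<Longrightarrow> cdiff (e A i) p"
    and diff_N: "\<And>p A. p \<in> S \<Longrightarrow> cdiff (N A) p"
    and diff_\<omega>: "\<And>p A B C. p \<in> S \<Longrightarrow> cdiff (\<omega> A C B) p"
    and sym_\<theta>: "\<And>p A i j k. p \<in> S \<Longrightarrow>
      coord_deriv i (coord_deriv j (\<theta> A k)) p = coord_deriv j (coord_deriv i (\<theta> A k)) p"
    and torsion_free: "\<And>p A i j. p \<in> S \<Longrightarrow> coord_deriv i (\<theta> A j) p - coord_deriv j (\<theta> A i) p
      = - (\<Sum>C\<in>UNIV. \<Sum>B\<in>UNIV. (\<omega> A C B p - \<omega> A B C p) * \<theta> C i p * \<theta> B j p)"
    and compatible: "\<And>p A B C. p \<in> S \<Longrightarrow>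
      (if A = B then fderiv e C (N A) p else 0) = N A p * \<omega> A C B p + N B p * \<omega> B C A p"
begin

lemma ev_S: "p \<in> S \<Longrightarrow> eventually (\<lambda>q. q \<in> S) (nhds p)"
  using open_S by (simp add: eventually_nhds_in_open)

lemma coord_deriv_fderiv:
  assumes "p \<in> S"
  shows "coord_deriv c f p = (\<Sum>C\<in>UNIV. \<theta> C c p * fderiv e C f p)"
proof -
  have "(\<Sum>C\<in>UNIV. \<theta> C c p * fderiv e C f p)
      = (\<Sum>k\<in>UNIV. (\<Sum>C\<in>UNIV. \<theta> C c p * e C k p) * coord_deriv k f p)"
    unfolding fderiv_def sum_distrib_left sum_distrib_right
    by (subst sum.swap) (simp add: mult.assoc)
  also have "\<dots> = (\<Sum>k\<in>UNIV. (if c = k then coord_deriv k f p else 0))"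
    by (rule sum.cong) (auto simp: dual_coord[OF assms])
  finally show ?thesis by simp
qed

text \<open>In the dual frame the inverse metric is diagonal with entries 1/N; both duality
  relations enter when the product is multiplied out.\<close>

lemma matrix_inv_frame:
  assumes "p \<in> S"
  shows "matrix_inv (g p) $ i $ j = (\<Sum>A\<in>UNIV. e A i p * e A j p / N A p)"
proof -
  define T where "T = (\<chi> i j. \<theta> j i p)"
  define V where "V = (\<chi> i j. e i j p)"
  define G where "G = (\<chi> i j. \<Sum>A\<in>UNIV. e A i p * e A j p / N A p)"
  have "(g p ** G) $ i $ j = mat 1 $ i $ j" for i j
  proof -
    have "(g p ** G) $ i $ j = (\<Sum>k\<in>UNIV. (\<Sum>A\<in>UNIV. N A p * \<theta> A i p * \<theta> A k p) * (\<Sum>B\<in>UNIV. e B k p * e B j p / N B p))"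
      by (simp add: matrix_matrix_mult_def G_def metric[OF assms])
    also have "\<dots> = (\<Sum>k\<in>UNIV. \<Sum>A\<in>UNIV. \<Sum>B\<in>UNIV. (N A p * \<theta> A i p * e B j p * inverse (N B p)) * (e B k p * \<theta> A k p))"
      unfolding sum_product divide_inverse by (intro sum.cong refl) (simp add: algebra_simps)
    also have "\<dots> = (\<Sum>A\<in>UNIV. \<Sum>B\<in>UNIV. \<Sum>k\<in>UNIV. (N A p * \<theta> A i p * e B j p * inverse (N B p)) * (e B k p * \<theta> A k p))"
      by (subst sum.swap) (intro sum.cong refl, rule sum.swap)
    also have "\<dots> = (\<Sum>A\<in>UNIV. \<Sum>B\<in>UNIV. (N A p * \<theta> A i p * e B j p * inverse (N B p)) * (if B = A then 1 else 0))"
      by (simp add: sum_distrib_left[symmetric] dual_frame[OF assms])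
    also have "\<dots> = (\<Sum>A\<in>UNIV. \<theta> A i p * e A j p)"
      by (simp add: N_nonzero[OF assms] if_distrib field_simps cong: if_cong)
    also have "\<dots> = mat 1 $ i $ j"
      by (simp add: dual_coord[OF assms] mat_def)
    finally show ?thesis .
  qed
  then have "g p ** G = mat 1"
    by (simp add: vec_eq_iff)
  then have "matrix_inv (g p) = G"
    by (rule matrix_inv_eqI)
  then show ?thesis by (simp add: G_def)
qed

text \<open>The Levi-Civita connection is the only torsion free metric connection, so the Christoffel
  symbols can be read off from the connection coefficients of the frame.\<close>

definition conn :: "'n \<Rightarrow> 'n \<Rightarrow> 'n \<Rightarrow> real ^ 'n \<Rightarrow> real" where
  "conn k i j p = (\<Sum>A\<in>UNIV. e A k p * (coord_deriv i (\<theta> A j) p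
      + (\<Sum>C\<in>UNIV. \<Sum>B\<in>UNIV. \<omega> A C B p * \<theta> C i p * \<theta> B j p)))"

lemma conn_frame:
  assumes "p \<in> S"
  shows "(\<Sum>k\<in>UNIV. conn k i j p * \<theta> A k p) = coord_deriv i (\<theta> A j) p
      + (\<Sum>C\<in>UNIV. \<Sum>B\<in>UNIV. \<omega> A C B p * \<theta> C i p * \<theta> B j p)" (is "_ = ?X A")
proof -
  have "(\<Sum>k\<in>UNIV. conn k i j p * \<theta> A k p) = (\<Sum>B\<in>UNIV. (\<Sum>k\<in>UNIV. e B k p * \<theta> A k p) * ?X B)"
    unfolding conn_def sum_distrib_right by (subst sum.swap) (simp add: algebra_simps)
  also have "\<dots> = ?X A"
    by (simp add: dual_frame[OF assms] if_distrib[of "\<lambda>x. x * _"] cong: if_cong)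
  finally show ?thesis .
qed

text \<open>Vanishing torsion: the antisymmetric part of the \<omega>-term cancels the exterior
  derivative of the coframe.\<close>

lemma conn_sym:
  assumes "p \<in> S"
  shows "conn k i j p = conn k j i p"
proof -
  have "coord_deriv i (\<theta> A j) p + (\<Sum>C\<in>UNIV. \<Sum>B\<in>UNIV. \<omega> A C B p * \<theta> C i p * \<theta> B j p)
      = coord_deriv j (\<theta> A i) p + (\<Sum>C\<in>UNIV. \<Sum>B\<in>UNIV. \<omega> A C B p * \<theta> C j p * \<theta> B i p)" for A
  proof -
    have "(\<Sum>C\<in>UNIV. \<Sum>B\<in>UNIV. \<omega> A C B p * \<theta> C j p * \<theta> B i p) = (\<Sum>C\<in>UNIV. \<Sum>B\<in>UNIV. \<omega> A B C p * \<theta> C i p * \<theta> B j p)"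
      by (subst sum.swap) (simp add: algebra_simps)
    then show ?thesis
      using torsion_free[OF assms, of i A j]
      by (simp add: sum_subtractf left_diff_distrib)
  qed
  then show ?thesis by (simp add: conn_def)
qed

lemma conn_metric:
  assumes "p \<in> S"
  shows "coord_deriv k (\<lambda>q. g q $ i $ j) p
    = (\<Sum>l\<in>UNIV. conn l k i p * g p $ l $ j) + (\<Sum>l\<in>UNIV. conn l k j p * g p $ i $ l)"
proof -
  define X where "X A i = (\<Sum>C\<in>UNIV. \<Sum>B\<in>UNIV. \<omega> A C B p * \<theta> C k p * \<theta> B i p)" for A i
  have *: "(\<Sum>l\<in>UNIV. conn l k i p * g p $ l $ j) = (\<Sum>A\<in>UNIV. N A p * \<theta> A j p * (coord_deriv k (\<theta> A i) p + X A i))" for i j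
  proof -
    have "(\<Sum>l\<in>UNIV. conn l k i p * g p $ l $ j) = (\<Sum>A\<in>UNIV. N A p * \<theta> A j p * (\<Sum>l\<in>UNIV. conn l k i p * \<theta> A l p))"
      unfolding metric[OF assms] sum_distrib_left by (subst sum.swap) (simp add: algebra_simps)
    then show ?thesis by (simp add: conn_frame[OF assms] X_def)
  qed
  have gs: "g p $ i $ l = g p $ l $ i" for l
    by (simp add: metric[OF assms] algebra_simps)
  have "coord_deriv k (\<lambda>q. g q $ i $ j) p = coord_deriv k (\<lambda>q. \<Sum>A\<in>UNIV. N A q * \<theta> A i q * \<theta> A j q) p"
    by (rule coord_deriv_cong) (use ev_S[OF assms] in eventually_elim, simp add: metric)
  also have "\<dots> = (\<Sum>A\<in>UNIV. coord_deriv k (N A) p * \<theta> A i p * \<theta> A j p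
      + N A p * coord_deriv k (\<theta> A i) p * \<theta> A j p + N A p * \<theta> A i p * coord_deriv k (\<theta> A j) p)"
    by (simp add: coord_deriv_sum coord_deriv_mult cdiff_mult diff_N diff_\<theta> assms algebra_simps)
  also have "\<dots> = (\<Sum>A\<in>UNIV. coord_deriv k (N A) p * \<theta> A i p * \<theta> A j p)
      + (\<Sum>A\<in>UNIV. N A p * \<theta> A j p * coord_deriv k (\<theta> A i) p + N A p * \<theta> A i p * coord_deriv k (\<theta> A j) p)"
    by (simp add: sum.distrib[symmetric] algebra_simps)
  \<comment> \<open>The derivatives of the norms are traded for connection terms. Both sums are
    relabelled until they carry the common factor
    \<open>\<theta> C k p * \<theta> A i p * \<theta> B j p\<close>, and then
    \<open>compatible\<close> applies.\<close>
  also have "(\<Sum>A\<in>UNIV. coord_deriv k (N A) p * \<theta> A i p * \<theta> A j p)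
      = (\<Sum>A\<in>UNIV. N A p * \<theta> A j p * X A i + N A p * \<theta> A i p * X A j)"
  proof -
    have "(\<Sum>A\<in>UNIV. N A p * \<theta> A j p * X A i + N A p * \<theta> A i p * X A j)
       = (\<Sum>A\<in>UNIV. \<Sum>C\<in>UNIV. \<Sum>B\<in>UNIV. N A p * \<omega> A C B p * \<theta> C k p * \<theta> B i p * \<theta> A j p)
       + (\<Sum>A\<in>UNIV. \<Sum>C\<in>UNIV. \<Sum>B\<in>UNIV. N A p * \<omega> A C B p * \<theta> C k p * \<theta> B j p * \<theta> A i p)"
      unfolding X_def by (simp add: sum.distrib[symmetric] sum_distrib_left algebra_simps)
    also have "(\<Sum>A\<in>UNIV. \<Sum>C\<in>UNIV. \<Sum>B\<in>UNIV. N A p * \<omega> A C B p * \<theta> C k p * \<theta> B i p * \<theta> A j p)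
        = (\<Sum>C\<in>UNIV. \<Sum>A\<in>UNIV. \<Sum>B\<in>UNIV. N B p * \<omega> B C A p * \<theta> C k p * \<theta> A i p * \<theta> B j p)"
      by (rule trans[OF sum.swap]) (rule sum.cong[OF refl], rule sum.swap)
    also have "(\<Sum>A\<in>UNIV. \<Sum>C\<in>UNIV. \<Sum>B\<in>UNIV. N A p * \<omega> A C B p * \<theta> C k p * \<theta> B j p * \<theta> A i p)
        = (\<Sum>C\<in>UNIV. \<Sum>A\<in>UNIV. \<Sum>B\<in>UNIV. N A p * \<omega> A C B p * \<theta> C k p * \<theta> A i p * \<theta> B j p)"
      by (subst sum.swap) (simp add: algebra_simps)
    also have "(\<Sum>C\<in>UNIV. \<Sum>A\<in>UNIV. \<Sum>B\<in>UNIV. N B p * \<omega> B C A p * \<theta> C k p * \<theta> A i p * \<theta> B j p)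
        + (\<Sum>C\<in>UNIV. \<Sum>A\<in>UNIV. \<Sum>B\<in>UNIV. N A p * \<omega> A C B p * \<theta> C k p * \<theta> A i p * \<theta> B j p)
        = (\<Sum>C\<in>UNIV. \<Sum>A\<in>UNIV. \<Sum>B\<in>UNIV. \<theta> C k p * \<theta> A i p * \<theta> B j p * (N A p * \<omega> A C B p + N B p * \<omega> B C A p))"
      by (simp add: sum.distrib[symmetric] algebra_simps)
    also have "\<dots> = (\<Sum>C\<in>UNIV. \<Sum>A\<in>UNIV. \<theta> C k p * \<theta> A i p * \<theta> A j p * fderiv e C (N A) p)"
      by (simp add: compatible[OF assms, symmetric] if_distrib cong: if_cong)
    also have "\<dots> = (\<Sum>A\<in>UNIV. coord_deriv k (N A) p * \<theta> A i p * \<theta> A j p)"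
      unfolding coord_deriv_fderiv[OF assms] sum_distrib_right
      by (subst sum.swap) (simp add: algebra_simps)
    finally show ?thesis by simp
  qed
  finally show ?thesis
    unfolding * gs[abs_def] by (simp add: sum.distrib algebra_simps gs *)
qed

lemma christoffel_frame:
  assumes "p \<in> S"
  shows "christoffel g k i j p = conn k i j p"
proof -
  have gs: "g p $ i $ l = g p $ l $ i" for i l
    by (simp add: metric[OF assms] algebra_simps)
  \<comment> \<open>Koszul's combination: by the symmetry of \<open>conn\<close> in its lower
    indices, four of the six connection terms cancel and the other two coincide.\<close>
  have 1: "coord_deriv i (\<lambda>q. g q $ j $ l) p + coord_deriv j (\<lambda>q. g q $ i $ l) p
      - coord_deriv l (\<lambda>q. g q $ i $ j) p = 2 * (\<Sum>s\<in>UNIV. conn s i j p * g p $ s $ l)" for l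
    unfolding conn_metric[OF assms]
    by (simp add: conn_sym[OF assms, of _ j i] conn_sym[OF assms, of _ l] gs[of i] gs[of j])
  have 2: "(\<Sum>l\<in>UNIV. matrix_inv (g p) $ k $ l * g p $ s $ l) = (if k = s then 1 else 0)" for s
  proof -
    have "(\<Sum>l\<in>UNIV. matrix_inv (g p) $ k $ l * g p $ s $ l)
       = (\<Sum>l\<in>UNIV. (\<Sum>A\<in>UNIV. e A k p * e A l p / N A p) * (\<Sum>B\<in>UNIV. N B p * \<theta> B s p * \<theta> B l p))"
      by (simp add: matrix_inv_frame[OF assms] metric[OF assms])
    also have "\<dots> = (\<Sum>l\<in>UNIV. \<Sum>A\<in>UNIV. \<Sum>B\<in>UNIV. (e A k p * inverse (N A p) * N B p * \<theta> B s p) * (e A l p * \<theta> B l p))"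
      unfolding sum_product divide_inverse by (intro sum.cong refl) (simp add: algebra_simps)
    also have "\<dots> = (\<Sum>A\<in>UNIV. \<Sum>B\<in>UNIV. \<Sum>l\<in>UNIV. (e A k p * inverse (N A p) * N B p * \<theta> B s p) * (e A l p * \<theta> B l p))"
      by (subst sum.swap) (intro sum.cong refl, rule sum.swap)
    also have "\<dots> = (\<Sum>A\<in>UNIV. \<Sum>B\<in>UNIV. (e A k p * inverse (N A p) * N B p * \<theta> B s p) * (if A = B then 1 else 0))"
      by (simp add: sum_distrib_left[symmetric] dual_frame[OF assms])
    also have "\<dots> = (\<Sum>A\<in>UNIV. \<theta> A s p * e A k p)"
      by (simp add: N_nonzero[OF assms] if_distrib field_simps cong: if_cong)
    finally show ?thesis by (auto simp: dual_coord[OF assms])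
  qed
  have "christoffel g k i j p = (\<Sum>l\<in>UNIV. matrix_inv (g p) $ k $ l * (\<Sum>s\<in>UNIV. conn s i j p * g p $ s $ l))"
    unfolding christoffel_def 1 by (simp add: sum_distrib_left sum_divide_distrib)
  also have "\<dots> = (\<Sum>s\<in>UNIV. conn s i j p * (\<Sum>l\<in>UNIV. matrix_inv (g p) $ k $ l * g p $ s $ l))"
    unfolding sum_distrib_left by (subst sum.swap) (simp add: algebra_simps)
  also have "\<dots> = conn k i j p"
    by (simp add: 2 if_distrib cong: if_cong)
  finally show ?thesis .
qed

lemma christoffel_sym: "p \<in> S \<Longrightarrow> christoffel g k i j p = christoffel g k j i p"
  by (simp add: christoffel_frame conn_sym)

text \<open>The left side is the covariant derivative of the one-form \<open>\<theta> A\<close> in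
  coordinates. In the tensor calculus below the passage from Christoffel symbols to
  \<open>\<omega>\<close> goes through this identity.\<close>

lemma christoffel_coframe:
  assumes "p \<in> S"
  shows "coord_deriv c (\<theta> A a) p - (\<Sum>k\<in>UNIV. christoffel g k c a p * \<theta> A k p)
    = - (\<Sum>C\<in>UNIV. \<Sum>B\<in>UNIV. \<omega> A C B p * \<theta> C c p * \<theta> B a p)"
  by (simp add: christoffel_frame[OF assms] conn_frame[OF assms])

lemma cdiff_christoffel:
  assumes "p \<in> S"
  shows "cdiff (christoffel g k i j) p"
proof (rule cdiff_cong)
  show "eventually (\<lambda>q. christoffel g k i j q = conn k i j q) (nhds p)"
    using ev_S[OF assms] by eventually_elim (rule christoffel_frame)
  show "cdiff (conn k i j) p"
    unfolding conn_def[abs_def]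
    by (intro cdiff_sum cdiff_mult cdiff_add diff_e diff_d\<theta> diff_\<theta> diff_\<omega> assms)
qed

text \<open>Leibniz rule, one coframe factor at a time: the derivative of the first factor supplies
  the \<omega>-correction of that slot by \<open>christoffel_coframe\<close>, and the rest is the
  induction hypothesis for \<open>\<tau>\<close> with its first slot frozen.\<close>

lemma cov_deriv_expand_aux:
  assumes "p \<in> S" "\<And>A. length A = length idx \<Longrightarrow> cdiff (\<tau> A) p"
  shows "cov_deriv g (expand \<theta> \<tau>) (c # idx) p
    = (\<Sum>C\<in>UNIV. \<theta> C c p * expand \<theta> (\<lambda>A. fnabla e \<omega> \<tau> (C # A)) idx p)"
  using assms(2)
proof (induction idx arbitrary: \<tau>)
  case Nil
  then show ?case
    by (simp add: cov_deriv_def fnabla_def coord_deriv_fderiv[OF assms(1)] expand_Nil)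
next
  case (Cons a idx)
  define \<tau>' where "\<tau>' A = (\<lambda>B. \<tau> (A # B))" for A
  define X where "X A = expand \<theta> (\<tau>' A)" for A
  have dX: "cdiff (X A idx) p" for A
    unfolding X_def \<tau>'_def by (rule cdiff_expand) (auto simp: diff_\<theta> assms Cons.prems)
  have len: "(\<Sum>s<length (a # idx). f s) = f 0 + (\<Sum>s<length idx. f (Suc s))" for f :: "nat \<Rightarrow> real"
    by (simp add: sum.lessThan_Suc_shift del: sum.lessThan_Suc)
  have IH: "cov_deriv g (X A) (c # idx) p
    = (\<Sum>C\<in>UNIV. \<theta> C c p * expand \<theta> (\<lambda>B. fnabla e \<omega> (\<tau>' A) (C # B)) idx p)" for A
    unfolding X_def \<tau>'_def by (rule Cons.IH) (auto simp: Cons.prems)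
  have "cov_deriv g (expand \<theta> \<tau>) (c # a # idx) p
     = coord_deriv c (\<lambda>q. \<Sum>A\<in>UNIV. \<theta> A a q * X A idx q) p
       - ((\<Sum>k\<in>UNIV. christoffel g k c a p * (\<Sum>A\<in>UNIV. \<theta> A k p * X A idx p))
          + (\<Sum>s<length idx. \<Sum>k\<in>UNIV. christoffel g k c (idx ! s) p * (\<Sum>A\<in>UNIV. \<theta> A a p * X A (idx[s := k]) p)))"
    unfolding cov_deriv_def list.sel len by (simp add: X_def \<tau>'_def expand_Cons)
  also have "coord_deriv c (\<lambda>q. \<Sum>A\<in>UNIV. \<theta> A a q * X A idx q) p
     = (\<Sum>A\<in>UNIV. coord_deriv c (\<theta> A a) p * X A idx p + \<theta> A a p * coord_deriv c (X A idx) p)"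
    by (simp add: coord_deriv_sum cdiff_mult coord_deriv_mult diff_\<theta> assms dX)
  also have "(\<Sum>k\<in>UNIV. christoffel g k c a p * (\<Sum>A\<in>UNIV. \<theta> A k p * X A idx p))
     = (\<Sum>A\<in>UNIV. (\<Sum>k\<in>UNIV. christoffel g k c a p * \<theta> A k p) * X A idx p)"
    unfolding sum_distrib_left sum_distrib_right by (subst sum.swap) (simp add: algebra_simps)
  also have "(\<Sum>s<length idx. \<Sum>k\<in>UNIV. christoffel g k c (idx ! s) p * (\<Sum>A\<in>UNIV. \<theta> A a p * X A (idx[s := k]) p))
     = (\<Sum>A\<in>UNIV. \<theta> A a p * (\<Sum>s<length idx. \<Sum>k\<in>UNIV. christoffel g k c (idx ! s) p * X A (idx[s := k]) p))"
  proof -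
    have "(\<Sum>s<length idx. \<Sum>k\<in>UNIV. christoffel g k c (idx ! s) p * (\<Sum>A\<in>UNIV. \<theta> A a p * X A (idx[s := k]) p))
       = (\<Sum>s<length idx. \<Sum>A\<in>UNIV. \<Sum>k\<in>UNIV. \<theta> A a p * (christoffel g k c (idx ! s) p * X A (idx[s := k]) p))"
      unfolding sum_distrib_left by (intro sum.cong refl) (subst sum.swap, simp add: algebra_simps)
    also have "\<dots> = (\<Sum>A\<in>UNIV. \<Sum>s<length idx. \<Sum>k\<in>UNIV. \<theta> A a p * (christoffel g k c (idx ! s) p * X A (idx[s := k]) p))"
      by (rule sum.swap)
    finally show ?thesis by (simp add: sum_distrib_left)
  qed
  also have "(\<Sum>A\<in>UNIV. coord_deriv c (\<theta> A a) p * X A idx p + \<theta> A a p * coord_deriv c (X A idx) p)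
     - ((\<Sum>A\<in>UNIV. (\<Sum>k\<in>UNIV. christoffel g k c a p * \<theta> A k p) * X A idx p) +
       (\<Sum>A\<in>UNIV. \<theta> A a p * (\<Sum>s<length idx. \<Sum>k\<in>UNIV. christoffel g k c (idx ! s) p * X A (idx[s := k]) p)))
     = (\<Sum>A\<in>UNIV. (coord_deriv c (\<theta> A a) p - (\<Sum>k\<in>UNIV. christoffel g k c a p * \<theta> A k p)) * X A idx p
        + \<theta> A a p * cov_deriv g (X A) (c # idx) p)"
    unfolding cov_deriv_def list.sel by (simp add: sum.distrib sum_subtractf algebra_simps)
  also have "\<dots> = (\<Sum>A\<in>UNIV. - (\<Sum>C\<in>UNIV. \<Sum>B\<in>UNIV. \<omega> A C B p * \<theta> C c p * \<theta> B a p) * X A idx p)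
     + (\<Sum>A\<in>UNIV. \<theta> A a p * (\<Sum>C\<in>UNIV. \<theta> C c p * expand \<theta> (\<lambda>B. fnabla e \<omega> (\<tau>' A) (C # B)) idx p))"
    by (simp add: IH christoffel_coframe[OF assms(1)] sum_subtractf sum_negf)
  also have "(\<Sum>A\<in>UNIV. - (\<Sum>C\<in>UNIV. \<Sum>B\<in>UNIV. \<omega> A C B p * \<theta> C c p * \<theta> B a p) * X A idx p)
     = (\<Sum>C\<in>UNIV. \<Sum>A\<in>UNIV. \<theta> C c p * \<theta> A a p * (- (\<Sum>D\<in>UNIV. \<omega> D C A p * X D idx p)))"
  proof -
    have "(\<Sum>A\<in>UNIV. - (\<Sum>C\<in>UNIV. \<Sum>B\<in>UNIV. \<omega> A C B p * \<theta> C c p * \<theta> B a p) * X A idx p)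
      = (\<Sum>D\<in>UNIV. \<Sum>C\<in>UNIV. \<Sum>A\<in>UNIV. - (\<theta> C c p * \<theta> A a p * \<omega> D C A p * X D idx p))"
      by (simp add: sum_distrib_left sum_distrib_right sum_negf algebra_simps)
    also have "\<dots> = (\<Sum>C\<in>UNIV. \<Sum>A\<in>UNIV. \<Sum>D\<in>UNIV. - (\<theta> C c p * \<theta> A a p * \<omega> D C A p * X D idx p))"
      by (rule trans[OF sum.swap]) (rule sum.cong[OF refl], rule sum.swap)
    finally show ?thesis by (simp add: sum_distrib_left sum_negf algebra_simps)
  qed
  also have "(\<Sum>A\<in>UNIV. \<theta> A a p * (\<Sum>C\<in>UNIV. \<theta> C c p * expand \<theta> (\<lambda>B. fnabla e \<omega> (\<tau>' A) (C # B)) idx p))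
     = (\<Sum>C\<in>UNIV. \<Sum>A\<in>UNIV. \<theta> C c p * \<theta> A a p * expand \<theta> (\<lambda>B. fnabla e \<omega> (\<tau>' A) (C # B)) idx p)"
    unfolding sum_distrib_left by (subst sum.swap) (simp add: algebra_simps)
  finally have eq: "cov_deriv g (expand \<theta> \<tau>) (c # a # idx) p
     = (\<Sum>C\<in>UNIV. \<theta> C c p * (\<Sum>A\<in>UNIV. \<theta> A a p * (expand \<theta> (\<lambda>B. fnabla e \<omega> (\<tau>' A) (C # B)) idx p
          - (\<Sum>D\<in>UNIV. \<omega> D C A p * X D idx p))))"
    by (simp add: sum_distrib_left sum.distrib[symmetric] sum_subtractf[symmetric] algebra_simps)
  \<comment> \<open>The same splitting on the frame side: in \<open>fnabla\<close> slot 0 is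
    separated from the later slots.\<close>
  have "expand \<theta> (\<lambda>B. fnabla e \<omega> \<tau> (C # A # B)) idx p
      = expand \<theta> (\<lambda>B. fnabla e \<omega> (\<tau>' A) (C # B)) idx p - (\<Sum>D\<in>UNIV. \<omega> D C A p * X D idx p)" for A C
  proof -
    have "fnabla e \<omega> \<tau> (C # A # B) p
       = fnabla e \<omega> (\<tau>' A) (C # B) p - (\<Sum>D\<in>UNIV. \<omega> D C A p * \<tau>' D B p)" for B
    proof -
      have "(\<Sum>s<length (A # B). f s) = f 0 + (\<Sum>s<length B. f (Suc s))" for f :: "nat \<Rightarrow> real"
        by (simp add: sum.lessThan_Suc_shift del: sum.lessThan_Suc)
      note len = this
      show ?thesis
        unfolding fnabla_def list.sel len by (simp add: \<tau>'_def)
    qed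
    then have "expand \<theta> (\<lambda>B. fnabla e \<omega> \<tau> (C # A # B)) idx p
       = expand \<theta> (\<lambda>B q. fnabla e \<omega> (\<tau>' A) (C # B) q - (\<Sum>D\<in>UNIV. \<omega> D C A q * \<tau>' D B q)) idx p"
      by (intro expand_cong)
    then show ?thesis
      by (simp add: expand_diff expand_sum expand_mult X_def)
  qed
  then show ?case
    by (simp add: eq)
qed

text \<open>Agreement of \<open>T\<close> with the expansion is asked on all of the open set
  \<open>S\<close>, because \<open>T\<close> is differentiated. In this form a closed formula can be
  substituted between two covariant derivatives.\<close>

lemma cov_deriv_expand:
  assumes "p \<in> S" "\<And>A. length A = length idx \<Longrightarrow> cdiff (\<tau> A) p"
    and "\<And>q idx'. q \<in> S \<Longrightarrow> length idx' = length idx \<Longrightarrow> T idx' q = expand \<theta> \<tau> idx' q"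
  shows "cov_deriv g T (c # idx) p = expand \<theta> (fnabla e \<omega> \<tau>) (c # idx) p"
proof -
  have "cov_deriv g T (c # idx) p = cov_deriv g (expand \<theta> \<tau>) (c # idx) p"
  proof -
    have "coord_deriv c (T idx) p = coord_deriv c (expand \<theta> \<tau> idx) p"
      by (rule coord_deriv_cong) (use ev_S[OF assms(1)] in eventually_elim, simp add: assms(3))
    then show ?thesis
      by (simp add: cov_deriv_def assms(1,3))
  qed
  also have "\<dots> = expand \<theta> (fnabla e \<omega> \<tau>) (c # idx) p"
    using cov_deriv_expand_aux[OF assms(1,2)] by simp
  finally show ?thesis .
qed

end

section \<open>Curvature, Ricci, Weyl and Bach tensors in the frame\<close>

lemma sum_rotate3:
  "(\<Sum>a\<in>A. \<Sum>b\<in>B. \<Sum>c\<in>C. f a b c) = (\<Sum>c\<in>C. \<Sum>a\<in>A. \<Sum>b\<in>B. f a b c)"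
  by (rule trans[OF _ sum.swap]) (rule sum.cong[OF refl], rule sum.swap)

context moving_frame begin

text \<open>The components of the covariant derivative of \<open>\<theta> A\<close> are the
  negatives of \<open>\<omega> A\<close>. The curvature is read off from the commutator of second
  covariant derivatives of this one-form, which reuses \<open>fnabla\<close> and avoids the brackets
  of the frame vectors.\<close>

definition fcurv :: "'f \<Rightarrow> 'f \<Rightarrow> 'f \<Rightarrow> 'f \<Rightarrow> real ^ 'n \<Rightarrow> real" where
  "fcurv I J K A p = fnabla e \<omega> (\<lambda>L q. - \<omega> A (L ! 0) (L ! 1) q) [J, I, K] p
     - fnabla e \<omega> (\<lambda>L q. - \<omega> A (L ! 0) (L ! 1) q) [I, J, K] p"

definition fric :: "'f \<Rightarrow> 'f \<Rightarrow> real ^ 'n \<Rightarrow> real" where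
  "fric J K p = (\<Sum>I\<in>UNIV. fcurv I J K I p)"

definition fscal :: "real ^ 'n \<Rightarrow> real" where
  "fscal p = (\<Sum>A\<in>UNIV. fric A A p / N A p)"

definition fmetric :: "'f \<Rightarrow> 'f \<Rightarrow> real ^ 'n \<Rightarrow> real" where
  "fmetric A B p = (if A = B then N A p else 0)"

definition fweyl :: "'f \<Rightarrow> 'f \<Rightarrow> 'f \<Rightarrow> 'f \<Rightarrow> real ^ 'n \<Rightarrow> real" where
  "fweyl I J K L p = N L p * fcurv I J K L p
     - (fric I L p * fmetric J K p + fric J K p * fmetric I L p
        - fric I K p * fmetric J L p - fric J L p * fmetric I K p) / (real CARD('n) - 2)
     + fscal p * (fmetric I L p * fmetric J K p - fmetric I K p * fmetric J L p)
        / ((real CARD('n) - 1) * (real CARD('n) - 2))"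

text \<open>The Ricci identity for the members of the coframe.\<close>

lemma riemann_up_coframe:
  assumes p: "p \<in> S"
  shows "(\<Sum>l\<in>UNIV. riemann_up g i j k l p * \<theta> A l p)
    = (\<Sum>I\<in>UNIV. \<Sum>J\<in>UNIV. \<Sum>K\<in>UNIV. \<theta> I i p * \<theta> J j p * \<theta> K k p * fcurv I J K A p)"
proof -
  \<comment> \<open>\<open>T\<close> is the covariant derivative of \<open>\<theta> A\<close>. Its
    own covariant derivative is computed twice, in the frame and with Christoffel symbols, and the
    results are compared.\<close>
  define T :: "'n list \<Rightarrow> real ^ 'n \<Rightarrow> real" where
    "T idx q = coord_deriv (idx ! 0) (\<theta> A (idx ! 1)) q
      - (\<Sum>l\<in>UNIV. christoffel g l (idx ! 0) (idx ! 1) q * \<theta> A l q)" for idx q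
  define \<kappa> where "\<kappa> = (\<lambda>L q. - \<omega> A (L ! 0) (L ! 1) q)"
  have cov: "cov_deriv g T [i, j, k] p = expand \<theta> (fnabla e \<omega> \<kappa>) [i, j, k] p" for i j k
  proof (rule cov_deriv_expand[OF p])
    show "cdiff (\<kappa> L) p" for L
      unfolding \<kappa>_def by (intro cdiff_minus diff_\<omega> p)
    fix q and idx' :: "'n list" assume q: "q \<in> S" and "length idx' = length [j, k]"
    then obtain a b where "idx' = [a, b]"
      by (auto simp: length_Suc_conv)
    moreover have "T [a, b] q = - (\<Sum>C\<in>UNIV. \<Sum>B\<in>UNIV. \<omega> A C B q * \<theta> C a q * \<theta> B b q)"
      unfolding T_def using christoffel_coframe[OF q, of a A b] by simp
    ultimately show "T idx' q = expand \<theta> \<kappa> idx' q"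
      by (simp add: \<kappa>_def sum_negf sum_distrib_left algebra_simps)
  qed
  have dT: "coord_deriv i (T [j, k]) p = coord_deriv i (coord_deriv j (\<theta> A k)) p
     - (\<Sum>l\<in>UNIV. coord_deriv i (christoffel g l j k) p * \<theta> A l p + christoffel g l j k p * coord_deriv i (\<theta> A l) p)"
    for i j k
    unfolding T_def
    by (simp add: coord_deriv_diff coord_deriv_sum coord_deriv_mult cdiff_sum cdiff_mult
        diff_d\<theta> diff_\<theta> cdiff_christoffel p)
  have sum2: "(\<Sum>s<Suc (Suc 0). f s) = f 0 + f 1" for f :: "nat \<Rightarrow> real" by simp
  have cd: "cov_deriv g T [i, j, k] p = coord_deriv i (T [j, k]) p
     - (\<Sum>l\<in>UNIV. christoffel g l i j p * T [l, k] p) - (\<Sum>l\<in>UNIV. christoffel g l i k p * T [j, l] p)" for i j k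
    by (simp add: cov_deriv_def)
  have prod: "(\<Sum>l\<in>UNIV. christoffel g l i k p * T [j, l] p)
     = (\<Sum>l\<in>UNIV. christoffel g l i k p * coord_deriv j (\<theta> A l) p)
       - (\<Sum>l\<in>UNIV. (\<Sum>s\<in>UNIV. christoffel g l j s p * christoffel g s i k p) * \<theta> A l p)" for i j k
  proof -
    have "(\<Sum>l\<in>UNIV. christoffel g l i k p * (\<Sum>s\<in>UNIV. christoffel g s j l p * \<theta> A s p))
       = (\<Sum>l\<in>UNIV. (\<Sum>s\<in>UNIV. christoffel g l j s p * christoffel g s i k p) * \<theta> A l p)"
      unfolding sum_distrib_left sum_distrib_right by (subst sum.swap) (simp add: algebra_simps)
    then show ?thesis
      by (simp add: T_def right_diff_distrib sum_subtractf)
  qed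
  \<comment> \<open>Antisymmetrising in i and j removes the second derivatives of the coframe and
    the terms with its first derivatives, by the symmetry of second derivatives and of the
    Christoffel symbols. What remains is the coordinate formula for the curvature.\<close>
  have "cov_deriv g T [i, j, k] p - cov_deriv g T [j, i, k] p
     = - (\<Sum>l\<in>UNIV. riemann_up g i j k l p * \<theta> A l p)"
    unfolding cd dT prod sym_\<theta>[OF p, of i j] christoffel_sym[OF p, of _ j i] riemann_up_def
    by (simp add: sum.distrib sum_subtractf algebra_simps sum_distrib_left)
  then have "(\<Sum>l\<in>UNIV. riemann_up g i j k l p * \<theta> A l p)
     = expand \<theta> (fnabla e \<omega> \<kappa>) [j, i, k] p - expand \<theta> (fnabla e \<omega> \<kappa>) [i, j, k] p"
    by (simp add: cov)
  also have "expand \<theta> (fnabla e \<omega> \<kappa>) [j, i, k] p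
     = (\<Sum>I\<in>UNIV. \<Sum>J\<in>UNIV. \<Sum>K\<in>UNIV. \<theta> I i p * \<theta> J j p * \<theta> K k p * fnabla e \<omega> \<kappa> [J, I, K] p)"
    unfolding expand.simps sum_distrib_left by (subst sum.swap) (simp add: algebra_simps)
  also have "expand \<theta> (fnabla e \<omega> \<kappa>) [i, j, k] p
     = (\<Sum>I\<in>UNIV. \<Sum>J\<in>UNIV. \<Sum>K\<in>UNIV. \<theta> I i p * \<theta> J j p * \<theta> K k p * fnabla e \<omega> \<kappa> [I, J, K] p)"
    unfolding expand.simps sum_distrib_left by (simp add: algebra_simps)
  finally show ?thesis
    by (simp add: fcurv_def \<kappa>_def sum_subtractf[symmetric] algebra_simps)
qed

lemma riemann_up_frame:
  assumes p: "p \<in> S"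
  shows "riemann_up g i j k l p
    = (\<Sum>A\<in>UNIV. e A l p * (\<Sum>I\<in>UNIV. \<Sum>J\<in>UNIV. \<Sum>K\<in>UNIV. \<theta> I i p * \<theta> J j p * \<theta> K k p * fcurv I J K A p))"
proof -
  have "(\<Sum>A\<in>UNIV. e A l p * (\<Sum>m\<in>UNIV. riemann_up g i j k m p * \<theta> A m p))
     = (\<Sum>m\<in>UNIV. riemann_up g i j k m p * (\<Sum>A\<in>UNIV. \<theta> A m p * e A l p))"
    unfolding sum_distrib_left by (subst sum.swap) (simp add: algebra_simps)
  also have "\<dots> = riemann_up g i j k l p"
    by (simp add: dual_coord[OF p] if_distrib cong: if_cong)
  finally show ?thesis
    by (simp add: riemann_up_coframe[OF p])
qed

lemma ricci_frame:
  assumes p: "p \<in> S"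
  shows "ricci g j k p = (\<Sum>J\<in>UNIV. \<Sum>K\<in>UNIV. \<theta> J j p * \<theta> K k p * fric J K p)"
proof -
  have "ricci g j k p = (\<Sum>i\<in>UNIV. \<Sum>A\<in>UNIV. \<Sum>I\<in>UNIV. (e A i p * \<theta> I i p) *
      (\<Sum>J\<in>UNIV. \<Sum>K\<in>UNIV. \<theta> J j p * \<theta> K k p * fcurv I J K A p))"
    by (simp add: ricci_def riemann_up_frame[OF p] sum_distrib_left algebra_simps)
  also have "\<dots> = (\<Sum>A\<in>UNIV. \<Sum>I\<in>UNIV. \<Sum>i\<in>UNIV. (e A i p * \<theta> I i p) *
      (\<Sum>J\<in>UNIV. \<Sum>K\<in>UNIV. \<theta> J j p * \<theta> K k p * fcurv I J K A p))"
    by (rule trans[OF sum.swap]) (rule sum.cong[OF refl], rule sum.swap)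
  also have "\<dots> = (\<Sum>A\<in>UNIV. (\<Sum>J\<in>UNIV. \<Sum>K\<in>UNIV. \<theta> J j p * \<theta> K k p * fcurv A J K A p))"
    by (simp add: sum_distrib_right[symmetric] dual_frame[OF p] if_distrib[of "\<lambda>x. x * _"] cong: if_cong)
  also have "\<dots> = (\<Sum>J\<in>UNIV. \<Sum>K\<in>UNIV. \<Sum>A\<in>UNIV. \<theta> J j p * \<theta> K k p * fcurv A J K A p)"
    by (rule trans[OF sum.swap]) (rule sum.cong[OF refl], rule sum.swap)
  finally show ?thesis by (simp add: fric_def sum_distrib_left)
qed

lemma raise_coframe:
  assumes p: "p \<in> S"
  shows "(\<Sum>q\<in>UNIV. matrix_inv (g p) $ k $ q * \<theta> A q p) = e A k p / N A p"
proof -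
  have "(\<Sum>q\<in>UNIV. matrix_inv (g p) $ k $ q * \<theta> A q p)
     = (\<Sum>q\<in>UNIV. \<Sum>B\<in>UNIV. e B k p / N B p * (e B q p * \<theta> A q p))"
    by (simp add: matrix_inv_frame[OF p] sum_distrib_right mult.assoc)
  also have "\<dots> = (\<Sum>B\<in>UNIV. e B k p / N B p * (\<Sum>q\<in>UNIV. e B q p * \<theta> A q p))"
    unfolding sum_distrib_left by (rule sum.swap)
  finally show ?thesis
    by (simp add: dual_frame[OF p] if_distrib cong: if_cong)
qed

text \<open>Raising an index in an orthogonal frame is division by the squared norm, so a
  contraction over two coordinate indices becomes one diagonal sum.\<close>

lemma contract_frame:
  assumes p: "p \<in> S"
  shows "(\<Sum>k\<in>UNIV. \<Sum>q\<in>UNIV. matrix_inv (g p) $ k $ q * (\<Sum>Q\<in>UNIV. \<theta> Q q p * (\<Sum>K\<in>UNIV. \<theta> K k p * Z Q K)))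
    = (\<Sum>K\<in>UNIV. Z K K / N K p)"
proof -
  have "(\<Sum>q\<in>UNIV. matrix_inv (g p) $ k $ q * (\<Sum>Q\<in>UNIV. \<theta> Q q p * X Q))
      = (\<Sum>Q\<in>UNIV. e Q k p / N Q p * X Q)" for X k
  proof -
    have "(\<Sum>q\<in>UNIV. matrix_inv (g p) $ k $ q * (\<Sum>Q\<in>UNIV. \<theta> Q q p * X Q))
       = (\<Sum>Q\<in>UNIV. (\<Sum>q\<in>UNIV. matrix_inv (g p) $ k $ q * \<theta> Q q p) * X Q)"
      unfolding sum_distrib_left sum_distrib_right by (subst sum.swap) (simp add: algebra_simps)
    then show ?thesis by (simp add: raise_coframe[OF p])
  qed
  then have "(\<Sum>k\<in>UNIV. \<Sum>q\<in>UNIV. matrix_inv (g p) $ k $ q * (\<Sum>Q\<in>UNIV. \<theta> Q q p * (\<Sum>K\<in>UNIV. \<theta> K k p * Z Q K)))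
    = (\<Sum>k\<in>UNIV. \<Sum>Q\<in>UNIV. e Q k p / N Q p * (\<Sum>K\<in>UNIV. \<theta> K k p * Z Q K))"
    by simp
  also have "\<dots> = (\<Sum>k\<in>UNIV. \<Sum>Q\<in>UNIV. \<Sum>K\<in>UNIV. (e Q k p * \<theta> K k p) * (Z Q K / N Q p))"
    by (simp add: sum_distrib_left mult.assoc)
  also have "\<dots> = (\<Sum>Q\<in>UNIV. \<Sum>K\<in>UNIV. \<Sum>k\<in>UNIV. (e Q k p * \<theta> K k p) * (Z Q K / N Q p))"
    by (rule trans[OF sum.swap]) (rule sum.cong[OF refl], rule sum.swap)
  also have "\<dots> = (\<Sum>K\<in>UNIV. Z K K / N K p)"
    by (simp only: sum_distrib_right[symmetric] dual_frame[OF p])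
       (simp add: if_distrib[of "\<lambda>x. x * _"] if_distrib[of "\<lambda>x. x / _"] cong: if_cong)
  finally show ?thesis .
qed

lemma scal_frame:
  assumes p: "p \<in> S"
  shows "scal g p = fscal p"
proof -
  have "ricci g k q p = (\<Sum>Q\<in>UNIV. \<theta> Q q p * (\<Sum>K\<in>UNIV. \<theta> K k p * fric K Q p))" for k q
    unfolding ricci_frame[OF p] sum_distrib_left by (subst sum.swap) (simp add: algebra_simps)
  then show ?thesis
    by (simp add: scal_def contract_frame[OF p] fscal_def)
qed

lemma metric_frame: "p \<in> S \<Longrightarrow> g p $ i $ j = (\<Sum>A\<in>UNIV. \<Sum>B\<in>UNIV. \<theta> A i p * \<theta> B j p * fmetric A B p)"
  by (simp add: metric fmetric_def if_distrib algebra_simps cong: if_cong)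

text \<open>Index pattern of the Kulkarni-Nomizu terms in the Weyl tensor: one factor carries slots
  1 and 4, the other slots 2 and 3.\<close>

lemma sum_product_14_23:
  fixes r s :: "'f \<Rightarrow> 'f \<Rightarrow> real"
  shows "(\<Sum>I\<in>UNIV. \<Sum>L\<in>UNIV. r I L) * (\<Sum>J\<in>UNIV. \<Sum>K\<in>UNIV. s J K)
    = (\<Sum>I\<in>UNIV. \<Sum>J\<in>UNIV. \<Sum>K\<in>UNIV. \<Sum>L\<in>UNIV. r I L * s J K)"
proof -
  have "(\<Sum>I\<in>UNIV. \<Sum>L\<in>UNIV. r I L) * (\<Sum>J\<in>UNIV. \<Sum>K\<in>UNIV. s J K)
    = (\<Sum>I\<in>UNIV. \<Sum>J\<in>UNIV. (\<Sum>L\<in>UNIV. r I L) * (\<Sum>K\<in>UNIV. s J K))"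
    by (rule sum_product)
  also have "\<dots> = (\<Sum>I\<in>UNIV. \<Sum>J\<in>UNIV. \<Sum>L\<in>UNIV. \<Sum>K\<in>UNIV. r I L * s J K)"
    by (intro sum.cong refl sum_product)
  also have "\<dots> = (\<Sum>I\<in>UNIV. \<Sum>J\<in>UNIV. \<Sum>K\<in>UNIV. \<Sum>L\<in>UNIV. r I L * s J K)"
    by (rule sum.cong[OF refl], rule sum.cong[OF refl], rule sum.swap)
  finally show ?thesis .
qed

lemma sum_product_13_24:
  fixes r s :: "'f \<Rightarrow> 'f \<Rightarrow> real"
  shows "(\<Sum>I\<in>UNIV. \<Sum>K\<in>UNIV. r I K) * (\<Sum>J\<in>UNIV. \<Sum>L\<in>UNIV. s J L)
    = (\<Sum>I\<in>UNIV. \<Sum>J\<in>UNIV. \<Sum>K\<in>UNIV. \<Sum>L\<in>UNIV. r I K * s J L)"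
  unfolding sum_product_14_23[of r s] by (intro sum.cong refl sum.swap)

lemma prod_expand_14_23:
  "(\<Sum>I\<in>UNIV. \<Sum>L\<in>UNIV. \<theta> I i p * \<theta> L l p * r I L) * (\<Sum>J\<in>UNIV. \<Sum>K\<in>UNIV. \<theta> J j p * \<theta> K k p * s J K)
   = expand \<theta> (\<lambda>A q. r (A ! 0) (A ! 3) * s (A ! 1) (A ! 2)) [i, j, k, l] p"
  unfolding sum_product_14_23 unfolding expand.simps sum_distrib_left
  by (simp add: algebra_simps numeral_eq_Suc)

lemma prod_expand_13_24:
  "(\<Sum>I\<in>UNIV. \<Sum>K\<in>UNIV. \<theta> I i p * \<theta> K k p * r I K) * (\<Sum>J\<in>UNIV. \<Sum>L\<in>UNIV. \<theta> J j p * \<theta> L l p * s J L)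
   = expand \<theta> (\<lambda>A q. r (A ! 0) (A ! 2) * s (A ! 1) (A ! 3)) [i, j, k, l] p"
  unfolding sum_product_13_24 unfolding expand.simps sum_distrib_left
  by (simp add: algebra_simps numeral_eq_Suc)

lemma riemann_frame:
  assumes p: "p \<in> S"
  shows "riemann g i j k l p = expand \<theta> (\<lambda>A q. N (A ! 3) q * fcurv (A ! 0) (A ! 1) (A ! 2) (A ! 3) q) [i, j, k, l] p"
proof -
  have "riemann g i j k l p = (\<Sum>s\<in>UNIV. \<Sum>A\<in>UNIV. N A p * \<theta> A l p * (riemann_up g i j k s p * \<theta> A s p))"
    by (simp add: riemann_def metric[OF p] sum_distrib_left algebra_simps)
  also have "\<dots> = (\<Sum>A\<in>UNIV. N A p * \<theta> A l p * (\<Sum>s\<in>UNIV. riemann_up g i j k s p * \<theta> A s p))"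
    unfolding sum_distrib_left by (rule sum.swap)
  also have "\<dots> = (\<Sum>A\<in>UNIV. \<Sum>I\<in>UNIV. \<Sum>J\<in>UNIV. \<Sum>K\<in>UNIV. N A p * \<theta> A l p * (\<theta> I i p * \<theta> J j p * \<theta> K k p * fcurv I J K A p))"
    by (simp add: riemann_up_coframe[OF p] sum_distrib_left)
  also have "\<dots> = (\<Sum>I\<in>UNIV. \<Sum>J\<in>UNIV. \<Sum>K\<in>UNIV. \<Sum>A\<in>UNIV. N A p * \<theta> A l p * (\<theta> I i p * \<theta> J j p * \<theta> K k p * fcurv I J K A p))"
    by (rule trans[OF sum.swap], rule sum.cong[OF refl], rule trans[OF sum.swap], rule sum.cong[OF refl], rule sum.swap)
  finally show ?thesis
    by (simp add: sum_distrib_left algebra_simps numeral_eq_Suc)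
qed

lemma weyl_frame:
  assumes p: "p \<in> S"
  shows "weyl g i j k l p = expand \<theta> (\<lambda>A. fweyl (A ! 0) (A ! 1) (A ! 2) (A ! 3)) [i, j, k, l] p"
proof -
  let ?e = "\<lambda>\<tau>. expand \<theta> (\<lambda>A q. \<tau> (A ! 0) (A ! 1) (A ! 2) (A ! 3)) [i, j, k, l] p"
  have 1: "ricci g i l p * g p $ j $ k = ?e (\<lambda>I J K L. fric I L p * fmetric J K p)"
    "ricci g j k p * g p $ i $ l = ?e (\<lambda>I J K L. fmetric I L p * fric J K p)"
    "g p $ i $ l * g p $ j $ k = ?e (\<lambda>I J K L. fmetric I L p * fmetric J K p)"
    "ricci g i k p * g p $ j $ l = ?e (\<lambda>I J K L. fric I K p * fmetric J L p)"
    "ricci g j l p * g p $ i $ k = ?e (\<lambda>I J K L. fmetric I K p * fric J L p)"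
    "g p $ i $ k * g p $ j $ l = ?e (\<lambda>I J K L. fmetric I K p * fmetric J L p)"
    subgoal by (simp only: ricci_frame[OF p] metric_frame[OF p] prod_expand_14_23)
    subgoal by (subst mult.commute) (simp only: ricci_frame[OF p] metric_frame[OF p] prod_expand_14_23)
    subgoal by (simp only: ricci_frame[OF p] metric_frame[OF p] prod_expand_14_23)
    subgoal by (simp only: ricci_frame[OF p] metric_frame[OF p] prod_expand_13_24)
    subgoal by (subst mult.commute) (simp only: ricci_frame[OF p] metric_frame[OF p] prod_expand_13_24)
    subgoal by (simp only: ricci_frame[OF p] metric_frame[OF p] prod_expand_13_24)
    done
  show ?thesis
    unfolding weyl_def 1 scal_frame[OF p] riemann_frame[OF p] fweyl_def
    by (simp add: sum_distrib_left sum_subtractf sum.distrib sum_divide_distrib diff_divide_distrib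
        add_divide_distrib algebra_simps)
qed

text \<open>Contraction with two dual frame vectors recovers each single frame component.\<close>

lemma frame_eq_0_iff:
  assumes p: "p \<in> S"
  shows "(\<forall>i j. (\<Sum>I\<in>UNIV. \<Sum>J\<in>UNIV. \<theta> I i p * \<theta> J j p * X I J) = 0) \<longleftrightarrow> (\<forall>I J. X I J = 0)"
proof (intro iffI allI)
  fix A B assume 0: "\<forall>i j. (\<Sum>I\<in>UNIV. \<Sum>J\<in>UNIV. \<theta> I i p * \<theta> J j p * X I J) = 0"
  have "0 = (\<Sum>i\<in>UNIV. \<Sum>j\<in>UNIV. e A i p * e B j p * (\<Sum>I\<in>UNIV. \<Sum>J\<in>UNIV. \<theta> I i p * \<theta> J j p * X I J))"
    by (simp add: 0)
  also have "\<dots> = (\<Sum>i\<in>UNIV. \<Sum>j\<in>UNIV. \<Sum>I\<in>UNIV. \<Sum>J\<in>UNIV. (e A i p * \<theta> I i p) * (e B j p * \<theta> J j p) * X I J)"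
    by (simp add: sum_distrib_left algebra_simps)
  also have "\<dots> = (\<Sum>I\<in>UNIV. \<Sum>i\<in>UNIV. \<Sum>j\<in>UNIV. \<Sum>J\<in>UNIV. (e A i p * \<theta> I i p) * (e B j p * \<theta> J j p) * X I J)"
    by (rule sum_rotate3)
  also have "\<dots> = (\<Sum>I\<in>UNIV. \<Sum>J\<in>UNIV. \<Sum>i\<in>UNIV. \<Sum>j\<in>UNIV. (e A i p * \<theta> I i p) * (e B j p * \<theta> J j p) * X I J)"
    by (rule sum.cong[OF refl]) (rule sum_rotate3)
  also have "\<dots> = (\<Sum>I\<in>UNIV. \<Sum>J\<in>UNIV. (\<Sum>i\<in>UNIV. e A i p * \<theta> I i p) * (\<Sum>j\<in>UNIV. e B j p * \<theta> J j p) * X I J)"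
    by (simp only: sum_product) (simp only: sum_distrib_right)
  also have "\<dots> = X A B"
  proof -
    have "(\<Sum>J\<in>UNIV. (if A = I then 1 else 0) * (if B = J then 1 else 0) * X I J) = (if A = I then X I B else 0)" for I
      by (simp add: if_distrib[of "\<lambda>x. x * _"] cong: if_cong)
    then show ?thesis unfolding dual_frame[OF p] by simp
  qed
  finally show "X A B = 0" by simp
qed simp

text \<open>\<open>w\<close> and \<open>w'\<close> stand for closed formulas of the Weyl tensor and
  of its covariant derivative. After the metric contraction only repeated legs survive; the two
  derivative slots come first, as in \<open>cov_deriv\<close>.\<close>

definition fbach :: "('f list \<Rightarrow> real ^ 'n \<Rightarrow> real) \<Rightarrow> ('f list \<Rightarrow> real ^ 'n \<Rightarrow> real) \<Rightarrow> 'f \<Rightarrow> 'f \<Rightarrow> real ^ 'n \<Rightarrow> real" where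
  "fbach w w' I J p = (\<Sum>L\<in>UNIV. \<Sum>K\<in>UNIV.
     (fnabla e \<omega> w' [K, L, K, I, J, L] p + fric K L p * w [K, I, J, L] p / 2) / (N K p * N L p))"

lemma bach_frame:
  assumes p: "p \<in> S"
    and w: "\<And>q I J K L. q \<in> S \<Longrightarrow> fweyl I J K L q = w [I, J, K, L] q"
    and dw: "\<And>q A. q \<in> S \<Longrightarrow> length A = 4 \<Longrightarrow> cdiff (w A) q"
    and w': "\<And>q C I J K L. q \<in> S \<Longrightarrow> fnabla e \<omega> w [C, I, J, K, L] q = w' [C, I, J, K, L] q"
    and dw': "\<And>A. length A = 5 \<Longrightarrow> cdiff (w' A) p"
  shows "bach g i j p = (\<Sum>I\<in>UNIV. \<Sum>J\<in>UNIV. \<theta> I i p * \<theta> J j p * fbach w w' I J p)"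
proof -
  have weyl: "weyl_tensor g idx q = expand \<theta> w idx q" if q: "q \<in> S" and "length idx = 4" for q idx
  proof -
    obtain a b c d where "idx = [a, b, c, d]"
      using \<open>length idx = 4\<close> by (auto simp: length_Suc_conv numeral_eq_Suc)
    then show ?thesis
      using w[OF q] by (simp add: weyl_tensor_def weyl_frame[OF q] numeral_eq_Suc)
  qed
  have cov1: "cov_deriv g (weyl_tensor g) idx q = expand \<theta> w' idx q" if q: "q \<in> S" and len: "length idx = 5" for q idx
  proof -
    obtain c idx' where idx: "idx = c # idx'" "length idx' = 4"
      using len by (auto simp: length_Suc_conv numeral_eq_Suc)
    have "cov_deriv g (weyl_tensor g) idx q = expand \<theta> (fnabla e \<omega> w) idx q"
      unfolding idx(1) by (rule cov_deriv_expand) (simp_all add: q dw weyl idx(2))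
    also have "\<dots> = expand \<theta> w' idx q"
    proof (rule expand_cong)
      fix A :: "'f list" assume "length A = length idx"
      then obtain C I J K L where "A = [C, I, J, K, L]"
        using len by (auto simp: length_Suc_conv numeral_eq_Suc)
      then show "fnabla e \<omega> w A q = w' A q" by (simp add: w'[OF q])
    qed
    finally show ?thesis .
  qed
  have cov2: "cov_deriv g (cov_deriv g (weyl_tensor g)) [q, s, k, i, j, l] p
     = expand \<theta> (fnabla e \<omega> w') [q, s, k, i, j, l] p" for q s k l
    by (rule cov_deriv_expand) (simp_all add: p dw' cov1)
  define X where "X Q S' K I J L = fnabla e \<omega> w' [Q, S', K, I, J, L] p + fric Q S' p * w [K, I, J, L] p / 2"
    for Q S' K I J L
  define Y where "Y Q S' K l = (\<Sum>L\<in>UNIV. \<theta> L l p * (\<Sum>I\<in>UNIV. \<Sum>J\<in>UNIV. \<theta> I i p * \<theta> J j p * X Q S' K I J L))"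
    for Q S' K l
  \<comment> \<open>The sums are ordered so that the pairs to be contracted, first \<open>Q\<close>
    with \<open>K\<close> and then \<open>S'\<close> with \<open>L\<close>, can be brought to the
    outside, where \<open>contract_frame\<close> applies.\<close>
  have int: "cov_deriv g (cov_deriv g (weyl_tensor g)) [q, s, k, i, j, l] p + ricci g q s p * weyl g k i j l p / 2
     = (\<Sum>Q\<in>UNIV. \<theta> Q q p * (\<Sum>K\<in>UNIV. \<theta> K k p * (\<Sum>S'\<in>UNIV. \<theta> S' s p * Y Q S' K l)))" for q s k l
  proof -
    have 1: "cov_deriv g (cov_deriv g (weyl_tensor g)) [q, s, k, i, j, l] p
       = (\<Sum>Q\<in>UNIV. \<Sum>S'\<in>UNIV. \<Sum>K\<in>UNIV. \<Sum>I\<in>UNIV. \<Sum>J\<in>UNIV. \<Sum>L\<in>UNIV.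
          \<theta> Q q p * \<theta> K k p * \<theta> S' s p * \<theta> L l p * \<theta> I i p * \<theta> J j p * fnabla e \<omega> w' [Q, S', K, I, J, L] p)"
      unfolding cov2 expand.simps sum_distrib_left by (simp add: algebra_simps)
    have wl: "weyl g k i j l p = (\<Sum>K\<in>UNIV. \<Sum>I\<in>UNIV. \<Sum>J\<in>UNIV. \<Sum>L\<in>UNIV. \<theta> K k p * \<theta> L l p * \<theta> I i p * \<theta> J j p * w [K, I, J, L] p)"
      using weyl[OF p, of "[k, i, j, l]"] unfolding weyl_tensor_def expand.simps sum_distrib_left
      by (simp add: algebra_simps numeral_eq_Suc)
    have "ricci g q s p * weyl g k i j l p / 2 = (\<Sum>Q\<in>UNIV. \<Sum>S'\<in>UNIV. \<theta> Q q p * \<theta> S' s p * fric Q S' p * weyl g k i j l p / 2)"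
      unfolding ricci_frame[OF p] sum_distrib_right sum_divide_distrib ..
    also have "\<dots> = (\<Sum>Q\<in>UNIV. \<Sum>S'\<in>UNIV. \<Sum>K\<in>UNIV. \<Sum>I\<in>UNIV. \<Sum>J\<in>UNIV. \<Sum>L\<in>UNIV.
          \<theta> Q q p * \<theta> K k p * \<theta> S' s p * \<theta> L l p * \<theta> I i p * \<theta> J j p * (fric Q S' p * w [K, I, J, L] p / 2))"
      unfolding wl sum_distrib_left sum_divide_distrib by (simp add: algebra_simps)
    finally have "cov_deriv g (cov_deriv g (weyl_tensor g)) [q, s, k, i, j, l] p + ricci g q s p * weyl g k i j l p / 2
      = (\<Sum>Q\<in>UNIV. \<Sum>S'\<in>UNIV. \<Sum>K\<in>UNIV. \<Sum>I\<in>UNIV. \<Sum>J\<in>UNIV. \<Sum>L\<in>UNIV.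
          \<theta> Q q p * \<theta> K k p * \<theta> S' s p * \<theta> L l p * \<theta> I i p * \<theta> J j p * X Q S' K I J L)"
      unfolding 1 X_def by (simp only: sum.distrib[symmetric] distrib_left)
    also have "\<dots> = (\<Sum>Q\<in>UNIV. \<Sum>K\<in>UNIV. \<Sum>S'\<in>UNIV. \<Sum>L\<in>UNIV. \<Sum>I\<in>UNIV. \<Sum>J\<in>UNIV.
          \<theta> Q q p * \<theta> K k p * \<theta> S' s p * \<theta> L l p * \<theta> I i p * \<theta> J j p * X Q S' K I J L)"
      apply (rule sum.cong[OF refl], rule trans[OF sum.swap], rule sum.cong[OF refl], rule sum.cong[OF refl])
      apply (rule sum_rotate3)
      done
    finally show ?thesis
      by (simp add: Y_def sum_distrib_left algebra_simps)
  qed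
  let ?G = "matrix_inv (g p)"
  have "bach g i j p = (\<Sum>k\<in>UNIV. \<Sum>l\<in>UNIV. \<Sum>q\<in>UNIV. \<Sum>s\<in>UNIV. ?G $ l $ s * (?G $ k $ q *
      (\<Sum>Q\<in>UNIV. \<theta> Q q p * (\<Sum>K\<in>UNIV. \<theta> K k p * (\<Sum>S'\<in>UNIV. \<theta> S' s p * Y Q S' K l)))))"
    unfolding bach_def int by (simp add: algebra_simps)
  also have "\<dots> = (\<Sum>l\<in>UNIV. \<Sum>s\<in>UNIV. \<Sum>k\<in>UNIV. \<Sum>q\<in>UNIV. ?G $ l $ s * (?G $ k $ q *
      (\<Sum>Q\<in>UNIV. \<theta> Q q p * (\<Sum>K\<in>UNIV. \<theta> K k p * (\<Sum>S'\<in>UNIV. \<theta> S' s p * Y Q S' K l)))))"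
    by (rule trans[OF sum.swap], rule sum.cong[OF refl], rule sum_rotate3)
  also have "\<dots> = (\<Sum>l\<in>UNIV. \<Sum>s\<in>UNIV. ?G $ l $ s * (\<Sum>K\<in>UNIV. (\<Sum>S'\<in>UNIV. \<theta> S' s p * Y K S' K l) / N K p))"
    by (simp add: sum_distrib_left[symmetric] contract_frame[OF p])
  also have "\<dots> = (\<Sum>l\<in>UNIV. \<Sum>s\<in>UNIV. ?G $ l $ s * (\<Sum>S'\<in>UNIV. \<theta> S' s p * (\<Sum>L\<in>UNIV. \<theta> L l p *
      (\<Sum>K\<in>UNIV. (\<Sum>I\<in>UNIV. \<Sum>J\<in>UNIV. \<theta> I i p * \<theta> J j p * X K S' K I J L) / N K p))))"
  proof -
    have "(\<Sum>K\<in>UNIV. (\<Sum>S'\<in>UNIV. \<theta> S' s p * Y K S' K l) / N K p)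
      = (\<Sum>S'\<in>UNIV. \<theta> S' s p * (\<Sum>L\<in>UNIV. \<theta> L l p *
      (\<Sum>K\<in>UNIV. (\<Sum>I\<in>UNIV. \<Sum>J\<in>UNIV. \<theta> I i p * \<theta> J j p * X K S' K I J L) / N K p)))" for l s
    proof -
      define V where "V K S' L = (\<Sum>I\<in>UNIV. \<Sum>J\<in>UNIV. \<theta> I i p * \<theta> J j p * X K S' K I J L) / N K p" for K S' L
      have "(\<Sum>K\<in>UNIV. (\<Sum>S'\<in>UNIV. \<theta> S' s p * Y K S' K l) / N K p)
         = (\<Sum>K\<in>UNIV. \<Sum>S'\<in>UNIV. \<Sum>L\<in>UNIV. \<theta> S' s p * (\<theta> L l p * V K S' L))"
        by (simp add: Y_def V_def sum_divide_distrib[symmetric] sum_distrib_left[symmetric])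
      also have "\<dots> = (\<Sum>S'\<in>UNIV. \<Sum>L\<in>UNIV. \<Sum>K\<in>UNIV. \<theta> S' s p * (\<theta> L l p * V K S' L))"
        by (rule trans[OF sum.swap]) (rule sum.cong[OF refl], rule sum.swap)
      finally show ?thesis by (simp add: V_def sum_distrib_left)
    qed
    then show ?thesis by simp
  qed
  also have "\<dots> = (\<Sum>L\<in>UNIV. (\<Sum>K\<in>UNIV. (\<Sum>I\<in>UNIV. \<Sum>J\<in>UNIV. \<theta> I i p * \<theta> J j p * X K L K I J L) / N K p) / N L p)"
    by (rule contract_frame[OF p])
  also have "\<dots> = (\<Sum>L\<in>UNIV. \<Sum>K\<in>UNIV. \<Sum>I\<in>UNIV. \<Sum>J\<in>UNIV. \<theta> I i p * \<theta> J j p * (X K L K I J L / (N K p * N L p)))"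
    by (simp add: sum_divide_distrib)
  also have "\<dots> = (\<Sum>I\<in>UNIV. \<Sum>J\<in>UNIV. \<Sum>L\<in>UNIV. \<Sum>K\<in>UNIV. \<theta> I i p * \<theta> J j p * (X K L K I J L / (N K p * N L p)))"
  proof -
    have *: "(\<Sum>L\<in>UNIV. \<Sum>K\<in>UNIV. \<Sum>I\<in>UNIV. f L K I) = (\<Sum>I\<in>UNIV. \<Sum>L\<in>UNIV. \<Sum>K\<in>UNIV. f L K I)"
      for f :: "'f \<Rightarrow> 'f \<Rightarrow> 'f \<Rightarrow> real"
      by (rule sum_rotate3)
    show ?thesis
      by (rule trans[OF *]) (rule sum.cong[OF refl], rule *)
  qed
  finally show ?thesis
    by (simp add: fbach_def X_def sum_distrib_left)
qed

lemma bach_eq_0_iff: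
  assumes "p \<in> S"
    and "\<And>q I J K L. q \<in> S \<Longrightarrow> fweyl I J K L q = w [I, J, K, L] q"
    and "\<And>q A. q \<in> S \<Longrightarrow> length A = 4 \<Longrightarrow> cdiff (w A) q"
    and "\<And>q C I J K L. q \<in> S \<Longrightarrow> fnabla e \<omega> w [C, I, J, K, L] q = w' [C, I, J, K, L] q"
    and "\<And>A. length A = 5 \<Longrightarrow> cdiff (w' A) p"
  shows "(\<forall>i j. bach g i j p = 0) \<longleftrightarrow> (\<forall>I J. fbach w w' I J p = 0)"
proof -
  have "bach g i j p = (\<Sum>I\<in>UNIV. \<Sum>J\<in>UNIV. \<theta> I i p * \<theta> J j p * fbach w w' I J p)" for i j
    by (rule bach_frame) (use assms in auto)
  then show ?thesis
    by (simp only: frame_eq_0_iff[OF assms(1)])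
qed

end

section \<open>The coframe of a $U(2)$-invariant metric\<close>

text \<open>Radial direction, circle fibre, and latitude and longitude on the base sphere.\<close>

datatype leg = Rad | Lat | Fib | Lon

lemma UNIV_leg: "UNIV = {Rad, Lat, Fib, Lon}"
  by (auto intro: leg.exhaust)

instance leg :: finite
  by standard (simp add: UNIV_leg)

lemma sum_leg: "sum f (UNIV :: leg set) = f Rad + f Lat + f Fib + f Lon"
  by (simp add: UNIV_leg add.assoc)

lemma sum_action_angle:
  "sum f (UNIV :: (2 + 2) set) = f (Inl 1) + f (Inl 2) + (f (Inr 1) + f (Inr 2))"
  unfolding UNIV_sum by (subst sum.union_disjoint) (auto simp: sum.reindex UNIV_2)

lemma all_action_angle:
  "(\<forall>i :: 2 + 2. P i) \<longleftrightarrow> P (Inl 1) \<and> P (Inl 2) \<and> P (Inr 1) \<and> P (Inr 2)"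
  by (simp add: split_sum_all forall_2)

lemma two_neq_one [simp]: "(2 :: 2) \<noteq> 1" "(1 :: 2) \<noteq> 2"
  by simp_all

definition rr :: "action_angle \<Rightarrow> real" where
  "rr p = p $ Inl 1 + p $ Inl 2"

definition zz :: "action_angle \<Rightarrow> real" where
  "zz p = p $ Inl 1 / rr p"

definition ww :: "action_angle \<Rightarrow> real" where
  "ww p = sqrt (zz p * (1 - zz p))"

text \<open>The z-derivative of w. With z = (1 - cos \<phi>)/2 it equals cot \<phi>, the Christoffel
  symbol of the round sphere.\<close>

definition mu :: "action_angle \<Rightarrow> real" where
  "mu p = (1 - 2 * zz p) / (2 * ww p)"

definition dr :: "2 + 2 \<Rightarrow> real" where
  "dr i = (case i of Inl _ \<Rightarrow> 1 | Inr _ \<Rightarrow> 0)"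

definition dz :: "2 + 2 \<Rightarrow> action_angle \<Rightarrow> real" where
  "dz i p = (case i of Inl j \<Rightarrow> if j = 1 then (1 - zz p) / rr p else - zz p / rr p | Inr _ \<Rightarrow> 0)"

text \<open>With z = (1 - cos \<phi>)/2 one has 2 w = sin \<phi>, so \<open>Lat\<close> and
  \<open>Lon\<close> are d\<phi> and sin \<phi> (d\<theta>1 - d\<theta>2), the standard coframe of
  the unit sphere. \<open>Fib\<close> is the connection form of the circle fibration; its exterior
  derivative is half of the area form built from \<open>Lat\<close> and \<open>Lon\<close>.\<close>

fun cofr :: "leg \<Rightarrow> 2 + 2 \<Rightarrow> action_angle \<Rightarrow> real" where
  "cofr Rad i p = dr i"
| "cofr Lat i p = dz i p / ww p"
| "cofr Fib i p = (case i of Inl _ \<Rightarrow> 0 | Inr j \<Rightarrow> if j = 1 then zz p else 1 - zz p)"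
| "cofr Lon i p = (case i of Inl _ \<Rightarrow> 0 | Inr j \<Rightarrow> if j = 1 then 2 * ww p else - 2 * ww p)"

fun frm :: "leg \<Rightarrow> 2 + 2 \<Rightarrow> action_angle \<Rightarrow> real" where
  "frm Rad i p = (case i of Inl j \<Rightarrow> if j = 1 then zz p else 1 - zz p | Inr _ \<Rightarrow> 0)"
| "frm Lat i p = (case i of Inl j \<Rightarrow> if j = 1 then ww p * rr p else - ww p * rr p | Inr _ \<Rightarrow> 0)"
| "frm Fib i p = (case i of Inl _ \<Rightarrow> 0 | Inr _ \<Rightarrow> 1)"
| "frm Lon i p = (case i of Inl _ \<Rightarrow> 0 | Inr j \<Rightarrow> if j = 1 then (1 - zz p) / (2 * ww p) else - zz p / (2 * ww p))"

lemma cdiff_component: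
  "cdiff (\<lambda>p. p $ j) p" "coord_deriv i (\<lambda>p. p $ j) p = (if i = j then 1 else 0)"
proof -
  have "((\<lambda>s. (p + s *\<^sub>R axis i 1) $ j) has_field_derivative (if i = j then 1 else 0)) (at 0)" for i
    by (auto simp: axis_def intro!: derivative_eq_intros)
  from cdiffI[OF this] show "cdiff (\<lambda>p. p $ j) p" "coord_deriv i (\<lambda>p. p $ j) p = (if i = j then 1 else 0)"
    by auto
qed

text \<open>\<open>has_rz f a b p\<close>: in terms of the coordinates \<open>rr\<close>, \<open>zz\<close>, the differential of \<open>f\<close> at \<open>p\<close>
  is $a\,dr + b\,dz$.\<close>

definition has_rz :: "(action_angle \<Rightarrow> real) \<Rightarrow> real \<Rightarrow> real \<Rightarrow> action_angle \<Rightarrow> bool" where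
  "has_rz f a b p \<longleftrightarrow> cdiff f p \<and> (\<forall>i. coord_deriv i f p = a * dr i + b * dz i p)"

lemma has_rzD:
  assumes "has_rz f a b p"
  shows "cdiff f p" "coord_deriv i f p = a * dr i + b * dz i p"
  using assms by (auto simp: has_rz_def)

lemma has_rz_cong:
  assumes "has_rz g a b p" "eventually (\<lambda>q. f q = g q) (nhds p)"
  shows "has_rz f a b p"
  using assms cdiff_cong coord_deriv_cong[OF assms(2)] unfolding has_rz_def by metis

lemma has_rz_eq: "has_rz f a b p \<Longrightarrow> a = a' \<Longrightarrow> b = b' \<Longrightarrow> has_rz f a' b' p"
  by simp

lemma has_rz_const: "has_rz (\<lambda>p. c) 0 0 p"
  by (simp add: has_rz_def)

lemma has_rz_rr: "has_rz rr 1 0 p"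
  unfolding has_rz_def rr_def[abs_def]
  by (auto simp: cdiff_add coord_deriv_add cdiff_component dr_def all_action_angle split: sum.splits)

lemma has_rz_add: "has_rz f a b p \<Longrightarrow> has_rz g c d p \<Longrightarrow> has_rz (\<lambda>p. f p + g p) (a + c) (b + d) p"
  by (auto simp: has_rz_def cdiff_add coord_deriv_add algebra_simps)

lemma has_rz_diff: "has_rz f a b p \<Longrightarrow> has_rz g c d p \<Longrightarrow> has_rz (\<lambda>p. f p - g p) (a - c) (b - d) p"
  by (auto simp: has_rz_def cdiff_diff coord_deriv_diff algebra_simps)

lemma has_rz_minus: "has_rz f a b p \<Longrightarrow> has_rz (\<lambda>p. - f p) (- a) (- b) p"
  by (auto simp: has_rz_def cdiff_minus coord_deriv_minus algebra_simps)

lemma has_rz_mult: "has_rz f a b p \<Longrightarrow> has_rz g c d p \<Longrightarrow>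
    has_rz (\<lambda>p. f p * g p) (a * g p + f p * c) (b * g p + f p * d) p"
  by (auto simp: has_rz_def cdiff_mult coord_deriv_mult algebra_simps)

lemma has_rz_chain: "has_rz f a b p \<Longrightarrow> (\<phi> has_field_derivative D) (at (f p)) \<Longrightarrow>
    has_rz (\<lambda>p. \<phi> (f p)) (D * a) (D * b) p"
  by (auto simp: has_rz_def cdiff_chain algebra_simps)

lemma has_rz_inverse: "has_rz f a b p \<Longrightarrow> f p \<noteq> 0 \<Longrightarrow>
    has_rz (\<lambda>p. inverse (f p)) (- a / (f p)^2) (- b / (f p)^2) p"
  by (rule has_rz_eq[OF has_rz_chain[OF _ DERIV_inverse]])
     (auto simp: field_simps power2_eq_square)

lemma has_rz_divide: "has_rz f a b p \<Longrightarrow> has_rz g c d p \<Longrightarrow> g p \<noteq> 0 \<Longrightarrow>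
    has_rz (\<lambda>p. f p / g p) ((a * g p - f p * c) / (g p)^2) ((b * g p - f p * d) / (g p)^2) p"
  unfolding divide_inverse
  by (rule has_rz_eq[OF has_rz_mult[OF _ has_rz_inverse]]) (auto simp: field_simps power2_eq_square)

lemma has_rz_zz:
  assumes "rr p \<noteq> 0"
  shows "has_rz zz 0 1 p"
proof -
  have r: "cdiff rr p" "coord_deriv i rr p = dr i" for i
    using has_rzD[OF has_rz_rr] by simp_all
  have inv: "cdiff (\<lambda>p. inverse (rr p)) p"
    "coord_deriv i (\<lambda>p. inverse (rr p)) p = - (inverse (rr p) ^ Suc (Suc 0)) * dr i" for i
    using cdiff_chain[OF r(1) DERIV_inverse[OF assms]] by (auto simp: r(2))
  have "has_rz (\<lambda>p. p $ Inl 1 * inverse (rr p)) 0 1 p"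
    using assms
    by (simp add: has_rz_def cdiff_mult coord_deriv_mult cdiff_component inv all_action_angle dr_def dz_def zz_def)
       (simp add: field_simps power2_eq_square)
  then show ?thesis
    by (simp add: zz_def[abs_def] divide_inverse)
qed

lemma zz_bounds:
  assumes "0 < p $ Inl 1" "0 < p $ Inl 2"
  shows "0 < rr p" "0 < zz p" "zz p < 1" "0 < ww p" "(ww p)^2 = zz p * (1 - zz p)"
    "p $ Inl 1 = rr p * zz p" "p $ Inl 2 = rr p * (1 - zz p)"
proof -
  show r: "0 < rr p" and z: "0 < zz p" "zz p < 1"
    using assms by (auto simp: rr_def zz_def)
  then show "0 < ww p" "(ww p)^2 = zz p * (1 - zz p)"
    by (auto simp: ww_def)
  show 1: "p $ Inl 1 = rr p * zz p"
    using r by (simp add: zz_def)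
  show "p $ Inl 2 = rr p * (1 - zz p)"
    using 1 by (simp add: rr_def algebra_simps)
qed

lemma has_rz_ww:
  assumes "0 < p $ Inl 1" "0 < p $ Inl 2"
  shows "has_rz ww 0 (mu p) p"
proof -
  note zb = zz_bounds[OF assms]
  have z: "has_rz zz 0 1 p"
    using zb by (intro has_rz_zz) auto
  have "has_rz (\<lambda>p. sqrt (zz p * (1 - zz p))) 0 (mu p) p"
    by (rule has_rz_eq[OF has_rz_chain[OF has_rz_mult[OF z has_rz_diff[OF has_rz_const z]] DERIV_real_sqrt]])
       (use zb in \<open>auto simp: mu_def ww_def field_simps\<close>)
  then show ?thesis by (simp add: ww_def[abs_def])
qed

lemma has_rz_mu:
  assumes "0 < p $ Inl 1" "0 < p $ Inl 2"
  shows "has_rz mu 0 (- (1 + (mu p)^2) / ww p) p"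
proof -
  note zb = zz_bounds[OF assms]
  have z: "has_rz zz 0 1 p"
    using zb by (intro has_rz_zz) auto
  have "has_rz (\<lambda>p. (1 - 2 * zz p) / (2 * ww p)) 0 (- (1 + (mu p)^2) / ww p) p"
    by (rule has_rz_eq[OF has_rz_divide[OF has_rz_diff[OF has_rz_const has_rz_mult[OF has_rz_const z]]
          has_rz_mult[OF has_rz_const has_rz_ww[OF assms]]]])
       (use zb in \<open>auto simp: mu_def field_simps power2_eq_square\<close>)
  then show ?thesis by (simp add: mu_def[abs_def])
qed

text \<open>This is the coordinate Hessian of z, namely - (dr dz + dz dr)/r; its symmetry is what
  makes mixed second derivatives commute later.\<close>

lemma has_rz_dz:
  assumes "rr p \<noteq> 0"
  shows "has_rz (dz i) (- dz i p / rr p) (- dr i / rr p) p"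
proof -
  note z = has_rz_zz[OF assms]
  have 1: "has_rz (\<lambda>p. (1 - zz p) / rr p) (- ((1 - zz p) / rr p) / rr p) (- 1 / rr p) p"
    by (rule has_rz_eq[OF has_rz_divide[OF has_rz_diff[OF has_rz_const z] has_rz_rr]])
       (use assms in \<open>auto simp: field_simps power2_eq_square\<close>)
  have 2: "has_rz (\<lambda>p. - zz p / rr p) (- (- zz p / rr p) / rr p) (- 1 / rr p) p"
    by (rule has_rz_eq[OF has_rz_divide[OF has_rz_minus[OF z] has_rz_rr]])
       (use assms in \<open>auto simp: field_simps power2_eq_square\<close>)
  show ?thesis
  proof (cases i)
    case (Inl j)
    then show ?thesis
      using 1 2 by (cases "j = 1") (auto simp: dz_def[abs_def] dr_def)
  next
    case (Inr j)
    then show ?thesis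
      using has_rz_const by (auto simp: dz_def[abs_def] dr_def)
  qed
qed

text \<open>Closedness of $a\,dr + b\,dz$ gives the symmetry of the second derivatives.\<close>

lemma coord_deriv2_rz:
  assumes f: "eventually (\<lambda>q. has_rz f (a q) (b q) q) (nhds p)"
    and a: "has_rz a ar c p" and b: "has_rz b c bz p" and r: "rr p \<noteq> 0"
  shows "cdiff (coord_deriv j f) p"
    "coord_deriv i (coord_deriv j f) p = coord_deriv j (coord_deriv i f) p"
proof -
  have rz: "has_rz (coord_deriv j f) (ar * dr j + c * dz j p + b p * (- dz j p / rr p))
      (c * dr j + bz * dz j p + b p * (- dr j / rr p)) p" for j
  proof (rule has_rz_cong)
    show "eventually (\<lambda>q. coord_deriv j f q = a q * dr j + b q * dz j q) (nhds p)"
      using f by eventually_elim (simp add: has_rzD)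
    show "has_rz (\<lambda>q. a q * dr j + b q * dz j q) (ar * dr j + c * dz j p + b p * (- dz j p / rr p))
      (c * dr j + bz * dz j p + b p * (- dr j / rr p)) p"
      by (rule has_rz_eq[OF has_rz_add[OF has_rz_mult[OF a has_rz_const] has_rz_mult[OF b has_rz_dz[OF r]]]]) auto
  qed
  show "cdiff (coord_deriv j f) p"
    using has_rzD(1)[OF rz] .
  show "coord_deriv i (coord_deriv j f) p = coord_deriv j (coord_deriv i f) p"
    unfolding has_rzD(2)[OF rz] by (simp add: algebra_simps)
qed


section \<open>Connection and curvature of the metric with a given profile\<close>

locale calabi =
  fixes a :: real and b :: ereal and q :: "nat \<Rightarrow> real \<Rightarrow> real"
    and g :: "action_angle \<Rightarrow> real ^ (2 + 2) ^ (2 + 2)"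
  assumes q_pos: "\<And>r. a < r \<Longrightarrow> ereal r < b \<Longrightarrow> 0 < q 0 r"
    and q_deriv: "\<And>k r. a < r \<Longrightarrow> ereal r < b \<Longrightarrow> (q k has_field_derivative q (Suc k) r) (at r)"
    and g_eq: "\<And>p i j. act p \<in> int_polygon a b \<Longrightarrow> g p $ i $ j =
      rr p / (2 * q 0 (rr p)) * cofr Rad i p * cofr Rad j p + rr p / 2 * cofr Lat i p * cofr Lat j p
      + (2 * q 0 (rr p) / rr p * cofr Fib i p * cofr Fib j p + rr p / 2 * cofr Lon i p * cofr Lon j p)"
begin

definition dom :: "action_angle set" where
  "dom = {p. act p \<in> int_polygon a b}"

text \<open>The k-th derivative of the profile as a function on the chart. An abstract sequence of
  successive derivatives keeps iterated \<open>deriv\<close> out of the curvature formulas.\<close>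

definition qq :: "nat \<Rightarrow> action_angle \<Rightarrow> real" where
  "qq k p = q k (rr p)"

fun nrm :: "leg \<Rightarrow> action_angle \<Rightarrow> real" where
  "nrm Rad p = rr p / (2 * qq 0 p)"
| "nrm Lat p = rr p / 2"
| "nrm Fib p = 2 * qq 0 p / rr p"
| "nrm Lon p = rr p / 2"

text \<open>The entries with \<open>mu\<close> are those of the round sphere; the entries with 1/4
  and with Q/r^2 come from the curvature of the circle fibration; the others from the dependence of
  the norms on r.\<close>

definition con :: "leg \<Rightarrow> leg \<Rightarrow> leg \<Rightarrow> action_angle \<Rightarrow> real" where
  "con A C B p = (case (A, C, B) of
      (Rad, Rad, Rad) \<Rightarrow> 1 / (2 * rr p) - qq 1 p / (2 * qq 0 p)
    | (Rad, Lat, Lat) \<Rightarrow> - qq 0 p / (2 * rr p)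
    | (Rad, Fib, Fib) \<Rightarrow> 2 * (qq 0 p)^2 / (rr p)^3 - 2 * qq 0 p * qq 1 p / (rr p)^2
    | (Rad, Lon, Lon) \<Rightarrow> - qq 0 p / (2 * rr p)
    | (Lat, Rad, Lat) \<Rightarrow> 1 / (2 * rr p)
    | (Lat, Lat, Rad) \<Rightarrow> 1 / (2 * rr p)
    | (Lat, Fib, Lon) \<Rightarrow> - qq 0 p / (rr p)^2
    | (Lat, Lon, Fib) \<Rightarrow> - qq 0 p / (rr p)^2
    | (Lat, Lon, Lon) \<Rightarrow> - mu p
    | (Fib, Rad, Fib) \<Rightarrow> qq 1 p / (2 * qq 0 p) - 1 / (2 * rr p)
    | (Fib, Fib, Rad) \<Rightarrow> qq 1 p / (2 * qq 0 p) - 1 / (2 * rr p)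
    | (Fib, Lat, Lon) \<Rightarrow> - 1 / 4
    | (Fib, Lon, Lat) \<Rightarrow> 1 / 4
    | (Lon, Rad, Lon) \<Rightarrow> 1 / (2 * rr p)
    | (Lon, Lon, Rad) \<Rightarrow> 1 / (2 * rr p)
    | (Lon, Lat, Fib) \<Rightarrow> qq 0 p / (rr p)^2
    | (Lon, Fib, Lat) \<Rightarrow> qq 0 p / (rr p)^2
    | (Lon, Lon, Lat) \<Rightarrow> mu p
    | _ \<Rightarrow> 0)"

text \<open>The partial derivatives of \<open>con\<close> in r, and below in z, are tabulated as
  well, so that the curvature becomes pure algebra.\<close>

definition con_r :: "leg \<Rightarrow> leg \<Rightarrow> leg \<Rightarrow> action_angle \<Rightarrow> real" where
  "con_r A C B p = (case (A, C, B) of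
      (Rad, Rad, Rad) \<Rightarrow> - 1 / (2 * (rr p)^2) - (qq 2 p * qq 0 p - (qq 1 p)^2) / (2 * (qq 0 p)^2)
    | (Rad, Lat, Lat) \<Rightarrow> qq 0 p / (2 * (rr p)^2) - qq 1 p / (2 * rr p)
    | (Rad, Fib, Fib) \<Rightarrow> 8 * qq 0 p * qq 1 p / (rr p)^3 - 6 * (qq 0 p)^2 / (rr p)^4
        - 2 * ((qq 1 p)^2 + qq 0 p * qq 2 p) / (rr p)^2
    | (Rad, Lon, Lon) \<Rightarrow> qq 0 p / (2 * (rr p)^2) - qq 1 p / (2 * rr p)
    | (Lat, Rad, Lat) \<Rightarrow> - 1 / (2 * (rr p)^2)
    | (Lat, Lat, Rad) \<Rightarrow> - 1 / (2 * (rr p)^2)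
    | (Lat, Fib, Lon) \<Rightarrow> 2 * qq 0 p / (rr p)^3 - qq 1 p / (rr p)^2
    | (Lat, Lon, Fib) \<Rightarrow> 2 * qq 0 p / (rr p)^3 - qq 1 p / (rr p)^2
    | (Fib, Rad, Fib) \<Rightarrow> (qq 2 p * qq 0 p - (qq 1 p)^2) / (2 * (qq 0 p)^2) + 1 / (2 * (rr p)^2)
    | (Fib, Fib, Rad) \<Rightarrow> (qq 2 p * qq 0 p - (qq 1 p)^2) / (2 * (qq 0 p)^2) + 1 / (2 * (rr p)^2)
    | (Lon, Rad, Lon) \<Rightarrow> - 1 / (2 * (rr p)^2)
    | (Lon, Lon, Rad) \<Rightarrow> - 1 / (2 * (rr p)^2)
    | (Lon, Lat, Fib) \<Rightarrow> qq 1 p / (rr p)^2 - 2 * qq 0 p / (rr p)^3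
    | (Lon, Fib, Lat) \<Rightarrow> qq 1 p / (rr p)^2 - 2 * qq 0 p / (rr p)^3
    | _ \<Rightarrow> 0)"

definition con_z :: "leg \<Rightarrow> leg \<Rightarrow> leg \<Rightarrow> action_angle \<Rightarrow> real" where
  "con_z A C B p = (case (A, C, B) of
      (Lat, Lon, Lon) \<Rightarrow> (1 + (mu p)^2) / ww p
    | (Lon, Lon, Lat) \<Rightarrow> - (1 + (mu p)^2) / ww p
    | _ \<Rightarrow> 0)"

lemma dom_facts:
  assumes "p \<in> dom"
  shows "a < rr p" "ereal (rr p) < b" "0 < p $ Inl 1" "0 < p $ Inl 2" "0 < rr p" "0 < zz p" "zz p < 1"
    "0 < ww p" "(ww p)^2 = zz p * (1 - zz p)" "0 < qq 0 p"
  using assms zz_bounds[of p] q_pos[of "rr p"]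
  by (auto simp: dom_def int_polygon_def act_def rr_def qq_def)

lemma has_rz_qq: "p \<in> dom \<Longrightarrow> has_rz (qq k) (qq (Suc k) p) 0 p"
  unfolding qq_def[abs_def]
  by (rule has_rz_eq[OF has_rz_chain[OF has_rz_rr q_deriv]]) (auto dest: dom_facts)

lemma open_dom: "open dom"
proof -
  have *: "dom = {p. 0 < p $ Inl 1} \<inter> {p. 0 < p $ Inl 2} \<inter> {p. a < p $ Inl 1 + p $ Inl 2} \<inter> (\<lambda>p. p $ Inl 1 + p $ Inl 2) -` {r. ereal r < b}"
    by (auto simp: dom_def int_polygon_def act_def)
  have "open {r. ereal r < b}"
    by (cases b) (auto simp: open_Collect_less continuous_on_id continuous_on_const)
  then have "open ((\<lambda>p :: action_angle. p $ Inl 1 + p $ Inl 2) -` {r. ereal r < b})"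
    by (intro open_vimage) (auto intro!: continuous_intros)
  then show ?thesis
    unfolding * by (intro open_Int open_Collect_less continuous_intros)
qed

lemma has_rz_nrm:
  assumes "p \<in> dom"
  shows "has_rz (nrm Rad) ((qq 0 p - rr p * qq 1 p) / (2 * (qq 0 p)^2)) 0 p"
    "has_rz (nrm Lat) (1 / 2) 0 p"
    "has_rz (nrm Fib) (2 * (qq 1 p * rr p - qq 0 p) / (rr p)^2) 0 p"
    "has_rz (nrm Lon) (1 / 2) 0 p"
proof -
  note d = dom_facts[OF assms]
  note q = has_rz_qq[OF assms]
  have h: "has_rz (\<lambda>p. rr p / 2) (1 / 2) 0 p"
    by (rule has_rz_eq[OF has_rz_divide[OF has_rz_rr has_rz_const]]) auto
  show "has_rz (nrm Lat) (1 / 2) 0 p" "has_rz (nrm Lon) (1 / 2) 0 p"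
    using h by (simp_all add: nrm.simps[abs_def])
  have "has_rz (\<lambda>p. rr p / (2 * qq 0 p)) ((qq 0 p - rr p * qq 1 p) / (2 * (qq 0 p)^2)) 0 p"
    by (rule has_rz_eq[OF has_rz_divide[OF has_rz_rr has_rz_mult[OF has_rz_const q]]])
       (use d in \<open>auto simp: field_simps power2_eq_square\<close>)
  then show "has_rz (nrm Rad) ((qq 0 p - rr p * qq 1 p) / (2 * (qq 0 p)^2)) 0 p" by (simp add: nrm.simps[abs_def])
  have "has_rz (\<lambda>p. 2 * qq 0 p / rr p) (2 * (qq 1 p * rr p - qq 0 p) / (rr p)^2) 0 p"
    by (rule has_rz_eq[OF has_rz_divide[OF has_rz_mult[OF has_rz_const q] has_rz_rr]])
       (use d in \<open>auto simp: field_simps power2_eq_square\<close>)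
  then show "has_rz (nrm Fib) (2 * (qq 1 p * rr p - qq 0 p) / (rr p)^2) 0 p" by (simp add: nrm.simps[abs_def])
qed

lemma has_rz_con:
  assumes "p \<in> dom"
  shows "has_rz (con A C B) (con_r A C B p) (con_z A C B p) p"
proof -
  note d = dom_facts[OF assms]
  have q0: "has_rz (qq 0) (qq 1 p) 0 p" and q1: "has_rz (qq 1) (qq 2 p) 0 p"
    using has_rz_qq[OF assms, of 0] has_rz_qq[OF assms, of 1] by (simp_all add: numeral_2_eq_2)
  note rr2 = has_rz_mult[OF has_rz_const has_rz_rr] and q02 = has_rz_mult[OF has_rz_const q0]
  have pw: "has_rz (\<lambda>p. rr p ^ n) (real n * rr p ^ (n - 1)) 0 p" for n
    by (rule has_rz_eq[OF has_rz_chain[OF has_rz_rr]]) (auto intro!: derivative_eq_intros)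
  have q0p: "has_rz (\<lambda>p. (qq 0 p)^2) (2 * qq 0 p * qq 1 p) 0 p"
    using has_rz_mult[OF q0 q0] by (simp add: power2_eq_square mult_ac)
  have 1: "has_rz (\<lambda>p. 1 / (2 * rr p)) (- 1 / (2 * (rr p)^2)) 0 p"
    by (rule has_rz_eq[OF has_rz_divide[OF has_rz_const rr2]])
       (use d in \<open>auto simp: field_simps power2_eq_square\<close>)
  have 2: "has_rz (\<lambda>p. qq 1 p / (2 * qq 0 p)) ((qq 2 p * qq 0 p - (qq 1 p)^2) / (2 * (qq 0 p)^2)) 0 p"
    by (rule has_rz_eq[OF has_rz_divide[OF q1 q02]])
       (use d in \<open>auto simp: field_simps power2_eq_square eval_nat_numeral\<close>)
  have 3: "has_rz (\<lambda>p. - qq 0 p / (2 * rr p)) (qq 0 p / (2 * (rr p)^2) - qq 1 p / (2 * rr p)) 0 p"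
    by (rule has_rz_eq[OF has_rz_divide[OF has_rz_minus[OF q0] rr2]])
       (use d in \<open>auto simp: field_simps power2_eq_square\<close>)
  have 4: "has_rz (\<lambda>p. qq 0 p / (rr p)^2) (qq 1 p / (rr p)^2 - 2 * qq 0 p / (rr p)^3) 0 p"
    by (rule has_rz_eq[OF has_rz_divide[OF q0 pw[of 2]]])
       (use d in \<open>auto simp: field_simps power2_eq_square power3_eq_cube\<close>)
  have 5: "has_rz (\<lambda>p. 2 * (qq 0 p)^2 / (rr p)^3) (4 * qq 0 p * qq 1 p / (rr p)^3 - 6 * (qq 0 p)^2 / (rr p)^4) 0 p"
    by (rule has_rz_eq[OF has_rz_divide[OF has_rz_mult[OF has_rz_const q0p] pw[of 3]]])
       (use d in \<open>auto simp: field_simps eval_nat_numeral\<close>)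
  have 6: "has_rz (\<lambda>p. 2 * qq 0 p * qq 1 p / (rr p)^2)
      (2 * ((qq 1 p)^2 + qq 0 p * qq 2 p) / (rr p)^2 - 4 * qq 0 p * qq 1 p / (rr p)^3) 0 p"
    by (rule has_rz_eq[OF has_rz_divide[OF has_rz_mult[OF q02 q1] pw[of 2]]])
       (use d in \<open>auto simp: field_simps eval_nat_numeral\<close>)
  note m = has_rz_mu[OF d(3,4)]
  have 7: "has_rz (\<lambda>p. - qq 0 p / (rr p)^2) (2 * qq 0 p / (rr p)^3 - qq 1 p / (rr p)^2) 0 p"
    using has_rz_minus[OF 4] by simp
  have 8: "has_rz (\<lambda>p. - mu p) 0 ((1 + (mu p)^2) / ww p) p"
    by (rule has_rz_eq[OF has_rz_minus[OF m]]) (use d in \<open>auto simp: field_simps\<close>)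
  have 9: "has_rz (\<lambda>p. - 1 / 4) 0 0 p" "has_rz (\<lambda>p. 1 / 4) 0 0 p" "has_rz (\<lambda>p. 0) 0 0 p"
    by (rule has_rz_const)+
  show ?thesis
    unfolding con_def[abs_def] con_r_def con_z_def
    apply (cases A; cases C; cases B)
    apply (simp_all only: prod.case leg.case)
    apply (rule 1 3 7 8 9 m 4 has_rz_eq[OF has_rz_diff[OF 1 2]] has_rz_eq[OF has_rz_diff[OF 2 1]]
          has_rz_eq[OF has_rz_diff[OF 5 6]] refl | simp)+
    done
qed

text \<open>Functions of r and z are constant on the tori, so the two angular legs annihilate them;
  the latitude leg is w times the z-derivative.\<close>

lemma fderiv_rz:
  assumes "p \<in> dom" "has_rz f x y p"
  shows "fderiv frm C f p = (case C of Rad \<Rightarrow> x | Lat \<Rightarrow> ww p * y | _ \<Rightarrow> 0)"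
proof -
  note d = dom_facts[OF assms(1)]
  show ?thesis
    unfolding fderiv_def has_rzD(2)[OF assms(2)] sum_action_angle
    using d by (cases C) (auto simp: dr_def dz_def field_simps)
qed

lemma eventually_dom: "p \<in> dom \<Longrightarrow> eventually (\<lambda>q. q \<in> dom) (nhds p)"
  using open_dom by (simp add: eventually_nhds_in_open)

lemma has_rz_inv_ww:
  assumes "p \<in> dom"
  shows "has_rz (\<lambda>p. inverse (ww p)) 0 (- mu p / (ww p)^2) p"
  by (rule has_rz_eq[OF has_rz_inverse[OF has_rz_ww]]) (use dom_facts[OF assms] in auto)

lemma coframe_smooth:
  assumes p: "p \<in> dom"
  shows "cdiff (cofr A k) p" "cdiff (coord_deriv j (cofr A k)) p"
    "coord_deriv i (coord_deriv j (cofr A k)) p = coord_deriv j (coord_deriv i (cofr A k)) p"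
proof -
  note d = dom_facts[OF p]
  have ev: "eventually (\<lambda>q. has_rz f (x q) (y q) q) (nhds p)" if "\<And>q. q \<in> dom \<Longrightarrow> has_rz f (x q) (y q) q" for f x y
    using eventually_dom[OF p] by eventually_elim (rule that)
  \<comment> \<open>A closed form x dr + y dz has equal cross derivatives. Their common value
    \<open>c\<close> is what \<open>coord_deriv2_rz\<close> asks for, and every component of the
    coframe is an instance.\<close>
  have main: "cdiff f p \<and> cdiff (coord_deriv j f) p \<and> coord_deriv i (coord_deriv j f) p = coord_deriv j (coord_deriv i f) p"
    if "\<And>q. q \<in> dom \<Longrightarrow> has_rz f (x q) (y q) q" "has_rz x xr c p" "has_rz y c yz p" for f x y xr c yz
    using coord_deriv2_rz[OF ev[OF that(1)] that(2,3)] has_rzD(1)[OF that(1)[OF p]] d by auto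
  have rz: "q \<in> dom \<Longrightarrow> rr q \<noteq> 0" for q using dom_facts[of q] by simp
  have const: "cdiff f p \<and> cdiff (coord_deriv j f) p \<and> coord_deriv i (coord_deriv j f) p = coord_deriv j (coord_deriv i f) p"
    if "f = (\<lambda>q. c)" for f c
    by (rule main[of _ "\<lambda>q. 0" "\<lambda>q. 0"]) (auto intro: has_rz_const simp: that)
  have "cdiff (cofr A k) p \<and> cdiff (coord_deriv j (cofr A k)) p
      \<and> coord_deriv i (coord_deriv j (cofr A k)) p = coord_deriv j (coord_deriv i (cofr A k)) p"
  proof (cases A)
    case Rad
    then show ?thesis by (intro const[of _ "dr k"]) auto
  next
    case Lat
    have *: "cofr A k = (\<lambda>q. dz k q * inverse (ww q))"
      by (auto simp: Lat divide_inverse)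
    show ?thesis
    proof (rule main)
      show "has_rz (cofr A k) (- dz k q / rr q * inverse (ww q)) (- dr k / rr q * inverse (ww q) - dz k q * mu q / (ww q)^2) q"
        if "q \<in> dom" for q
        unfolding * by (rule has_rz_eq[OF has_rz_mult[OF has_rz_dz has_rz_inv_ww[OF that]]])
          (use dom_facts[OF that] in auto)
      have dzr: "has_rz (\<lambda>q. - dz k q / rr q) (2 * dz k p / (rr p)^2) (dr k / (rr p)^2) p"
        by (rule has_rz_eq[OF has_rz_divide[OF has_rz_minus[OF has_rz_dz] has_rz_rr]])
           (use d in \<open>auto simp: field_simps power2_eq_square\<close>)
      show "has_rz (\<lambda>q. - dz k q / rr q * inverse (ww q)) (2 * dz k p / (rr p)^2 * inverse (ww p))
          (dr k / (rr p)^2 * inverse (ww p) + dz k p / rr p * mu p / (ww p)^2) p"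
        by (rule has_rz_eq[OF has_rz_mult[OF dzr has_rz_inv_ww[OF p]]]) auto
      have drr: "has_rz (\<lambda>q. - dr k / rr q) (dr k / (rr p)^2) 0 p"
        by (rule has_rz_eq[OF has_rz_divide[OF has_rz_const has_rz_rr]]) (use d in auto)
      have muw: "has_rz (\<lambda>q. mu q / (ww q)^2) 0 ((- (1 + (mu p)^2) / ww p * (ww p)^2 - mu p * (mu p * ww p + ww p * mu p)) / ((ww p)^2)^2) p"
        unfolding power2_eq_square[of "ww _"]
        by (rule has_rz_eq[OF has_rz_divide[OF has_rz_mu has_rz_mult[OF has_rz_ww has_rz_ww]]]) (use d in auto)
      show "has_rz (\<lambda>q. - dr k / rr q * inverse (ww q) - dz k q * mu q / (ww q)^2)
        (dr k / (rr p)^2 * inverse (ww p) + dz k p / rr p * mu p / (ww p)^2)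
        (dr k / rr p * mu p / (ww p)^2 + dr k / rr p * (mu p / (ww p)^2)
          - dz k p * ((- (1 + (mu p)^2) / ww p * (ww p)^2 - mu p * (mu p * ww p + ww p * mu p)) / ((ww p)^2)^2)) p"
        unfolding times_divide_eq_right[symmetric, of "dz k _"]
        by (rule has_rz_eq[OF has_rz_diff[OF has_rz_mult[OF drr has_rz_inv_ww[OF p]] has_rz_mult[OF has_rz_dz muw]]])
           (use d in auto)
    qed
  next
    case Fib
    show ?thesis
    proof (cases k)
      case (Inl l)
      then show ?thesis by (intro const[of _ 0]) (auto simp: Fib)
    next
      case (Inr l)
      show ?thesis
      proof (cases "l = 1")
        case True
        then have "cofr A k = zz" by (auto simp: Fib Inr)
        then show ?thesis
          using main[of zz "\<lambda>q. 0" "\<lambda>q. 1" 0 0 0] has_rz_zz rz has_rz_const by simp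
      next
        case False
        then have "cofr A k = (\<lambda>q. 1 - zz q)" by (auto simp: Fib Inr)
        moreover have "has_rz (\<lambda>q. 1 - zz q) 0 (- 1) q" if "q \<in> dom" for q
          by (rule has_rz_eq[OF has_rz_diff[OF has_rz_const has_rz_zz]]) (use rz[OF that] in auto)
        ultimately show ?thesis
          using main[of "\<lambda>q. 1 - zz q" "\<lambda>q. 0" "\<lambda>q. - 1" 0 0 0] has_rz_const by simp
      qed
    qed
  next
    case Lon
    show ?thesis
    proof (cases k)
      case (Inl l)
      then show ?thesis by (intro const[of _ 0]) (auto simp: Lon)
    next
      case (Inr l)
      define c :: real where "c = (if l = 1 then 2 else - 2)"
      have *: "cofr A k = (\<lambda>q. c * ww q)" by (auto simp: Lon Inr c_def)
      show ?thesis
      proof (rule main)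
        show "has_rz (cofr A k) 0 (c * mu q) q" if "q \<in> dom" for q
          unfolding * by (rule has_rz_eq[OF has_rz_mult[OF has_rz_const has_rz_ww]]) (use dom_facts[OF that] in auto)
        show "has_rz (\<lambda>q. 0) 0 0 p" by (rule has_rz_const)
        show "has_rz (\<lambda>q. c * mu q) 0 (c * (- (1 + (mu p)^2) / ww p)) p"
          by (rule has_rz_eq[OF has_rz_mult[OF has_rz_const has_rz_mu]]) (use d in auto)
      qed
    qed
  qed
  then show "cdiff (cofr A k) p" "cdiff (coord_deriv j (cofr A k)) p"
    "coord_deriv i (coord_deriv j (cofr A k)) p = coord_deriv j (coord_deriv i (cofr A k)) p"
    by auto
qed

lemma coord_deriv_cofr:
  assumes p: "p \<in> dom"
  shows "coord_deriv i (cofr A k) p = (case A of Rad \<Rightarrow> 0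
    | Lat \<Rightarrow> (- dz k p / rr p / ww p) * dr i + (- dr k / rr p / ww p - dz k p * mu p / (ww p)^2) * dz i p
    | Fib \<Rightarrow> (case k of Inl _ \<Rightarrow> 0 | Inr l \<Rightarrow> if l = 1 then dz i p else - dz i p)
    | Lon \<Rightarrow> (case k of Inl _ \<Rightarrow> 0 | Inr l \<Rightarrow> if l = 1 then 2 * mu p * dz i p else - 2 * mu p * dz i p))"
proof -
  note d = dom_facts[OF p]
  have z: "has_rz zz 0 1 p" by (rule has_rz_zz) (use d in auto)
  have w: "has_rz ww 0 (mu p) p" by (rule has_rz_ww) (use d in auto)
  have 1: "coord_deriv i (\<lambda>p. 1 - zz p) p = - dz i p" "coord_deriv i zz p = dz i p"
    using has_rzD(2)[OF has_rz_diff[OF has_rz_const z]] has_rzD(2)[OF z] by auto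
  have 2: "coord_deriv i (\<lambda>p. 2 * ww p) p = 2 * mu p * dz i p" "coord_deriv i (\<lambda>p. - (2 * ww p)) p = - 2 * mu p * dz i p"
    using has_rzD(2)[OF has_rz_mult[OF has_rz_const w]] has_rzD(2)[OF has_rz_minus[OF has_rz_mult[OF has_rz_const w]]] by auto
  have 3: "coord_deriv i (\<lambda>p. dz k p / ww p) p =
      (- dz k p / rr p / ww p) * dr i + (- dr k / rr p / ww p - dz k p * mu p / (ww p)^2) * dz i p" for k
    by (rule has_rzD(2), rule has_rz_eq[OF has_rz_divide[OF has_rz_dz w]])
       (use d in \<open>auto simp: field_simps power2_eq_square\<close>)
  have eqs: "cofr Rad k = (\<lambda>p. dr k)" "cofr Lat k = (\<lambda>p. dz k p / ww p)"
    "cofr Fib (Inl j) = (\<lambda>p. 0)" "cofr Fib (Inr l) = (if l = 1 then zz else (\<lambda>p. 1 - zz p))"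
    "cofr Lon (Inl j) = (\<lambda>p. 0)" "cofr Lon (Inr l) = (if l = 1 then (\<lambda>p. 2 * ww p) else (\<lambda>p. - (2 * ww p)))" for j l k
    by auto
  show ?thesis
    by (cases A; cases k) (simp_all add: eqs 1 2 3)
qed

text \<open>Certifies the table \<open>con\<close> as the Levi-Civita connection: the structure
  equation and the compatibility with the metric are rational identities in r, z, w, mu and the
  profile, checked leg by leg.\<close>

sublocale moving_frame g dom cofr frm nrm con
proof
  show "open dom" by (rule open_dom)
  fix p :: action_angle assume p: "p \<in> dom"
  note d = dom_facts[OF p]
  have w2: "ww p * ww p = zz p * (1 - zz p)" using d by (simp add: power2_eq_square)
  show "(\<Sum>i\<in>UNIV. frm A i p * cofr B i p) = (if A = B then 1 else 0)" for A B
    unfolding sum_action_angle using d by (cases A; cases B) (auto simp: dr_def dz_def field_simps)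
  show "(\<Sum>A\<in>UNIV. cofr A i p * frm A j p) = (if i = j then 1 else 0)" for i j
  proof -
    have "\<forall>i j. (\<Sum>A\<in>UNIV. cofr A i p * frm A j p) = (if i = j then 1 else 0)"
      unfolding sum_leg all_action_angle using d by (auto simp: dr_def dz_def field_simps)
    then show ?thesis by blast
  qed
  show "g p $ i $ j = (\<Sum>A\<in>UNIV. nrm A p * cofr A i p * cofr A j p)" for i j
    using p by (simp add: g_eq dom_def sum_leg qq_def)
  show "nrm A p \<noteq> 0" for A
    using d by (cases A) auto
  show "cdiff (cofr A i) p" "cdiff (coord_deriv j (cofr A i)) p"
    "coord_deriv i (coord_deriv j (cofr A k)) p = coord_deriv j (coord_deriv i (cofr A k)) p" for A i j k
    by (rule coframe_smooth[OF p])+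
  show "cdiff (frm A i) p" for A i
  proof -
    have z: "cdiff zz p" "cdiff (\<lambda>p. 1 - zz p) p"
      using has_rzD(1)[OF has_rz_zz[of p]] has_rzD(1)[OF has_rz_diff[OF has_rz_const has_rz_zz[of p]]] d by auto
    have w: "cdiff (\<lambda>p. ww p * rr p) p" "cdiff (\<lambda>p. inverse (ww p)) p"
      using has_rzD(1)[OF has_rz_mult[OF has_rz_ww has_rz_rr]] has_rzD(1)[OF has_rz_inv_ww[OF p]] d by auto
    have eqs: "frm Rad (Inl l) = (if l = 1 then zz else (\<lambda>p. 1 - zz p))" "frm Rad (Inr l) = (\<lambda>p. 0)"
      "frm Lat (Inl l) = (if l = 1 then (\<lambda>p. ww p * rr p) else (\<lambda>p. - (ww p * rr p)))" "frm Lat (Inr l) = (\<lambda>p. 0)"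
      "frm Fib (Inl l) = (\<lambda>p. 0)" "frm Fib (Inr l) = (\<lambda>p. 1)"
      "frm Lon (Inl l) = (\<lambda>p. 0)"
      "frm Lon (Inr l) = (if l = 1 then (\<lambda>p. (1 - zz p) * (1 / 2 * inverse (ww p))) else (\<lambda>p. - (zz p * (1 / 2 * inverse (ww p)))))" for l
      by (auto simp: field_simps)
    show ?thesis
      by (cases A; cases i) (auto simp only: eqs split: if_splits intro!: z w cdiff_mult cdiff_minus cdiff_const)
  qed
  show "cdiff (nrm A) p" for A
    using has_rz_nrm[OF p] by (cases A) (auto dest: has_rzD(1))
  show "cdiff (con A C B) p" for A B C
    using has_rz_con[OF p] by (rule has_rzD(1))
  show "coord_deriv i (cofr A j) p - coord_deriv j (cofr A i) p
      = - (\<Sum>C\<in>UNIV. \<Sum>B\<in>UNIV. (con A C B p - con A B C p) * cofr C i p * cofr B j p)" for A i j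
    unfolding coord_deriv_cofr[OF p] sum_leg con_def
    using d by (cases A; cases i; cases j) (auto simp: dr_def dz_def field_simps)
  show "(if A = B then fderiv frm C (nrm A) p else 0) = nrm A p * con A C B p + nrm B p * con B C A p" for A B C
    using d
    by (cases A; cases B; cases C)
       (simp_all add: con_def has_rz_nrm[OF p, THEN fderiv_rz[OF p]], simp_all add: field_simps eval_nat_numeral)
qed

end

section \<open>Curvature tensors as quadratic forms on two-forms\<close>

definition biv :: "leg \<Rightarrow> leg \<Rightarrow> leg \<Rightarrow> leg \<Rightarrow> real" where
  "biv X Y I J = (if I = X \<and> J = Y then 1 else 0) - (if I = Y \<and> J = X then 1 else 0)"

text \<open>A tensor with the pair symmetries of a curvature tensor is a quadratic form on
  two-forms. Squares and, below, polarised products of simple two-forms span these quadratic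
  forms.\<close>

definition bsq :: "leg \<Rightarrow> leg \<Rightarrow> leg \<Rightarrow> leg \<Rightarrow> leg \<Rightarrow> leg \<Rightarrow> real" where
  "bsq X Y I J K L = biv X Y I J * biv X Y K L"

definition bpr :: "leg \<Rightarrow> leg \<Rightarrow> leg \<Rightarrow> leg \<Rightarrow> leg \<Rightarrow> leg \<Rightarrow> leg \<Rightarrow> leg \<Rightarrow> real" where
  "bpr X Y U V I J K L = biv X Y I J * biv U V K L + biv U V I J * biv X Y K L"

context calabi
begin

lemma fnabla_con:
  assumes p: "p \<in> dom"
  shows "fnabla frm con (\<lambda>L q. - con A (L ! 0) (L ! 1) q) [J, I, K] p
    = - (case J of Rad \<Rightarrow> con_r A I K p | Lat \<Rightarrow> ww p * con_z A I K p | _ \<Rightarrow> 0)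
      + (\<Sum>D\<in>UNIV. con D J I p * con A D K p) + (\<Sum>D\<in>UNIV. con D J K p * con A I D p)"
proof -
  have "fderiv frm J (\<lambda>q. - con A I K q) p
    = - (case J of Rad \<Rightarrow> con_r A I K p | Lat \<Rightarrow> ww p * con_z A I K p | _ \<Rightarrow> 0)"
    by (subst fderiv_rz[OF p has_rz_minus[OF has_rz_con[OF p]]]) (auto split: leg.splits)
  then show ?thesis
    by (simp add: fnabla_def sum_negf)
qed

text \<open>The curvature with its last index lowered. The weights 1, 1/2, 1/2 of the three pairings
  of four distinct legs are compatible with the first Bianchi identity.\<close>

definition rm :: "leg \<Rightarrow> leg \<Rightarrow> leg \<Rightarrow> leg \<Rightarrow> action_angle \<Rightarrow> real" where
  "rm I J K L p =
     (qq 1 p / (8 * qq 0 p) - 1 / (4 * rr p)) * (bsq Rad Lat I J K L + bsq Rad Lon I J K L)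
     + (2 * qq 0 p / (rr p)^3 - 2 * qq 1 p / (rr p)^2 + qq 2 p / rr p) * bsq Rad Fib I J K L
     + (qq 0 p * qq 1 p / (2 * (rr p)^2) - (qq 0 p)^2 / (rr p)^3) * (bsq Lat Fib I J K L + bsq Fib Lon I J K L)
     + (qq 0 p / (2 * rr p) - rr p / 2) * bsq Lat Lon I J K L
     + (qq 1 p / (2 * rr p) - qq 0 p / (rr p)^2) *
        (bpr Rad Fib Lat Lon I J K L + (bpr Rad Lat Fib Lon I J K L + bpr Rad Lon Lat Fib I J K L) / 2)"

lemma nrm_nz: "p \<in> dom \<Longrightarrow> nrm A p \<noteq> 0"
  by (rule N_nonzero)

lemma fcurv_rm:
  assumes p: "p \<in> dom"
  shows "nrm L p * fcurv I J K L p = rm I J K L p"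
proof -
  note d = dom_facts[OF p]
  have w: "ww p \<noteq> 0" "rr p \<noteq> 0" "qq 0 p \<noteq> 0" using d by auto
  show ?thesis
    unfolding fcurv_def fnabla_con[OF p] sum_leg rm_def bsq_def bpr_def
    by (cases I; cases J; cases K; cases L;
        simp add: con_def con_r_def con_z_def biv_def w; (simp add: w field_simps eval_nat_numeral)?)
qed

lemma fric_table:
  assumes p: "p \<in> dom"
  shows "fric J K p = (case (J, K) of
      (Rad, Rad) \<Rightarrow> qq 1 p / (2 * rr p * qq 0 p) - qq 2 p / (2 * qq 0 p)
    | (Lat, Lat) \<Rightarrow> 1 - qq 1 p / (2 * rr p)
    | (Lon, Lon) \<Rightarrow> 1 - qq 1 p / (2 * rr p)
    | (Fib, Fib) \<Rightarrow> 2 * qq 0 p * qq 1 p / (rr p)^3 - 2 * qq 0 p * qq 2 p / (rr p)^2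
    | _ \<Rightarrow> 0)"
proof -
  note d = dom_facts[OF p]
  have w: "rr p \<noteq> 0" "qq 0 p \<noteq> 0" using d by auto
  have "fcurv I J K L p = rm I J K L p / nrm L p" for I J K L
    using fcurv_rm[OF p, of L I J K] nrm_nz[OF p, of L] by (simp add: field_simps)
  then show ?thesis
    unfolding fric_def sum_leg rm_def bsq_def bpr_def
    by (cases J; cases K; simp add: biv_def w; (simp add: w field_simps eval_nat_numeral)?)
qed

lemma fscal_table:
  assumes p: "p \<in> dom"
  shows "fscal p = 4 / rr p - 2 * qq 2 p / rr p"
  using dom_facts[OF p] unfolding fscal_def sum_leg fric_table[OF p]
  by (simp add: field_simps eval_nat_numeral)

text \<open>The index n counts r-derivatives. In an orthonormal frame the Weyl operator has the
  entries \<open>wA 0 p\<close> and \<open>2 * wK 0 p / rr p\<close>. Their sum equals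
  \<open>- fscal p / 6\<close>: on a Kaehler surface the self-dual half of the Weyl tensor is
  determined by the scalar curvature. Their difference belongs to the other half.\<close>

definition wA :: "nat \<Rightarrow> action_angle \<Rightarrow> real" where
  "wA n p = (if n = 0 then 2 * qq 0 p / (rr p)^3 - qq 1 p / (rr p)^2 + (qq 2 p - 2) / (3 * rr p)
    else if n = 1 then 4 * qq 1 p / (rr p)^3 - 6 * qq 0 p / (rr p)^4 - qq 2 p / (rr p)^2
       - (qq 2 p - 2) / (3 * (rr p)^2) + qq 3 p / (3 * rr p)
    else 24 * qq 0 p / (rr p)^5 - 18 * qq 1 p / (rr p)^4 + 6 * qq 2 p / (rr p)^3
       + 2 * (qq 2 p - 2) / (3 * (rr p)^3) - 5 * qq 3 p / (3 * (rr p)^2) + qq 4 p / (3 * rr p))"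

definition wK :: "nat \<Rightarrow> action_angle \<Rightarrow> real" where
  "wK n p = (if n = 0 then qq 1 p / (2 * rr p) - qq 0 p / (rr p)^2
    else if n = 1 then 2 * qq 0 p / (rr p)^3 - 3 * qq 1 p / (2 * (rr p)^2) + qq 2 p / (2 * rr p)
    else 5 * qq 1 p / (rr p)^3 - 6 * qq 0 p / (rr p)^4 - 2 * qq 2 p / (rr p)^2 + qq 3 p / (2 * rr p))"

lemma has_rz_wA:
  assumes p: "p \<in> dom" and "n < 2"
  shows "has_rz (wA n) (wA (Suc n) p) 0 p" "has_rz (wK n) (wK (Suc n) p) 0 p"
proof -
  note d = dom_facts[OF p]
  have q: "has_rz (qq 0) (qq 1 p) 0 p" "has_rz (qq 1) (qq 2 p) 0 p" "has_rz (qq 2) (qq 3 p) 0 p" "has_rz (qq 3) (qq 4 p) 0 p"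
    using has_rz_qq[OF p, of 0] has_rz_qq[OF p, of 1] has_rz_qq[OF p, of 2] has_rz_qq[OF p, of 3]
    by (simp_all add: eval_nat_numeral)
  have pw: "has_rz (\<lambda>p. rr p ^ n) (real n * rr p ^ (n - 1)) 0 p" for n
    by (rule has_rz_eq[OF has_rz_chain[OF has_rz_rr]]) (auto intro!: derivative_eq_intros)
  have frac: "has_rz (\<lambda>p. f p / rr p ^ k) (x / rr p ^ k - real k * f p / rr p ^ Suc k) 0 p"
    if "has_rz f x 0 p" for f x k
    by (rule has_rz_eq[OF has_rz_divide[OF that pw]])
       (use d in \<open>cases k; auto simp: field_simps power2_eq_square\<close>)+
  note C = has_rz_const
  have A0: "has_rz (wA 0) (wA 1 p) 0 p"
  proof -
    have "has_rz (\<lambda>p. 2 * qq 0 p / rr p ^ 3 - qq 1 p / rr p ^ 2 + 1 / 3 * ((qq 2 p - 2) / rr p ^ 1)) (wA 1 p) 0 p"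
      by (rule has_rz_eq[OF has_rz_add[OF has_rz_diff[OF frac[OF has_rz_eq[OF has_rz_mult[OF C q(1)]]] frac[OF q(2)]]
            has_rz_mult[OF C frac[OF has_rz_eq[OF has_rz_diff[OF q(3) C]]]]]])
         (use d in \<open>auto simp: wA_def field_simps eval_nat_numeral\<close>)
    then show ?thesis by (simp add: wA_def[abs_def])
  qed
  have K0: "has_rz (wK 0) (wK 1 p) 0 p"
  proof -
    have "has_rz (\<lambda>p. 1 / 2 * (qq 1 p / rr p ^ 1) - qq 0 p / rr p ^ 2) (wK 1 p) 0 p"
      by (rule has_rz_eq[OF has_rz_diff[OF has_rz_mult[OF C frac[OF q(2)]] frac[OF q(1)]]])
         (use d in \<open>auto simp: wK_def field_simps eval_nat_numeral\<close>)
    then show ?thesis by (simp add: wK_def[abs_def])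
  qed
  have A1: "has_rz (wA 1) (wA 2 p) 0 p"
  proof -
    have "has_rz (\<lambda>p. 4 * (qq 1 p / rr p ^ 3) - 6 * (qq 0 p / rr p ^ 4) - qq 2 p / rr p ^ 2
       - 1 / 3 * ((qq 2 p - 2) / rr p ^ 2) + 1 / 3 * (qq 3 p / rr p ^ 1)) (wA 2 p) 0 p"
      by (rule has_rz_eq[OF has_rz_add[OF has_rz_diff[OF has_rz_diff[OF has_rz_diff[OF
          has_rz_mult[OF C frac[OF q(2)]] has_rz_mult[OF C frac[OF q(1)]]] frac[OF q(3)]]
          has_rz_mult[OF C frac[OF has_rz_eq[OF has_rz_diff[OF q(3) C]]]]] has_rz_mult[OF C frac[OF q(4)]]]])
         (use d in \<open>auto simp: wA_def field_simps eval_nat_numeral\<close>)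
    then show ?thesis by (simp add: wA_def[abs_def])
  qed
  have K1: "has_rz (wK 1) (wK 2 p) 0 p"
  proof -
    have "has_rz (\<lambda>p. 2 * (qq 0 p / rr p ^ 3) - 3 / 2 * (qq 1 p / rr p ^ 2) + 1 / 2 * (qq 2 p / rr p ^ 1)) (wK 2 p) 0 p"
      by (rule has_rz_eq[OF has_rz_add[OF has_rz_diff[OF has_rz_mult[OF C frac[OF q(1)]] has_rz_mult[OF C frac[OF q(2)]]]
          has_rz_mult[OF C frac[OF q(3)]]]])
         (use d in \<open>auto simp: wK_def field_simps eval_nat_numeral\<close>)
    then show ?thesis by (simp add: wK_def[abs_def])
  qed
  show "has_rz (wA n) (wA (Suc n) p) 0 p" "has_rz (wK n) (wK (Suc n) p) 0 p"
    using A0 A1 K0 K1 \<open>n < 2\<close> by (auto simp: less_Suc_eq numeral_2_eq_2)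
qed

text \<open>\<open>wR x y\<close> is the algebraic curvature tensor with the symmetries of the metric whose
  \<open>Rad, Fib, Rad, Fib\<close> and \<open>Rad, Fib, Lat, Lon\<close> components are \<open>x\<close> and \<open>y\<close>.  The Weyl tensor and
  its radial covariant derivative are of this form.\<close>

definition wR :: "real \<Rightarrow> real \<Rightarrow> leg \<Rightarrow> leg \<Rightarrow> leg \<Rightarrow> leg \<Rightarrow> action_angle \<Rightarrow> real" where
  "wR x y I J K L p =
     x * (bsq Rad Fib I J K L - (rr p)^2 / (8 * qq 0 p) * (bsq Rad Lat I J K L + bsq Rad Lon I J K L)
       - qq 0 p / 2 * (bsq Lat Fib I J K L + bsq Fib Lon I J K L) + (rr p)^2 / 4 * bsq Lat Lon I J K L)
     + y * (bpr Rad Fib Lat Lon I J K L + (bpr Rad Lat Fib Lon I J K L + bpr Rad Lon Lat Fib I J K L) / 2)"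

definition wt :: "leg list \<Rightarrow> action_angle \<Rightarrow> real" where
  "wt X p = wR (wA 0 p) (wK 0 p) (X ! 0) (X ! 1) (X ! 2) (X ! 3) p"

lemma fweyl_wt:
  assumes p: "p \<in> dom"
  shows "fweyl I J K L p = wt [I, J, K, L] p"
proof -
  note d = dom_facts[OF p]
  have w: "rr p \<noteq> 0" "qq 0 p \<noteq> 0" using d by auto
  have c: "real CARD(2 + 2) = 4" by simp
  have n: "nrm L p * fcurv I J K L p = rm I J K L p" by (rule fcurv_rm[OF p])
  show ?thesis
    unfolding fweyl_def n c fscal_table[OF p] wt_def wR_def rm_def bsq_def bpr_def fric_table[OF p] fmetric_def
    by (cases I; cases J; cases K; cases L;
        simp add: biv_def wA_def wK_def w; (simp add: w field_simps eval_nat_numeral)?)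
qed

lemma has_rz_wR:
  assumes p: "p \<in> dom" and x: "has_rz x x' 0 p" and y: "has_rz y y' 0 p"
  shows "has_rz (\<lambda>p. wR (x p) (y p) I J K L p) (wR x' y' I J K L p
     + x p * (- (2 * rr p * qq 0 p - (rr p)^2 * qq 1 p) / (8 * (qq 0 p)^2) * (bsq Rad Lat I J K L + bsq Rad Lon I J K L)
       - qq 1 p / 2 * (bsq Lat Fib I J K L + bsq Fib Lon I J K L) + rr p / 2 * bsq Lat Lon I J K L)) 0 p"
proof -
  note d = dom_facts[OF p]
  have q0: "has_rz (qq 0) (qq 1 p) 0 p"
    using has_rz_qq[OF p, of 0] by simp
  have r2: "has_rz (\<lambda>p. (rr p)^2) (2 * rr p) 0 p"
    using has_rz_mult[OF has_rz_rr has_rz_rr] by (simp add: power2_eq_square)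
  have 1: "has_rz (\<lambda>p. (rr p)^2 / (8 * qq 0 p)) ((2 * rr p * qq 0 p - (rr p)^2 * qq 1 p) / (8 * (qq 0 p)^2)) 0 p"
    by (rule has_rz_eq[OF has_rz_divide[OF r2 has_rz_mult[OF has_rz_const q0]]])
       (use d in \<open>auto simp: field_simps eval_nat_numeral\<close>)
  have 2: "has_rz (\<lambda>p. qq 0 p / 2) (qq 1 p / 2) 0 p" "has_rz (\<lambda>p. (rr p)^2 / 4) (rr p / 2) 0 p"
    by (rule has_rz_eq[OF has_rz_divide[OF q0 has_rz_const]], auto,
        rule has_rz_eq[OF has_rz_divide[OF r2 has_rz_const]], auto)
  note C = has_rz_const
  show ?thesis
    unfolding wR_def
    by (rule has_rz_eq[OF has_rz_add[OF has_rz_mult[OF x has_rz_add[OF has_rz_diff[OF has_rz_diff[OF C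
          has_rz_mult[OF 1 C]] has_rz_mult[OF 2(1) C]] has_rz_mult[OF 2(2) C]]] has_rz_mult[OF y C]]])
       (simp_all add: algebra_simps diff_divide_distrib add_divide_distrib)
qed

text \<open>A multiple of \<open>wA 0 p - 2 * wK 0 p / rr p\<close>, hence of the anti-self-dual
  half. The self-dual half is a function of r times a parallel tensor and does not contribute to
  derivatives transverse to the radial direction.\<close>

definition wM :: "action_angle \<Rightarrow> real" where
  "wM p = 3 / 8 * wA 0 p - 3 / 4 * (wK 0 p / rr p)"

text \<open>In the radial case \<open>wK 1 p - wK 0 p / rr p\<close> is r times the derivative of
  the normalised entry \<open>wK 0 p / rr p\<close>. In the fibre case the connection only rotates
  the Rad-Fib and Lat-Lon planes, and the Weyl tensor is invariant under such rotations.\<close>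

definition dwt :: "leg list \<Rightarrow> action_angle \<Rightarrow> real" where
  "dwt X p = (let I = X ! 1; J = X ! 2; K = X ! 3; L = X ! 4 in case X ! 0 of
      Rad \<Rightarrow> wR (wA 1 p) (wK 1 p - wK 0 p / rr p) I J K L p
    | Lat \<Rightarrow> wM p * (bpr Rad Fib Rad Lon I J K L + 2 * (qq 0 p / rr p) * bpr Rad Fib Lat Fib I J K L
        - rr p / 2 * bpr Rad Lon Lat Lon I J K L - qq 0 p * bpr Lat Fib Lat Lon I J K L)
    | Fib \<Rightarrow> 0
    | Lon \<Rightarrow> wM p * (rr p / 2 * bpr Rad Lat Lat Lon I J K L - bpr Rad Lat Rad Fib I J K L
        - 2 * (qq 0 p / rr p) * bpr Rad Fib Fib Lon I J K L + qq 0 p * bpr Lat Lon Fib Lon I J K L))"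

definition dwt_r :: "leg list \<Rightarrow> action_angle \<Rightarrow> real" where
  "dwt_r X p = (let I = X ! 1; J = X ! 2; K = X ! 3; L = X ! 4;
      M' = 3 / 8 * wA 1 p - 3 / 4 * (wK 1 p / rr p - wK 0 p / (rr p)^2);
      s = 2 * (qq 1 p / rr p - qq 0 p / (rr p)^2) in case X ! 0 of
      Rad \<Rightarrow> wR (wA 2 p) (wK 2 p - (wK 1 p / rr p - wK 0 p / (rr p)^2)) I J K L p
        + wA 1 p * (- (2 * rr p * qq 0 p - (rr p)^2 * qq 1 p) / (8 * (qq 0 p)^2) * (bsq Rad Lat I J K L + bsq Rad Lon I J K L)
       - qq 1 p / 2 * (bsq Lat Fib I J K L + bsq Fib Lon I J K L) + rr p / 2 * bsq Lat Lon I J K L)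
    | Lat \<Rightarrow> M' * (bpr Rad Fib Rad Lon I J K L + 2 * (qq 0 p / rr p) * bpr Rad Fib Lat Fib I J K L
        - rr p / 2 * bpr Rad Lon Lat Lon I J K L - qq 0 p * bpr Lat Fib Lat Lon I J K L)
      + wM p * (s * bpr Rad Fib Lat Fib I J K L - 1 / 2 * bpr Rad Lon Lat Lon I J K L - qq 1 p * bpr Lat Fib Lat Lon I J K L)
    | Fib \<Rightarrow> 0
    | Lon \<Rightarrow> M' * (rr p / 2 * bpr Rad Lat Lat Lon I J K L - bpr Rad Lat Rad Fib I J K L
        - 2 * (qq 0 p / rr p) * bpr Rad Fib Fib Lon I J K L + qq 0 p * bpr Lat Lon Fib Lon I J K L)
      + wM p * (1 / 2 * bpr Rad Lat Lat Lon I J K L - s * bpr Rad Fib Fib Lon I J K L + qq 1 p * bpr Lat Lon Fib Lon I J K L))"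

lemma has_rz_dwt:
  assumes p: "p \<in> dom"
  shows "has_rz (dwt X) (dwt_r X p) 0 p"
proof -
  note d = dom_facts[OF p]
  have q0: "has_rz (qq 0) (qq 1 p) 0 p"
    using has_rz_qq[OF p, of 0] by simp
  have A: "has_rz (wA 0) (wA 1 p) 0 p" "has_rz (wA 1) (wA 2 p) 0 p" "has_rz (wK 0) (wK 1 p) 0 p" "has_rz (wK 1) (wK 2 p) 0 p"
    using has_rz_wA[OF p, of 0] has_rz_wA[OF p, of 1] by (simp_all add: numeral_2_eq_2)
  have over_r: "has_rz (\<lambda>p. f p / rr p) (x / rr p - f p / (rr p)^2) 0 p" if "has_rz f x 0 p" for f x
    by (rule has_rz_eq[OF has_rz_divide[OF that has_rz_rr]]) (use d in \<open>auto simp: field_simps power2_eq_square\<close>)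
  note C = has_rz_const
  have M: "has_rz wM (3 / 8 * wA 1 p - 3 / 4 * (wK 1 p / rr p - wK 0 p / (rr p)^2)) 0 p"
    unfolding wM_def[abs_def]
    by (rule has_rz_eq[OF has_rz_diff[OF has_rz_mult[OF C A(1)] has_rz_mult[OF C over_r[OF A(3)]]]]) auto
  have r: "has_rz (\<lambda>p. rr p / 2) (1 / 2) 0 p"
    by (rule has_rz_eq[OF has_rz_divide[OF has_rz_rr C]]) auto
  note q = has_rz_mult[OF C over_r[OF q0]]
  show ?thesis
  proof (cases "X ! 0")
    case Rad
    show ?thesis
      unfolding dwt_def[abs_def] dwt_r_def Rad Let_def leg.case
      by (rule has_rz_wR[OF p A(2) has_rz_eq[OF has_rz_diff[OF A(4) over_r[OF A(3)]]]]) auto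
  next
    case Lat
    show ?thesis
      unfolding dwt_def[abs_def] dwt_r_def Lat Let_def leg.case
      by (rule has_rz_eq[OF has_rz_mult[OF M has_rz_diff[OF has_rz_diff[OF has_rz_add[OF C has_rz_mult[OF q C]]
            has_rz_mult[OF r C]] has_rz_mult[OF q0 C]]]]) (simp_all add: algebra_simps)
  next
    case Fib
    show ?thesis
      unfolding dwt_def[abs_def] dwt_r_def Fib Let_def leg.case by (rule C)
  next
    case Lon
    show ?thesis
      unfolding dwt_def[abs_def] dwt_r_def Lon Let_def leg.case
      by (rule has_rz_eq[OF has_rz_mult[OF M has_rz_add[OF has_rz_diff[OF has_rz_diff[OF has_rz_mult[OF r C] C]
            has_rz_mult[OF q C]] has_rz_mult[OF q0 C]]]]) (simp_all add: algebra_simps)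
  qed
qed

lemma con_sum:
  "(\<Sum>D\<in>UNIV. con D Rad Rad p * X D) = (1 / (2 * rr p) - qq 1 p / (2 * qq 0 p)) * X Rad"
  "(\<Sum>D\<in>UNIV. con D Rad Lat p * X D) = 1 / (2 * rr p) * X Lat"
  "(\<Sum>D\<in>UNIV. con D Rad Fib p * X D) = (qq 1 p / (2 * qq 0 p) - 1 / (2 * rr p)) * X Fib"
  "(\<Sum>D\<in>UNIV. con D Rad Lon p * X D) = 1 / (2 * rr p) * X Lon"
  "(\<Sum>D\<in>UNIV. con D Lat Rad p * X D) = 1 / (2 * rr p) * X Lat"
  "(\<Sum>D\<in>UNIV. con D Lat Lat p * X D) = - qq 0 p / (2 * rr p) * X Rad"
  "(\<Sum>D\<in>UNIV. con D Lat Fib p * X D) = qq 0 p / (rr p)^2 * X Lon"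
  "(\<Sum>D\<in>UNIV. con D Lat Lon p * X D) = - 1 / 4 * X Fib"
  "(\<Sum>D\<in>UNIV. con D Fib Rad p * X D) = (qq 1 p / (2 * qq 0 p) - 1 / (2 * rr p)) * X Fib"
  "(\<Sum>D\<in>UNIV. con D Fib Lat p * X D) = qq 0 p / (rr p)^2 * X Lon"
  "(\<Sum>D\<in>UNIV. con D Fib Fib p * X D) = (2 * (qq 0 p)^2 / (rr p)^3 - 2 * qq 0 p * qq 1 p / (rr p)^2) * X Rad"
  "(\<Sum>D\<in>UNIV. con D Fib Lon p * X D) = - qq 0 p / (rr p)^2 * X Lat"
  "(\<Sum>D\<in>UNIV. con D Lon Rad p * X D) = 1 / (2 * rr p) * X Lon"
  "(\<Sum>D\<in>UNIV. con D Lon Lat p * X D) = 1 / 4 * X Fib + mu p * X Lon"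
  "(\<Sum>D\<in>UNIV. con D Lon Fib p * X D) = - qq 0 p / (rr p)^2 * X Lat"
  "(\<Sum>D\<in>UNIV. con D Lon Lon p * X D) = - qq 0 p / (2 * rr p) * X Rad - mu p * X Lat"
  by (simp_all add: sum_leg con_def)

text \<open>The connection is applied to the six basic two-forms once for each direction. Everything
  of rank 4 then follows by the Leibniz rule, which replaces a case split over all index tuples by a
  short table.\<close>

definition nb :: "leg \<Rightarrow> leg \<Rightarrow> leg \<Rightarrow> action_angle \<Rightarrow> leg \<Rightarrow> leg \<Rightarrow> real" where
  "nb C X Y p I J = (\<Sum>D\<in>UNIV. con D C I p * biv X Y D J) + (\<Sum>D\<in>UNIV. con D C J p * biv X Y I D)"

lemma nb_table:
  "nb Rad Rad Lat p I J = ((1 / (2 * rr p) - qq 1 p / (2 * qq 0 p)) * biv Rad Lat I J) + (1 / (2 * rr p) * biv Rad Lat I J)"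
  "nb Rad Rad Fib p I J = 0"
  "nb Rad Rad Lon p I J = ((1 / (2 * rr p) - qq 1 p / (2 * qq 0 p)) * biv Rad Lon I J) + (1 / (2 * rr p) * biv Rad Lon I J)"
  "nb Rad Lat Fib p I J = (1 / (2 * rr p) * biv Lat Fib I J) + ((qq 1 p / (2 * qq 0 p) - 1 / (2 * rr p)) * biv Lat Fib I J)"
  "nb Rad Lat Lon p I J = (1 / (2 * rr p) * biv Lat Lon I J) + (1 / (2 * rr p) * biv Lat Lon I J)"
  "nb Rad Fib Lon p I J = ((qq 1 p / (2 * qq 0 p) - 1 / (2 * rr p)) * biv Fib Lon I J) + (1 / (2 * rr p) * biv Fib Lon I J)"
  "nb Lat Rad Lat p I J = 0"
  "nb Lat Rad Fib p I J = - (qq 0 p / (2 * rr p) * biv Lat Fib I J) - (1 / 4 * biv Rad Lon I J)"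
  "nb Lat Rad Lon p I J = - (qq 0 p / (2 * rr p) * biv Lat Lon I J) + (qq 0 p / (rr p)^2 * biv Rad Fib I J)"
  "nb Lat Lat Fib p I J = (1 / (2 * rr p) * biv Rad Fib I J) - (1 / 4 * biv Lat Lon I J)"
  "nb Lat Lat Lon p I J = (1 / (2 * rr p) * biv Rad Lon I J) + (qq 0 p / (rr p)^2 * biv Lat Fib I J)"
  "nb Lat Fib Lon p I J = 0"
  "nb Fib Rad Lat p I J = - ((2 * (qq 0 p)^2 / (rr p)^3 - 2 * qq 0 p * qq 1 p / (rr p)^2) * biv Lat Fib I J) - (qq 0 p / (rr p)^2 * biv Rad Lon I J)"
  "nb Fib Rad Fib p I J = 0"
  "nb Fib Rad Lon p I J = (qq 0 p / (rr p)^2 * biv Rad Lat I J) + ((2 * (qq 0 p)^2 / (rr p)^3 - 2 * qq 0 p * qq 1 p / (rr p)^2) * biv Fib Lon I J)"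
  "nb Fib Lat Fib p I J = - ((qq 1 p / (2 * qq 0 p) - 1 / (2 * rr p)) * biv Rad Lat I J) + (qq 0 p / (rr p)^2 * biv Fib Lon I J)"
  "nb Fib Lat Lon p I J = 0"
  "nb Fib Fib Lon p I J = ((qq 1 p / (2 * qq 0 p) - 1 / (2 * rr p)) * biv Rad Lon I J) - (qq 0 p / (rr p)^2 * biv Lat Fib I J)"
  "nb Lon Rad Lat p I J = - (qq 0 p / (rr p)^2 * biv Rad Fib I J) + (qq 0 p / (2 * rr p) * biv Lat Lon I J) - (mu p * biv Rad Lon I J)"
  "nb Lon Rad Fib p I J = (1 / 4 * biv Rad Lat I J) + (qq 0 p / (2 * rr p) * biv Fib Lon I J)"
  "nb Lon Rad Lon p I J = (mu p * biv Rad Lat I J)"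
  "nb Lon Lat Fib p I J = (mu p * biv Fib Lon I J)"
  "nb Lon Lat Lon p I J = - (1 / (2 * rr p) * biv Rad Lat I J) - (qq 0 p / (rr p)^2 * biv Fib Lon I J)"
  "nb Lon Fib Lon p I J = - (1 / (2 * rr p) * biv Rad Fib I J) + (1 / 4 * biv Lat Lon I J) - (mu p * biv Lat Fib I J)"
  by (cases I; cases J; simp only: nb_def con_sum; simp add: biv_def)+

definition conn4 :: "leg \<Rightarrow> (leg \<Rightarrow> leg \<Rightarrow> leg \<Rightarrow> leg \<Rightarrow> real) \<Rightarrow> action_angle \<Rightarrow>
    leg \<Rightarrow> leg \<Rightarrow> leg \<Rightarrow> leg \<Rightarrow> real" where
  "conn4 C F p I J K L = (\<Sum>D\<in>UNIV. con D C I p * F D J K L) + (\<Sum>D\<in>UNIV. con D C J p * F I D K L)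
     + (\<Sum>D\<in>UNIV. con D C K p * F I J D L) + (\<Sum>D\<in>UNIV. con D C L p * F I J K D)"

lemma conn4_add: "conn4 C (\<lambda>I J K L. F I J K L + G I J K L) p I J K L = conn4 C F p I J K L + conn4 C G p I J K L"
  by (simp add: conn4_def distrib_left sum.distrib)

lemma conn4_diff: "conn4 C (\<lambda>I J K L. F I J K L - G I J K L) p I J K L = conn4 C F p I J K L - conn4 C G p I J K L"
  by (simp add: conn4_def right_diff_distrib sum_subtractf)

lemma conn4_cmult: "conn4 C (\<lambda>I J K L. c * F I J K L) p I J K L = c * conn4 C F p I J K L"
  by (simp add: conn4_def distrib_left sum_distrib_left mult.left_commute)

lemma conn4_divide: "conn4 C (\<lambda>I J K L. F I J K L / c) p I J K L = conn4 C F p I J K L / c"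
  by (simp add: conn4_def add_divide_distrib sum_divide_distrib)

lemma conn4_zero: "conn4 C (\<lambda>I J K L. 0) p I J K L = 0"
  by (simp add: conn4_def)

lemma conn4_bpr: "conn4 C (bpr X Y U V) p I J K L =
    nb C X Y p I J * biv U V K L + biv X Y I J * nb C U V p K L
    + (nb C U V p I J * biv X Y K L + biv U V I J * nb C X Y p K L)"
  by (simp add: conn4_def nb_def bpr_def distrib_left distrib_right sum.distrib sum_distrib_left sum_distrib_right mult_ac)

lemma conn4_bsq: "conn4 C (bsq X Y) p I J K L =
    nb C X Y p I J * biv X Y K L + biv X Y I J * nb C X Y p K L"
  by (simp add: conn4_def nb_def bsq_def distrib_left distrib_right sum_distrib_left sum_distrib_right mult_ac)

lemmas conn4_simps = conn4_add conn4_diff conn4_cmult conn4_divide conn4_zero conn4_bpr conn4_bsq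

lemma nth_leg_list:
  fixes C I J K L :: leg
  shows "[I, J, K, L] ! 0 = I" "[I, J, K, L] ! 1 = J" "[I, J, K, L] ! 2 = K" "[I, J, K, L] ! 3 = L"
    "[C, I, J, K, L] ! 0 = C" "[C, I, J, K, L] ! 1 = I" "[C, I, J, K, L] ! 2 = J" "[C, I, J, K, L] ! 3 = K"
    "[C, I, J, K, L] ! 4 = L"
  by (simp_all add: eval_nat_numeral)

lemma fnabla_rank4:
  "fnabla frm con \<tau> [C, I, J, K, L] p
    = fderiv frm C (\<tau> [I, J, K, L]) p - conn4 C (\<lambda>I J K L. \<tau> [I, J, K, L] p) p I J K L"
  by (simp add: fnabla_def conn4_def numeral_eq_Suc)

lemma fnabla_rank5:
  "fnabla frm con \<tau> [B, C, I, J, K, L] p = fderiv frm B (\<tau> [C, I, J, K, L]) p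
    - (\<Sum>D\<in>UNIV. con D B C p * \<tau> [D, I, J, K, L] p) - conn4 B (\<lambda>I J K L. \<tau> [C, I, J, K, L] p) p I J K L"
  by (simp add: fnabla_def conn4_def numeral_eq_Suc)

lemma fnabla_wt:
  assumes p: "p \<in> dom"
  shows "fnabla frm con wt [C, I, J, K, L] p = dwt [C, I, J, K, L] p"
proof -
  note d = dom_facts[OF p]
  have w: "rr p \<noteq> 0" "qq 0 p \<noteq> 0" using d by auto
  have A: "has_rz (wA 0) (wA 1 p) 0 p" "has_rz (wK 0) (wK 1 p) 0 p"
    using has_rz_wA[OF p, of 0] by simp_all
  have fd: "fderiv frm C (wt [I, J, K, L]) p = (case C of Rad \<Rightarrow> wR (wA 1 p) (wK 1 p) I J K L p
     + wA 0 p * (- (2 * rr p * qq 0 p - (rr p)^2 * qq 1 p) / (8 * (qq 0 p)^2) * (bsq Rad Lat I J K L + bsq Rad Lon I J K L)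
       - qq 1 p / 2 * (bsq Lat Fib I J K L + bsq Fib Lon I J K L) + rr p / 2 * bsq Lat Lon I J K L) | _ \<Rightarrow> 0)"
    unfolding wt_def[abs_def] nth_leg_list
    by (subst fderiv_rz[OF p has_rz_wR[OF p A]]) (auto split: leg.splits)
  show ?thesis
    unfolding fnabla_rank4 fd wt_def nth_leg_list wR_def conn4_simps dwt_def Let_def
    by (cases C; simp only: nb_table leg.case; simp add: bsq_def bpr_def wM_def w field_simps eval_nat_numeral)
qed

end

section \<open>Second derivatives of the Weyl tensor and the Bach-flat equations\<close>

context calabi
begin

text \<open>The second derivatives contracted in the Bach tensor, already divided by
  \<open>nrm K p * nrm L p\<close>. One leg \<open>I\<close> suffices as an argument, since by
  \<open>fnabla_dwt\<close> the terms with distinct free legs vanish.\<close>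

definition ddwt :: "leg \<Rightarrow> leg \<Rightarrow> leg \<Rightarrow> action_angle \<Rightarrow> real" where
  "ddwt K L I p = (case (K, L, I) of
     (Lat, Lat, Rad) \<Rightarrow> wA 1 p / (4 * rr p)
   | (Lat, Fib, Rad) \<Rightarrow> 3 * wK 0 p / (4 * (rr p)^3) - 3 * wA 0 p / (8 * (rr p)^2)
   | (Lat, Lon, Rad) \<Rightarrow> - 1 * 3 * wK 0 p / (2 * (rr p)^3) + 3 * wA 0 p / (4 * (rr p)^2)
   | (Fib, Lat, Rad) \<Rightarrow> - 1 * 3 * wK 0 p / (4 * (rr p)^3) + 3 * qq 1 p * wK 0 p / (4 * (rr p)^2 * qq 0 p) + 3 * wA 0 p / (8 * (rr p)^2) - 3 * qq 1 p * wA 0 p / (8 * rr p * qq 0 p)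
   | (Fib, Fib, Rad) \<Rightarrow> wA 1 p / (2 * rr p) - qq 1 p * wA 1 p / (2 * qq 0 p)
   | (Fib, Lon, Rad) \<Rightarrow> - 1 * 3 * wK 0 p / (4 * (rr p)^3) + 3 * qq 1 p * wK 0 p / (4 * (rr p)^2 * qq 0 p) + 3 * wA 0 p / (8 * (rr p)^2) - 3 * qq 1 p * wA 0 p / (8 * rr p * qq 0 p)
   | (Lon, Lat, Rad) \<Rightarrow> - 1 * 3 * wK 0 p / (2 * (rr p)^3) + 3 * wA 0 p / (4 * (rr p)^2)
   | (Lon, Fib, Rad) \<Rightarrow> 3 * wK 0 p / (4 * (rr p)^3) - 3 * wA 0 p / (8 * (rr p)^2)
   | (Lon, Lon, Rad) \<Rightarrow> wA 1 p / (4 * rr p)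
   | (Rad, Rad, Lat) \<Rightarrow> - 1 * qq 0 p * wA 1 p / (4 * rr p) + qq 1 p * wA 1 p / 4 + qq 0 p * wA 2 p / 2
   | (Rad, Lon, Lat) \<Rightarrow> 15 * qq 0 p * wK 0 p / (4 * (rr p)^3) - 3 * qq 1 p * wK 0 p / (4 * (rr p)^2) - 3 * qq 0 p * wK 1 p / (2 * (rr p)^2) - 9 * qq 0 p * wA 0 p / (8 * (rr p)^2) + 3 * qq 1 p * wA 0 p / (8 * rr p) + 3 * qq 0 p * wA 1 p / (4 * rr p)
   | (Fib, Fib, Lat) \<Rightarrow> - 1 * qq 0 p * wA 1 p / (4 * rr p) + qq 1 p * wA 1 p / 4
   | (Fib, Lon, Lat) \<Rightarrow> 3 * qq 0 p * wK 0 p / (4 * (rr p)^3) - 3 * qq 1 p * wK 0 p / (4 * (rr p)^2) - 3 * qq 0 p * wA 0 p / (8 * (rr p)^2) + 3 * qq 1 p * wA 0 p / (8 * rr p)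
   | (Lon, Rad, Lat) \<Rightarrow> 9 * qq 0 p * wK 0 p / (4 * (rr p)^3) - 3 * qq 0 p * wK 1 p / (2 * (rr p)^2) - 3 * qq 0 p * wA 0 p / (8 * (rr p)^2) + 3 * qq 0 p * wA 1 p / (4 * rr p)
   | (Lon, Fib, Lat) \<Rightarrow> - 1 * 3 * qq 0 p * wK 0 p / (4 * (rr p)^3) + 3 * qq 0 p * wA 0 p / (8 * (rr p)^2)
   | (Lon, Lon, Lat) \<Rightarrow> - 1 * 3 * qq 0 p * wK 0 p / (rr p)^3 + 3 * qq 0 p * wA 0 p / (2 * (rr p)^2) - qq 0 p * wA 1 p / (2 * rr p)
   | (Rad, Rad, Fib) \<Rightarrow> 2 * (qq 0 p)^2 * wA 1 p / (rr p)^3 - 2 * qq 0 p * qq 1 p * wA 1 p / (rr p)^2 - 4 * (qq 0 p)^2 * wA 2 p / (rr p)^2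
   | (Rad, Lat, Fib) \<Rightarrow> - 1 * 15 * (qq 0 p)^2 * wK 0 p / (rr p)^5 + 3 * qq 0 p * qq 1 p * wK 0 p / (rr p)^4 + 6 * (qq 0 p)^2 * wK 1 p / (rr p)^4 + 9 * (qq 0 p)^2 * wA 0 p / (2 * (rr p)^4) - 3 * qq 0 p * qq 1 p * wA 0 p / (2 * (rr p)^3) - 3 * (qq 0 p)^2 * wA 1 p / (rr p)^3
   | (Rad, Lon, Fib) \<Rightarrow> - 1 * 15 * (qq 0 p)^2 * wK 0 p / (rr p)^5 + 3 * qq 0 p * qq 1 p * wK 0 p / (rr p)^4 + 6 * (qq 0 p)^2 * wK 1 p / (rr p)^4 + 9 * (qq 0 p)^2 * wA 0 p / (2 * (rr p)^4) - 3 * qq 0 p * qq 1 p * wA 0 p / (2 * (rr p)^3) - 3 * (qq 0 p)^2 * wA 1 p / (rr p)^3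
   | (Lat, Rad, Fib) \<Rightarrow> - 1 * 9 * (qq 0 p)^2 * wK 0 p / (rr p)^5 + 6 * (qq 0 p)^2 * wK 1 p / (rr p)^4 + 3 * (qq 0 p)^2 * wA 0 p / (2 * (rr p)^4) - 3 * (qq 0 p)^2 * wA 1 p / (rr p)^3
   | (Lat, Lat, Fib) \<Rightarrow> 12 * (qq 0 p)^2 * wK 0 p / (rr p)^5 - 6 * (qq 0 p)^2 * wA 0 p / (rr p)^4 + (qq 0 p)^2 * wA 1 p / (rr p)^3
   | (Lat, Lon, Fib) \<Rightarrow> 6 * (qq 0 p)^2 * wK 0 p / (rr p)^5 - 3 * (qq 0 p)^2 * wA 0 p / (rr p)^4
   | (Lon, Rad, Fib) \<Rightarrow> - 1 * 9 * (qq 0 p)^2 * wK 0 p / (rr p)^5 + 6 * (qq 0 p)^2 * wK 1 p / (rr p)^4 + 3 * (qq 0 p)^2 * wA 0 p / (2 * (rr p)^4) - 3 * (qq 0 p)^2 * wA 1 p / (rr p)^3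
   | (Lon, Lat, Fib) \<Rightarrow> 6 * (qq 0 p)^2 * wK 0 p / (rr p)^5 - 3 * (qq 0 p)^2 * wA 0 p / (rr p)^4
   | (Lon, Lon, Fib) \<Rightarrow> 12 * (qq 0 p)^2 * wK 0 p / (rr p)^5 - 6 * (qq 0 p)^2 * wA 0 p / (rr p)^4 + (qq 0 p)^2 * wA 1 p / (rr p)^3
   | (Rad, Rad, Lon) \<Rightarrow> - 1 * qq 0 p * wA 1 p / (4 * rr p) + qq 1 p * wA 1 p / 4 + qq 0 p * wA 2 p / 2
   | (Rad, Lat, Lon) \<Rightarrow> 15 * qq 0 p * wK 0 p / (4 * (rr p)^3) - 3 * qq 1 p * wK 0 p / (4 * (rr p)^2) - 3 * qq 0 p * wK 1 p / (2 * (rr p)^2) - 9 * qq 0 p * wA 0 p / (8 * (rr p)^2) + 3 * qq 1 p * wA 0 p / (8 * rr p) + 3 * qq 0 p * wA 1 p / (4 * rr p)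
   | (Lat, Rad, Lon) \<Rightarrow> 9 * qq 0 p * wK 0 p / (4 * (rr p)^3) - 3 * qq 0 p * wK 1 p / (2 * (rr p)^2) - 3 * qq 0 p * wA 0 p / (8 * (rr p)^2) + 3 * qq 0 p * wA 1 p / (4 * rr p)
   | (Lat, Lat, Lon) \<Rightarrow> - 1 * 3 * qq 0 p * wK 0 p / (rr p)^3 + 3 * qq 0 p * wA 0 p / (2 * (rr p)^2) - qq 0 p * wA 1 p / (2 * rr p)
   | (Lat, Fib, Lon) \<Rightarrow> - 1 * 3 * qq 0 p * wK 0 p / (4 * (rr p)^3) + 3 * qq 0 p * wA 0 p / (8 * (rr p)^2)
   | (Fib, Lat, Lon) \<Rightarrow> 3 * qq 0 p * wK 0 p / (4 * (rr p)^3) - 3 * qq 1 p * wK 0 p / (4 * (rr p)^2) - 3 * qq 0 p * wA 0 p / (8 * (rr p)^2) + 3 * qq 1 p * wA 0 p / (8 * rr p)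
   | (Fib, Fib, Lon) \<Rightarrow> - 1 * qq 0 p * wA 1 p / (4 * rr p) + qq 1 p * wA 1 p / 4
   | _ \<Rightarrow> 0)"

lemma fnabla_dwt:
  assumes p: "p \<in> dom"
  shows "fnabla frm con dwt [K, L, K, I, J, L] p = (if I = J then ddwt K L I p * (nrm K p * nrm L p) else 0)"
proof -
  note d = dom_facts[OF p]
  have w: "rr p \<noteq> 0" "qq 0 p \<noteq> 0" using d by auto
  have fd: "fderiv frm C (dwt X) p = (case C of Rad \<Rightarrow> dwt_r X p | _ \<Rightarrow> 0)" for C X
    by (subst fderiv_rz[OF p has_rz_dwt[OF p]]) (auto split: leg.splits)
  show ?thesis
    apply (cases K; cases L; simp only: fnabla_rank5 con_sum fd nth_leg_list leg.case dwt_def dwt_r_def Let_def;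
        (simp only: conn4_simps wR_def)?; (simp only: nb_table bsq_def bpr_def)?)
    apply (cases I; cases J; simp add: biv_def ddwt_def; (simp add: wM_def w field_simps eval_nat_numeral)?)+
    done
qed

lemma ddwt_sum:
  "(\<Sum>L\<in>UNIV. \<Sum>K\<in>UNIV. ddwt K L I p) = (case I of
    Rad \<Rightarrow> 3 * qq 1 p * wK 0 p / (2 * (rr p)^2 * qq 0 p) - 3 * wK 0 p / (rr p)^3 + 3 * wA 0 p / (2 * (rr p)^2)
      - 3 * qq 1 p * wA 0 p / (4 * rr p * qq 0 p) + wA 1 p / rr p - qq 1 p * wA 1 p / (2 * qq 0 p)
  | Fib \<Rightarrow> 6 * qq 0 p * qq 1 p * wK 0 p / (rr p)^4 - 12 * (qq 0 p)^2 * wK 0 p / (rr p)^5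
      + 24 * (qq 0 p)^2 * wK 1 p / (rr p)^4 - 6 * (qq 0 p)^2 * wA 0 p / (rr p)^4 - 3 * qq 0 p * qq 1 p * wA 0 p / (rr p)^3
      - 8 * (qq 0 p)^2 * wA 1 p / (rr p)^3 - 2 * qq 0 p * qq 1 p * wA 1 p / (rr p)^2 - 4 * (qq 0 p)^2 * wA 2 p / (rr p)^2
  | _ \<Rightarrow> 3 * qq 0 p * wK 0 p / (rr p)^3 - 3 * qq 1 p * wK 0 p / (2 * (rr p)^2) - 3 * qq 0 p * wK 1 p / (rr p)^2
      + 3 * qq 1 p * wA 0 p / (4 * rr p) + qq 0 p * wA 1 p / (2 * rr p) + qq 1 p * wA 1 p / 2 + qq 0 p * wA 2 p / 2)"
  unfolding sum_leg by (cases I) (simp_all add: ddwt_def mult_ac)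

lemma ric_wt_sum:
  assumes p: "p \<in> dom"
  shows "(\<Sum>L\<in>UNIV. \<Sum>K\<in>UNIV. fric K L p * wt [K, I, J, L] p / 2 / (nrm K p * nrm L p))
    = (if I = J then (case I of
      Rad \<Rightarrow> wA 0 p / (2 * qq 0 p) - qq 1 p * wA 0 p / (2 * rr p * qq 0 p) + qq 2 p * wA 0 p / (4 * qq 0 p)
    | Fib \<Rightarrow> 2 * qq 0 p * wA 0 p / (rr p)^2 - 2 * qq 0 p * qq 1 p * wA 0 p / (rr p)^3 + qq 0 p * qq 2 p * wA 0 p / (rr p)^2
    | _ \<Rightarrow> qq 1 p * wA 0 p / (2 * rr p) - wA 0 p / 2 - qq 2 p * wA 0 p / 4) else 0)"
proof -
  note d = dom_facts[OF p]
  have nz: "rr p \<noteq> 0" "qq 0 p \<noteq> 0" using d by auto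
  show ?thesis
    unfolding sum_leg fric_table[OF p] wt_def nth_leg_list wR_def bsq_def bpr_def prod.case leg.case
    by (cases I; cases J; simp add: biv_def; (simp add: nrm.simps nz field_simps eval_nat_numeral)?)
qed

lemma fbach_diag:
  assumes p: "p \<in> dom"
  shows "fbach wt dwt I J p = (if I = J then (\<Sum>L\<in>UNIV. \<Sum>K\<in>UNIV. ddwt K L I p) else 0)
    + (\<Sum>L\<in>UNIV. \<Sum>K\<in>UNIV. fric K L p * wt [K, I, J, L] p / 2 / (nrm K p * nrm L p))"
proof -
  have "nrm K p * nrm L p \<noteq> 0" for K L using nrm_nz[OF p] by simp
  then show ?thesis
    by (simp add: fbach_def fnabla_dwt[OF p] add_divide_distrib sum.distrib)
qed

text \<open>Stated for plain real numbers, so that clearing denominators meets atoms instead of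
  function applications. All diagonal components turn out to be combinations of the same two
  expressions, which are the two equations for the profile.\<close>

lemma bach_components:
  fixes r q0 q1 q2 q3 q4 :: real
  assumes nz: "r \<noteq> 0" "q0 \<noteq> 0"
  defines "A0 \<equiv> (6 * q0 - 3 * r * q1 + r^2 * (q2 - 2)) / (3 * r^3)"
    and "A1 \<equiv> (12 * r * q1 - 18 * q0 - 3 * r^2 * q2 - r^2 * (q2 - 2) + r^3 * q3) / (3 * r^4)"
    and "A2 \<equiv> (72 * q0 - 54 * r * q1 + 18 * r^2 * q2 + 2 * r^2 * (q2 - 2) - 5 * r^3 * q3 + r^4 * q4) / (3 * r^5)"
    and "K0 \<equiv> (r * q1 - 2 * q0) / (2 * r^2)" and "K1 \<equiv> (4 * q0 - 3 * r * q1 + r^2 * q2) / (2 * r^3)"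
  shows "3 * q1 * K0 / (2 * r^2 * q0) - 3 * K0 / r^3 + 3 * A0 / (2 * r^2)
      - 3 * q1 * A0 / (4 * r * q0) + A1 / r - q1 * A1 / (2 * q0)
      + (A0 / (2 * q0) - q1 * A0 / (2 * r * q0) + q2 * A0 / (4 * q0))
     = ((8 - 4 * q2 + 4 * r * q3) * q0 + r^2 * (q2^2 - 4 - 2 * q1 * q3)) / (12 * r^3 * q0)" (is ?R)
    and "6 * q0 * q1 * K0 / r^4 - 12 * q0^2 * K0 / r^5
      + 24 * q0^2 * K1 / r^4 - 6 * q0^2 * A0 / r^4 - 3 * q0 * q1 * A0 / r^3
      - 8 * q0^2 * A1 / r^3 - 2 * q0 * q1 * A1 / r^2 - 4 * q0^2 * A2 / r^2
      + (2 * q0 * A0 / r^2 - 2 * q0 * q1 * A0 / r^3 + q0 * q2 * A0 / r^2)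
     = q0 * ((8 - 4 * q2 + 4 * r * q3) * q0 + r^2 * (q2^2 - 4 - 2 * q1 * q3)) / (3 * r^5)
       + 4 * q0^2 * (4 - 2 * q2 + 2 * r * q3 - r^2 * q4) / (3 * r^5)" (is ?E)
    and "3 * q0 * K0 / r^3 - 3 * q1 * K0 / (2 * r^2) - 3 * q0 * K1 / r^2
      + 3 * q1 * A0 / (4 * r) + q0 * A1 / (2 * r) + q1 * A1 / 2 + q0 * A2 / 2
      + (q1 * A0 / (2 * r) - A0 / 2 - q2 * A0 / 4)
     = - ((8 - 4 * q2 + 4 * r * q3) * q0 + r^2 * (q2^2 - 4 - 2 * q1 * q3)) / (12 * r^3)
       - q0 * (4 - 2 * q2 + 2 * r * q3 - r^2 * q4) / (6 * r^3)" (is ?Z)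
  unfolding assms
  subgoal using nz by (simp add: field_simps eval_nat_numeral)
  subgoal using nz by (simp add: field_simps eval_nat_numeral)
  subgoal using nz by (simp add: field_simps eval_nat_numeral)
  done

lemma bach_zero_iff:
  assumes p: "p \<in> dom"
  shows "(\<forall>i j. bach g i j p = 0) \<longleftrightarrow>
      (8 - 4 * q 2 (rr p) + 4 * rr p * q 3 (rr p)) * q 0 (rr p)
        + (rr p)^2 * ((q 2 (rr p))^2 - 4 - 2 * q 1 (rr p) * q 3 (rr p)) = 0 \<and>
      4 - 2 * q 2 (rr p) + 2 * rr p * q 3 (rr p) - (rr p)^2 * q 4 (rr p) = 0" (is "_ \<longleftrightarrow> ?X = 0 \<and> ?Y = 0")
proof -
  note d = dom_facts[OF p]
  have nz: "rr p \<noteq> 0" "qq 0 p \<noteq> 0" using d by auto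
  have w: "wA 0 p = (6 * qq 0 p - 3 * rr p * qq 1 p + (rr p)^2 * (qq 2 p - 2)) / (3 * (rr p)^3)"
    "wA 1 p = (12 * rr p * qq 1 p - 18 * qq 0 p - 3 * (rr p)^2 * qq 2 p - (rr p)^2 * (qq 2 p - 2) + (rr p)^3 * qq 3 p) / (3 * (rr p)^4)"
    "wA 2 p = (72 * qq 0 p - 54 * rr p * qq 1 p + 18 * (rr p)^2 * qq 2 p + 2 * (rr p)^2 * (qq 2 p - 2) - 5 * (rr p)^3 * qq 3 p
       + (rr p)^4 * qq 4 p) / (3 * (rr p)^5)"
    "wK 0 p = (rr p * qq 1 p - 2 * qq 0 p) / (2 * (rr p)^2)"
    "wK 1 p = (4 * qq 0 p - 3 * rr p * qq 1 p + (rr p)^2 * qq 2 p) / (2 * (rr p)^3)"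
    using nz by (simp_all add: wA_def wK_def field_simps eval_nat_numeral)
  note comp = bach_components(1)[OF nz, where ?q1.0 = "qq 1 p" and ?q2.0 = "qq 2 p" and ?q3.0 = "qq 3 p", folded w]
    bach_components(2,3)[OF nz, where ?q1.0 = "qq 1 p" and ?q2.0 = "qq 2 p" and ?q3.0 = "qq 3 p" and ?q4.0 = "qq 4 p", folded w]
  have diag: "fbach wt dwt I I p = (case I of
      Rad \<Rightarrow> ?X / (12 * (rr p)^3 * qq 0 p)
    | Fib \<Rightarrow> qq 0 p * ?X / (3 * (rr p)^5) + 4 * (qq 0 p)^2 * ?Y / (3 * (rr p)^5)
    | _ \<Rightarrow> - ?X / (12 * (rr p)^3) - qq 0 p * ?Y / (6 * (rr p)^3))" for I
    unfolding qq_def[symmetric]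
    by (cases I; simp only: fbach_diag[OF p] ddwt_sum ric_wt_sum[OF p] refl if_True leg.case comp)
  have off: "fbach wt dwt I J p = 0" if "I \<noteq> J" for I J
    using that unfolding fbach_diag[OF p] ric_wt_sum[OF p] by simp
  have "(\<forall>i j. bach g i j p = 0) \<longleftrightarrow> (\<forall>I J. fbach wt dwt I J p = 0)"
  proof (rule bach_eq_0_iff[OF p])
    show "cdiff (wt A) q" if "q \<in> dom" "length A = 4" for q A
      using has_rzD(1)[OF has_rz_wR[OF that(1) has_rz_wA(1)[OF that(1)] has_rz_wA(2)[OF that(1)]], of 0 0]
      by (simp add: wt_def[abs_def])
    show "cdiff (dwt A) p" for A
      using has_rzD(1)[OF has_rz_dwt[OF p]] .
  qed (auto intro: fweyl_wt fnabla_wt)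
  also have "\<dots> \<longleftrightarrow> ?X = 0 \<and> ?Y = 0"
  proof
    assume *: "\<forall>I J. fbach wt dwt I J p = 0"
    \<comment> \<open>The radial component contains only the first expression; the fibre component
      then isolates the second, because the profile does not vanish.\<close>
    have X: "?X = 0" using diag[of Rad] * nz by simp
    moreover have "?Y = 0" using diag[of Fib] * nz unfolding X by simp
    ultimately show "?X = 0 \<and> ?Y = 0" ..
  next
    assume XY: "?X = 0 \<and> ?Y = 0"
    have "fbach wt dwt I I p = 0" for I
      unfolding diag conjunct1[OF XY] conjunct2[OF XY] by (simp split: leg.splits)
    then show "\<forall>I J. fbach wt dwt I J p = 0"
      using off by metis
  qed
  finally show ?thesis .
qed

end

section \<open>Smooth functions\<close>

lemma smooth_on_has_deriv:
  "smooth_on U f \<Longrightarrow> x \<in> U \<Longrightarrow> ((deriv ^^ k) f has_field_derivative (deriv ^^ Suc k) f x) (at x)"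
  by (simp add: smooth_on_def DERIV_deriv_iff_field_differentiable)

lemma deriv_iter_eq:
  assumes "open U" "\<And>x. x \<in> U \<Longrightarrow> f x = F 0 x"
    and "\<And>k x. x \<in> U \<Longrightarrow> (F k has_field_derivative F (Suc k) x) (at x)"
  shows "x \<in> U \<Longrightarrow> (deriv ^^ k) f x = F k x"
proof (induction k arbitrary: x)
  case (Suc k)
  have "eventually (\<lambda>y. y \<in> U) (nhds x)"
    using assms(1) Suc.prems by (simp add: eventually_nhds_in_open)
  then have "eventually (\<lambda>y. (deriv ^^ k) f y = F k y) (nhds x)"
    by eventually_elim (rule Suc.IH)
  then have "deriv ((deriv ^^ k) f) x = deriv (F k) x"
    by (rule deriv_cong_ev) simp
  also have "\<dots> = F (Suc k) x"
    using assms(3)[OF Suc.prems] by (rule DERIV_imp_deriv)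
  finally show ?case by simp
qed (simp add: assms)

text \<open>A proposed sequence of derivatives stands in for iterated \<open>deriv\<close>. Openness
  of \<open>U\<close> matters, since each further derivative at a point depends on the previous one
  in a neighbourhood.\<close>

lemma smooth_on_seqI:
  assumes "open U" "\<And>x. x \<in> U \<Longrightarrow> f x = F 0 x"
    and "\<And>k x. x \<in> U \<Longrightarrow> (F k has_field_derivative F (Suc k) x) (at x)"
  shows "smooth_on U f"
  unfolding smooth_on_def
proof (intro allI ballI)
  fix k x assume x: "x \<in> U"
  have "eventually (\<lambda>y. y \<in> U) (nhds x)"
    using assms(1) x by (simp add: eventually_nhds_in_open)
  then have "eventually (\<lambda>y. (deriv ^^ k) f y = F k y) (nhds x)"
    by eventually_elim (rule deriv_iter_eq[OF assms])
  then have "((deriv ^^ k) f has_field_derivative F (Suc k) x) (at x)"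
    using DERIV_cong_ev[OF refl _ refl, of "(deriv ^^ k) f" "F k" x "F (Suc k) x"] assms(3)[OF x] by blast
  then show "(deriv ^^ k) f field_differentiable at x"
    by (auto simp: field_differentiable_def)
qed

text \<open>Choosing a derivative inside the class \<open>C\<close> again and again produces the
  sequence that \<open>smooth_on_seqI\<close> wants.\<close>

lemma smooth_on_coinduct:
  assumes "open U" "C f"
    and step: "\<And>f. C f \<Longrightarrow> \<exists>g. C g \<and> (\<forall>x\<in>U. (f has_field_derivative g x) (at x))"
  shows "smooth_on U f"
proof -
  define F where "F = rec_nat f (\<lambda>_ f. SOME g. C g \<and> (\<forall>x\<in>U. (f has_field_derivative g x) (at x)))"
  have F: "F 0 = f" "F (Suc k) = (SOME g. C g \<and> (\<forall>x\<in>U. (F k has_field_derivative g x) (at x)))" for k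
    by (simp_all add: F_def)
  have C: "C (F k)" for k
  proof (induction k)
    case (Suc k)
    then show ?case
      unfolding F(2) using someI_ex[OF step[OF Suc]] by blast
  qed (simp add: F assms)
  have "\<forall>x\<in>U. (F k has_field_derivative F (Suc k) x) (at x)" for k
    unfolding F(2) using someI_ex[OF step[OF C[of k]]] by blast
  then show ?thesis
    by (intro smooth_on_seqI[of U f F]) (auto simp: F assms)
qed

lemma smooth_on_deriv_iter: "smooth_on U f \<Longrightarrow> smooth_on U ((deriv ^^ n) f)"
  by (simp add: smooth_on_def funpow_add[symmetric, THEN fun_cong, unfolded comp_def])

lemma smooth_on_cong:
  assumes "open U" "smooth_on U f" "\<And>x. x \<in> U \<Longrightarrow> g x = f x"
  shows "smooth_on U g"
  by (rule smooth_on_seqI[OF assms(1), of g "\<lambda>k. (deriv ^^ k) f"])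
     (use assms(3) smooth_on_has_deriv[OF assms(2)] in auto)

lemma deriv_iter_cong:
  assumes "open U" "smooth_on U f" "\<And>x. x \<in> U \<Longrightarrow> g x = f x" "x \<in> U"
  shows "(deriv ^^ k) g x = (deriv ^^ k) f x"
  by (rule deriv_iter_eq[OF assms(1), of g "\<lambda>k. (deriv ^^ k) f"])
     (use assms(3,4) smooth_on_has_deriv[OF assms(2)] in auto)

lemma smooth_on_subset: "smooth_on U f \<Longrightarrow> V \<subseteq> U \<Longrightarrow> smooth_on V f"
  by (auto simp: smooth_on_def)

text \<open>The closure of the smooth functions under sums, products and inverses is stable under
  differentiation, so coinduction yields all closure properties at once, without formulas for higher
  derivatives of products and quotients.\<close>

inductive smooth_alg :: "real set \<Rightarrow> (real \<Rightarrow> real) \<Rightarrow> bool" for U where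
  smooth: "smooth_on U f \<Longrightarrow> smooth_alg U f"
| add: "smooth_alg U f \<Longrightarrow> smooth_alg U g \<Longrightarrow> smooth_alg U (\<lambda>x. f x + g x)"
| mult: "smooth_alg U f \<Longrightarrow> smooth_alg U g \<Longrightarrow> smooth_alg U (\<lambda>x. f x * g x)"
| inv: "smooth_alg U f \<Longrightarrow> (\<And>x. x \<in> U \<Longrightarrow> f x \<noteq> 0) \<Longrightarrow> smooth_alg U (\<lambda>x. inverse (f x))"

lemma smooth_on_const [simp]: "smooth_on U (\<lambda>x. c)"
proof -
  have "smooth_on UNIV (\<lambda>x. c)"
    by (rule smooth_on_coinduct[where C = "\<lambda>f. \<exists>c. f = (\<lambda>x. c)"]) (auto intro!: exI[of _ "\<lambda>x. 0"])
  then show ?thesis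
    by (rule smooth_on_subset) simp
qed

lemma smooth_on_ident: "smooth_on U (\<lambda>x. x)"
proof -
  have "smooth_on UNIV (\<lambda>x. x)"
  proof (rule smooth_on_coinduct[where C = "\<lambda>f. \<exists>c d. f = (\<lambda>x. c * x + d)"])
    show "\<exists>c d. (\<lambda>x :: real. x) = (\<lambda>x. c * x + d)"
      by (rule exI[of _ 1], rule exI[of _ 0]) simp
    fix f :: "real \<Rightarrow> real" assume "\<exists>c d. f = (\<lambda>x. c * x + d)"
    then obtain c d where "f = (\<lambda>x. c * x + d)" by blast
    then show "\<exists>g. (\<exists>c d. g = (\<lambda>x. c * x + d)) \<and> (\<forall>x\<in>UNIV. (f has_field_derivative g x) (at x))"
      by (intro exI[of _ "\<lambda>x. 0 * x + c"] conjI) (blast, auto intro!: derivative_eq_intros)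
  qed simp
  then show ?thesis
    by (rule smooth_on_subset) simp
qed

lemma smooth_alg_deriv:
  assumes "smooth_alg U f"
  shows "\<exists>g. smooth_alg U g \<and> (\<forall>x\<in>U. (f has_field_derivative g x) (at x))"
  using assms
proof induction
  case (smooth f)
  then show ?case
    using smooth_on_has_deriv[OF smooth, where k = 0] smooth_on_deriv_iter[OF smooth, of 1]
    by (intro exI[of _ "deriv f"]) (auto intro: smooth_alg.smooth)
next
  case (add f g)
  then obtain f' g' where "smooth_alg U f'" "smooth_alg U g'"
    "\<And>x. x \<in> U \<Longrightarrow> (f has_field_derivative f' x) (at x)" "\<And>x. x \<in> U \<Longrightarrow> (g has_field_derivative g' x) (at x)"
    by blast
  then show ?case
    by (intro exI[of _ "\<lambda>x. f' x + g' x"]) (auto intro: smooth_alg.intros DERIV_add)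
next
  case (mult f g)
  then obtain f' g' where "smooth_alg U f'" "smooth_alg U g'"
    "\<And>x. x \<in> U \<Longrightarrow> (f has_field_derivative f' x) (at x)" "\<And>x. x \<in> U \<Longrightarrow> (g has_field_derivative g' x) (at x)"
    by blast
  with mult show ?case
    by (intro exI[of _ "\<lambda>x. f' x * g x + g' x * f x"]) (auto intro: smooth_alg.intros DERIV_mult)
next
  case (inv f)
  then obtain f' where f': "smooth_alg U f'" "\<And>x. x \<in> U \<Longrightarrow> (f has_field_derivative f' x) (at x)"
    by blast
  have "smooth_alg U (\<lambda>x. - 1 * (inverse (f x) * f' x * inverse (f x)))"
    by (intro smooth_alg.mult smooth_alg.inv inv f' smooth_alg.smooth smooth_on_const)
  with inv f' show ?case
    by (intro exI[of _ "\<lambda>x. - 1 * (inverse (f x) * f' x * inverse (f x))"])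
       (auto intro!: derivative_eq_intros)
qed

lemma smooth_algD: "open U \<Longrightarrow> smooth_alg U f \<Longrightarrow> smooth_on U f"
  by (rule smooth_on_coinduct[where C = "smooth_alg U"]) (auto intro: smooth_alg_deriv)

lemma
  assumes "open U" "smooth_on U f" "smooth_on U g"
  shows smooth_on_add: "smooth_on U (\<lambda>x. f x + g x)"
    and smooth_on_mult: "smooth_on U (\<lambda>x. f x * g x)"
  by (rule smooth_algD[OF assms(1)], intro smooth_alg.add smooth_alg.mult smooth_alg.smooth assms)+

lemma smooth_on_inverse:
  assumes "open U" "smooth_on U f" "\<And>x. x \<in> U \<Longrightarrow> f x \<noteq> 0"
  shows "smooth_on U (\<lambda>x. inverse (f x))"
  by (rule smooth_algD[OF assms(1)]) (intro smooth_alg.inv smooth_alg.smooth assms)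

lemma smooth_on_divide:
  assumes "open U" "smooth_on U f" "smooth_on U g" "\<And>x. x \<in> U \<Longrightarrow> g x \<noteq> 0"
  shows "smooth_on U (\<lambda>x. f x / g x)"
  unfolding divide_inverse by (intro smooth_on_mult smooth_on_inverse assms)

lemma smooth_on_power:
  assumes "open U" "smooth_on U f"
  shows "smooth_on U (\<lambda>x. f x ^ n)"
  by (induction n) (auto intro: smooth_on_mult assms)

section \<open>The metric in terms of the momentum profile\<close>

lemma open_interval_ereal: "open {r :: real. a < r \<and> ereal r < b}"
proof (cases b)
  case (real c)
  then have "{r :: real. a < r \<and> ereal r < b} = {a<..<c}" by auto
  then show ?thesis by simp
next
  case PInf
  then have "{r :: real. a < r \<and> ereal r < b} = {a<..}" by auto
  then show ?thesis by simp
qed simp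

lemma open_int_polygon: "open (int_polygon a b)"
proof -
  have *: "int_polygon a b = {x. 0 < x $ 1} \<inter> ({x. 0 < x $ 2} \<inter> (\<lambda>x. x $ 1 + x $ 2) -` {r. a < r \<and> ereal r < b})"
    by (auto simp: int_polygon_def)
  have "open ((\<lambda>x :: real ^ 2. x $ 1 + x $ 2) -` {r. a < r \<and> ereal r < b})"
    by (rule open_vimage[OF open_interval_ereal]) (intro continuous_intros)
  moreover have "open {x :: real ^ 2. 0 < x $ i}" for i
    by (intro open_Collect_less continuous_intros)
  ultimately show ?thesis
    unfolding * by (intro open_Int)
qed

lemma coord_deriv_divide_const:
  assumes "cdiff f p"
  shows "coord_deriv i (\<lambda>q. f q / c) p = coord_deriv i f p / c"
  using coord_deriv_mult[OF assms cdiff_const(1), of i "inverse c"] by (simp add: divide_inverse)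

lemma
  fixes h :: "real \<Rightarrow> real"
  assumes h: "smooth_on {r. a < r \<and> ereal r < b} h" and x: "x \<in> int_polygon a b"
  shows sympl_pot_deriv: "coord_deriv i (sympl_pot h) x = (ln (x $ i) + 1 + deriv h (x $ 1 + x $ 2)) / 2"
    and hessian_sympl_pot: "hessian (sympl_pot h) x $ i $ j =
      ((if i = j then 1 / x $ i else 0) + (deriv ^^ 2) h (x $ 1 + x $ 2)) / 2"
proof -
  have comp: "cdiff (\<lambda>y :: real ^ 2. y $ 1 + y $ 2) y" "coord_deriv k (\<lambda>y :: real ^ 2. y $ 1 + y $ 2) y = 1" for k y
    using exhaust_2[of k] by (auto simp: cdiff_component coord_deriv_add cdiff_add)
  have d1: "coord_deriv i (sympl_pot h) y = (ln (y $ i) + 1 + deriv h (y $ 1 + y $ 2)) / 2"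
    if y: "y \<in> int_polygon a b" for y i
  proof -
    have pos: "0 < y $ 1" "0 < y $ 2" and r: "y $ 1 + y $ 2 \<in> {r. a < r \<and> ereal r < b}"
      using y by (auto simp: int_polygon_def)
    have ent: "cdiff (\<lambda>y :: real ^ 2. y $ j * ln (y $ j)) y"
      "coord_deriv i (\<lambda>y :: real ^ 2. y $ j * ln (y $ j)) y = (if i = j then ln (y $ j) + 1 else 0)" for i j
    proof -
      have p: "0 < y $ j" using pos exhaust_2[of j] by auto
      have "((\<lambda>t. t * ln t) has_field_derivative (ln (y $ j) + 1)) (at (y $ j))"
        using p by (auto intro!: derivative_eq_intros)
      from cdiff_chain[OF cdiff_component(1) this] show "cdiff (\<lambda>y :: real ^ 2. y $ j * ln (y $ j)) y"
        "coord_deriv i (\<lambda>y :: real ^ 2. y $ j * ln (y $ j)) y = (if i = j then ln (y $ j) + 1 else 0)"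
        by (auto simp: cdiff_component)
    qed
    have "(h has_field_derivative deriv h (y $ 1 + y $ 2)) (at (y $ 1 + y $ 2))"
      using smooth_on_has_deriv[OF h r, of 0] by simp
    from cdiff_chain[OF comp(1) this]
    have hh: "cdiff (\<lambda>y :: real ^ 2. h (y $ 1 + y $ 2)) y"
      "coord_deriv i (\<lambda>y :: real ^ 2. h (y $ 1 + y $ 2)) y = deriv h (y $ 1 + y $ 2)" for i
      by (auto simp: comp)
    show ?thesis
      unfolding sympl_pot_def[abs_def] coord_deriv_divide_const[OF cdiff_add[OF cdiff_add[OF ent(1) ent(1)] hh(1)]]
        coord_deriv_add[OF cdiff_add[OF ent(1) ent(1)] hh(1)] coord_deriv_add[OF ent(1) ent(1)] ent(2) hh(2)
      using exhaust_2[of i] by auto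
  qed
  show "coord_deriv i (sympl_pot h) x = (ln (x $ i) + 1 + deriv h (x $ 1 + x $ 2)) / 2"
    by (rule d1[OF x])
  have pos: "0 < x $ 1" "0 < x $ 2" and r: "x $ 1 + x $ 2 \<in> {r. a < r \<and> ereal r < b}"
    using x by (auto simp: int_polygon_def)
  have p: "0 < x $ j" using pos exhaust_2[of j] by auto
  have "eventually (\<lambda>y. y \<in> int_polygon a b) (nhds x)"
    using open_int_polygon x by (simp add: eventually_nhds_in_open)
  then have "eventually (\<lambda>y. coord_deriv j (sympl_pot h) y = (ln (y $ j) + 1 + deriv h (y $ 1 + y $ 2)) / 2) (nhds x)"
    by eventually_elim (rule d1)
  then have "coord_deriv i (coord_deriv j (sympl_pot h)) x
    = coord_deriv i (\<lambda>y. (ln (y $ j) + 1 + deriv h (y $ 1 + y $ 2)) / 2) x"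
    by (rule coord_deriv_cong)
  also have "\<dots> = ((if i = j then 1 / x $ i else 0) + (deriv ^^ 2) h (x $ 1 + x $ 2)) / 2"
  proof -
    have 1: "(ln has_field_derivative 1 / x $ j) (at (x $ j))"
      using p by (auto intro!: derivative_eq_intros)
    have 2: "(deriv h has_field_derivative (deriv ^^ 2) h (x $ 1 + x $ 2)) (at (x $ 1 + x $ 2))"
      using smooth_on_has_deriv[OF h r, of 1] by (simp add: numeral_2_eq_2)
    have c1: "cdiff (\<lambda>y. ln (y $ j)) x" "coord_deriv i (\<lambda>y. ln (y $ j)) x = (if i = j then 1 / x $ j else 0)"
      using cdiff_chain[OF cdiff_component(1) 1] by (auto simp: cdiff_component)
    have c2: "cdiff (\<lambda>y. deriv h (y $ 1 + y $ 2)) x" "coord_deriv i (\<lambda>y. deriv h (y $ 1 + y $ 2)) x = (deriv ^^ 2) h (x $ 1 + x $ 2)"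
      using cdiff_chain[OF comp(1) 2] by (auto simp: comp)
    show ?thesis
      unfolding coord_deriv_divide_const[OF cdiff_add[OF cdiff_add[OF c1(1) cdiff_const(1)] c2(1)]]
        coord_deriv_add[OF cdiff_add[OF c1(1) cdiff_const(1)] c2(1)] coord_deriv_add[OF c1(1) cdiff_const(1)]
        c1(2) c2(2) cdiff_const(2) by simp
  qed
  finally show "hessian (sympl_pot h) x $ i $ j =
      ((if i = j then 1 / x $ i else 0) + (deriv ^^ 2) h (x $ 1 + x $ 2)) / 2"
    by (simp add: hessian_def)
qed

lemma hessian_quadratic:
  assumes h: "smooth_on {r. a < r \<and> ereal r < b} h" and x: "x \<in> int_polygon a b"
  shows "v \<bullet> (hessian (sympl_pot h) x *v v) = ((v $ 1)^2 / x $ 1 + (v $ 2)^2 / x $ 2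
    + (deriv ^^ 2) h (x $ 1 + x $ 2) * (v $ 1 + v $ 2)^2) / 2"
  unfolding inner_vec_def matrix_vector_mult_def sum_2 hessian_sympl_pot[OF assms]
  by (simp add: hessian_sympl_pot[OF assms] sum_2 field_simps power2_eq_square)

text \<open>Separates a lateral square, which vanishes in the direction of x, from a radial square
  whose coefficient carries the factor 1 + r h''.\<close>

lemma quadratic_split:
  fixes x1 x2 v1 v2 c :: real
  assumes "0 < x1" "0 < x2"
  shows "v1^2 / x1 + v2^2 / x2 + c * (v1 + v2)^2
    = (v1 * x2 - v2 * x1)^2 / (x1 * x2 * (x1 + x2)) + (1 + (x1 + x2) * c) / (x1 + x2) * (v1 + v2)^2"
proof -
  define s where "s = x1 + x2"
  have nz: "s \<noteq> 0" "x1 \<noteq> 0" "x2 \<noteq> 0" using assms by (auto simp: s_def)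
  have frac: "A / (x1 * x2 * s) + (1 + s * c) / s * B = (A + B * x1 * x2) / (x1 * x2 * s) + c * B" for A B
    using nz by (simp add: field_simps)
  have "(v1 * x2 - v2 * x1)^2 / (x1 * x2 * s) + (1 + s * c) / s * (v1 + v2)^2
     = ((v1 * x2 - v2 * x1)^2 + (v1 + v2)^2 * x1 * x2) / (x1 * x2 * s) + c * (v1 + v2)^2"
    by (rule frac)
  also have "(v1 * x2 - v2 * x1)^2 + (v1 + v2)^2 * x1 * x2 = (v1^2 * x2 + v2^2 * x1) * s"
    by (simp add: s_def power2_eq_square algebra_simps)
  also have "\<dots> / (x1 * x2 * s) = v1^2 / x1 + v2^2 / x2"
    using nz by (simp add: field_simps)
  finally show ?thesis by (simp add: s_def)
qed

lemma pos_def_hessian_iff: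
  assumes h: "smooth_on {r. a < r \<and> ereal r < b} h" and x: "x \<in> int_polygon a b"
  shows "pos_def (hessian (sympl_pot h) x) \<longleftrightarrow> 0 < 1 + (x $ 1 + x $ 2) * (deriv ^^ 2) h (x $ 1 + x $ 2)"
proof -
  define r where "r = x $ 1 + x $ 2"
  define f where "f = (deriv ^^ 2) h r"
  have pos: "0 < x $ 1" "0 < x $ 2" "0 < r"
    using x by (auto simp: int_polygon_def r_def)
  have q: "v \<bullet> (hessian (sympl_pot h) x *v v)
     = ((v $ 1 * x $ 2 - v $ 2 * x $ 1)^2 / (x $ 1 * x $ 2 * r) + (1 + r * f) / r * (v $ 1 + v $ 2)^2) / 2" for v
    unfolding hessian_quadratic[OF assms] quadratic_split[OF pos(1,2)] r_def[symmetric] f_def[symmetric] ..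
  show ?thesis
    unfolding r_def[symmetric] f_def[symmetric]
  proof
    assume "pos_def (hessian (sympl_pot h) x)"
    \<comment> \<open>Tested on the vector x itself, the lateral square vanishes and only the radial
      coefficient is left.\<close>
    then have "0 < x \<bullet> (hessian (sympl_pot h) x *v x)"
      using pos unfolding pos_def_def by (auto dest: spec[of _ x])
    also have "\<dots> = (1 + r * f) * r / 2"
      unfolding q using pos by (simp add: r_def[symmetric] field_simps power2_eq_square)
    finally show "0 < 1 + r * f"
      using pos by (simp add: zero_less_mult_iff)
  next
    assume f: "0 < 1 + r * f"
    show "pos_def (hessian (sympl_pot h) x)"
      unfolding pos_def_def
    proof (intro allI impI)
      fix v :: "real ^ 2" assume "v \<noteq> 0"
      show "0 < v \<bullet> (hessian (sympl_pot h) x *v v)"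
      proof (cases "v $ 1 + v $ 2 = 0")
        case True
        then have v2: "v $ 2 = - v $ 1" by simp
        have "v $ 1 \<noteq> 0"
          using \<open>v \<noteq> 0\<close> v2 by (auto simp: vec_eq_iff forall_2)
        then have "v $ 1 * x $ 2 - v $ 2 * x $ 1 \<noteq> 0"
          using pos by (simp add: v2 distrib_left[symmetric] r_def)
        then show ?thesis
          unfolding q using True pos by simp
      next
        case False
        then have "0 < (1 + r * f) / r * (v $ 1 + v $ 2)^2"
          using f pos by simp
        moreover have "0 \<le> (v $ 1 * x $ 2 - v $ 2 * x $ 1)^2 / (x $ 1 * x $ 2 * r)"
          using pos by simp
        ultimately show ?thesis
          unfolding q by simp
      qed
    qed
  qed
qed

lemma toric_metric_eq:
  assumes h: "smooth_on {r. a < r \<and> ereal r < b} h" and p: "act p \<in> int_polygon a b"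
    and pos: "0 < 1 + rr p * (deriv ^^ 2) h (rr p)"
  defines "Q \<equiv> (rr p)^2 / (1 + rr p * (deriv ^^ 2) h (rr p))"
  shows "toric_metric h p $ i $ j =
      rr p / (2 * Q) * cofr Rad i p * cofr Rad j p + rr p / 2 * cofr Lat i p * cofr Lat j p
      + (2 * Q / rr p * cofr Fib i p * cofr Fib j p + rr p / 2 * cofr Lon i p * cofr Lon j p)"
proof -
  define f where "f = (deriv ^^ 2) h (rr p)"
  have x: "0 < p $ Inl 1" "0 < p $ Inl 2" "act p $ 1 = p $ Inl 1" "act p $ 2 = p $ Inl 2"
    using p by (auto simp: int_polygon_def act_def)
  note zb = zz_bounds[OF x(1,2)]
  have f: "0 < 1 + rr p * f" using pos by (simp add: f_def)
  have r: "act p $ 1 + act p $ 2 = rr p" by (simp add: x rr_def)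
  have ax: "act p $ 1 = rr p * zz p" "act p $ 2 = rr p * (1 - zz p)"
    using x zb(6,7) by auto
  have U: "hessian (sympl_pot h) (act p) $ i $ j = ((if i = j then 1 / act p $ i else 0) + f) / 2" for i j
    using hessian_sympl_pot[OF h p] by (simp add: r f_def)
  \<comment> \<open>The inverse Hessian: its rank one part along x has the profile as coefficient,
    while the part along (1, -1) does not involve h.\<close>
  define G :: "real ^ 2 ^ 2" where "G = (\<chi> i j. 2 / rr p * (Q / (rr p)^2 * act p $ i * act p $ j
      + (if i = j then 1 else - 1) * act p $ 1 * act p $ 2))"
  have Q: "Q = (rr p)^2 / (1 + rr p * f)" by (simp add: Q_def f_def)
  have nz: "1 + rr p * f \<noteq> 0" "rr p \<noteq> 0" "zz p \<noteq> 0" "1 - zz p \<noteq> 0" "ww p \<noteq> 0" using f zb by auto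
  \<comment> \<open>With 1 + r h'' as a single atom the entries become rational functions of r, z
    and \<open>D\<close>.\<close>
  define D where "D = 1 + rr p * f"
  have D: "D \<noteq> 0" "f = (D - 1) / rr p" "1 + rr p * f = D" using nz by (auto simp: D_def)
  have inv: "matrix_inv (hessian (sympl_pot h) (act p)) = G"
  proof (rule matrix_inv_eqI)
    have "\<forall>i j. (hessian (sympl_pot h) (act p) ** G) $ i $ j = mat 1 $ i $ j"
      unfolding forall_2 matrix_matrix_mult_def mat_def
      using nz D(1) by (simp add: sum_2 U G_def ax Q D(3)) (simp add: D(2) field_simps power2_eq_square)
    then show "hessian (sympl_pot h) (act p) ** G = mat 1" by (simp add: vec_eq_iff)
  qed
  have w2: "ww p * ww p = zz p * (1 - zz p)" using zb by (simp add: power2_eq_square)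
  have Q0: "Q \<noteq> 0" using nz by (simp add: Q)
  have QD: "Q = (rr p)^2 / D" by (simp add: Q D(3))
  have Qi: "rr p / (2 * Q) = D / (2 * rr p)"
    using nz D(1) by (simp add: QD field_simps power2_eq_square)
  have lat: "rr p / 2 * (dz i p / ww p) * (dz j p / ww p) = rr p * dz i p * dz j p / (2 * (zz p * (1 - zz p)))" for i j
    unfolding w2[symmetric] by simp
  show ?thesis
  proof (cases i)
    case i: (Inl k)
    show ?thesis
    proof (cases j)
      case j: (Inl l)
      have T: "toric_metric h p $ i $ j = ((if k = l then 1 / act p $ k else 0) + f) / 2"
        by (simp add: toric_metric_def i j U)
      show ?thesis
        unfolding T cofr.simps lat Qi
        using exhaust_2[of k] exhaust_2[of l] nz(2-4) D(1)
        by (elim disjE; simp add: i j dr_def dz_def ax D(2); simp add: field_simps power2_eq_square)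
    qed (simp add: i toric_metric_def dr_def dz_def)
  next
    case i: (Inr k)
    show ?thesis
    proof (cases j)
      case j: (Inr l)
      have T: "toric_metric h p $ i $ j = G $ k $ l"
        by (simp add: toric_metric_def i j inv)
      have lon: "rr p / 2 * cofr Lon i p * cofr Lon j p = (if k = l then 1 else - 1) * (2 * rr p * (zz p * (1 - zz p)))"
        using exhaust_2[of k] exhaust_2[of l] w2 by (elim disjE) (simp_all add: i j)
      show ?thesis
        unfolding T lon
        using exhaust_2[of k] exhaust_2[of l] nz(2)
        by (elim disjE; simp add: i j dr_def dz_def G_def ax; simp add: field_simps power2_eq_square)
    qed (simp add: i toric_metric_def dr_def dz_def)
  qed
qed

section \<open>The Bach-flat equation for the momentum profile\<close>

definition profile :: "(real \<Rightarrow> real) \<Rightarrow> real \<Rightarrow> real" where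
  "profile h r = r^2 / (1 + r * (deriv ^^ 2) h r)"

abbreviation ival :: "real \<Rightarrow> ereal \<Rightarrow> real set" where
  "ival a b \<equiv> {r. a < r \<and> ereal r < b}"

text \<open>One point of the chart for each value of r, so that an identity of tensors on the chart
  can be read as an equation in r.\<close>

definition point_at :: "real \<Rightarrow> action_angle" where
  "point_at r = (\<chi> i. r / 2)"

lemma point_at: "r \<in> ival a b \<Longrightarrow> 0 \<le> a \<Longrightarrow> act (point_at r) \<in> int_polygon a b" "rr (point_at r) = r"
  by (auto simp: point_at_def act_def int_polygon_def rr_def)

lemma rr_act: "act p \<in> int_polygon a b \<Longrightarrow> rr p \<in> ival a b"
  by (auto simp: act_def int_polygon_def rr_def)

lemma is_interval_ival: "convex (ival a b)"
proof -
  have "is_interval (ival a b)"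
    unfolding is_interval_1
  proof (intro ballI allI impI)
    fix x y z assume "x \<in> ival a b" "y \<in> ival a b" "x \<le> z \<and> z \<le> y"
    then show "z \<in> ival a b"
      using le_less_trans[of "ereal z" "ereal y" b] by simp
  qed
  then show ?thesis by (rule is_interval_convex)
qed

lemma smooth_on_profile:
  assumes "smooth_on (ival a b) h" "\<And>r. r \<in> ival a b \<Longrightarrow> 0 < 1 + r * (deriv ^^ 2) h r"
  shows "smooth_on (ival a b) (profile h)"
  unfolding profile_def[abs_def]
  by (intro smooth_on_divide smooth_on_power smooth_on_add smooth_on_mult smooth_on_ident smooth_on_const
      smooth_on_deriv_iter open_interval_ereal assms(1)) (use assms(2) in \<open>simp add: less_imp_neq[symmetric]\<close>)

lemma profile_pos:
  assumes "0 < r" "0 < 1 + r * (deriv ^^ 2) h r"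
  shows "0 < profile h r"
  using assms by (simp add: profile_def)

text \<open>With the scalar curvature s = (4 - 2 q'')/r the second equation is r^3 s''/2 = 0: the
  scalar curvature is affine in the moment coordinate r, that is, the metric is extremal.\<close>

definition profile_ode :: "(nat \<Rightarrow> real \<Rightarrow> real) \<Rightarrow> real \<Rightarrow> bool" where
  "profile_ode q r \<longleftrightarrow>
     (8 - 4 * q 2 r + 4 * r * q 3 r) * q 0 r + r^2 * ((q 2 r)^2 - 4 - 2 * q 1 r * q 3 r) = 0 \<and>
     4 - 2 * q 2 r + 2 * r * q 3 r - r^2 * q 4 r = 0"

lemma bach_flat_iff_ode:
  assumes "0 \<le> a" and h: "smooth_on (ival a b) h"
    and pos: "\<And>r. r \<in> ival a b \<Longrightarrow> 0 < 1 + r * (deriv ^^ 2) h r"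
  shows "bach_flat a b h \<longleftrightarrow> (\<forall>r\<in>ival a b. profile_ode (\<lambda>k. (deriv ^^ k) (profile h)) r)"
proof -
  have sm: "smooth_on (ival a b) (profile h)"
    by (rule smooth_on_profile[OF h pos])
  interpret calabi a b "\<lambda>k. (deriv ^^ k) (profile h)" "toric_metric h"
  proof
    show "0 < (deriv ^^ 0) (profile h) r" if "a < r" "ereal r < b" for r
      using that assms(1) pos[of r] by (auto intro!: profile_pos)
    show "((deriv ^^ k) (profile h) has_real_derivative (deriv ^^ Suc k) (profile h) r) (at r)"
      if "a < r" "ereal r < b" for k r
      using that by (intro smooth_on_has_deriv[OF sm]) auto
    fix p i j assume p: "act p \<in> int_polygon a b"
    show "toric_metric h p $ i $ j =
       rr p / (2 * (deriv ^^ 0) (profile h) (rr p)) * cofr Rad i p * cofr Rad j p +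
       rr p / 2 * cofr Lat i p * cofr Lat j p +
       (2 * (deriv ^^ 0) (profile h) (rr p) / rr p * cofr Fib i p * cofr Fib j p +
        rr p / 2 * cofr Lon i p * cofr Lon j p)"
      using toric_metric_eq[OF h p pos[OF rr_act[OF p]]] by (simp add: profile_def)
  qed
  have "bach_flat a b h \<longleftrightarrow> (\<forall>p\<in>dom. profile_ode (\<lambda>k. (deriv ^^ k) (profile h)) (rr p))"
    unfolding bach_flat_def profile_ode_def using bach_zero_iff by (auto simp: dom_def)
  also have "\<dots> \<longleftrightarrow> (\<forall>r\<in>ival a b. profile_ode (\<lambda>k. (deriv ^^ k) (profile h)) r)"
  proof
    assume *: "\<forall>p\<in>dom. profile_ode (\<lambda>k. (deriv ^^ k) (profile h)) (rr p)"
    show "\<forall>r\<in>ival a b. profile_ode (\<lambda>k. (deriv ^^ k) (profile h)) r"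
    proof
      fix r assume "r \<in> ival a b"
      then have "point_at r \<in> dom" using point_at(1)[OF _ assms(1)] by (simp add: dom_def)
      then show "profile_ode (\<lambda>k. (deriv ^^ k) (profile h)) r"
        using * point_at(2)[of r] by metis
    qed
  next
    assume *: "\<forall>r\<in>ival a b. profile_ode (\<lambda>k. (deriv ^^ k) (profile h)) r"
    show "\<forall>p\<in>dom. profile_ode (\<lambda>k. (deriv ^^ k) (profile h)) (rr p)"
      using * rr_act unfolding dom_def by blast
  qed
  finally show ?thesis .
qed

section \<open>Integration of the equations for the profile\<close>

lemma equal_derivs_differ_by_const:
  fixes F G f :: "real \<Rightarrow> real"
  assumes "\<And>r. r \<in> ival a b \<Longrightarrow> (F has_real_derivative f r) (at r)"
    and "\<And>r. r \<in> ival a b \<Longrightarrow> (G has_real_derivative f r) (at r)"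
  shows "\<exists>c. \<forall>r\<in>ival a b. F r = G r + c"
proof -
  have "((\<lambda>r. F r - G r) has_real_derivative 0) (at r within ival a b)" if "r \<in> ival a b" for r
    using DERIV_diff[OF assms[OF that]] by (auto intro: has_field_derivative_at_within)
  from has_field_derivative_zero_constant[OF is_interval_ival this]
  obtain c where "\<And>r. r \<in> ival a b \<Longrightarrow> F r - G r = c"
    by auto
  then show ?thesis by (intro exI[of _ c]) (auto simp: algebra_simps)
qed

definition quartic :: "real \<Rightarrow> real \<Rightarrow> real \<Rightarrow> real \<Rightarrow> real \<Rightarrow> real" where
  "quartic c4 c3 c1 c0 r = c4 * r^4 + c3 * r^3 + r^2 + c1 * r + c0"

text \<open>Differentiating the second, linear equation gives $q^{(5)} = 0$.\<close>

lemma ode_imp_quartic: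
  assumes "0 \<le> a" and "a < s" "ereal s < b"
    and q: "\<And>k r. r \<in> ival a b \<Longrightarrow> (q k has_real_derivative q (Suc k) r) (at r)"
    and ode: "\<And>r. r \<in> ival a b \<Longrightarrow> profile_ode q r"
  shows "\<exists>c4 c3 c1 c0. c1 * c3 = 4 * c0 * c4 \<and> (\<forall>r\<in>ival a b. q 0 r = quartic c4 c3 c1 c0 r)"
proof -
  have s: "s \<in> ival a b" "0 < s" using assms by auto
  have q': "(q 0 has_real_derivative q 1 r) (at r)" "(q 1 has_real_derivative q 2 r) (at r)"
    "(q 2 has_real_derivative q 3 r) (at r)" "(q 3 has_real_derivative q 4 r) (at r)"
    "(q 4 has_real_derivative q 5 r) (at r)" if "r \<in> ival a b" for r
    using q[OF that, of 0] q[OF that, of 1] q[OF that, of 2] q[OF that, of 3] q[OF that, of 4]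
    by (simp_all add: eval_nat_numeral)
  have q5: "q 5 r = 0" if r: "r \<in> ival a b" for r
  proof -
    have 2: "((\<lambda>r. 2 * r * q 3 r) has_real_derivative 2 * r * q 4 r + 2 * q 3 r) (at r)"
      by (rule DERIV_mult'[OF _ q'(4)[OF r]]) (auto intro!: derivative_eq_intros)
    have 4: "((\<lambda>r. r^2 * q 4 r) has_real_derivative r^2 * q 5 r + 2 * r * q 4 r) (at r)"
      by (rule DERIV_mult'[OF _ q'(5)[OF r]]) (auto intro!: derivative_eq_intros)
    have "((\<lambda>r. 4 - 2 * q 2 r + 2 * r * q 3 r - r^2 * q 4 r) has_real_derivative
       0 - 2 * q 3 r + (2 * r * q 4 r + 2 * q 3 r) - (r^2 * q 5 r + 2 * r * q 4 r)) (at r)"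
      by (intro DERIV_diff DERIV_add 2 4 DERIV_cmult DERIV_const q'(3)[OF r])
    moreover have "eventually (\<lambda>r. r \<in> ival a b) (nhds r)"
      using open_interval_ereal r by (rule eventually_nhds_in_open)
    then have "eventually (\<lambda>r. 4 - 2 * q 2 r + 2 * r * q 3 r - r^2 * q 4 r = 0) (nhds r)"
      by eventually_elim (use ode in \<open>simp add: profile_ode_def\<close>)
    then have "((\<lambda>r. 4 - 2 * q 2 r + 2 * r * q 3 r - r^2 * q 4 r) has_real_derivative 0) (at r)"
      using DERIV_cong_ev[OF refl, of _ "\<lambda>r. 0" r 0 0] by simp
    ultimately have "0 - 2 * q 3 r + (2 * r * q 4 r + 2 * q 3 r) - (r^2 * q 5 r + 2 * r * q 4 r) = 0"
      by (rule DERIV_unique)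
    moreover have "0 < r" using r assms(1) by simp
    ultimately show ?thesis by simp
  qed
  obtain k4 where k4: "\<And>r. r \<in> ival a b \<Longrightarrow> q 4 r = k4"
  proof -
    have "\<exists>c. \<forall>r\<in>ival a b. q 4 r = (\<lambda>r. 0) r + c"
      by (rule equal_derivs_differ_by_const[where f = "\<lambda>r. 0"]) (use q'(5) q5 in auto)
    then show ?thesis by (elim exE) (rule that, simp)
  qed
  obtain k3 where k3: "\<And>r. r \<in> ival a b \<Longrightarrow> q 3 r = k4 * r + k3"
  proof -
    have 1: "(q 3 has_real_derivative k4) (at r)" if "r \<in> ival a b" for r
      using q'(4)[OF that] unfolding k4[OF that] .
    have 2: "((\<lambda>r. k4 * r) has_real_derivative k4) (at r)" for r
      by (auto intro!: derivative_eq_intros)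
    have "\<exists>c. \<forall>r\<in>ival a b. q 3 r = (\<lambda>r. k4 * r) r + c"
      by (rule equal_derivs_differ_by_const[OF 1 2])
    then show ?thesis by (elim exE) (rule that, simp)
  qed
  obtain k2 where k2: "\<And>r. r \<in> ival a b \<Longrightarrow> q 2 r = k4 * r^2 / 2 + k3 * r + k2"
  proof -
    have 1: "(q 2 has_real_derivative k4 * r + k3) (at r)" if "r \<in> ival a b" for r
      using q'(3)[OF that] unfolding k3[OF that] .
    have 2: "((\<lambda>r. k4 * r^2 / 2 + k3 * r) has_real_derivative k4 * r + k3) (at r)" for r
      by (auto intro!: derivative_eq_intros)
    have "\<exists>c. \<forall>r\<in>ival a b. q 2 r = (\<lambda>r. k4 * r^2 / 2 + k3 * r) r + c"
      by (rule equal_derivs_differ_by_const[OF 1 2])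
    then show ?thesis by (elim exE) (rule that, simp)
  qed
  \<comment> \<open>In the linear equation the terms with k4 and k3 cancel identically and leave 4 -
    2 k2 = 0.\<close>
  have "k2 = 2"
    using ode[OF s(1)] by (simp add: profile_ode_def k4[OF s(1)] k3[OF s(1)] k2[OF s(1)] algebra_simps power2_eq_square)
  note k2 = k2[unfolded \<open>k2 = 2\<close>]
  obtain k1 where k1: "\<And>r. r \<in> ival a b \<Longrightarrow> q 1 r = k4 * r^3 / 6 + k3 * r^2 / 2 + 2 * r + k1"
  proof -
    have 1: "(q 1 has_real_derivative k4 * r^2 / 2 + k3 * r + 2) (at r)" if "r \<in> ival a b" for r
      using q'(2)[OF that] unfolding k2[OF that] .
    have 2: "((\<lambda>r. k4 * r^3 / 6 + k3 * r^2 / 2 + 2 * r) has_real_derivative k4 * r^2 / 2 + k3 * r + 2) (at r)" for r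
      by (auto intro!: derivative_eq_intros)
    have "\<exists>c. \<forall>r\<in>ival a b. q 1 r = (\<lambda>r. k4 * r^3 / 6 + k3 * r^2 / 2 + 2 * r) r + c"
      by (rule equal_derivs_differ_by_const[OF 1 2])
    then show ?thesis by (elim exE) (rule that, simp)
  qed
  obtain k0 where k0: "\<And>r. r \<in> ival a b \<Longrightarrow> q 0 r = k4 * r^4 / 24 + k3 * r^3 / 6 + r^2 + k1 * r + k0"
  proof -
    have 1: "(q 0 has_real_derivative k4 * r^3 / 6 + k3 * r^2 / 2 + 2 * r + k1) (at r)" if "r \<in> ival a b" for r
      using q'(1)[OF that] unfolding k1[OF that] .
    have 2: "((\<lambda>r. k4 * r^4 / 24 + k3 * r^3 / 6 + r^2 + k1 * r) has_real_derivative k4 * r^3 / 6 + k3 * r^2 / 2 + 2 * r + k1) (at r)" for r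
      by (auto intro!: derivative_eq_intros)
    have "\<exists>c. \<forall>r\<in>ival a b. q 0 r = (\<lambda>r. k4 * r^4 / 24 + k3 * r^3 / 6 + r^2 + k1 * r) r + c"
      by (rule equal_derivs_differ_by_const[OF 1 2])
    then show ?thesis by (elim exE) (rule that, simp)
  qed
  \<comment> \<open>All that the quadratic equation adds, read at a single point. With c4 = k4/24
    and c3 = k3/6 it becomes c1 c3 = 4 c0 c4.\<close>
  have "2 * s^2 * (k4 * k0 - k1 * k3) = 0"
    using ode[OF s(1)] unfolding profile_ode_def k4[OF s(1)] k3[OF s(1)] k2[OF s(1)] k1[OF s(1)] k0[OF s(1)]
    by (simp add: field_simps eval_nat_numeral)
  then have "k4 * k0 = k1 * k3" using s by simp
  then show ?thesis
    using k0 by - (rule exI[of _ "k4 / 24"], rule exI[of _ "k3 / 6"], rule exI[of _ k1], rule exI[of _ k0],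
      simp add: quartic_def mult.commute)
qed

lemma quartic_imp_ode:
  assumes rel: "c1 * c3 = 4 * c0 * c4"
    and f: "\<And>r. r \<in> ival a b \<Longrightarrow> f r = quartic c4 c3 c1 c0 r" and r: "r \<in> ival a b"
  shows "profile_ode (\<lambda>k. (deriv ^^ k) f) r"
proof -
  define F where "F k r = (if k = 0 then quartic c4 c3 c1 c0 r
    else if k = 1 then 4 * c4 * r^3 + 3 * c3 * r^2 + 2 * r + c1
    else if k = 2 then 12 * c4 * r^2 + 6 * c3 * r + 2
    else if k = 3 then 24 * c4 * r + 6 * c3 else if k = 4 then 24 * c4 else 0)" for k :: nat and r :: real
  have F: "(F k has_real_derivative F (Suc k) r) (at r)" for k r
  proof -
    consider "k = 0" | "k = 1" | "k = 2" | "k = 3" | "k = 4" | "4 < k" by linarith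
    then show ?thesis
      by cases (auto simp: F_def[abs_def] quartic_def[abs_def] intro!: derivative_eq_intros)
  qed
  have d: "(deriv ^^ k) f r = F k r" for k
    using deriv_iter_eq[of "ival a b" f F r k, OF open_interval_ereal _ F r] by (simp add: f F_def)
  have "4 * c4 * c0 * 12 * r^2 = c1 * c3 * 12 * r^2" using rel by (simp add: algebra_simps)
  then show ?thesis
    unfolding profile_ode_def d F_def quartic_def by (simp add: field_simps eval_nat_numeral)
qed

section \<open>The explicit family\<close>

definition fam_\<alpha> :: "real \<Rightarrow> real \<Rightarrow> real" where
  "fam_\<alpha> n t = (3 * t^2 - (n - 2) * t) / (2 * n)"

definition fam_\<beta> :: "real \<Rightarrow> real \<Rightarrow> real" where
  "fam_\<beta> n t = (2 * (n - 1) * t - 3 * t^2) / n"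

definition fam_\<gamma> :: "real \<Rightarrow> real \<Rightarrow> real" where
  "fam_\<gamma> n t = n - 2 + (3 * t^2 - (4 * n - 2) * t) / n"

definition fam_\<delta> :: "real \<Rightarrow> real \<Rightarrow> real" where
  "fam_\<delta> n t = 1 - n + ((5 * n - 2) * t - 3 * t^2) / (2 * n)"

lemmas fam_coeff_defs = fam_\<alpha>_def fam_\<beta>_def fam_\<gamma>_def fam_\<delta>_def

lemma fam_poly_quartic: "fam_poly m t \<rho> = quartic (fam_\<alpha> m t) (fam_\<beta> m t) (fam_\<gamma> m t) (fam_\<delta> m t) \<rho>"
  by (simp add: fam_poly_def quartic_def fam_coeff_defs)

text \<open>The cofactor of \<open>\<rho> - 1\<close>.\<close>

definition fam_cubic :: "real \<Rightarrow> real \<Rightarrow> real \<Rightarrow> real" where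
  "fam_cubic n t \<rho> = fam_\<alpha> n t * \<rho>^3 + (fam_\<alpha> n t + fam_\<beta> n t) * \<rho>^2 + (fam_\<alpha> n t + fam_\<beta> n t + 1) * \<rho> - fam_\<delta> n t"

lemma fam_coeffs:
  assumes "n \<noteq> 0"
  shows "2 * fam_\<alpha> n t + fam_\<beta> n t = t" "fam_\<alpha> n t + fam_\<beta> n t + 1 + fam_\<gamma> n t + fam_\<delta> n t = 0"
    "4 * fam_\<alpha> n t + 3 * fam_\<beta> n t + 2 + fam_\<gamma> n t = n" "fam_\<gamma> n t * fam_\<beta> n t = 4 * fam_\<delta> n t * fam_\<alpha> n t"
  using assms by (simp_all add: fam_coeff_defs field_simps power2_eq_square)

text \<open>The linear conditions give \<beta>, \<gamma>, \<delta> in terms of t and \<alpha>. After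
  this substitution the squares of \<alpha> cancel in the quadratic relation, which is therefore
  linear in \<alpha>; so t determines all coefficients.\<close>

lemma fam_coeffs_unique:
  assumes "n \<noteq> 0" "\<alpha> + \<beta> + 1 + \<gamma> + \<delta> = 0" "4 * \<alpha> + 3 * \<beta> + 2 + \<gamma> = n" "\<gamma> * \<beta> = 4 * \<delta> * \<alpha>"
  defines "t \<equiv> 2 * \<alpha> + \<beta>"
  shows "\<alpha> = fam_\<alpha> n t" "\<beta> = fam_\<beta> n t" "\<gamma> = fam_\<gamma> n t" "\<delta> = fam_\<delta> n t"
proof -
  have \<beta>: "\<beta> = t - 2 * \<alpha>" and \<gamma>: "\<gamma> = n - 2 - 3 * t + 2 * \<alpha>" and \<delta>: "\<delta> = 1 - n + 2 * t - \<alpha>"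
    using assms(2,3) by (auto simp: t_def)
  have "2 * n * \<alpha> = 3 * t^2 - (n - 2) * t"
    using assms(4) unfolding \<beta> \<gamma> \<delta> by (simp add: algebra_simps power2_eq_square)
  then show \<alpha>: "\<alpha> = fam_\<alpha> n t"
    using assms(1) by (simp add: fam_\<alpha>_def field_simps)
  show "\<beta> = fam_\<beta> n t" "\<gamma> = fam_\<gamma> n t" "\<delta> = fam_\<delta> n t"
    using fam_coeffs(1-3)[OF assms(1), of t] assms(2,3) \<alpha> unfolding t_def by linarith+
qed

lemma fam_poly_factor:
  assumes "m \<ge> 1"
  shows "fam_poly m t \<rho> = (\<rho> - 1) * fam_cubic m t \<rho>"
proof -
  have \<gamma>: "fam_\<gamma> m t = - fam_\<alpha> m t - fam_\<beta> m t - 1 - fam_\<delta> m t"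
    using fam_coeffs(2)[of "real m" t] assms by simp
  show ?thesis
    unfolding fam_poly_quartic quartic_def fam_cubic_def \<gamma>
    by (simp add: algebra_simps eval_nat_numeral)
qed

lemma fam_cubic_1: "(m :: nat) \<ge> 1 \<Longrightarrow> fam_cubic m t 1 = m"
  using fam_coeffs(2,3)[of "real m" t] by (simp add: fam_cubic_def)

text \<open>The cubic takes the value m at 1, so the left side vanishes there. The quotient is the
  numerator of the regular part of h'' at the zero section.\<close>

lemma fam_cubic_factor:
  assumes "(m :: nat) \<ge> 1"
  shows "m * \<rho> - fam_cubic m t \<rho> = (\<rho> - 1) *
    (m - (fam_\<alpha> m t * (\<rho>^2 + \<rho> + 1) + (fam_\<alpha> m t + fam_\<beta> m t) * (\<rho> + 1) + (fam_\<alpha> m t + fam_\<beta> m t + 1)))"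
proof -
  have \<delta>: "fam_\<delta> m t = fam_\<alpha> m t + (fam_\<alpha> m t + fam_\<beta> m t) + (fam_\<alpha> m t + fam_\<beta> m t + 1) - m"
    using fam_cubic_1[OF assms, of t] by (simp add: fam_cubic_def)
  show ?thesis
    unfolding fam_cubic_def \<delta> by (simp add: algebra_simps eval_nat_numeral)
qed

lemma continuous_fam_cubic: "continuous_on S (\<lambda>r. fam_cubic n t (r / a))"
  unfolding fam_cubic_def divide_inverse by (intro continuous_intros)

text \<open>The cubic is m > 0 at the zero section. Its zeros beyond it form a closed set bounded
  below, so there is a first one if there is any, and positivity before it follows from intermediate
  values.\<close>

lemma fam_end_cases:
  assumes "m \<ge> 1" "0 < a"
  obtains "fam_end m a t = \<infinity>" "\<And>r. a \<le> r \<Longrightarrow> 0 < fam_cubic m t (r / a)"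
  | c where "fam_end m a t = ereal c" "a < c" "fam_cubic m t (c / a) = 0"
      "\<And>r. a \<le> r \<Longrightarrow> r < c \<Longrightarrow> 0 < fam_cubic m t (r / a)"
proof -
  define Z where "Z = {r. a \<le> r \<and> fam_cubic m t (r / a) = 0}"
  have c1: "fam_cubic m t (a / a) = m" using fam_cubic_1 assms by simp
  have Z: "{ereal r | r. a < r \<and> fam_poly m t (r / a) = 0} = ereal ` Z"
  proof -
    \<comment> \<open>The zero of \<open>fam_poly\<close> at the zero section is excluded by the
      strict inequality. The cubic does not vanish there, so its zeros may be taken in the closed
      half-line.\<close>
    have "a < r \<and> fam_poly m t (r / a) = 0 \<longleftrightarrow> a \<le> r \<and> fam_cubic m t (r / a) = 0" for r
      using assms c1 by (cases "r = a") (auto simp: fam_poly_factor)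
    then show ?thesis by (auto simp: Z_def image_def)
  qed
  have pos: "0 < fam_cubic m t (r / a)" if ar: "a \<le> r" and nz: "\<And>s. a \<le> s \<Longrightarrow> s \<le> r \<Longrightarrow> s \<notin> Z" for r
  proof (rule ccontr)
    assume "\<not> 0 < fam_cubic m t (r / a)"
    then obtain s where "a \<le> s" "s \<le> r" "fam_cubic m t (s / a) = 0"
      using IVT2'[of "\<lambda>r. fam_cubic m t (r / a)" r 0 a] ar c1 continuous_fam_cubic by (auto simp del: divide_self_if)
    then show False using nz by (auto simp: Z_def)
  qed
  show ?thesis
  proof (cases "Z = {}")
    case True
    then show ?thesis
      using that(1) pos unfolding fam_end_def Z by (simp add: top_ereal_def)
  next
    case False
    have "closed Z"
    proof -
      have "Z = {a..} \<inter> {r. fam_cubic m t (r / a) = 0}" by (auto simp: Z_def)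
      then show ?thesis
        by (simp add: closed_Int closed_Collect_eq continuous_fam_cubic)
    qed
    moreover have bdd: "bdd_below Z" by (auto simp: Z_def bdd_below_def)
    ultimately have c: "Inf Z \<in> Z" using False by (intro closed_contains_Inf)
    have "fam_end m a t = ereal (Inf Z)"
      unfolding fam_end_def Z
    proof (rule antisym)
      show "Inf (ereal ` Z) \<le> ereal (Inf Z)" using c by (intro Inf_lower) auto
      show "ereal (Inf Z) \<le> Inf (ereal ` Z)"
        using cInf_lower[OF _ bdd] by (intro Inf_greatest) auto
    qed
    moreover have "a < Inf Z" using c c1 assms by (cases "Inf Z = a") (auto simp: Z_def)
    moreover have "0 < fam_cubic m t (r / a)" if "a \<le> r" "r < Inf Z" for r
      using that cInf_lower[OF _ bdd] by (intro pos) force+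
    ultimately show ?thesis using that(2)[of "Inf Z"] c by (auto simp: Z_def)
  qed
qed

lemma fam_end_greater: "m \<ge> 1 \<Longrightarrow> 0 < a \<Longrightarrow> ereal a < fam_end m a t"
  by (rule fam_end_cases[of m a t]) auto

lemma fam_cubic_pos: "m \<ge> 1 \<Longrightarrow> 0 < a \<Longrightarrow> a \<le> r \<Longrightarrow> ereal r < fam_end m a t \<Longrightarrow> 0 < fam_cubic m t (r / a)"
  by (rule fam_end_cases[of m a t]) auto

lemma fam_poly_pos:
  assumes "m \<ge> 1" "0 < a" "r \<in> ival a (fam_end m a t)"
  shows "0 < fam_poly m t (r / a)"
  using assms fam_cubic_pos[of m a r t] by (auto simp: fam_poly_factor intro!: mult_pos_pos)

lemma fam_h2_eq:
  assumes "0 < a" "0 < r"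
  shows "1 + r * fam_h2 m a t r = (r / a)^2 / fam_poly m t (r / a)"
  using assms by (simp add: fam_h2_def)

lemma fam_profile:
  assumes "0 < a" "0 < r" "(deriv ^^ 2) h r = fam_h2 m a t r"
  shows "profile h r = a^2 * fam_poly m t (r / a)"
  unfolding profile_def assms(3) fam_h2_eq[OF assms(1,2)] using assms(1,2) by (simp add: field_simps)

lemma smooth_on_fam_cubic: "open U \<Longrightarrow> smooth_on U (\<lambda>r. fam_cubic n t (r / a))"
proof -
  assume U: "open U"
  have "smooth_on U (\<lambda>r. fam_\<alpha> n t * (r * inverse a)^3 + (fam_\<alpha> n t + fam_\<beta> n t) * (r * inverse a)^2
     + (fam_\<alpha> n t + fam_\<beta> n t + 1) * (r * inverse a) + - fam_\<delta> n t)"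
    by (intro smooth_on_add smooth_on_mult smooth_on_power smooth_on_ident smooth_on_const U)
  then show ?thesis by (simp add: fam_cubic_def divide_inverse)
qed

lemma smooth_on_fam_poly: "m \<ge> 1 \<Longrightarrow> open U \<Longrightarrow> smooth_on U (\<lambda>r. fam_poly m t (r / a))"
proof -
  assume m: "m \<ge> 1" and U: "open U"
  have "smooth_on U (\<lambda>r. (r * inverse a + - 1) * fam_cubic m t (r / a))"
    by (intro smooth_on_add smooth_on_mult smooth_on_ident smooth_on_const smooth_on_fam_cubic U)
  then show ?thesis by (simp add: fam_poly_factor[OF m] divide_inverse)
qed

lemma smooth_on_fam_h2:
  assumes "m \<ge> 1" "0 < a"
  shows "smooth_on (ival a (fam_end m a t)) (fam_h2 m a t)"
proof -
  have "smooth_on (ival a (fam_end m a t)) (\<lambda>r. ((r * inverse a)^2 / fam_poly m t (r / a) + - 1) / r)"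
    by (intro smooth_on_divide smooth_on_add smooth_on_mult smooth_on_power smooth_on_ident smooth_on_const
        smooth_on_fam_poly open_interval_ereal assms)
       (use fam_poly_pos[OF assms] assms in \<open>auto simp: less_imp_neq[symmetric]\<close>)
  then show ?thesis by (simp add: fam_h2_def[abs_def] divide_inverse)
qed

section \<open>Existence of the potentials and the pole at the zero section\<close>

lemma antiderivative_smooth:
  assumes f: "smooth_on (ival a b) f" and "ereal a < b"
  obtains F where "smooth_on (ival a b) F" "\<And>r. r \<in> ival a b \<Longrightarrow> (F has_real_derivative f r) (at r)"
proof -
  have "isCont f x" if "ereal a < ereal x" "ereal x < b" for x
    using smooth_on_has_deriv[OF f, of x 0] that by (auto intro: DERIV_isCont)
  then obtain F where F: "\<And>x. ereal a < ereal x \<Longrightarrow> ereal x < b \<Longrightarrow> (F has_vector_derivative f x) (at x)"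
    using einterval_antiderivative[OF assms(2), of f] by blast
  then have d: "(F has_real_derivative f r) (at r)" if "r \<in> ival a b" for r
    using that by (simp add: has_real_derivative_iff_has_vector_derivative)
  have "smooth_on (ival a b) F"
  proof (rule smooth_on_seqI[OF open_interval_ereal, of a b F "\<lambda>k. if k = 0 then F else (deriv ^^ (k - 1)) f"])
    show "((if k = 0 then F else (deriv ^^ (k - 1)) f) has_real_derivative
       (if Suc k = 0 then F else (deriv ^^ (Suc k - 1)) f) r) (at r)" if "r \<in> ival a b" for k r
      using d[OF that] smooth_on_has_deriv[OF f that, of "k - 1"] by (cases k) auto
  qed simp
  then show ?thesis using d that by blast
qed

lemma family_member_exists:
  assumes "m \<ge> 1" "0 < a"
  shows "\<exists>h. family_member m a t h"
proof -
  let ?I = "ival a (fam_end m a t)"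
  note e = fam_end_greater[OF assms]
  obtain F where F: "smooth_on ?I F" "\<And>r. r \<in> ?I \<Longrightarrow> (F has_real_derivative fam_h2 m a t r) (at r)"
    using antiderivative_smooth[OF smooth_on_fam_h2[OF assms] e] by blast
  obtain h where h: "smooth_on ?I h" "\<And>r. r \<in> ?I \<Longrightarrow> (h has_real_derivative F r) (at r)"
    using antiderivative_smooth[OF F(1) e] by blast
  have "(deriv ^^ 2) h r = fam_h2 m a t r" if r: "r \<in> ?I" for r
  proof -
    have "eventually (\<lambda>r. r \<in> ?I) (nhds r)"
      using open_interval_ereal r by (rule eventually_nhds_in_open)
    then have "eventually (\<lambda>r. deriv h r = F r) (nhds r)"
      by eventually_elim (rule DERIV_imp_deriv[OF h(2)])
    then have "deriv (deriv h) r = deriv F r"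
      by (rule deriv_cong_ev) simp
    then show ?thesis
      using DERIV_imp_deriv[OF F(2)[OF r]] by (simp add: numeral_2_eq_2)
  qed
  then show ?thesis using h(1) by (auto simp: family_member_def)
qed

lemma family_pos:
  assumes "m \<ge> 1" "0 < a" "family_member m a t h" "r \<in> ival a (fam_end m a t)"
  shows "0 < 1 + r * (deriv ^^ 2) h r"
proof -
  have "(deriv ^^ 2) h r = fam_h2 m a t r"
    using assms(3,4) by (auto simp: family_member_def)
  moreover have "0 < r" using assms by auto
  ultimately show ?thesis
    using fam_poly_pos[OF assms(1,2,4)] assms(2) by (simp add: fam_h2_eq)
qed

lemma pos_def_iff_profile:
  assumes "0 \<le> a" "smooth_on (ival a b) h"
  shows "(\<forall>x\<in>int_polygon a b. pos_def (hessian (sympl_pot h) x)) \<longleftrightarrow>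
    (\<forall>r\<in>ival a b. 0 < 1 + r * (deriv ^^ 2) h r)"
proof
  assume *: "\<forall>x\<in>int_polygon a b. pos_def (hessian (sympl_pot h) x)"
  show "\<forall>r\<in>ival a b. 0 < 1 + r * (deriv ^^ 2) h r"
  proof
    fix r assume r: "r \<in> ival a b"
    have x: "act (point_at r) \<in> int_polygon a b" by (rule point_at(1)[OF r assms(1)])
    have "act (point_at r) $ 1 + act (point_at r) $ 2 = r"
      by (simp add: act_def point_at_def)
    then show "0 < 1 + r * (deriv ^^ 2) h r"
      using * x pos_def_hessian_iff[OF assms(2) x] by auto
  qed
next
  assume *: "\<forall>r\<in>ival a b. 0 < 1 + r * (deriv ^^ 2) h r"
  show "\<forall>x\<in>int_polygon a b. pos_def (hessian (sympl_pot h) x)"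
    using * pos_def_hessian_iff[OF assms(2)] by (auto simp: int_polygon_def)
qed

lemma interior_ival: "interior {r. a \<le> r \<and> ereal r < b} = ival a b"
proof (rule interior_unique)
  show "T \<subseteq> ival a b" if T: "T \<subseteq> {r. a \<le> r \<and> ereal r < b}" "open T" for T
  proof
    fix r assume r: "r \<in> T"
    then obtain e where e: "0 < e" "ball r e \<subseteq> T"
      using T(2) open_contains_ball by blast
    then have "r - e / 2 \<in> T" by (auto simp: dist_real_def subset_eq)
    then show "r \<in> ival a b" using T(1) r e(1) by fastforce
  qed
qed (auto simp: open_interval_ereal)

lemma family_u2_kaehler:
  assumes "m \<ge> 1" "0 < a" "family_member m a t h"
  shows "u2_kaehler m a (fam_end m a t) h"
  unfolding u2_kaehler_def
proof (intro conjI)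
  show "ereal a < fam_end m a t" by (rule fam_end_greater[OF assms(1,2)])
  show sm: "smooth_on (ival a (fam_end m a t)) h" using assms(3) by (simp add: family_member_def)
  show "\<forall>x\<in>int_polygon a (fam_end m a t). pos_def (hessian (sympl_pot h) x)"
    using pos_def_iff_profile[OF _ sm] family_pos[OF assms] assms(2) by auto
  define D where "D \<rho> = m - (fam_\<alpha> m t * (\<rho>^2 + \<rho> + 1) + (fam_\<alpha> m t + fam_\<beta> m t) * (\<rho> + 1) + (fam_\<alpha> m t + fam_\<beta> m t + 1))" for \<rho>
  define U where "U = {r. 0 < r} \<inter> {r. 0 < fam_cubic m t (r / a)}"
  \<comment> \<open>Regular part of h'' at r = a. The quotient \<open>D\<close> of
    \<open>fam_cubic_factor\<close> has absorbed the factor \<rho> - 1, so the formula makes sense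
    across the zero section.\<close>
  define G where "G r = D (r / a) / (m * a * fam_cubic m t (r / a)) + - 1 / r" for r
  have "open U"
    unfolding U_def by (intro open_Int open_Collect_less continuous_fam_cubic continuous_intros)
  moreover have "{r. a \<le> r \<and> ereal r < fam_end m a t} \<subseteq> U"
    using fam_cubic_pos[OF assms(1,2)] assms(2) by (auto simp: U_def)
  moreover have "smooth_on U G"
  proof -
    have "smooth_on U (\<lambda>r. m + - 1 * (fam_\<alpha> m t * ((r * inverse a)^2 + r * inverse a + 1)
        + (fam_\<alpha> m t + fam_\<beta> m t) * (r * inverse a + 1) + (fam_\<alpha> m t + fam_\<beta> m t + 1)))"
      by (intro smooth_on_add smooth_on_mult smooth_on_power smooth_on_ident smooth_on_const \<open>open U\<close>)
    then have D: "smooth_on U (\<lambda>r. D (r / a))"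
      by (rule smooth_on_cong[OF \<open>open U\<close>]) (simp add: D_def divide_inverse)
    show ?thesis
      unfolding G_def[abs_def]
      by (intro smooth_on_add smooth_on_divide smooth_on_mult D smooth_on_fam_cubic smooth_on_ident smooth_on_const \<open>open U\<close>)
         (use assms in \<open>auto simp: U_def\<close>)
  qed
  moreover have "G r = (deriv ^^ 2) h r - 1 / (m * (r - a))" if "r \<in> interior {r. a \<le> r \<and> ereal r < fam_end m a t}" for r
  proof -
    have r: "r \<in> ival a (fam_end m a t)" using that by (simp add: interior_ival)
    define \<rho> where "\<rho> = r / a"
    have \<rho>: "\<rho> - 1 \<noteq> 0" "\<rho> \<noteq> 0" "a \<noteq> 0" "real m \<noteq> 0" "r = a * \<rho>" "fam_cubic m t \<rho> \<noteq> 0"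
      using r assms(1,2) fam_cubic_pos[OF assms(1,2), of r t] by (auto simp: \<rho>_def field_simps)
    have D: "D \<rho> = (m * \<rho> - fam_cubic m t \<rho>) / (\<rho> - 1)"
      using fam_cubic_factor[OF assms(1), of \<rho> t] \<rho>(1) by (simp add: D_def)
    have h2: "(deriv ^^ 2) h r = (\<rho>^2 / ((\<rho> - 1) * fam_cubic m t \<rho>) - 1) / (a * \<rho>)"
      using assms(3) r by (simp add: family_member_def fam_h2_def fam_poly_factor[OF assms(1)] \<rho>(5)[symmetric] flip: \<rho>_def)
    define e where "e = \<rho> - 1"
    define C where "C = fam_cubic m t \<rho>"
    have nz: "e \<noteq> 0" "C \<noteq> 0" and ra: "r - a = a * e" using \<rho> by (auto simp: e_def C_def algebra_simps)
    have "((m * \<rho> - C) / e) / (m * a * C) + - 1 / (a * \<rho>) = (\<rho>^2 / (e * C) - 1) / (a * \<rho>) - 1 / (m * (a * e))"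
      using nz \<rho>(2-4) by (simp add: field_simps power2_eq_square)
    then show ?thesis
      unfolding G_def \<rho>_def[symmetric] D h2 ra e_def[symmetric] C_def[symmetric] using \<rho>(5) by simp
  qed
  ultimately show "smooth_up_to {r. a \<le> r \<and> ereal r < fam_end m a t} (\<lambda>r. (deriv ^^ 2) h r - 1 / (m * (r - a)))"
    unfolding smooth_up_to_def by blast
qed

lemma cont_eq_at_left_end:
  fixes F G :: "real \<Rightarrow> real"
  assumes "isCont F a" "isCont G a" "ereal a < b" "\<And>r. r \<in> ival a b \<Longrightarrow> F r = G r"
  shows "F a = G a"
proof -
  have "eventually (\<lambda>r. r \<in> ival a b) (at_right a)"
  proof -
    obtain c where "a < c" "ereal c \<le> b"
      using assms(3) by (metis dense_le_bounded ereal_dense2 ereal_less_eq(3) less_ereal.simps(1) less_imp_le)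
    then have "\<forall>r. a < r \<and> r < c \<longrightarrow> r \<in> ival a b"
      using less_le_trans[of "ereal _" "ereal c" b] by auto
    then show ?thesis
      using \<open>a < c\<close> unfolding eventually_at_right_field by blast
  qed
  then have ev: "eventually (\<lambda>r. F r = G r) (at_right a)"
    by eventually_elim (rule assms(4))
  have "(F \<longlongrightarrow> F a) (at_right a)" "(G \<longlongrightarrow> G a) (at_right a)"
    using assms(1,2) by (auto simp: isCont_def intro: filterlim_mono[OF _ order_refl at_le])
  then show ?thesis
    using tendsto_cong[OF ev] tendsto_unique[of "at_right a" F] by auto
qed

lemma u2_kaehlerD:
  assumes "u2_kaehler m a b h" "0 \<le> a"
  shows "ereal a < b" "smooth_on (ival a b) h" "\<And>r. r \<in> ival a b \<Longrightarrow> 0 < 1 + r * (deriv ^^ 2) h r"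
proof -
  show *: "ereal a < b" "smooth_on (ival a b) h"
    using assms(1) by (auto simp: u2_kaehler_def)
  show "0 < 1 + r * (deriv ^^ 2) h r" if "r \<in> ival a b" for r
    using pos_def_iff_profile[OF assms(2) *(2)] assms(1) that by (auto simp: u2_kaehler_def)
qed

lemma smooth_on_isCont: "smooth_on U f \<Longrightarrow> x \<in> U \<Longrightarrow> isCont f x"
  using smooth_on_has_deriv[of U f x 0] by (auto intro: DERIV_isCont)

text \<open>Cleared of denominators, the definition of the profile and the prescribed pole of h''
  give an identity between functions continuous at r = a. Its limit yields the zero of the profile
  and, after division by r - a, the slope.\<close>

lemma u2_kaehler_boundary:
  assumes u: "u2_kaehler m a b h" and "0 < a" "m \<ge> 1"
    and q: "\<And>r. r \<in> ival a b \<Longrightarrow> profile h r = quartic c4 c3 c1 c0 r"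
  shows "quartic c4 c3 c1 c0 a = 0" "4 * c4 * a^3 + 3 * c3 * a^2 + 2 * a + c1 = m * a"
proof -
  have a0: "0 \<le> a" using assms by simp
  note d = u2_kaehlerD[OF u a0]
  obtain U G where U: "open U" "{r. a \<le> r \<and> ereal r < b} \<subseteq> U" "smooth_on U G"
    "\<And>r. r \<in> ival a b \<Longrightarrow> G r = (deriv ^^ 2) h r - 1 / (m * (r - a))"
    using u unfolding u2_kaehler_def smooth_up_to_def interior_ival by blast
  have "a \<in> U" using U(2) d(1) by auto
  then have G: "isCont G a" using U(3) by (rule smooth_on_isCont[rotated])
  have eq: "quartic c4 c3 c1 c0 r * ((r - a) * (1 + r * G r) + r / m) = r^2 * (r - a)" if r: "r \<in> ival a b" for r
  proof -
    have nz: "r - a \<noteq> 0" "real m \<noteq> 0" using r assms by auto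
    have "(r - a) * (1 + r * G r) + r / m = (r - a) * (1 + r * (deriv ^^ 2) h r)"
      unfolding U(4)[OF r] using nz by (simp add: field_simps)
    then show ?thesis
      unfolding q[OF r, symmetric] profile_def using d(3)[OF r] by simp
  qed
  have cont: "isCont (quartic c4 c3 c1 c0) a"
    unfolding quartic_def[abs_def] by (intro continuous_intros)
  have "quartic c4 c3 c1 c0 a * ((a - a) * (1 + a * G a) + a / m) = a^2 * (a - a)"
    by (rule cont_eq_at_left_end[where F = "\<lambda>r. quartic c4 c3 c1 c0 r * ((r - a) * (1 + r * G r) + r / m)" and G = "\<lambda>r. r^2 * (r - a)" and a = a and b = b])
       (use assms in \<open>auto intro!: continuous_intros G cont d(1) eq\<close>)
  then show 0: "quartic c4 c3 c1 c0 a = 0" using assms by simp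
  \<comment> \<open>Difference quotient of the quartic at a, written as a polynomial so that its
    value at a is the derivative.\<close>
  define T where "T r = c4 * (r^3 + r^2 * a + r * a^2 + a^3) + c3 * (r^2 + r * a + a^2) + r + a + c1" for r
  have T: "quartic c4 c3 c1 c0 r = (r - a) * T r" for r
  proof -
    have "quartic c4 c3 c1 c0 r - quartic c4 c3 c1 c0 a = (r - a) * T r"
      by (simp add: quartic_def T_def algebra_simps eval_nat_numeral)
    then show ?thesis by (simp add: 0)
  qed
  have eq2: "T r * ((r - a) * (1 + r * G r) + r / m) = r^2" if r: "r \<in> ival a b" for r
  proof -
    have "(r - a) * (T r * ((r - a) * (1 + r * G r) + r / m)) = (r - a) * r^2"
      using eq[OF r] by (simp add: T mult_ac)
    then show ?thesis using r by simp
  qed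
  have "T a * ((a - a) * (1 + a * G a) + a / m) = a^2"
    by (rule cont_eq_at_left_end[where F = "\<lambda>r. T r * ((r - a) * (1 + r * G r) + r / m)" and G = "\<lambda>r. r^2" and a = a and b = b])
       (use assms in \<open>auto simp: T_def[abs_def] intro!: continuous_intros G d(1) eq2[unfolded T_def]\<close>)
  then have "T a = m * a" using assms by (simp add: field_simps power2_eq_square)
  then show "4 * c4 * a^3 + 3 * c3 * a^2 + 2 * a + c1 = m * a"
    by (simp add: T_def algebra_simps eval_nat_numeral)
qed

section \<open>Bach-flat metrics belong to the family\<close>

lemma fam_poly_scaled:
  assumes "a \<noteq> 0"
  shows "a^2 * fam_poly m t (r / a)
    = quartic (fam_\<alpha> m t / a^2) (fam_\<beta> m t / a) (fam_\<gamma> m t * a) (fam_\<delta> m t * a^2) r"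
  using assms by (simp add: fam_poly_quartic quartic_def field_simps eval_nat_numeral)

lemma bach_flat_classification:
  assumes u: "u2_kaehler m a b h" and B: "bach_flat a b h" and "0 < a" "m \<ge> 1"
  obtains t where "\<And>r. r \<in> ival a b \<Longrightarrow> profile h r = a^2 * fam_poly m t (r / a)"
proof -
  have a0: "0 \<le> a" using assms by simp
  note d = u2_kaehlerD[OF u a0]
  obtain s where s: "a < s" "ereal s < b"
    using ereal_dense2[OF d(1)] by auto
  have sm: "smooth_on (ival a b) (profile h)" by (rule smooth_on_profile[OF d(2,3)])
  have "\<exists>c4 c3 c1 c0. c1 * c3 = 4 * c0 * c4 \<and> (\<forall>r\<in>ival a b. (deriv ^^ 0) (profile h) r = quartic c4 c3 c1 c0 r)"
    by (rule ode_imp_quartic[OF a0 s, where q = "\<lambda>k. (deriv ^^ k) (profile h)"])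
       (use smooth_on_has_deriv[OF sm] bach_flat_iff_ode[OF a0 d(2,3)] B in blast)+
  then obtain c4 c3 c1 c0 where rel: "c1 * c3 = 4 * c0 * c4"
    and q: "\<And>r. r \<in> ival a b \<Longrightarrow> profile h r = quartic c4 c3 c1 c0 r" by auto
  note bd = u2_kaehler_boundary[OF u assms(3,4) q]
  \<comment> \<open>In the variable \<rho> = r/a the coefficients satisfy the normalised conditions,
    and this is 2 \<alpha> + \<beta> for them.\<close>
  define t where "t = 2 * (c4 * a^2) + c3 * a"
  have n: "real m \<noteq> 0" using assms by simp
  have e: "c4 * a^2 + c3 * a + 1 + c1 / a + c0 / a^2 = 0" "4 * (c4 * a^2) + 3 * (c3 * a) + 2 + c1 / a = m"
    "c1 / a * (c3 * a) = 4 * (c0 / a^2) * (c4 * a^2)"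
    using bd rel assms(3) by (auto simp: quartic_def field_simps eval_nat_numeral)
  note co = fam_coeffs_unique[OF n e, folded t_def]
  have "profile h r = a^2 * fam_poly m t (r / a)" if "r \<in> ival a b" for r
    unfolding q[OF that] fam_poly_scaled[OF less_imp_neq[OF assms(3), symmetric]] co[symmetric]
    using assms(3) by simp
  then show ?thesis by (rule that)
qed

lemma profile_imp_fam_h2:
  assumes "0 < a" "0 < r" "0 < 1 + r * (deriv ^^ 2) h r" "profile h r = a^2 * fam_poly m t (r / a)"
  shows "(deriv ^^ 2) h r = fam_h2 m a t r" "0 < fam_poly m t (r / a)"
proof -
  have p: "0 < a^2 * fam_poly m t (r / a)"
    using profile_pos[OF assms(2,3)] assms(4) by simp
  then show P: "0 < fam_poly m t (r / a)" using assms(1) by (simp add: zero_less_mult_iff)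
  have "1 + r * (deriv ^^ 2) h r = r^2 / (a^2 * fam_poly m t (r / a))"
    using assms(2,3) p unfolding assms(4)[symmetric] profile_def by simp
  then show "(deriv ^^ 2) h r = fam_h2 m a t r"
    using assms(1,2) unfolding fam_h2_def by (simp add: field_simps)
qed

lemma family_bach_flat:
  assumes "m \<ge> 1" "0 < a" "family_member m a t h"
  shows "bach_flat a (fam_end m a t) h"
proof -
  have sm: "smooth_on (ival a (fam_end m a t)) h" using assms by (simp add: family_member_def)
  have a0: "0 \<le> a" "a \<noteq> 0" using assms by auto
  have q: "profile h r = quartic (fam_\<alpha> m t / a^2) (fam_\<beta> m t / a) (fam_\<gamma> m t * a) (fam_\<delta> m t * a^2) r"
    if "r \<in> ival a (fam_end m a t)" for r
    using fam_profile[OF assms(2), of r h m t] that assms(2,3)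
    by (auto simp: family_member_def fam_poly_scaled[OF a0(2)])
  have rel: "fam_\<gamma> m t * a * (fam_\<beta> m t / a) = 4 * (fam_\<delta> m t * a^2) * (fam_\<alpha> m t / a^2)"
    using fam_coeffs(4)[of "real m" t] assms by simp
  show ?thesis
    by (rule iffD2[OF bach_flat_iff_ode[OF a0(1) sm family_pos[OF assms]]], assumption)
       (intro ballI quartic_imp_ode[OF rel q])
qed

text \<open>If h'' were continuous across the end, the identity P(r/a) (1 + r h'') = (r/a)^2 would
  persist at the zero of P, where its left side is 0 and its right side is positive.\<close>

lemma family_end_profile_unextendable:
  assumes "m \<ge> 1" "0 < a" "fam_end m a t < b'" "u2_kaehler m a b' h'"
  shows "\<exists>r\<in>ival a (fam_end m a t). (deriv ^^ 2) h' r \<noteq> fam_h2 m a t r"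
proof (rule ccontr)
  assume *: "\<not> (\<exists>r\<in>ival a (fam_end m a t). (deriv ^^ 2) h' r \<noteq> fam_h2 m a t r)"
  obtain c where c: "fam_end m a t = ereal c" "a < c" "fam_cubic m t (c / a) = 0"
    by (rule fam_end_cases[OF assms(1,2), of t]) (use assms(3) that in auto)
  note d = u2_kaehlerD[OF assms(4) less_imp_le[OF assms(2)]]
  have cb: "c \<in> ival a b'" using c assms(3) by simp
  have ch: "isCont ((deriv ^^ 2) h') c"
    by (rule smooth_on_isCont[OF smooth_on_deriv_iter[OF d(2)] cb])
  have cP: "isCont (\<lambda>r. fam_poly m t (r / a)) c"
    unfolding fam_poly_def by (intro continuous_intros) (use assms in auto)
  have eq: "fam_poly m t (r / a) * (1 + r * (deriv ^^ 2) h' r) = (r / a)^2" if "r \<in> ival a (ereal c)" for r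
  proof -
    have "(deriv ^^ 2) h' r = fam_h2 m a t r" using * that c(1) by auto
    then show ?thesis
      using fam_h2_eq[OF assms(2), of r m t] fam_poly_pos[OF assms(1,2), of r t] that c(1) assms(2) by auto
  qed
  have "fam_poly m t (c / a) * (1 + c * (deriv ^^ 2) h' c) = (c / a)^2"
  proof (rule tendsto_unique[of "at_left c"])
    have ev: "eventually (\<lambda>r. r \<in> ival a (ereal c)) (at_left c)"
      using c(2) eventually_at_left_field by fastforce
    have 1: "((\<lambda>r. fam_poly m t (r / a) * (1 + r * (deriv ^^ 2) h' r)) \<longlongrightarrow> fam_poly m t (c / a) * (1 + c * (deriv ^^ 2) h' c)) (at c)"
      using isCont_mult[OF cP continuous_add[OF continuous_const continuous_mult[OF continuous_ident ch]]]
      by (simp add: isCont_def)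
    show "((\<lambda>r. (r / a)^2) \<longlongrightarrow> (c / a)^2) (at_left c)"
      using assms by (intro tendsto_intros) auto
    have "((\<lambda>r. fam_poly m t (r / a) * (1 + r * (deriv ^^ 2) h' r)) \<longlongrightarrow> fam_poly m t (c / a) * (1 + c * (deriv ^^ 2) h' c)) (at_left c)"
      using 1 by (rule filterlim_mono[OF _ order_refl at_le]) simp
    moreover have "eventually (\<lambda>r. fam_poly m t (r / a) * (1 + r * (deriv ^^ 2) h' r) = (r / a)^2) (at_left c)"
      using ev by eventually_elim (rule eq)
    ultimately show "((\<lambda>r. (r / a)^2) \<longlongrightarrow> fam_poly m t (c / a) * (1 + c * (deriv ^^ 2) h' c)) (at_left c)"
      using tendsto_cong by fast
  qed simp
  then show False
    using c assms(2) by (simp add: fam_poly_factor[OF assms(1)])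
qed

lemma deriv2_cong:
  assumes "smooth_on (ival a b) h" "\<And>r. r \<in> ival a b \<Longrightarrow> h' r = h r" "r \<in> ival a b"
  shows "(deriv ^^ 2) h' r = (deriv ^^ 2) h r"
  by (rule deriv_iter_cong[OF open_interval_ereal assms])

lemma family_maximal:
  assumes "m \<ge> 1" "0 < a" "family_member m a t h"
  shows "u2_kaehler_maximal m a (fam_end m a t) h"
  unfolding u2_kaehler_maximal_def
proof (intro conjI notI)
  show "u2_kaehler m a (fam_end m a t) h" by (rule family_u2_kaehler[OF assms])
  assume "\<exists>b' h'. fam_end m a t < b' \<and> u2_kaehler m a b' h' \<and> (\<forall>r. a < r \<and> ereal r < fam_end m a t \<longrightarrow> h' r = h r)"
  then obtain b' h' where b': "fam_end m a t < b'" "u2_kaehler m a b' h'" "\<And>r. r \<in> ival a (fam_end m a t) \<Longrightarrow> h' r = h r"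
    by auto
  have "(deriv ^^ 2) h' r = fam_h2 m a t r" if r: "r \<in> ival a (fam_end m a t)" for r
    using deriv2_cong[of a "fam_end m a t" h h', OF _ b'(3) r] assms(3) r by (auto simp: family_member_def)
  then show False
    using family_end_profile_unextendable[OF assms(1,2) b'(1,2)] by blast
qed

text \<open>All members share value and slope at the zero section, whence the double factor. The
  last factor equals 3 at \<rho> = 1, so distinct parameters are already separated close to the zero
  section.\<close>

lemma fam_poly_diff:
  assumes "m \<ge> 1"
  shows "fam_poly m t \<rho> - fam_poly m t' \<rho> = (t - t') * ((\<rho> - 1)^2 *
    ((t + t') * 3 / (2 * m) * (\<rho>^2 - 1) + ((5 * real m - 2) / (2 * m) + \<rho> - (real m - 2) / (2 * m) * \<rho>^2)))"
  using assms by (simp add: fam_poly_def field_simps eval_nat_numeral)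

lemma fam_parameter_unique:
  assumes "m \<ge> 1" "0 < a" "ereal a < b"
    and "\<And>r. r \<in> ival a b \<Longrightarrow> fam_poly m t (r / a) = fam_poly m t' (r / a)"
  shows "t = t'"
proof (rule ccontr)
  assume "t \<noteq> t'"
  define K where "K r = (t + t') * 3 / (2 * m) * ((r / a)^2 - 1) + ((5 * real m - 2) / (2 * m) + r / a - (real m - 2) / (2 * m) * (r / a)^2)" for r
  have "K r = 0" if r: "r \<in> ival a b" for r
  proof -
    have "r \<noteq> a" "a \<noteq> 0" using r assms(2) by auto
    then show ?thesis
      using fam_poly_diff[OF assms(1), of t "r / a" t'] assms(4)[OF r] \<open>t \<noteq> t'\<close> by (simp add: K_def)
  qed
  moreover have "isCont K a"
    unfolding K_def by (intro continuous_intros) (use assms in auto)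
  ultimately have "K a = 0"
    using cont_eq_at_left_end[where F = K and G = "\<lambda>r. 0" and a = a and b = b] assms(3) by simp
  moreover have "K a = 3" using assms by (simp add: K_def field_simps)
  ultimately show False by simp
qed

lemma u2_kaehler_cong:
  assumes "0 \<le> a" "u2_kaehler m a b h" "smooth_on (ival a b) h'" "\<And>r. r \<in> ival a b \<Longrightarrow> (deriv ^^ 2) h' r = (deriv ^^ 2) h r"
  shows "u2_kaehler m a b h'"
proof -
  note d = u2_kaehlerD[OF assms(2,1)]
  have "\<forall>x\<in>int_polygon a b. pos_def (hessian (sympl_pot h') x)"
    using pos_def_iff_profile[OF assms(1,3)] d(3) assms(4) by simp
  moreover obtain U G where U: "open U" "{r. a \<le> r \<and> ereal r < b} \<subseteq> U" "smooth_on U G"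
    "\<And>r. r \<in> ival a b \<Longrightarrow> G r = (deriv ^^ 2) h r - 1 / (m * (r - a))"
    using assms(2) unfolding u2_kaehler_def smooth_up_to_def interior_ival by blast
  have "smooth_up_to {r. a \<le> r \<and> ereal r < b} (\<lambda>r. (deriv ^^ 2) h' r - 1 / (m * (r - a)))"
    unfolding smooth_up_to_def interior_ival
    using U assms(4) by (intro exI[of _ U] exI[of _ G]) auto
  ultimately show ?thesis
    using d(1) assms(3) unfolding u2_kaehler_def by blast
qed

lemma bach_flat_in_family:
  assumes "m \<ge> 1" "0 < a" and u: "u2_kaehler m a b h" and B: "bach_flat a b h"
  shows "\<exists>!t. b \<le> fam_end m a t \<and> (\<forall>r. a < r \<and> ereal r < b \<longrightarrow> (deriv ^^ 2) h r = fam_h2 m a t r) \<and>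
    (u2_kaehler_maximal m a b h \<longrightarrow> b = fam_end m a t \<and> family_member m a t h)"
proof -
  have a0: "0 \<le> a" using assms by simp
  note d = u2_kaehlerD[OF u a0]
  obtain t where t: "\<And>r. r \<in> ival a b \<Longrightarrow> profile h r = a^2 * fam_poly m t (r / a)"
    using bach_flat_classification[OF u B assms(2,1)] by blast
  have h2: "(deriv ^^ 2) h r = fam_h2 m a t r" "0 < fam_poly m t (r / a)" if "r \<in> ival a b" for r
    using profile_imp_fam_h2[OF assms(2) _ d(3)[OF that] t[OF that]] that assms(2) by auto
  have be: "b \<le> fam_end m a t"
  proof (rule ccontr)
    assume "\<not> b \<le> fam_end m a t"
    then have lt: "fam_end m a t < b" by simp
    obtain c where c: "fam_end m a t = ereal c" "a < c" "fam_cubic m t (c / a) = 0" "ereal c < b"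
      by (rule fam_end_cases[OF assms(1,2), of t]) (use lt that in auto)
    then have "fam_poly m t (c / a) = 0" by (simp add: fam_poly_factor[OF assms(1)])
    then show False using h2(2)[of c] c by simp
  qed
  show ?thesis
  proof (rule ex1I[of _ t])
    show "b \<le> fam_end m a t \<and> (\<forall>r. a < r \<and> ereal r < b \<longrightarrow> (deriv ^^ 2) h r = fam_h2 m a t r) \<and>
      (u2_kaehler_maximal m a b h \<longrightarrow> b = fam_end m a t \<and> family_member m a t h)"
    proof (intro conjI impI allI be)
      show "(deriv ^^ 2) h r = fam_h2 m a t r" if "a < r \<and> ereal r < b" for r using h2(1) that by simp
      assume max: "u2_kaehler_maximal m a b h"
      show b: "b = fam_end m a t"
      proof (rule ccontr)
        assume "b \<noteq> fam_end m a t"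
        then have lt: "b < fam_end m a t" using be by simp
        let ?e = "fam_end m a t"
        \<comment> \<open>If h stopped before \<open>fam_end\<close>, a member of the family would
          have the same second derivative and so differ from h by an affine function. Adding this
          function to the member continues h beyond b, against maximality.\<close>
        obtain h1 where h1: "family_member m a t h1" using family_member_exists[OF assms(1,2)] by blast
        have sm1: "smooth_on (ival a ?e) h1" "\<And>r. r \<in> ival a ?e \<Longrightarrow> (deriv ^^ 2) h1 r = fam_h2 m a t r"
          using h1 by (auto simp: family_member_def)
        have sub: "r \<in> ival a ?e" if "r \<in> ival a b" for r using that lt by auto
        have dd: "(deriv f has_real_derivative fam_h2 m a t r) (at r)"
          if "smooth_on (ival a b) f" "\<And>r. r \<in> ival a b \<Longrightarrow> (deriv ^^ 2) f r = fam_h2 m a t r" "r \<in> ival a b" for f r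
          using smooth_on_has_deriv[OF that(1,3), of 1] that(2)[OF that(3)] by (simp add: numeral_2_eq_2)
        have sm1b: "smooth_on (ival a b) h1" by (rule smooth_on_subset[OF sm1(1)]) (use sub in auto)
        have "\<exists>k. \<forall>r\<in>ival a b. deriv h r = deriv h1 r + k"
          by (rule equal_derivs_differ_by_const[OF dd[OF d(2) h2(1)] dd[OF sm1b sm1(2)[OF sub]]])
        then obtain k where k: "\<And>r. r \<in> ival a b \<Longrightarrow> deriv h r = deriv h1 r + k" by blast
        have "\<exists>l. \<forall>r\<in>ival a b. h r = (\<lambda>r. h1 r + k * r) r + l"
        proof (rule equal_derivs_differ_by_const)
          show "(h has_real_derivative deriv h r) (at r)" if "r \<in> ival a b" for r
            using smooth_on_has_deriv[OF d(2) that, of 0] by simp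
          show "((\<lambda>r. h1 r + k * r) has_real_derivative deriv h r) (at r)" if "r \<in> ival a b" for r
            using DERIV_add[OF smooth_on_has_deriv[OF sm1b that, of 0] DERIV_cmult_Id[of k r]] k[OF that] by simp
        qed
        then obtain l where l: "\<And>r. r \<in> ival a b \<Longrightarrow> h r = h1 r + k * r + l" by auto
        define h' where "h' r = h1 r + (k * r + l)" for r
        have sm': "smooth_on (ival a ?e) h'"
          unfolding h'_def[abs_def]
          by (intro smooth_on_add smooth_on_mult smooth_on_ident smooth_on_const sm1(1) open_interval_ereal)
        have h'2: "(deriv ^^ 2) h' r = (deriv ^^ 2) h1 r" if r: "r \<in> ival a ?e" for r
        proof -
          define F where "F j r = (if j = 0 then h' r else (deriv ^^ j) h1 r + (if j = 1 then k else 0))" for j :: nat and r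
          have "(F j has_real_derivative F (Suc j) r) (at r)" if "r \<in> ival a ?e" for j r
          proof -
            consider "j = 0" | "j = 1" | "j > 1" by linarith
            then show ?thesis
            proof cases
              case 1
              have "((\<lambda>r. h1 r + (k * r + l)) has_real_derivative deriv h1 r + (k + 0)) (at r)"
                by (intro DERIV_add DERIV_const DERIV_cmult_Id) (use smooth_on_has_deriv[OF sm1(1) that, of 0] in simp)
              then show ?thesis using 1 by (simp add: F_def[abs_def] h'_def[abs_def])
            next
              case 2
              then show ?thesis
                using DERIV_add[OF smooth_on_has_deriv[OF sm1(1) that, of 1] DERIV_const[of k]] by (simp add: F_def[abs_def])
            next
              case 3
              then show ?thesis
                using smooth_on_has_deriv[OF sm1(1) that, of j] by (simp add: F_def[abs_def])
            qed
          qed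
          from deriv_iter_eq[of "ival a ?e" h' F r 2, OF open_interval_ereal _ this r]
          show ?thesis by (simp add: F_def)
        qed
        have "u2_kaehler m a ?e h'"
          by (rule u2_kaehler_cong[OF a0 family_u2_kaehler[OF assms(1,2) h1] sm' h'2])
        moreover have "\<forall>r. a < r \<and> ereal r < b \<longrightarrow> h' r = h r" using l by (simp add: h'_def)
        ultimately show False using max lt unfolding u2_kaehler_maximal_def by blast
      qed
      show "family_member m a t h"
        using d(2) h2(1) b unfolding family_member_def by simp
    qed
    fix t' assume t': "b \<le> fam_end m a t' \<and> (\<forall>r. a < r \<and> ereal r < b \<longrightarrow> (deriv ^^ 2) h r = fam_h2 m a t' r) \<and>
      (u2_kaehler_maximal m a b h \<longrightarrow> b = fam_end m a t' \<and> family_member m a t' h)"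
    show "t' = t"
    proof (rule fam_parameter_unique[OF assms(1,2) d(1)])
      fix r assume r: "r \<in> ival a b"
      have "profile h r = a^2 * fam_poly m t' (r / a)"
        by (rule fam_profile[OF assms(2)]) (use r t' assms(2) in auto)
      then show "fam_poly m t' (r / a) = fam_poly m t (r / a)" using t[OF r] assms(2) by simp
    qed
  qed
qed

section \<open>Scaling\<close>

lemma fam_end_scale:
  assumes "m \<ge> 1" "0 < a" "0 < c"
  shows "fam_end m (c * a) t = ereal c * fam_end m a t"
proof -
  have ca: "0 < c * a" using assms by simp
  have P: "fam_cubic m t (c * r / (c * a)) = fam_cubic m t (r / a)" for r using assms by simp
  show ?thesis
  proof (rule fam_end_cases[OF assms(1,2), of t])
    assume inf: "fam_end m a t = \<infinity>" and pos: "\<And>r. a \<le> r \<Longrightarrow> 0 < fam_cubic m t (r / a)"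
    show ?thesis
    proof (rule fam_end_cases[OF assms(1) ca, of t])
      fix d assume d: "c * a < d" "fam_cubic m t (d / (c * a)) = 0"
      have "0 < fam_cubic m t ((d / c) / a)"
        by (rule pos) (use d assms in \<open>simp add: field_simps\<close>)
      then show ?thesis using d(2) by (simp add: mult.commute)
    qed (use inf assms in simp)
  next
    fix d assume d: "fam_end m a t = ereal d" "a < d" "fam_cubic m t (d / a) = 0"
      "\<And>r. a \<le> r \<Longrightarrow> r < d \<Longrightarrow> 0 < fam_cubic m t (r / a)"
    show ?thesis
    proof (rule fam_end_cases[OF assms(1) ca, of t])
      assume "\<And>r. c * a \<le> r \<Longrightarrow> 0 < fam_cubic m t (r / (c * a))"
      from this[of "c * d"] show ?thesis using d P[of d] assms by simp
    next
      fix e assume e: "fam_end m (c * a) t = ereal e" "c * a < e" "fam_cubic m t (e / (c * a)) = 0"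
        "\<And>r. c * a \<le> r \<Longrightarrow> r < e \<Longrightarrow> 0 < fam_cubic m t (r / (c * a))"
      have "e \<le> c * d"
      proof (rule ccontr)
        assume "\<not> e \<le> c * d"
        then show False using e(4)[of "c * d"] d P[of d] assms by simp
      qed
      moreover have "c * d \<le> e"
      proof (rule ccontr)
        assume "\<not> c * d \<le> e"
        then have "0 < fam_cubic m t ((e / c) / a)"
          by (intro d(4)) (use e assms in \<open>simp_all add: field_simps\<close>)
        then show False using e(3) by (simp add: mult.commute)
      qed
      ultimately show ?thesis using e d by simp
    qed
  qed
qed

text \<open>The profile is homogeneous: its value at c r is c^2 Q. The powers of c from the profile,
  from r and from the rescaled components leave the same factor c in every leg.\<close>

lemma family_dilation:
  assumes "m \<ge> 1" "0 < a" "0 < c" and h: "family_member m a t h" and h': "family_member m (c * a) t h'"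
    and p: "act p \<in> int_polygon a (fam_end m a t)"
  shows "dilation c v \<bullet> (toric_metric h' (dilation c p) *v dilation c w) = c * (v \<bullet> (toric_metric h p *v w))"
proof -
  let ?b = "fam_end m a t" and ?b' = "fam_end m (c * a) t"
  have ca: "0 < c * a" using assms by simp
  have r: "rr p \<in> ival a ?b" by (rule rr_act[OF p])
  have x: "0 < p $ Inl 1" "0 < p $ Inl 2" using p by (auto simp: int_polygon_def act_def)
  have r': "rr (dilation c p) = c * rr p" and z': "zz (dilation c p) = zz p"
    using assms(3) by (auto simp: rr_def zz_def dilation_def distrib_left[symmetric])
  then have w': "ww (dilation c p) = ww p" by (simp add: ww_def)
  have p': "act (dilation c p) \<in> int_polygon (c * a) ?b'"
  proof -
    have "ereal (c * rr p) < ereal c * ?b"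
      using r assms(3) ereal_mult_strict_left_mono[of "ereal (rr p)" ?b "ereal c"] by simp
    then show ?thesis
      using x r assms(3) unfolding fam_end_scale[OF assms(1-3)]
      by (auto simp: int_polygon_def act_def dilation_def rr_def distrib_left[symmetric])
  qed
  have r'': "rr (dilation c p) \<in> ival (c * a) ?b'" by (rule rr_act[OF p'])
  define Q where "Q = profile h (rr p)"
  have Q: "profile h (rr p) = a^2 * fam_poly m t (rr p / a)"
    by (rule fam_profile[OF assms(2)]) (use r h assms in \<open>auto simp: family_member_def\<close>)
  have "profile h' (rr (dilation c p)) = (c * a)^2 * fam_poly m t (rr (dilation c p) / (c * a))"
    by (rule fam_profile[OF ca]) (use r'' h' ca in \<open>auto simp: family_member_def\<close>)
  then have Q': "profile h' (rr (dilation c p)) = c^2 * Q"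
    using assms(3) by (simp add: Q_def Q r' power_mult_distrib)
  have T: "toric_metric h p $ i $ j =
      rr p / (2 * Q) * cofr Rad i p * cofr Rad j p + rr p / 2 * cofr Lat i p * cofr Lat j p
      + (2 * Q / rr p * cofr Fib i p * cofr Fib j p + rr p / 2 * cofr Lon i p * cofr Lon j p)" for i j
    unfolding Q_def profile_def
    by (rule toric_metric_eq[OF _ p family_pos[OF assms(1,2) h r]]) (use h in \<open>simp add: family_member_def\<close>)
  have T': "toric_metric h' (dilation c p) $ i $ j =
      c * rr p / (2 * (c^2 * Q)) * cofr Rad i (dilation c p) * cofr Rad j (dilation c p)
      + c * rr p / 2 * cofr Lat i (dilation c p) * cofr Lat j (dilation c p)
      + (2 * (c^2 * Q) / (c * rr p) * cofr Fib i (dilation c p) * cofr Fib j (dilation c p)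
      + c * rr p / 2 * cofr Lon i (dilation c p) * cofr Lon j (dilation c p))" for i j
    unfolding r'[symmetric] Q'[symmetric] profile_def
    by (rule toric_metric_eq[OF _ p' family_pos[OF assms(1) ca h' r'']]) (use h' in \<open>simp add: family_member_def\<close>)
  define s where "s i = (case i of Inl _ \<Rightarrow> c | Inr _ \<Rightarrow> 1)" for i :: "2 + 2"
  have nz: "rr p \<noteq> 0" "c \<noteq> 0" using r assms by auto
  have dz': "dz i (dilation c p) = dz i p / c" for i
    by (cases i) (simp_all add: dz_def z' r')
  have co: "cofr Rad i (dilation c p) = cofr Rad i p" "cofr Lat i (dilation c p) = cofr Lat i p / c"
    "cofr Fib i (dilation c p) = cofr Fib i p" "cofr Lon i (dilation c p) = cofr Lon i p" for i
    using nz by (simp_all add: dz' w' z' split: sum.split)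
  have Inl0: "cofr Fib (Inl k) p = 0" "cofr Lon (Inl k) p = 0" "cofr Rad (Inr k) p = 0" "cofr Lat (Inr k) p = 0" for k
    by (simp_all add: dr_def dz_def)
  have comp: "s i * s j * toric_metric h' (dilation c p) $ i $ j = c * toric_metric h p $ i $ j" for i j
    unfolding T T' co using nz
    by (cases i; cases j) (simp_all add: s_def Inl0 field_simps power2_eq_square del: cofr.simps)
  have "dilation c v \<bullet> (toric_metric h' (dilation c p) *v dilation c w)
     = (\<Sum>i\<in>UNIV. \<Sum>j\<in>UNIV. v $ i * w $ j * (s i * s j * toric_metric h' (dilation c p) $ i $ j))"
  proof -
    have "dilation c v $ i = s i * v $ i" for v i
      by (cases i) (simp_all add: dilation_def s_def)
    then show ?thesis
      by (simp add: inner_vec_def matrix_vector_mult_def sum_distrib_left mult_ac)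
  qed
  also have "\<dots> = c * (v \<bullet> (toric_metric h p *v w))"
    unfolding comp by (simp add: inner_vec_def matrix_vector_mult_def sum_distrib_left mult_ac)
  finally show ?thesis .
qed

section \<open>Lengths of curves\<close>

text \<open>The squared speed written without w. Besides h'' and the profile it is rational in the
  point, and the singular terms at the edges are visible one by one.\<close>

definition speed2 :: "(real \<Rightarrow> real) \<Rightarrow> action_angle \<Rightarrow> action_angle \<Rightarrow> real" where
  "speed2 h p v = ((v $ Inl 1)^2 / p $ Inl 1 + (v $ Inl 2)^2 / p $ Inl 2
      + (deriv ^^ 2) h (rr p) * (v $ Inl 1 + v $ Inl 2)^2) / 2
    + 2 / rr p * (profile h (rr p) / (rr p)^2 * (p $ Inl 1 * v $ Inr 1 + p $ Inl 2 * v $ Inr 2)^2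
      + p $ Inl 1 * p $ Inl 2 * (v $ Inr 1 - v $ Inr 2)^2)"

locale u2_metric =
  fixes m :: nat and a :: real and b :: ereal and h :: "real \<Rightarrow> real"
  assumes kaehler: "u2_kaehler m a b h" and a_pos: "0 < a" and m_pos: "m \<ge> 1"
begin

lemma a_nonneg: "0 \<le> a" using a_pos by simp

lemmas data = u2_kaehlerD[OF kaehler a_nonneg]

definition stretch :: "real \<Rightarrow> real" where
  "stretch r = sqrt (r / (2 * profile h r))"

lemma profile_positive: "r \<in> ival a b \<Longrightarrow> 0 < profile h r"
  using profile_pos[OF _ data(3)] a_pos by auto

lemma cofr_linear_sum:
  assumes "act p \<in> int_polygon a b"
  shows "(\<Sum>i\<in>UNIV. cofr Rad i p * v $ i) = v $ Inl 1 + v $ Inl 2"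
    "(\<Sum>i\<in>UNIV. cofr Lat i p * v $ i) = (p $ Inl 2 * v $ Inl 1 - p $ Inl 1 * v $ Inl 2) / (ww p * (rr p)^2)"
    "(\<Sum>i\<in>UNIV. cofr Fib i p * v $ i) = (p $ Inl 1 * v $ Inr 1 + p $ Inl 2 * v $ Inr 2) / rr p"
    "(\<Sum>i\<in>UNIV. cofr Lon i p * v $ i) = 2 * ww p * (v $ Inr 1 - v $ Inr 2)"
proof -
  have x: "0 < p $ Inl 1" "0 < p $ Inl 2" using assms by (auto simp: int_polygon_def act_def)
  note zb = zz_bounds[OF x]
  have x1: "p $ Inl 1 = rr p * zz p" and x2: "p $ Inl 2 = rr p * (1 - zz p)" by (rule zb(6), rule zb(7))
  show "(\<Sum>i\<in>UNIV. cofr Rad i p * v $ i) = v $ Inl 1 + v $ Inl 2"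
    unfolding sum_action_angle by (simp add: dr_def)
  show "(\<Sum>i\<in>UNIV. cofr Lat i p * v $ i) = (p $ Inl 2 * v $ Inl 1 - p $ Inl 1 * v $ Inl 2) / (ww p * (rr p)^2)"
    unfolding sum_action_angle x1 x2 using zb(1,4) by (simp add: dz_def field_simps power2_eq_square)
  show "(\<Sum>i\<in>UNIV. cofr Fib i p * v $ i) = (p $ Inl 1 * v $ Inr 1 + p $ Inl 2 * v $ Inr 2) / rr p"
    unfolding sum_action_angle x1 x2 using zb(1) by (simp add: field_simps)
  show "(\<Sum>i\<in>UNIV. cofr Lon i p * v $ i) = 2 * ww p * (v $ Inr 1 - v $ Inr 2)"
    unfolding sum_action_angle by (simp add: algebra_simps)
qed

lemma metric_squares:
  assumes p: "act p \<in> int_polygon a b"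
  shows "v \<bullet> (toric_metric h p *v v) =
      rr p / (2 * profile h (rr p)) * (v $ Inl 1 + v $ Inl 2)^2
      + rr p / 2 * ((p $ Inl 2 * v $ Inl 1 - p $ Inl 1 * v $ Inl 2) / (ww p * (rr p)^2))^2
      + 2 * profile h (rr p) / rr p * ((p $ Inl 1 * v $ Inr 1 + p $ Inl 2 * v $ Inr 2) / rr p)^2
      + rr p / 2 * (2 * ww p * (v $ Inr 1 - v $ Inr 2))^2"
proof -
  have sq: "c * (\<Sum>i\<in>UNIV. x i * v $ i)^2 = (\<Sum>i\<in>UNIV. \<Sum>j\<in>UNIV. v $ i * (c * x i * x j * v $ j))"
    for c and x :: "2 + 2 \<Rightarrow> real"
  proof -
    have "c * (\<Sum>i\<in>UNIV. x i * v $ i)^2 = (\<Sum>i\<in>UNIV. \<Sum>j\<in>UNIV. c * ((x i * v $ i) * (x j * v $ j)))"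
      by (simp only: power2_eq_square sum_product) (simp only: sum_distrib_left)
    also have "\<dots> = (\<Sum>i\<in>UNIV. \<Sum>j\<in>UNIV. v $ i * (c * x i * x j * v $ j))"
      by (intro sum.cong refl) (simp only: mult_ac)
    finally show ?thesis .
  qed
  have T: "toric_metric h p $ i $ j =
      rr p / (2 * profile h (rr p)) * cofr Rad i p * cofr Rad j p + rr p / 2 * cofr Lat i p * cofr Lat j p
      + (2 * profile h (rr p) / rr p * cofr Fib i p * cofr Fib j p + rr p / 2 * cofr Lon i p * cofr Lon j p)" for i j
    unfolding profile_def by (rule toric_metric_eq[OF data(2) p data(3)[OF rr_act[OF p]]])
  have "v \<bullet> (toric_metric h p *v v) = (\<Sum>i\<in>UNIV. \<Sum>j\<in>UNIV. v $ i * (toric_metric h p $ i $ j * v $ j))"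
    by (simp add: inner_vec_def matrix_vector_mult_def sum_distrib_left)
  also have "\<dots> = rr p / (2 * profile h (rr p)) * (\<Sum>i\<in>UNIV. cofr Rad i p * v $ i)^2
      + rr p / 2 * (\<Sum>i\<in>UNIV. cofr Lat i p * v $ i)^2
      + (2 * profile h (rr p) / rr p * (\<Sum>i\<in>UNIV. cofr Fib i p * v $ i)^2
      + rr p / 2 * (\<Sum>i\<in>UNIV. cofr Lon i p * v $ i)^2)"
    unfolding sq T distrib_right distrib_left sum.distrib ..
  finally show ?thesis
    unfolding cofr_linear_sum[OF p] by (simp only: add.assoc)
qed

lemma metric_nonneg:
  assumes p: "act p \<in> int_polygon a b"
  shows "rr p / (2 * profile h (rr p)) * (v $ Inl 1 + v $ Inl 2)^2 \<le> v \<bullet> (toric_metric h p *v v)"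
proof -
  have r: "rr p \<in> ival a b" by (rule rr_act[OF p])
  then have "0 < rr p" "0 < profile h (rr p)" using a_pos profile_positive[OF r] by auto
  then have nn: "0 \<le> rr p / 2 * ((p $ Inl 2 * v $ Inl 1 - p $ Inl 1 * v $ Inl 2) / (ww p * (rr p)^2))^2"
    "0 \<le> 2 * profile h (rr p) / rr p * ((p $ Inl 1 * v $ Inr 1 + p $ Inl 2 * v $ Inr 2) / rr p)^2"
    "0 \<le> rr p / 2 * (2 * ww p * (v $ Inr 1 - v $ Inr 2))^2"
    by (intro mult_nonneg_nonneg; simp)+
  show ?thesis unfolding metric_squares[OF p] using nn by linarith
qed

lemma speed2_eq:
  assumes p: "act p \<in> int_polygon a b"
  shows "v \<bullet> (toric_metric h p *v v) = speed2 h p v"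
proof -
  have x: "0 < p $ Inl 1" "0 < p $ Inl 2" using assms by (auto simp: int_polygon_def act_def)
  note zb = zz_bounds[OF x]
  have r: "rr p = p $ Inl 1 + p $ Inl 2" by (simp add: rr_def)
  have D: "0 < 1 + rr p * (deriv ^^ 2) h (rr p)" by (rule data(3)[OF rr_act[OF p]])
  have w2: "(ww p)^2 * (rr p)^2 = p $ Inl 1 * p $ Inl 2"
    unfolding zb(5) by (simp add: zb(6,7) power2_eq_square)
  have 1: "rr p / (2 * profile h (rr p)) = (1 + rr p * (deriv ^^ 2) h (rr p)) / (2 * rr p)"
    using zb(1) D by (simp add: profile_def field_simps power2_eq_square)
  have 2: "rr p / 2 * (y / (ww p * (rr p)^2))^2 = y^2 / (p $ Inl 1 * p $ Inl 2 * rr p) / 2" for y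
  proof -
    have "(ww p * (rr p)^2)^2 = (ww p)^2 * (rr p)^2 * (rr p * rr p)"
      by (simp add: power2_eq_square)
    then show ?thesis unfolding w2 power_divide using zb(1) by simp
  qed
  have 3: "rr p / 2 * (2 * ww p * y)^2 = 2 / rr p * (p $ Inl 1 * p $ Inl 2 * y^2)" for y
    unfolding w2[symmetric] using zb(1) by (simp add: power2_eq_square)
  have 4: "2 * c / rr p * (y / rr p)^2 = 2 / rr p * (c / (rr p)^2 * y^2)" for c y
    by (simp add: power_divide)
  show ?thesis
    unfolding metric_squares[OF p] 1 2 3 4 speed2_def quadratic_split[OF x] r[symmetric]
    by (simp add: algebra_simps add_divide_distrib)
qed

lemma stretch_speed:
  assumes p: "act p \<in> int_polygon a b"
  shows "stretch (rr p) * \<bar>v $ Inl 1 + v $ Inl 2\<bar> \<le> sqrt (v \<bullet> (toric_metric h p *v v))"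
proof -
  have "stretch (rr p) * \<bar>v $ Inl 1 + v $ Inl 2\<bar> = sqrt (rr p / (2 * profile h (rr p)) * (v $ Inl 1 + v $ Inl 2)^2)"
    unfolding stretch_def real_sqrt_mult by simp
  then show ?thesis using metric_nonneg[OF p] by simp
qed

lemma rr_polygon: "act p \<in> polygon a b \<Longrightarrow> a \<le> rr p \<and> ereal (rr p) < b"
  by (auto simp: polygon_def act_def rr_def)

subsection \<open>Lower bounds\<close>

text \<open>Along any arc, \<open>T\<close> varies by at most the length.\<close>

definition minorant :: "(real \<Rightarrow> real) \<Rightarrow> bool" where
  "minorant T \<longleftrightarrow> continuous_on {r. a \<le> r \<and> ereal r < b} T \<and>
     (\<exists>T'. \<forall>r\<in>ival a b. (T has_real_derivative T' r) (at r) \<and> \<bar>T' r\<bar> \<le> stretch r)"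

lemma continuous_on_rr: "continuous_on S rr"
  unfolding rr_def[abs_def] by (intro continuous_intros)

lemma arc_lower_bound_aux:
  assumes T: "minorant T" and arc: "arc_of_length a b h \<gamma> L"
  shows "T (rr (\<gamma> 1)) - T (rr (\<gamma> 0)) \<le> L"
proof -
  obtain T' where T': "\<And>r. r \<in> ival a b \<Longrightarrow> (T has_real_derivative T' r) (at r)" "\<And>r. r \<in> ival a b \<Longrightarrow> \<bar>T' r\<bar> \<le> stretch r"
    using T unfolding minorant_def by blast
  let ?e = "\<lambda>s. sqrt (vector_derivative \<gamma> (at s) \<bullet> (toric_metric h (\<gamma> s) *v vector_derivative \<gamma> (at s)))"
  from arc have \<gamma>: "continuous_on {0..1} \<gamma>" "\<gamma> C1_differentiable_on {0<..<1}" "act (\<gamma> 0) \<in> polygon a b" "act (\<gamma> 1) \<in> polygon a b"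
    "\<And>s. s \<in> {0<..<1} \<Longrightarrow> act (\<gamma> s) \<in> int_polygon a b" and L: "(?e has_integral L) {0..1}"
    unfolding arc_of_length_def by auto
  define V where "V s = vector_derivative \<gamma> (at s)" for s
  have V: "(\<gamma> has_vector_derivative V s) (at s)" if "s \<in> {0<..<1}" for s
    using \<gamma>(2) that unfolding C1_differentiable_on_eq V_def by (simp add: vector_derivative_works)
  \<comment> \<open>The arc may fail to be differentiable at its two ends. Copying the speed there
    makes the comparison of integrands hold everywhere, while the fundamental theorem only looks at
    the interior.\<close>
  define d where "d s = (if s \<in> {0<..<1} then T' (rr (\<gamma> s)) * (V s $ Inl 1 + V s $ Inl 2) else ?e s)" for s
  have "(d has_integral (T (rr (\<gamma> 1)) - T (rr (\<gamma> 0)))) {0..1}"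
  proof (rule fundamental_theorem_of_calculus_interior[where f = "\<lambda>s. T (rr (\<gamma> s))"])
    have "rr (\<gamma> s) \<in> {r. a \<le> r \<and> ereal r < b}" if "s \<in> {0..1}" for s
    proof (cases "s = 0 \<or> s = 1")
      case True
      then show ?thesis using rr_polygon \<gamma>(3,4) by auto
    next
      case False
      then show ?thesis using rr_act[OF \<gamma>(5)[of s]] that by auto
    qed
    then show "continuous_on {0..1} (\<lambda>s. T (rr (\<gamma> s)))"
      using T unfolding minorant_def
      by (intro continuous_on_compose2[of _ T _ "\<lambda>s. rr (\<gamma> s)"] continuous_on_compose2[OF continuous_on_rr \<gamma>(1)]) auto
    show "((\<lambda>s. T (rr (\<gamma> s))) has_vector_derivative d s) (at s)" if s: "s \<in> {0<..<1}" for s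
    proof -
      have "((\<lambda>s. rr (\<gamma> s)) has_vector_derivative (V s $ Inl 1 + V s $ Inl 2)) (at s)"
        unfolding rr_def
        by (intro has_vector_derivative_add bounded_linear.has_vector_derivative[OF bounded_linear_vec_nth] V s)
      then have "((\<lambda>s. rr (\<gamma> s)) has_real_derivative (V s $ Inl 1 + V s $ Inl 2)) (at s)"
        by (simp add: has_real_derivative_iff_has_vector_derivative)
      from DERIV_chain2[OF T'(1)[OF rr_act[OF \<gamma>(5)[OF s]]] this]
      show ?thesis using s by (simp add: d_def has_real_derivative_iff_has_vector_derivative)
    qed
  qed simp
  then show ?thesis
  proof (rule has_integral_le[OF _ L])
    fix s :: real
    show "d s \<le> ?e s"
    proof (cases "s \<in> {0<..<1}")
      case True
      note p = \<gamma>(5)[OF True]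
      have "d s \<le> \<bar>T' (rr (\<gamma> s))\<bar> * \<bar>V s $ Inl 1 + V s $ Inl 2\<bar>"
        using True by (simp add: d_def abs_mult[symmetric])
      also have "\<dots> \<le> stretch (rr (\<gamma> s)) * \<bar>V s $ Inl 1 + V s $ Inl 2\<bar>"
        by (intro mult_right_mono T'(2)[OF rr_act[OF p]]) simp
      also have "\<dots> \<le> ?e s" unfolding V_def by (rule stretch_speed[OF p])
      finally show ?thesis .
    qed (simp only: d_def if_False order_refl)
  qed
qed

lemma minorant_uminus: "minorant T \<Longrightarrow> minorant (\<lambda>r. - T r)"
  unfolding minorant_def
proof (elim conjE exE, intro conjI)
  fix T' assume "continuous_on {r. a \<le> r \<and> ereal r < b} T"
    and *: "\<forall>r\<in>ival a b. (T has_real_derivative T' r) (at r) \<and> \<bar>T' r\<bar> \<le> stretch r"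
  then show "continuous_on {r. a \<le> r \<and> ereal r < b} (\<lambda>r. - T r)" by (intro continuous_intros)
  show "\<exists>T'. \<forall>r\<in>ival a b. ((\<lambda>r. - T r) has_real_derivative T' r) (at r) \<and> \<bar>T' r\<bar> \<le> stretch r"
    using * by (intro exI[of _ "\<lambda>r. - T' r"]) (auto intro: DERIV_minus)
qed

lemma arc_lower_bound:
  assumes "minorant T" "arc_of_length a b h \<gamma> L"
  shows "\<bar>T (rr (\<gamma> 1)) - T (rr (\<gamma> 0))\<bar> \<le> L"
  using arc_lower_bound_aux[OF assms] arc_lower_bound_aux[OF minorant_uminus[OF assms(1)] assms(2)] by simp

lemma minorant_const: "minorant (\<lambda>r. c)"
proof -
  have "\<bar>0\<bar> \<le> stretch r" if "r \<in> ival a b" for r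
    using that a_pos profile_positive[OF that] by (simp add: stretch_def)
  then show ?thesis
    unfolding minorant_def by (auto intro!: exI[of _ "\<lambda>r. 0"] continuous_intros)
qed

abbreviation join :: "action_angle \<Rightarrow> action_angle \<Rightarrow> real \<Rightarrow> bool" where
  "join \<equiv> joined m a b h"

abbreviation rdist :: "action_angle \<Rightarrow> action_angle \<Rightarrow> real" where
  "rdist \<equiv> riem_dist m a b h"

lemma same_point_rr: "same_point m a p q \<Longrightarrow> rr p = rr q"
proof -
  assume "same_point m a p q"
  then have e: "act p = act q" by (simp add: same_point_def)
  have "p $ Inl i = q $ Inl i" for i
    using arg_cong[OF e, of "\<lambda>x. x $ i"] by (simp add: act_def)
  then show ?thesis by (simp add: rr_def)
qed

text \<open>Gluing identifies points with the same r, so the bounds for the single arcs add up along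
  the chain.\<close>

lemma join_lower_bound:
  assumes T: "minorant T" and "join p q L"
  shows "\<bar>T (rr q) - T (rr p)\<bar> \<le> L"
  using assms(2)
proof induction
  case (start p q)
  then show ?case using same_point_rr[of p q] by simp
next
  case (glue p q L q')
  then show ?case using same_point_rr[of q q'] by simp
next
  case (append p \<gamma> L L')
  then show ?case using arc_lower_bound[OF T append(2)] by linarith
qed

lemma join_nonneg: "join p q L \<Longrightarrow> 0 \<le> L"
  using join_lower_bound[OF minorant_const, of p q L] by simp

lemma same_point_refl: "same_point m a p p"
  unfolding same_point_def by (auto intro!: exI[of _ "0::int"] exI[of _ "0::real"])

lemma join_refl: "join p p 0"
  by (rule joined.start[OF same_point_refl])

lemma join_trans:
  assumes "join q s L'" "join p q L"
  shows "join p s (L + L')"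
  using assms
proof induction
  case (start q s)
  then show ?case using joined.glue by simp
next
  case (glue q s L s')
  then show ?case using joined.glue by blast
next
  case (append q \<gamma> L' L'')
  then show ?case using joined.append[of m a b h p \<gamma> "L + L'" L''] by (simp add: add.assoc)
qed

lemma rdist_le: "join p q L \<Longrightarrow> rdist p q \<le> L"
  unfolding riem_dist_def using join_nonneg by (intro cInf_lower) (auto intro!: bdd_belowI[of _ 0])

text \<open>The infimum of an empty set of reals carries no information, so some chain must be known
  before one of nearly minimal length can be found.\<close>

lemma rdist_less:
  assumes "rdist p q < \<epsilon>" "join p q L0"
  shows "\<exists>L<\<epsilon>. join p q L"
  using cInf_lessD[of "{L. join p q L}" \<epsilon>] assms unfolding riem_dist_def by blast

lemma rdist_lower_bound:
  assumes "minorant T" "join p q L0"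
  shows "\<bar>T (rr q) - T (rr p)\<bar> \<le> rdist p q"
  unfolding riem_dist_def using assms join_lower_bound[OF assms(1)] by (intro cInf_greatest) auto

subsection \<open>Upper bounds\<close>

text \<open>The length is dominated, not computed: the speed is continuous on the open interval and
  bounded by the derivative of \<open>\<phi>\<close>, which is integrable even if it blows up at the
  ends. This is how arcs may start or end on an edge.\<close>

lemma arc_of_length_linear:
  fixes p v :: action_angle
  assumes ends: "act p \<in> polygon a b" "act (p + v) \<in> polygon a b"
    and int: "\<And>s. s \<in> {0<..<1} \<Longrightarrow> act (p + s *\<^sub>R v) \<in> int_polygon a b"
    and \<phi>: "continuous_on {0..1} \<phi>" "\<And>s. s \<in> {0<..<1} \<Longrightarrow> (\<phi> has_real_derivative \<phi>' s) (at s)"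
    and le: "\<And>s. s \<in> {0<..<1} \<Longrightarrow> sqrt (speed2 h (p + s *\<^sub>R v) v) \<le> \<phi>' s"
  shows "\<exists>L. 0 \<le> L \<and> L \<le> \<phi> 1 - \<phi> 0 \<and> join p (p + v) L"
proof -
  let ?\<gamma> = "\<lambda>s. p + s *\<^sub>R v"
  let ?e = "\<lambda>s. sqrt (speed2 h (?\<gamma> s) v)"
  have dv: "(?\<gamma> has_vector_derivative v) (at s)" for s
    by (auto intro!: derivative_eq_intros)
  have vd: "vector_derivative ?\<gamma> (at s) = v" for s
    using dv by (rule vector_derivative_at)
  have cont: "continuous_on {0<..<1} ?e"
  proof -
    have pos: "(?\<gamma> s) $ Inl 1 \<noteq> 0" "(?\<gamma> s) $ Inl 2 \<noteq> 0" "rr (?\<gamma> s) \<noteq> 0" "rr (?\<gamma> s) \<in> ival a b" if "s \<in> {0<..<1}" for s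
      using int[OF that] rr_act[OF int[OF that]] a_pos by (auto simp: int_polygon_def act_def)
    have cr: "continuous_on {0<..<1} (\<lambda>s. rr (?\<gamma> s))"
      by (intro continuous_on_compose2[OF continuous_on_rr[of UNIV]] continuous_intros) auto
    have "continuous_on (ival a b) ((deriv ^^ 2) h)"
      using smooth_on_isCont[OF smooth_on_deriv_iter[OF data(2)]] by (intro continuous_at_imp_continuous_on) auto
    from continuous_on_compose2[OF this cr] pos(4)
    have c1: "continuous_on {0<..<1} (\<lambda>s. (deriv ^^ 2) h (rr (?\<gamma> s)))" by blast
    have "continuous_on (ival a b) (profile h)"
      using smooth_on_isCont[OF smooth_on_profile[OF data(2,3)]] by (intro continuous_at_imp_continuous_on) auto
    from continuous_on_compose2[OF this cr] pos(4)
    have c2: "continuous_on {0<..<1} (\<lambda>s. profile h (rr (?\<gamma> s)))" by blast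
    show ?thesis
      unfolding speed2_def by (intro continuous_intros c1 c2 cr) (use pos in auto)
  qed
  have nonneg: "0 \<le> speed2 h (?\<gamma> s) v" if "s \<in> {0<..<1}" for s
  proof -
    note p = int[OF that]
    have "0 < rr (?\<gamma> s)" "0 < profile h (rr (?\<gamma> s))"
      using rr_act[OF p] a_pos profile_positive[OF rr_act[OF p]] by auto
    then have "0 \<le> rr (?\<gamma> s) / (2 * profile h (rr (?\<gamma> s))) * (v $ Inl 1 + v $ Inl 2)^2" by simp
    then show ?thesis using metric_nonneg[OF p, of v] speed2_eq[OF p] by simp
  qed
  have FTC: "(\<phi>' has_integral (\<phi> 1 - \<phi> 0)) {0..1}"
    by (rule fundamental_theorem_of_calculus_interior)
       (use \<phi> in \<open>auto simp: has_real_derivative_iff_has_vector_derivative\<close>)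
  have "?e absolutely_integrable_on {0<..<1}"
  proof (rule measurable_bounded_by_integrable_imp_absolutely_integrable)
    show "?e \<in> borel_measurable (lebesgue_on {0<..<1})"
      by (rule continuous_imp_measurable_on_sets_lebesgue[OF cont]) simp
    show "\<phi>' integrable_on {0<..<1}"
      using FTC integrable_on_open_interval_real by (metis has_integral_integrable)
  qed (use le nonneg in auto)
  then have "?e integrable_on {0..1}"
    using set_lebesgue_integral_eq_integral(1) integrable_on_open_interval_real by blast
  then obtain L where L: "(?e has_integral L) {0..1}" by blast
  have L': "(?e has_integral L) {0<..<1}" and FTC': "(\<phi>' has_integral (\<phi> 1 - \<phi> 0)) {0<..<1}"
    using L FTC has_integral_open_interval[of _ _ "0::real" 1] by auto
  have "L \<le> \<phi> 1 - \<phi> 0" by (rule has_integral_le[OF L' FTC' le])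
  moreover have "0 \<le> L"
    by (rule has_integral_nonneg[OF L']) (use nonneg in auto)
  moreover have "arc_of_length a b h ?\<gamma> L"
    unfolding arc_of_length_def vd
  proof (intro conjI ballI)
    show "continuous_on {0..1} ?\<gamma>" by (intro continuous_intros)
    show "?\<gamma> C1_differentiable_on {0<..<1}"
      unfolding C1_differentiable_on_def by (rule exI[of _ "\<lambda>s. v"]) (auto intro!: dv)
    show "act (?\<gamma> 0) \<in> polygon a b" "act (?\<gamma> 1) \<in> polygon a b" using ends by auto
    show "act (?\<gamma> s) \<in> int_polygon a b" if "s \<in> {0<..<1}" for s by (rule int[OF that])
    have "((\<lambda>s. sqrt (v \<bullet> (toric_metric h (?\<gamma> s) *v v))) has_integral L) {0<..<1}"
      by (rule has_integral_eq[OF _ L']) (simp add: speed2_eq[OF int])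
    then show "((\<lambda>s. sqrt (v \<bullet> (toric_metric h (?\<gamma> s) *v v))) has_integral L) {0..1}"
      using has_integral_open_interval[of _ _ "0::real" 1] by auto
  qed
  then have "join p (p + v) L"
    using joined.append[of m a b h p ?\<gamma> 0 L] join_refl[of p] by simp
  ultimately show ?thesis by blast
qed

end

section \<open>Explicit paths and upper bounds for the distance\<close>

definition mkp :: "real \<Rightarrow> real \<Rightarrow> real \<Rightarrow> real \<Rightarrow> action_angle" where
  "mkp x1 x2 t1 t2 = (\<chi> I. case I of Inl i \<Rightarrow> if i = 1 then x1 else x2 | Inr i \<Rightarrow> if i = 1 then t1 else t2)"

lemma mkp_nth [simp]:
  "mkp x1 x2 t1 t2 $ Inl 1 = x1" "mkp x1 x2 t1 t2 $ Inl 2 = x2"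
  "mkp x1 x2 t1 t2 $ Inr 1 = t1" "mkp x1 x2 t1 t2 $ Inr 2 = t2"
  by (simp_all add: mkp_def)

lemma rr_mkp [simp]: "rr (mkp x1 x2 t1 t2) = x1 + x2"
  by (simp add: rr_def)

lemma act_in_polygon:
  "act p \<in> polygon a b \<longleftrightarrow> 0 \<le> p $ Inl 1 \<and> 0 \<le> p $ Inl 2 \<and> a \<le> rr p \<and> ereal (rr p) < b"
  by (simp add: polygon_def act_def rr_def)

lemma act_in_int_polygon:
  "act p \<in> int_polygon a b \<longleftrightarrow> 0 < p $ Inl 1 \<and> 0 < p $ Inl 2 \<and> a < rr p \<and> ereal (rr p) < b"
  by (simp add: int_polygon_def act_def rr_def)

lemma int_polygon_subset: "int_polygon a b \<subseteq> polygon a b"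
  by (auto simp: int_polygon_def polygon_def)

lemma act_eq_iff: "act p = act q \<longleftrightarrow> p $ Inl 1 = q $ Inl 1 \<and> p $ Inl 2 = q $ Inl 2"
  by (simp add: vec_eq_iff act_def forall_2)

text \<open>Bounds the length of a segment in the \<open>x\<close>-plane: the speed has singularities
  $x_1^{-1/2}$, $x_2^{-1/2}$, $(r-a)^{-1/2}$ at the edges, which are integrated exactly.\<close>

definition seg_cost :: "real \<Rightarrow> real \<Rightarrow> action_angle \<Rightarrow> action_angle \<Rightarrow> real" where
  "seg_cost a C p q =
     sqrt 2 * (\<bar>sqrt (q $ Inl 1) - sqrt (p $ Inl 1)\<bar> + \<bar>sqrt (q $ Inl 2) - sqrt (p $ Inl 2)\<bar>)
     + sqrt (2 * C) * \<bar>sqrt (rr q - a) - sqrt (rr p - a)\<bar>"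

lemma sgn_mult_sqrt_diff: "sgn (y - x) * (sqrt y - sqrt x) = \<bar>sqrt y - sqrt x\<bar>"
  by (auto simp: sgn_if abs_if)

lemma line_pos:
  fixes x y s :: real
  assumes "0 \<le> x" "0 \<le> y" "0 < x \<or> 0 < y" "0 < s" "s < 1"
  shows "0 < x + s * (y - x)"
proof -
  have e: "x + s * (y - x) = (1 - s) * x + s * y" by (simp add: algebra_simps)
  have "0 \<le> (1 - s) * x" "0 \<le> s * y" using assms by simp_all
  moreover have "0 < (1 - s) * x \<or> 0 < s * y" using assms by auto
  ultimately show ?thesis unfolding e by linarith
qed

lemma line_le:
  fixes x y s r :: real
  assumes "x \<le> r" "y \<le> r" "0 < s" "s < 1"
  shows "x + s * (y - x) \<le> r"
proof -
  have "(1 - s) * x + s * y \<le> (1 - s) * r + s * r"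
    using assms by (intro add_mono mult_left_mono) auto
  then show ?thesis by (simp add: algebra_simps)
qed

lemma ereal_less_if_le_max: "x \<le> max y z \<Longrightarrow> ereal y < b \<Longrightarrow> ereal z < b \<Longrightarrow> ereal x < b"
  by (cases b) auto

lemma sqrt_sum3_le:
  assumes "0 \<le> (A::real)" "0 \<le> B" "0 \<le> D" "X \<le> A^2 + B^2 + D^2"
  shows "sqrt X \<le> A + B + D"
proof (rule real_le_lsqrt)
  have "A^2 + B^2 + D^2 \<le> (A + B + D)^2"
    using assms by (simp add: power2_eq_square algebra_simps)
  then show "X \<le> (A + B + D)^2" using assms by simp
qed (use assms in auto)

context u2_metric
begin

text \<open>Without its pole h'' is bounded on the compact interval from a to r1, and there a
  constant is at most a multiple of 1/(r - a).\<close>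

lemma pole_bound:
  assumes r1: "r1 \<in> ival a b"
  obtains C where "0 \<le> C" "\<And>r. a < r \<Longrightarrow> r \<le> r1 \<Longrightarrow> (deriv ^^ 2) h r \<le> C / (r - a)"
proof -
  obtain U G where U: "open U" "{r. a \<le> r \<and> ereal r < b} \<subseteq> U" "smooth_on U G"
    "\<And>r. r \<in> ival a b \<Longrightarrow> G r = (deriv ^^ 2) h r - 1 / (m * (r - a))"
    using kaehler unfolding u2_kaehler_def smooth_up_to_def interior_ival by blast
  have sub: "{a..r1} \<subseteq> {r. a \<le> r \<and> ereal r < b}"
    using r1 by (auto intro: le_less_trans[of "ereal _" "ereal r1"])
  have "continuous_on {a..r1} G"
    using smooth_on_isCont[OF U(3)] sub U(2) by (intro continuous_at_imp_continuous_on) blast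
  then have "bounded (G ` {a..r1})"
    by (intro compact_imp_bounded compact_continuous_image) auto
  then obtain B where B: "\<And>r. r \<in> {a..r1} \<Longrightarrow> \<bar>G r\<bar> \<le> B"
    unfolding bounded_iff real_norm_def by blast
  have Bn: "0 \<le> B" using B[of r1] r1 by simp
  show thesis
  proof (rule that[of "B * (r1 - a) + 1 / m"])
    show "0 \<le> B * (r1 - a) + 1 / m" using Bn r1 by simp
    show "(deriv ^^ 2) h r \<le> (B * (r1 - a) + 1 / m) / (r - a)" if r: "a < r" "r \<le> r1" for r
    proof -
      have iv: "r \<in> ival a b" using r subsetD[OF sub, of r] by auto
      have "G r \<le> B" using B[of r] r by auto
      also have "B \<le> B * (r1 - a) / (r - a)"
        using Bn r by (simp add: pos_le_divide_eq mult_left_mono)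
      finally show ?thesis
        using U(4)[OF iv] by (simp add: add_divide_distrib)
    qed
  qed
qed

text \<open>By convexity one interior endpoint keeps the open segment off the edges. The speed is at
  most a sum of three inverse square roots of affine functions of the parameter, one for each
  edge.\<close>

lemma seg_join:
  assumes p: "act p \<in> polygon a b" and q: "act q \<in> polygon a b"
    and int: "act p \<in> int_polygon a b \<or> act q \<in> int_polygon a b"
    and le: "rr p \<le> r1" "rr q \<le> r1" and ang: "q $ Inr 1 = p $ Inr 1" "q $ Inr 2 = p $ Inr 2"
    and C: "0 \<le> C" "\<And>r. a < r \<Longrightarrow> r \<le> r1 \<Longrightarrow> (deriv ^^ 2) h r \<le> C / (r - a)"
  shows "\<exists>L. L \<le> seg_cost a C p q \<and> join p q L"
proof -
  define v where "v = q - p"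
  define v1 where "v1 = q $ Inl 1 - p $ Inl 1"
  define v2 where "v2 = q $ Inl 2 - p $ Inl 2"
  define w where "w = rr q - rr p"
  have v: "v $ Inl 1 = v1" "v $ Inl 2 = v2" "v $ Inr 1 = 0" "v $ Inr 2 = 0" "v1 + v2 = w"
    using ang by (auto simp: v_def v1_def v2_def w_def rr_def)
  define X where "X s = p $ Inl 1 + s * v1" for s
  define Y where "Y s = p $ Inl 2 + s * v2" for s
  define R where "R s = rr p - a + s * w" for s
  have XY: "(p + s *\<^sub>R v) $ Inl 1 = X s" "(p + s *\<^sub>R v) $ Inl 2 = Y s" "rr (p + s *\<^sub>R v) = a + R s" for s
    by (simp_all add: X_def Y_def R_def v rr_def w_def v1_def v2_def v_def algebra_simps)
  have pos: "0 < X s" "0 < Y s" "0 < R s" "a + R s \<le> r1" "ereal (a + R s) < b" if s: "s \<in> {0<..<1}" for s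
  proof -
    show "0 < X s" unfolding X_def v1_def
      using p q int s by (intro line_pos) (auto simp: act_in_polygon act_in_int_polygon)
    show "0 < Y s" unfolding Y_def v2_def
      using p q int s by (intro line_pos) (auto simp: act_in_polygon act_in_int_polygon)
    have "0 < rr p - a + s * ((rr q - a) - (rr p - a))"
      using p q int s by (intro line_pos) (auto simp: act_in_polygon act_in_int_polygon)
    then show "0 < R s" by (simp add: R_def w_def)
    have R: "a + R s = rr p + s * (rr q - rr p)" by (simp add: R_def w_def)
    show "a + R s \<le> r1" unfolding R using le s by (intro line_le) auto
    have "a + R s \<le> max (rr p) (rr q)" unfolding R using s by (intro line_le) auto
    then show "ereal (a + R s) < b"
      by (rule ereal_less_if_le_max) (use p q in \<open>auto simp: act_in_polygon\<close>)
  qed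
  \<comment> \<open>Sum of the primitives of the three bounding terms; the signs make each
    contribution nondecreasing whichever way the segment runs.\<close>
  define \<phi> where "\<phi> s = sqrt 2 * (sgn v1 * sqrt (X s) + sgn v2 * sqrt (Y s)) + sqrt (2 * C) * (sgn w * sqrt (R s))" for s
  define \<phi>' where "\<phi>' s = \<bar>v1\<bar> / sqrt (2 * X s) + \<bar>v2\<bar> / sqrt (2 * Y s) + sqrt (C / (2 * R s)) * \<bar>w\<bar>" for s
  have q_eq: "p + v = q" by (simp add: v_def)
  have "\<exists>L. 0 \<le> L \<and> L \<le> \<phi> 1 - \<phi> 0 \<and> join p (p + v) L"
  proof (rule arc_of_length_linear[OF p, where \<phi>' = \<phi>'])
    show "act (p + v) \<in> polygon a b" using q by (simp add: q_eq)
    show "act (p + s *\<^sub>R v) \<in> int_polygon a b" if "s \<in> {0<..<1}" for s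
      using pos[OF that] unfolding act_in_int_polygon XY by auto
    show "continuous_on {0..1} \<phi>"
      unfolding \<phi>_def X_def Y_def R_def by (intro continuous_intros)
    show "(\<phi> has_real_derivative \<phi>' s) (at s)" if "s \<in> {0<..<1}" for s
    proof -
      note ps = pos[OF that]
      have D: "((\<lambda>s. sqrt (c + s * u)) has_real_derivative (u / (2 * sqrt (c + s * u)))) (at s)" if "0 < c + s * u" for c u
        using that by (auto intro!: derivative_eq_intros simp: field_simps)
      have half: "sqrt 2 * (x / (2 * y)) = x / (sqrt 2 * y)" for x y :: real
      proof -
        have "(2::real) = sqrt 2 * sqrt 2" by simp
        then show ?thesis by (metis mult.assoc mult_divide_mult_cancel_left real_sqrt_eq_zero_cancel_iff times_divide_eq_right zero_neq_numeral)
      qed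
      have D1: "((\<lambda>s. sqrt (X s)) has_real_derivative (v1 / (2 * sqrt (X s)))) (at s)"
        "((\<lambda>s. sqrt (Y s)) has_real_derivative (v2 / (2 * sqrt (Y s)))) (at s)"
        "((\<lambda>s. sqrt (R s)) has_real_derivative (w / (2 * sqrt (R s)))) (at s)"
        unfolding X_def Y_def R_def by (rule D; use ps in \<open>simp add: X_def Y_def R_def\<close>)+
      have "(\<phi> has_real_derivative (sqrt 2 * (sgn v1 * (v1 / (2 * sqrt (X s))) + sgn v2 * (v2 / (2 * sqrt (Y s))))
          + sqrt (2 * C) * (sgn w * (w / (2 * sqrt (R s)))))) (at s)"
        unfolding \<phi>_def[abs_def] by (intro DERIV_add DERIV_cmult D1)
      moreover have "sqrt 2 * (sgn v1 * (v1 / (2 * sqrt (X s))) + sgn v2 * (v2 / (2 * sqrt (Y s))))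
          + sqrt (2 * C) * (sgn w * (w / (2 * sqrt (R s)))) = \<phi>' s"
      proof -
        have a: "sqrt 2 * (sgn u * (u / (2 * y))) = \<bar>u\<bar> / (sqrt 2 * y)" for u y :: real
          using half[of "\<bar>u\<bar>" y] by (simp add: abs_sgn mult.commute)
        have b: "sqrt (2 * C) * z = sqrt C * (sqrt 2 * z)" for z
          by (simp add: real_sqrt_mult)
        show ?thesis
          unfolding \<phi>'_def distrib_left b a by (simp add: real_sqrt_mult real_sqrt_divide)
      qed
      ultimately show ?thesis by simp
    qed
    show "sqrt (speed2 h (p + s *\<^sub>R v) v) \<le> \<phi>' s" if "s \<in> {0<..<1}" for s
      unfolding \<phi>'_def
    proof (rule sqrt_sum3_le)
      note ps = pos[OF that]
      have "(deriv ^^ 2) h (a + R s) * w^2 \<le> C / R s * w^2"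
        using C(2)[of "a + R s"] ps by (intro mult_right_mono) auto
      then show "speed2 h (p + s *\<^sub>R v) v \<le> (\<bar>v1\<bar> / sqrt (2 * X s))^2 + (\<bar>v2\<bar> / sqrt (2 * Y s))^2 + (sqrt (C / (2 * R s)) * \<bar>w\<bar>)^2"
        unfolding speed2_def XY v using ps C(1) by (simp add: power_divide power_mult_distrib add_divide_distrib)
    qed (use C(1) pos(1-3)[OF that] in auto)
  qed
  moreover have "\<phi> 1 - \<phi> 0 = seg_cost a C p q"
  proof -
    have "sgn v1 * (sqrt (X 1) - sqrt (X 0)) = \<bar>sqrt (q $ Inl 1) - sqrt (p $ Inl 1)\<bar>"
      "sgn v2 * (sqrt (Y 1) - sqrt (Y 0)) = \<bar>sqrt (q $ Inl 2) - sqrt (p $ Inl 2)\<bar>"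
      using sgn_mult_sqrt_diff by (simp_all add: X_def v1_def Y_def v2_def)
    moreover have "sgn w * (sqrt (R 1) - sqrt (R 0)) = \<bar>sqrt (rr q - a) - sqrt (rr p - a)\<bar>"
      using sgn_mult_sqrt_diff[of "rr q - a" "rr p - a"] by (simp add: R_def w_def)
    ultimately show ?thesis
      unfolding seg_cost_def \<phi>_def by (simp add: algebra_simps)
  qed
  ultimately show ?thesis by (auto simp: q_eq)
qed

text \<open>Bound for a rotation at fixed x. Both angular terms of the metric are estimated by means
  of x1 + x2 = r, so that of the point only r enters.\<close>

definition ang_cost :: "real \<Rightarrow> action_angle \<Rightarrow> action_angle \<Rightarrow> real" where
  "ang_cost r p q = sqrt (2 / r * (profile h r + r^2)) * (\<bar>q $ Inr 1 - p $ Inr 1\<bar> + \<bar>q $ Inr 2 - p $ Inr 2\<bar>)"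

lemma ang_join:
  assumes p: "act p \<in> int_polygon a b" and e: "act q = act p"
  shows "\<exists>L. L \<le> ang_cost (rr p) p q \<and> join p q L"
proof -
  define v where "v = q - p"
  have v: "v $ Inl 1 = 0" "v $ Inl 2 = 0" "v $ Inr 1 = q $ Inr 1 - p $ Inr 1" "v $ Inr 2 = q $ Inr 2 - p $ Inr 2"
    using e by (auto simp: v_def act_eq_iff)
  have q_eq: "p + v = q" by (simp add: v_def)
  have ap: "act (p + s *\<^sub>R v) = act p" for s by (simp add: act_eq_iff v)
  have sp: "speed2 h (p + s *\<^sub>R v) v = speed2 h p v" for s
    by (simp add: speed2_def rr_def v)
  have pp: "act p \<in> polygon a b" using p int_polygon_subset by blast
  have "\<exists>L. 0 \<le> L \<and> L \<le> (\<lambda>s. s * sqrt (speed2 h p v)) 1 - (\<lambda>s. s * sqrt (speed2 h p v)) 0 \<and> join p (p + v) L"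
  proof (rule arc_of_length_linear[OF pp, where \<phi>' = "\<lambda>s. sqrt (speed2 h p v)"])
    show "act (p + v) \<in> polygon a b" using pp e by (simp add: q_eq)
    show "((\<lambda>s. s * sqrt (speed2 h p v)) has_real_derivative sqrt (speed2 h p v)) (at s)" for s
      by (auto intro!: derivative_eq_intros)
  qed (auto simp: ap p sp intro!: continuous_intros)
  then obtain L where L: "L \<le> sqrt (speed2 h p v)" "join p q L" by (auto simp: q_eq)
  have "sqrt (speed2 h p v) \<le> ang_cost (rr p) p q"
  proof -
    have x: "0 < p $ Inl 1" "0 < p $ Inl 2" "rr p = p $ Inl 1 + p $ Inl 2"
      using p by (auto simp: act_in_int_polygon rr_def)
    have r: "0 < rr p" using x by simp
    have Q: "0 < profile h (rr p)" by (rule profile_positive[OF rr_act[OF p]])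
    let ?d = "\<bar>v $ Inr 1\<bar> + \<bar>v $ Inr 2\<bar>"
    have "\<bar>p $ Inl 1 * v $ Inr 1 + p $ Inl 2 * v $ Inr 2\<bar> \<le> p $ Inl 1 * \<bar>v $ Inr 1\<bar> + p $ Inl 2 * \<bar>v $ Inr 2\<bar>"
      using abs_triangle_ineq[of "p $ Inl 1 * v $ Inr 1" "p $ Inl 2 * v $ Inr 2"] x by (simp add: abs_mult)
    also have "\<dots> \<le> rr p * ?d"
      using x by (simp add: algebra_simps)
    finally have "\<bar>p $ Inl 1 * v $ Inr 1 + p $ Inl 2 * v $ Inr 2\<bar>^2 \<le> (rr p * ?d)^2"
      by (intro power_mono) auto
    then have 1: "(p $ Inl 1 * v $ Inr 1 + p $ Inl 2 * v $ Inr 2)^2 \<le> (rr p)^2 * ?d^2"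
      by (simp add: power_mult_distrib)
    have "\<bar>v $ Inr 1 - v $ Inr 2\<bar>^2 \<le> ?d^2"
      using abs_triangle_ineq4[of "v $ Inr 1" "v $ Inr 2"] by (intro power_mono) auto
    then have d: "(v $ Inr 1 - v $ Inr 2)^2 \<le> ?d^2" by (simp only: power2_abs)
    have 2: "p $ Inl 1 * p $ Inl 2 * (v $ Inr 1 - v $ Inr 2)^2 \<le> (rr p)^2 * ?d^2"
    proof (rule mult_mono[OF _ d])
      show "p $ Inl 1 * p $ Inl 2 \<le> (rr p)^2" using x by (simp add: power2_eq_square algebra_simps)
    qed simp_all
    have "profile h (rr p) / (rr p)^2 * (p $ Inl 1 * v $ Inr 1 + p $ Inl 2 * v $ Inr 2)^2
        \<le> profile h (rr p) / (rr p)^2 * ((rr p)^2 * ?d^2)"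
      using Q 1 by (intro mult_left_mono) auto
    also have "\<dots> = profile h (rr p) * ?d^2" using r by simp
    finally have "speed2 h p v \<le> 2 / rr p * (profile h (rr p) * ?d^2 + (rr p)^2 * ?d^2)"
      unfolding speed2_def using 2 r by (simp add: v(1,2) divide_right_mono)
    also have "\<dots> = 2 / rr p * (profile h (rr p) + (rr p)^2) * ?d^2"
      by (simp add: algebra_simps)
    finally have "sqrt (speed2 h p v) \<le> sqrt (2 / rr p * (profile h (rr p) + (rr p)^2) * ?d^2)"
      by simp
    also have "\<dots> = sqrt (2 / rr p * (profile h (rr p) + (rr p)^2)) * ?d"
      by (simp only: real_sqrt_mult[of _ "?d^2"] real_sqrt_abs abs_of_nonneg abs_ge_zero add_nonneg_nonneg)
    also have "\<dots> = ang_cost (rr p) p q" unfolding ang_cost_def v ..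
    finally show ?thesis .
  qed
  then show ?thesis using order_trans[OF L(1)] L(2) by blast
qed

text \<open>Along a ray through the origin of the x-plane the lateral square vanishes and the speed
  per unit of r is exactly \<open>stretch\<close>; any primitive of a larger function bounds the
  length.\<close>

lemma radial_join:
  assumes p: "act p \<in> int_polygon a b" and q: "act q \<in> int_polygon a b"
    and l: "q $ Inl 1 = l * p $ Inl 1" "q $ Inl 2 = l * p $ Inl 2"
    and ang: "q $ Inr 1 = p $ Inr 1" "q $ Inr 2 = p $ Inr 2"
    and G: "\<And>r. min (rr p) (rr q) \<le> r \<Longrightarrow> r \<le> max (rr p) (rr q) \<Longrightarrow> (G has_real_derivative G' r) (at r)"
      "\<And>r. min (rr p) (rr q) \<le> r \<Longrightarrow> r \<le> max (rr p) (rr q) \<Longrightarrow> stretch r \<le> G' r"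
  shows "\<exists>L. 0 \<le> L \<and> L \<le> sgn (rr q - rr p) * (G (rr q) - G (rr p)) \<and> join p q L"
proof -
  define v where "v = q - p"
  define w where "w = rr q - rr p"
  have x: "0 < p $ Inl 1" "0 < p $ Inl 2" "0 < q $ Inl 1" "0 < q $ Inl 2" using p q by (auto simp: act_in_int_polygon)
  have v: "v $ Inl 1 = q $ Inl 1 - p $ Inl 1" "v $ Inl 2 = q $ Inl 2 - p $ Inl 2" "v $ Inr 1 = 0" "v $ Inr 2 = 0"
    using ang by (auto simp: v_def)
  have w: "v $ Inl 1 + v $ Inl 2 = w"
    by (simp add: w_def rr_def v)
  have q_eq: "p + v = q" by (simp add: v_def)
  have R: "rr (p + s *\<^sub>R v) = rr p + s * w" for s
    using w by (simp add: rr_def algebra_simps flip: w)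
  have Rle: "min (rr p) (rr q) \<le> rr p + s * w" "rr p + s * w \<le> max (rr p) (rr q)" if "s \<in> {0..1}" for s
  proof -
    have e: "rr p + s * w = (1 - s) * rr p + s * rr q" by (simp add: w_def algebra_simps)
    have "(1 - s) * rr p + s * rr q \<le> (1 - s) * max (rr p) (rr q) + s * max (rr p) (rr q)"
      using that by (intro add_mono mult_left_mono) auto
    moreover have "(1 - s) * min (rr p) (rr q) + s * min (rr p) (rr q) \<le> (1 - s) * rr p + s * rr q"
      using that by (intro add_mono mult_left_mono) auto
    ultimately show "min (rr p) (rr q) \<le> rr p + s * w" "rr p + s * w \<le> max (rr p) (rr q)"
      unfolding e by (simp_all add: algebra_simps)
  qed
  have pos: "act (p + s *\<^sub>R v) \<in> int_polygon a b" if s: "s \<in> {0..1}" for s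
  proof -
    have "0 < y + s * (z - y)" if "0 < y" "0 < z" for y z
      using s that line_pos[of y z s] by (cases "s = 0 \<or> s = 1") auto
    moreover have "a < rr p + s * w" "ereal (rr p + s * w) < b"
      using p q Rle[OF s] ereal_less_if_le_max[OF Rle(2)[OF s]] by (auto simp: act_in_int_polygon)
    ultimately show ?thesis
      unfolding act_in_int_polygon R using x v by simp
  qed
  have pp: "act p \<in> polygon a b" "act q \<in> polygon a b" using p q int_polygon_subset by blast+
  have "\<exists>L. 0 \<le> L \<and> L \<le> (\<lambda>s. sgn w * G (rr p + s * w)) 1 - (\<lambda>s. sgn w * G (rr p + s * w)) 0 \<and> join p (p + v) L"
  proof (rule arc_of_length_linear[OF pp(1), where \<phi>' = "\<lambda>s. sgn w * (G' (rr p + s * w) * w)"])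
    show "act (p + v) \<in> polygon a b" using pp(2) by (simp add: q_eq)
    show "act (p + s *\<^sub>R v) \<in> int_polygon a b" if "s \<in> {0<..<1}" for s using pos that by simp
    have D: "((\<lambda>s. sgn w * G (rr p + s * w)) has_real_derivative sgn w * (G' (rr p + s * w) * w)) (at s)" if "s \<in> {0..1}" for s
      by (rule DERIV_cmult, rule DERIV_chain2[where f = G and g = "\<lambda>s. rr p + s * w", OF G(1)[OF Rle[OF that]]])
         (auto intro!: derivative_eq_intros)
    then show "((\<lambda>s. sgn w * G (rr p + s * w)) has_real_derivative sgn w * (G' (rr p + s * w) * w)) (at s)" if "s \<in> {0<..<1}" for s
      using that by simp
    show "continuous_on {0..1} (\<lambda>s. sgn w * G (rr p + s * w))"
      by (intro continuous_at_imp_continuous_on ballI DERIV_isCont[OF D])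
    show "sqrt (speed2 h (p + s *\<^sub>R v) v) \<le> sgn w * (G' (rr p + s * w) * w)" if s: "s \<in> {0<..<1}" for s
    proof -
      have s': "s \<in> {0..1}" using s by simp
      have lat: "(p + s *\<^sub>R v) $ Inl 2 * v $ Inl 1 - (p + s *\<^sub>R v) $ Inl 1 * v $ Inl 2 = 0"
        by (simp add: v l algebra_simps)
      have "speed2 h (p + s *\<^sub>R v) v = rr (p + s *\<^sub>R v) / (2 * profile h (rr (p + s *\<^sub>R v))) * w^2"
        unfolding speed2_eq[OF pos[OF s'], symmetric] metric_squares[OF pos[OF s']] w lat
        by (simp add: v(3,4))
      then have "sqrt (speed2 h (p + s *\<^sub>R v) v) = stretch (rr p + s * w) * \<bar>w\<bar>"
        unfolding stretch_def R by (simp only: real_sqrt_mult real_sqrt_abs)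
      also have "\<dots> \<le> G' (rr p + s * w) * \<bar>w\<bar>" using G(2)[OF Rle[OF s']] by (intro mult_right_mono) simp_all
      also have "\<dots> = sgn w * (G' (rr p + s * w) * w)" by (simp add: abs_sgn mult_ac)
      finally show ?thesis .
    qed
  qed
  then show ?thesis by (simp add: q_eq w_def right_diff_distrib)
qed

text \<open>Angles are changed at an interior point (x, y), since arcs run in the chart: a segment
  from p to it, a rotation there, and a segment to q.\<close>

lemma via_join:
  assumes p: "act p \<in> polygon a b" and q: "act q \<in> polygon a b"
    and le: "rr p \<le> r1" "rr q \<le> r1" "ereal r1 < b" and x: "0 < x" "0 < y" "a < x + y" "x + y \<le> r1"
    and C: "0 \<le> C" "\<And>r. a < r \<Longrightarrow> r \<le> r1 \<Longrightarrow> (deriv ^^ 2) h r \<le> C / (r - a)"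
  shows "\<exists>L. L \<le> seg_cost a C p (mkp x y 0 0) + ang_cost (x + y) p q + seg_cost a C (mkp x y 0 0) q \<and> join p q L"
proof -
  \<comment> \<open>Two copies of the interior point carry the angles of p and of q. In the stated
    bound both are replaced by zero angles, which \<open>seg_cost\<close> does not see.\<close>
  let ?p = "mkp x y (p $ Inr 1) (p $ Inr 2)" and ?q = "mkp x y (q $ Inr 1) (q $ Inr 2)"
  have xb: "ereal (x + y) < b" using x(4) le(3) by (auto intro: le_less_trans[of "ereal _" "ereal r1"])
  have int: "act ?p \<in> int_polygon a b" "act ?q \<in> int_polygon a b"
    using x xb by (auto simp: act_in_int_polygon)
  then have pol: "act ?p \<in> polygon a b" "act ?q \<in> polygon a b" using int_polygon_subset by blast+
  obtain L1 where L1: "L1 \<le> seg_cost a C p ?p" "join p ?p L1"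
    using seg_join[OF p pol(1) _ le(1) _ _ _ C] int x by auto
  obtain L2 where L2: "L2 \<le> ang_cost (rr ?p) ?p ?q" "join ?p ?q L2"
    using ang_join[OF int(1), of ?q] by (auto simp: act_eq_iff)
  obtain L3 where L3: "L3 \<le> seg_cost a C ?q q" "join ?q q L3"
    using seg_join[OF pol(2) q _ _ le(2) _ _ C] int x by auto
  have "join p q (L1 + L2 + L3)" by (rule join_trans[OF L3(2) join_trans[OF L2(2) L1(2)]])
  moreover have "L1 + L2 + L3 \<le> seg_cost a C p (mkp x y 0 0) + ang_cost (x + y) p q + seg_cost a C (mkp x y 0 0) q"
    using L1(1) L2(1) L3(1) by (simp add: seg_cost_def ang_cost_def)
  ultimately show ?thesis by blast
qed

lemma exists_larger:
  assumes "ereal r < b"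
  obtains r1 where "r < r1" "a < r1" "ereal r1 < b"
proof -
  have "ereal (max r a) < b" using assms data(1) by (simp add: max_def)
  then obtain r1 where "ereal (max r a) < ereal r1" "ereal r1 < b" using ereal_dense2 by blast
  then show thesis by (intro that[of r1]) auto
qed

lemma join_exists:
  assumes p: "act p \<in> polygon a b" and q: "act q \<in> polygon a b"
  shows "\<exists>L. join p q L"
proof -
  have "ereal (max (rr p) (rr q)) < b" using p q by (auto simp: act_in_polygon max_def)
  then obtain r1 where r1: "max (rr p) (rr q) < r1" "a < r1" "ereal r1 < b" by (rule exists_larger)
  then obtain C where "0 \<le> C" "\<And>r. a < r \<Longrightarrow> r \<le> r1 \<Longrightarrow> (deriv ^^ 2) h r \<le> C / (r - a)"
    using pole_bound[of r1] by auto
  from via_join[OF p q _ _ r1(3) _ _ _ _ this, of "r1 / 2" "r1 / 2"] r1 a_pos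
  show ?thesis by auto
qed

lemma rdist_nonneg: "act p \<in> polygon a b \<Longrightarrow> act q \<in> polygon a b \<Longrightarrow> 0 \<le> rdist p q"
  using rdist_lower_bound[OF minorant_const] join_exists by fastforce

lemma rdist_triangle:
  assumes "act p \<in> polygon a b" "act q \<in> polygon a b" "act s \<in> polygon a b"
  shows "rdist p s \<le> rdist p q + rdist q s"
proof (rule field_le_epsilon)
  fix e :: real assume e: "0 < e"
  obtain L0 where "join p q L0" using join_exists assms by blast
  then obtain L1 where L1: "L1 < rdist p q + e / 2" "join p q L1" using rdist_less[of p q "rdist p q + e / 2"] e by auto
  obtain L0' where "join q s L0'" using join_exists assms by blast
  then obtain L2 where L2: "L2 < rdist q s + e / 2" "join q s L2" using rdist_less[of q s "rdist q s + e / 2"] e by auto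
  show "rdist p s \<le> rdist p q + rdist q s + e"
    using rdist_le[OF join_trans[OF L2(2) L1(2)]] L1(1) L2(1) by simp
qed

lemma rdist_same_point: "same_point m a p q \<Longrightarrow> rdist p q \<le> 0"
  by (rule rdist_le[OF joined.start])

text \<open>Near an edge the distance is estimated through the interior point displaced from q by d
  along the diagonal. First d is chosen so that the cost for q itself is small, then n so that the
  cost for the sequence is close to it.\<close>

lemma rdist_tendsto_0:
  assumes \<sigma>: "\<And>n. act (\<sigma> n) \<in> polygon a b" and q: "act q \<in> polygon a b" and lim: "\<sigma> \<longlonglongrightarrow> q"
  shows "(\<lambda>n. rdist (\<sigma> n) q) \<longlonglongrightarrow> 0"
proof (rule tendstoI)
  fix e :: real assume e: "0 < e"
  obtain r1 where r1: "rr q < r1" "a < r1" "ereal r1 < b" using q by (auto simp: act_in_polygon elim: exists_larger)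
  then obtain C where C: "0 \<le> C" "\<And>r. a < r \<Longrightarrow> r \<le> r1 \<Longrightarrow> (deriv ^^ 2) h r \<le> C / (r - a)"
    using pole_bound[of r1] by auto
  define f where "f d p = seg_cost a C p (mkp (q $ Inl 1 + d) (q $ Inl 2 + d) 0 0)
    + ang_cost (q $ Inl 1 + d + (q $ Inl 2 + d)) p q + seg_cost a C (mkp (q $ Inl 1 + d) (q $ Inl 2 + d) 0 0) q" for d p
  have "isCont (\<lambda>d. f d q) 0"
    unfolding f_def seg_cost_def ang_cost_def by (simp, intro continuous_intros)
  then have "((\<lambda>d. f d q) \<longlongrightarrow> f 0 q) (at_right 0)"
    unfolding isCont_def by (rule filterlim_mono) (auto simp: at_within_le_at)
  moreover have "f 0 q < e" using e by (simp add: f_def seg_cost_def ang_cost_def rr_def)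
  ultimately have "eventually (\<lambda>d. f d q < e) (at_right 0)" by (rule order_tendstoD)
  moreover have "eventually (\<lambda>d. d \<in> {0<..<(r1 - rr q) / 2}) (at_right 0)"
    using r1(1) by (intro eventually_at_right_real) auto
  ultimately have "eventually (\<lambda>d. f d q < e \<and> d \<in> {0<..<(r1 - rr q) / 2}) (at_right 0)"
    by (rule eventually_conj)
  then obtain d where d: "f d q < e" "0 < d" "d < (r1 - rr q) / 2"
    using eventually_happens[of _ "at_right (0::real)"] by auto
  have lims: "(\<lambda>n. \<sigma> n $ i) \<longlonglongrightarrow> q $ i" for i by (rule tendsto_vec_nth[OF lim])
  have limr: "(\<lambda>n. rr (\<sigma> n)) \<longlonglongrightarrow> rr q" unfolding rr_def by (intro tendsto_add lims)
  have "(\<lambda>n. seg_cost a C (\<sigma> n) x) \<longlonglongrightarrow> seg_cost a C q x" for x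
    unfolding seg_cost_def
    by (rule tendsto_add; rule tendsto_mult_left; (rule tendsto_add)?;
        intro tendsto_rabs tendsto_diff tendsto_const tendsto_real_sqrt lims limr)
  moreover have "(\<lambda>n. ang_cost r (\<sigma> n) q) \<longlonglongrightarrow> ang_cost r q q" for r
    unfolding ang_cost_def
    by (rule tendsto_mult_left; rule tendsto_add; intro tendsto_rabs tendsto_diff tendsto_const lims)
  ultimately have "(\<lambda>n. f d (\<sigma> n)) \<longlonglongrightarrow> f d q"
    unfolding f_def by (intro tendsto_add tendsto_const)
  then have "eventually (\<lambda>n. f d (\<sigma> n) < e) sequentially" using d(1) by (rule order_tendstoD)
  moreover have "eventually (\<lambda>n. rr (\<sigma> n) < r1) sequentially" using limr r1(1) by (rule order_tendstoD)
  ultimately show "eventually (\<lambda>n. dist (rdist (\<sigma> n) q) 0 < e) sequentially"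
  proof eventually_elim
    case (elim n)
    have "\<exists>L. L \<le> f d (\<sigma> n) \<and> join (\<sigma> n) q L"
      unfolding f_def
    proof (rule via_join[OF \<sigma> q _ _ r1(3) _ _ _ _ C])
      show "0 < q $ Inl 1 + d" "0 < q $ Inl 2 + d" "a < q $ Inl 1 + d + (q $ Inl 2 + d)"
        "q $ Inl 1 + d + (q $ Inl 2 + d) \<le> r1"
        using q d by (auto simp: act_in_polygon rr_def)
    qed (use elim r1 in auto)
    then have "rdist (\<sigma> n) q < e" using rdist_le elim by fastforce
    then show ?case using rdist_nonneg[OF \<sigma>[of n] q] by simp
  qed
qed

subsection \<open>Completeness\<close>

text \<open>Translations by integer multiples of 2 pi belong to the lattice and bring both angles
  into a compact square.\<close>

lemma reduce_angles:
  "\<exists>q. same_point m a p q \<and> act q = act p \<and> q $ Inr 1 \<in> {0..2 * pi} \<and> q $ Inr 2 \<in> {0..2 * pi}"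
proof -
  define k where "k i = \<lfloor>p $ Inr i / (2 * pi)\<rfloor>" for i
  have k: "p $ Inr i - 2 * pi * k i \<in> {0..2 * pi}" for i
  proof -
    have "real_of_int (k i) \<le> p $ Inr i / (2 * pi)" "p $ Inr i / (2 * pi) < real_of_int (k i) + 1"
      unfolding k_def by linarith+
    then show ?thesis by (simp add: field_simps)
  qed
  let ?q = "mkp (p $ Inl 1) (p $ Inl 2) (p $ Inr 1 - 2 * pi * k 1) (p $ Inr 2 - 2 * pi * k 2)"
  have e: "act ?q = act p" by (simp add: act_eq_iff)
  have "same_point m a p ?q"
    unfolding same_point_def
    by (rule conjI, simp add: e, rule exI[of _ "k 1"], rule exI[of _ "k 2"], rule exI[of _ 0], rule exI[of _ 0],
        rule exI[of _ 0], rule exI[of _ 0]) (simp add: ang_def)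
  then show ?thesis using k e by (intro exI[of _ ?q]) simp
qed

text \<open>\<open>proper\<close> expresses that T is unbounded towards the end. A Cauchy sequence
  has bounded T, so it stays at r \<le> r1; with reduced angles it lies in a compact box, has a
  subsequence converging in coordinates and hence in distance, and converges by the Cauchy
  property.\<close>

lemma complete_metricI:
  assumes T: "minorant T"
    and proper: "\<And>M. \<exists>r1. ereal r1 < b \<and> (\<forall>r. a \<le> r \<and> ereal r < b \<and> \<bar>T r\<bar> \<le> M \<longrightarrow> r \<le> r1)"
  shows "complete_metric m a b h"
  unfolding complete_metric_def
proof (intro allI impI, elim conjE)
  fix \<sigma> :: "nat \<Rightarrow> action_angle"
  assume pol: "\<forall>n. act (\<sigma> n) \<in> polygon a b"
    and cauchy: "\<forall>\<epsilon>>0. \<exists>N. \<forall>n\<ge>N. \<forall>n'\<ge>N. rdist (\<sigma> n) (\<sigma> n') < \<epsilon>"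
  have "Cauchy (\<lambda>n. T (rr (\<sigma> n)))"
    unfolding Cauchy_def
  proof (intro allI impI)
    fix e :: real assume "0 < e"
    then obtain N where N: "\<And>n n'. n \<ge> N \<Longrightarrow> n' \<ge> N \<Longrightarrow> rdist (\<sigma> n) (\<sigma> n') < e" using cauchy by blast
    show "\<exists>M. \<forall>k\<ge>M. \<forall>n\<ge>M. dist (T (rr (\<sigma> k))) (T (rr (\<sigma> n))) < e"
    proof (intro exI[of _ N] allI impI)
      fix k n assume "N \<le> k" "N \<le> n"
      moreover obtain L where "join (\<sigma> n) (\<sigma> k) L" using join_exists pol by blast
      ultimately show "dist (T (rr (\<sigma> k))) (T (rr (\<sigma> n))) < e"
        using rdist_lower_bound[OF T] N[of n k] by (fastforce simp: dist_real_def)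
    qed
  qed
  then have "Bseq (\<lambda>n. T (rr (\<sigma> n)))" by (rule Cauchy_Bseq)
  then obtain M where M: "\<And>n. \<bar>T (rr (\<sigma> n))\<bar> \<le> M" unfolding Bseq_def by auto
  obtain r1 where r1: "ereal r1 < b" "\<And>r. a \<le> r \<Longrightarrow> ereal r < b \<Longrightarrow> \<bar>T r\<bar> \<le> M \<Longrightarrow> r \<le> r1"
    using proper[of M] by blast
  have le: "rr (\<sigma> n) \<le> r1" for n
    using r1(2)[of "rr (\<sigma> n)"] M[of n] pol by (auto simp: act_in_polygon)
  have "\<forall>n. \<exists>q. same_point m a (\<sigma> n) q \<and> act q = act (\<sigma> n) \<and> q $ Inr 1 \<in> {0..2 * pi} \<and> q $ Inr 2 \<in> {0..2 * pi}"
    using reduce_angles by blast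
  from choice[OF this] obtain \<tau> where \<tau>: "\<And>n. same_point m a (\<sigma> n) (\<tau> n)" "\<And>n. act (\<tau> n) = act (\<sigma> n)"
    "\<And>n. \<tau> n $ Inr 1 \<in> {0..2 * pi}" "\<And>n. \<tau> n $ Inr 2 \<in> {0..2 * pi}"
    by blast
  have \<tau>pol: "act (\<tau> n) \<in> polygon a b" for n using \<tau>(2) pol by simp
  have \<tau>le: "rr (\<tau> n) \<le> r1" for n using le[of n] same_point_rr[OF \<tau>(1)[of n]] by simp
  have "\<tau> n \<in> cbox (mkp 0 0 0 0) (mkp r1 r1 (2 * pi) (2 * pi))" for n
    using \<tau>pol[of n] \<tau>le[of n] \<tau>(3,4)[of n] by (auto simp: mem_box_cart all_action_angle act_in_polygon rr_def)
  then obtain q k where k: "strict_mono k" and lim: "(\<tau> \<circ> k) \<longlonglongrightarrow> q"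
    using compact_cbox[of "mkp 0 0 0 0" "mkp r1 r1 (2 * pi) (2 * pi)"] unfolding compact_def by blast
  have lims: "(\<lambda>n. (\<tau> \<circ> k) n $ i) \<longlonglongrightarrow> q $ i" for i by (rule tendsto_vec_nth[OF lim])
  have limr: "(\<lambda>n. rr ((\<tau> \<circ> k) n)) \<longlonglongrightarrow> rr q" unfolding rr_def by (intro tendsto_intros lims)
  have q: "act q \<in> polygon a b"
    unfolding act_in_polygon
  proof (intro conjI)
    show "0 \<le> q $ Inl 1" "0 \<le> q $ Inl 2" "a \<le> rr q"
      using \<tau>pol by (auto simp: act_in_polygon intro!: LIMSEQ_le_const[OF lims] LIMSEQ_le_const[OF limr])
    have "rr q \<le> r1" using \<tau>le by (auto intro!: LIMSEQ_le_const2[OF limr])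
    then show "ereal (rr q) < b" using r1(1) by (auto intro: le_less_trans[of _ "ereal r1"])
  qed
  have sub: "(\<lambda>n. rdist ((\<tau> \<circ> k) n) q) \<longlonglongrightarrow> 0"
    by (rule rdist_tendsto_0[OF _ q lim]) (simp add: \<tau>pol)
  have "(\<lambda>n. rdist (\<sigma> n) q) \<longlonglongrightarrow> 0"
  proof (rule LIMSEQ_I)
    fix e :: real assume e: "0 < e"
    have e2: "0 < e / 2" using e by simp
    then obtain N where N: "\<And>n n'. n \<ge> N \<Longrightarrow> n' \<ge> N \<Longrightarrow> rdist (\<sigma> n) (\<sigma> n') < e / 2"
      using cauchy by blast
    have "eventually (\<lambda>n. rdist ((\<tau> \<circ> k) n) q < e / 2) sequentially"
      by (rule order_tendstoD(2)[OF sub e2])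
    then obtain N' where N': "\<And>n. n \<ge> N' \<Longrightarrow> rdist ((\<tau> \<circ> k) n) q < e / 2"
      unfolding eventually_sequentially by blast
    define j where "j = k (max N N')"
    have j: "N \<le> j" "rdist (\<tau> j) q < e / 2"
      using seq_suble[OF k, of "max N N'"] N'[of "max N N'"] by (auto simp: j_def)
    show "\<exists>no. \<forall>n\<ge>no. norm (rdist (\<sigma> n) q - 0) < e"
    proof (intro exI[of _ N] allI impI)
      fix n assume n: "N \<le> n"
      have "rdist (\<sigma> n) q \<le> rdist (\<sigma> n) (\<sigma> j) + rdist (\<sigma> j) q" using pol q by (intro rdist_triangle) auto
      also have "rdist (\<sigma> j) q \<le> rdist (\<sigma> j) (\<tau> j) + rdist (\<tau> j) q" using pol q \<tau>pol by (intro rdist_triangle) auto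
      also have "rdist (\<sigma> j) (\<tau> j) \<le> 0" by (rule rdist_same_point[OF \<tau>(1)])
      finally have "rdist (\<sigma> n) q < e" using N[OF n j(1)] j(2) by simp
      moreover have "0 \<le> rdist (\<sigma> n) q" using pol q by (intro rdist_nonneg) auto
      ultimately show "norm (rdist (\<sigma> n) q - 0) < e" by simp
    qed
  qed
  with q show "\<exists>q. act q \<in> polygon a b \<and> (\<lambda>n. rdist (\<sigma> n) q) \<longlonglongrightarrow> 0" by blast
qed

text \<open>Points escaping along one ray form a Cauchy sequence, because a bounded G dominates
  radial lengths. A limit would have some r below s < b, and the strict growth of T keeps the late
  points at a definite distance from it.\<close>

lemma not_complete_metricI:
  assumes T: "minorant T" and mono: "\<And>r r'. a \<le> r \<Longrightarrow> r < r' \<Longrightarrow> ereal r' < b \<Longrightarrow> T r < T r'"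
    and r0: "r0 \<in> ival a b"
    and G: "\<And>r. r0 \<le> r \<Longrightarrow> ereal r < b \<Longrightarrow> (G has_real_derivative G' r) (at r)"
      "\<And>r. r0 \<le> r \<Longrightarrow> ereal r < b \<Longrightarrow> stretch r \<le> G' r"
      "\<And>r. r0 \<le> r \<Longrightarrow> ereal r < b \<Longrightarrow> G r \<le> M"
  shows "\<not> complete_metric m a b h"
proof
  assume comp: "complete_metric m a b h"
  obtain X :: "nat \<Rightarrow> real" where X: "incseq X" "\<And>i. r0 < X i" "\<And>i. ereal (X i) < b" "(\<lambda>i. ereal (X i)) \<longlonglongrightarrow> b"
    using ereal_incseq_approx[of "ereal r0" b] r0 by auto
  define \<sigma> where "\<sigma> n = mkp (X n / 2) (X n / 2) 0 0" for n
  have rs: "rr (\<sigma> n) = X n" for n by (simp add: \<sigma>_def)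
  have aX: "a < X n" for n using X(2)[of n] r0 by simp
  have int: "act (\<sigma> n) \<in> int_polygon a b" for n
    unfolding act_in_int_polygon rs using aX[of n] X(3) a_pos by (simp add: \<sigma>_def)
  have pol: "act (\<sigma> n) \<in> polygon a b" for n using int int_polygon_subset by blast
  \<comment> \<open>Besides the distance bound, the nonnegative length of the chain gives the
    monotonicity of G along the sequence.\<close>
  have ray: "rdist (\<sigma> n) (\<sigma> n') \<le> \<bar>G (X n') - G (X n)\<bar> \<and> 0 \<le> sgn (X n' - X n) * (G (X n') - G (X n))" for n n'
  proof -
    have Xn: "X n \<noteq> 0" using aX[of n] a_pos by simp
    have "\<exists>L. 0 \<le> L \<and> L \<le> sgn (rr (\<sigma> n') - rr (\<sigma> n)) * (G (rr (\<sigma> n')) - G (rr (\<sigma> n))) \<and> join (\<sigma> n) (\<sigma> n') L"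
    proof (rule radial_join[OF int int, where G' = G' and l = "X n' / X n"])
      show "\<sigma> n' $ Inl 1 = X n' / X n * \<sigma> n $ Inl 1" "\<sigma> n' $ Inl 2 = X n' / X n * \<sigma> n $ Inl 2"
        using Xn by (simp_all add: \<sigma>_def)
      show "\<sigma> n' $ Inr 1 = \<sigma> n $ Inr 1" "\<sigma> n' $ Inr 2 = \<sigma> n $ Inr 2" by (simp_all add: \<sigma>_def)
      fix r assume r: "min (rr (\<sigma> n)) (rr (\<sigma> n')) \<le> r" "r \<le> max (rr (\<sigma> n)) (rr (\<sigma> n'))"
      have "r0 \<le> r" "ereal r < b"
        using r X(2)[of n] X(2)[of n'] ereal_less_if_le_max[of r "X n" "X n'" b] X(3) by (auto simp: rs)
      then show "(G has_real_derivative G' r) (at r)" "stretch r \<le> G' r" using G by auto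
    qed
    then obtain L where L: "0 \<le> L" "L \<le> sgn (X n' - X n) * (G (X n') - G (X n))" "join (\<sigma> n) (\<sigma> n') L" unfolding rs by blast
    have "sgn (X n' - X n) * (G (X n') - G (X n)) \<le> \<bar>G (X n') - G (X n)\<bar>"
      by (auto simp: sgn_if)
    then show ?thesis using L rdist_le[OF L(3)] by linarith
  qed
  have "incseq (\<lambda>n. G (X n))"
  proof (rule incseq_SucI)
    fix n
    have "X n \<le> X (Suc n)" using X(1) by (simp add: incseq_SucD)
    then show "G (X n) \<le> G (X (Suc n))"
      using ray[of n "Suc n"] by (cases "X n = X (Suc n)") (auto simp: sgn_if)
  qed
  moreover have "G (X n) \<le> M" for n using G(3)[of "X n"] X(2)[of n] X(3)[of n] by simp
  ultimately obtain l where "(\<lambda>n. G (X n)) \<longlonglongrightarrow> l" using incseq_convergent by blast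
  then have C: "Cauchy (\<lambda>n. G (X n))" using LIMSEQ_imp_Cauchy by blast
  have "\<exists>N. \<forall>n\<ge>N. \<forall>n'\<ge>N. rdist (\<sigma> n) (\<sigma> n') < \<epsilon>" if e: "0 < \<epsilon>" for \<epsilon>
  proof -
    obtain N where N: "\<And>n n'. n \<ge> N \<Longrightarrow> n' \<ge> N \<Longrightarrow> dist (G (X n')) (G (X n)) < \<epsilon>"
      using C e unfolding Cauchy_def by blast
    show ?thesis
    proof (intro exI[of _ N] allI impI)
      fix n n' assume "N \<le> n" "N \<le> n'"
      then show "rdist (\<sigma> n) (\<sigma> n') < \<epsilon>" using N[of n n'] ray[of n n'] by (simp add: dist_real_def)
    qed
  qed
  then obtain q where q: "act q \<in> polygon a b" "(\<lambda>n. rdist (\<sigma> n) q) \<longlonglongrightarrow> 0"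
    using comp pol unfolding complete_metric_def by blast
  have "ereal (rr q) < b" using q(1) by (simp add: act_in_polygon)
  then obtain s where s: "rr q < s" "a < s" "ereal s < b" by (rule exists_larger)
  have Ts: "T (rr q) < T s" using mono[of "rr q" s] s q(1) by (simp add: act_in_polygon)
  have "eventually (\<lambda>n. rdist (\<sigma> n) q < T s - T (rr q)) sequentially"
    using Ts by (intro order_tendstoD(2)[OF q(2)]) simp
  moreover have "eventually (\<lambda>n. ereal s < ereal (X n)) sequentially"
    by (rule order_tendstoD(1)[OF X(4) s(3)])
  ultimately have "eventually (\<lambda>n. rdist (\<sigma> n) q < T s - T (rr q) \<and> ereal s < ereal (X n)) sequentially"
    by (rule eventually_conj)
  then obtain n where n: "rdist (\<sigma> n) q < T s - T (rr q)" "s < X n"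
    unfolding eventually_sequentially by auto
  obtain L where "join (\<sigma> n) q L" using join_exists[OF pol q(1)] by blast
  from rdist_lower_bound[OF T this] have "\<bar>T (rr q) - T (X n)\<bar> \<le> rdist (\<sigma> n) q" by (simp add: rs)
  moreover have "T s < T (X n)" using mono[of s "X n"] s n(2) X(3) by simp
  ultimately show False using n(1) by simp
qed

end

section \<open>Volume\<close>

lemma prod_action_angle:
  "prod f (UNIV :: (2 + 2) set) = f (Inl 1) * f (Inl 2) * (f (Inr 1) * f (Inr 2))"
  unfolding UNIV_sum by (subst prod.union_disjoint) (auto simp: prod.reindex UNIV_2)

lemma sum_Plus_UNIV:
  "sum f (UNIV :: ('a :: finite + 'b :: finite) set) = (\<Sum>i\<in>UNIV. f (Inl i)) + (\<Sum>i\<in>UNIV. f (Inr i))"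
  unfolding UNIV_sum by (subst sum.union_disjoint) (auto simp: sum.reindex)

lemma pos_def_matrix_inv:
  fixes A :: "real ^ 'n ^ 'n"
  assumes "pos_def A"
  shows "A ** matrix_inv A = mat 1" "matrix_inv A ** A = mat 1"
proof -
  have "x = 0" if "A *v x = 0" for x
    using assms that unfolding pos_def_def by force
  then have "\<exists>B. B ** A = mat 1" unfolding matrix_left_invertible_ker by blast
  then obtain B where "B ** A = mat 1" ..
  then have "A ** B = mat 1 \<and> B ** A = mat 1" using matrix_left_right_inverse by blast
  then have "A ** matrix_inv A = mat 1 \<and> matrix_inv A ** A = mat 1"
    unfolding matrix_inv_def by (rule someI)
  then show "A ** matrix_inv A = mat 1" "matrix_inv A ** A = mat 1" by auto
qed

definition sw :: "2 + 2 \<Rightarrow> 2 + 2" where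
  "sw = case_sum Inr Inl"

lemma sw_simps [simp]: "sw (Inl i) = Inr i" "sw (Inr i) = Inl i"
  by (simp_all add: sw_def)

lemma sw_sw: "sw (sw i) = i"
  by (cases i) auto

text \<open>Rows and columns undergo the same permutation, so its sign enters squared.\<close>

lemma det_swap:
  fixes A :: "real ^ (2 + 2) ^ (2 + 2)"
  shows "det (\<chi> i j. A $ sw i $ sw j) = det A"
proof -
  have bij: "bij_betw sw UNIV UNIV"
    by (rule bij_betwI[of _ _ _ sw]) (auto simp: sw_sw)
  have p: "sw permutes UNIV" by (rule bij_imp_permutes[OF bij]) simp
  have "det (\<chi> i. (\<chi> i j. A $ i $ sw j) $ sw i) = of_int (sign sw) * (of_int (sign sw) * det A)"
    unfolding det_permute_rows[OF p] det_permute_columns[OF p] ..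
  moreover have "(\<chi> i. (\<chi> i j. A $ i $ sw j) $ sw i) = (\<chi> i j. A $ sw i $ sw j)"
    by (simp add: vec_eq_iff)
  moreover have "of_int (sign sw) * of_int (sign sw) = (1::real)"
    by (simp flip: of_int_mult)
  ultimately show ?thesis by (simp add: mult.assoc[symmetric])
qed

lemma emeasure_action_angle_box:
  assumes "l1 \<le> u1" "l2 \<le> u2" "l3 \<le> u3" "l4 \<le> u4"
  shows "emeasure lborel (cbox (mkp l1 l2 l3 l4) (mkp u1 u2 u3 u4)) = ennreal ((u1 - l1) * (u2 - l2) * ((u3 - l3) * (u4 - l4)))"
proof -
  have ne: "cbox (mkp l1 l2 l3 l4) (mkp u1 u2 u3 u4) \<noteq> {}"
    using assms by (auto simp: interval_ne_empty_cart all_action_angle intro!: all_action_angle[THEN iffD2, rule_format])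
  have "emeasure lborel (cbox (mkp l1 l2 l3 l4) (mkp u1 u2 u3 u4)) = ennreal (measure lborel (cbox (mkp l1 l2 l3 l4) (mkp u1 u2 u3 u4)))"
    using emeasure_lborel_cbox_finite[of "mkp l1 l2 l3 l4" "mkp u1 u2 u3 u4"] by (intro emeasure_eq_ennreal_measure) auto
  then show ?thesis
    unfolding content_cbox_cart[OF ne] prod_action_angle by simp
qed

lemma fund_domain_subset:
  assumes "\<theta> \<in> fund_domain m" "m \<ge> 1"
  shows "0 \<le> \<theta> $ 1" "\<theta> $ 1 \<le> 2 * pi" "0 \<le> \<theta> $ 2" "\<theta> $ 2 \<le> 4 * pi"
proof -
  obtain s t where s: "0 \<le> s" "s < 1" "0 \<le> t" "t < 1" and e: "\<theta> $ 1 = 2 * pi * (s / m)" "\<theta> $ 2 = 2 * pi * (t + s / m)"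
    using assms(1) unfolding fund_domain_def by auto
  have "s \<le> 1 * real m" using s(2) assms(2) by linarith
  then have sm: "0 \<le> s / m" "s / m \<le> 1" using s assms(2) by (simp_all add: divide_le_eq)
  show "0 \<le> \<theta> $ 1" "0 \<le> \<theta> $ 2" unfolding e using s sm by simp_all
  have "2 * pi * (s / m) \<le> 2 * pi * 1" "2 * pi * (t + s / m) \<le> 2 * pi * 2"
    using s sm by (intro mult_left_mono; simp)+
  then show "\<theta> $ 1 \<le> 2 * pi" "\<theta> $ 2 \<le> 4 * pi" unfolding e by simp_all
qed

text \<open>A box inside the fundamental domain, with s = m \<theta>1/(2 pi) and t = (\<theta>2 -
  \<theta>1)/(2 pi). Letting \<theta>2 start at pi keeps t nonnegative.\<close>

lemma fund_domain_contains:
  assumes "m \<ge> 1" "0 \<le> \<theta> $ 1" "\<theta> $ 1 \<le> pi / m" "pi \<le> \<theta> $ 2" "\<theta> $ 2 \<le> 3 / 2 * pi"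
  shows "\<theta> \<in> fund_domain m"
  unfolding fund_domain_def
proof (rule CollectI, rule bexI[of _ "m * \<theta> $ 1 / (2 * pi)"], rule bexI[of _ "\<theta> $ 2 / (2 * pi) - \<theta> $ 1 / (2 * pi)"], intro conjI)
  have m: "real m \<ge> 1" using assms(1) by simp
  show "\<theta> $ 1 = 2 * pi * (m * \<theta> $ 1 / (2 * pi) / m)" using m by simp
  show "\<theta> $ 2 = 2 * pi * (\<theta> $ 2 / (2 * pi) - \<theta> $ 1 / (2 * pi) + m * \<theta> $ 1 / (2 * pi) / m)"
    using m by (simp add: field_simps)
  have t1: "m * \<theta> $ 1 \<le> pi" using assms(3) m by (simp add: field_simps)
  then have "m * \<theta> $ 1 < 2 * pi" using pi_gt_zero by linarith
  then show "m * \<theta> $ 1 / (2 * pi) \<in> {0..<1}" using assms(2) by (simp add: divide_less_eq)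
  have "\<theta> $ 1 \<le> m * \<theta> $ 1" using mult_right_mono[OF m assms(2)] by simp
  moreover have "\<theta> $ 2 < 2 * pi" using assms(5) pi_gt_zero by linarith
  ultimately show "\<theta> $ 2 / (2 * pi) - \<theta> $ 1 / (2 * pi) \<in> {0..<1}"
    using t1 assms(2,4) pi_gt_zero by (simp add: field_simps)
qed

fun leg_of :: "2 + 2 \<Rightarrow> leg" where
  "leg_of (Inl i) = (if i = 1 then Rad else Lat)"
| "leg_of (Inr i) = (if i = 1 then Fib else Lon)"

context u2_metric
begin

text \<open>Exchanging the two blocks of the metric inverts it, so its determinant squares to 1.\<close>

lemma det_toric_metric:
  assumes p: "act p \<in> int_polygon a b"
  shows "det (toric_metric h p) = 1"
proof -
  let ?g = "toric_metric h p"
  let ?U = "hessian (sympl_pot h) (act p)"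
  have r: "rr p \<in> ival a b" by (rule rr_act[OF p])
  then have rp: "0 < rr p" "0 < profile h (rr p)" using a_pos profile_positive[OF r] by auto
  define N where "N i = (case leg_of i of Rad \<Rightarrow> rr p / (2 * profile h (rr p)) | Fib \<Rightarrow> 2 * profile h (rr p) / rr p
    | _ \<Rightarrow> rr p / 2)" for i
  define \<Theta> :: "real ^ (2 + 2) ^ (2 + 2)" where "\<Theta> = (\<chi> i j. sqrt (N i) * cofr (leg_of i) j p)"
  have N: "sqrt (N i) * sqrt (N i) = N i" for i
    using rp by (auto simp: N_def split: leg.splits)
  \<comment> \<open>A Gram matrix has nonnegative determinant, which settles the sign that the
    square leaves open.\<close>
  have "?g = transpose \<Theta> ** \<Theta>"
  proof -
    have "?g $ i $ j = (\<Sum>k\<in>UNIV. N k * (cofr (leg_of k) i p * cofr (leg_of k) j p))" for i j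
      unfolding sum_action_angle toric_metric_eq[OF data(2) p data(3)[OF r], folded profile_def]
      by (simp add: N_def mult.assoc)
    moreover have "(transpose \<Theta> ** \<Theta>) $ i $ j = (\<Sum>k\<in>UNIV. (sqrt (N k) * sqrt (N k)) * (cofr (leg_of k) i p * cofr (leg_of k) j p))" for i j
      unfolding matrix_matrix_mult_def transpose_def \<Theta>_def by (simp only: vec_lambda_beta mult_ac)
    ultimately show ?thesis unfolding N by (simp add: vec_eq_iff)
  qed
  then have "det ?g = det \<Theta> * det \<Theta>" by (simp add: det_mul)
  then have nn: "0 \<le> det ?g" by simp
  have "pos_def ?U" using kaehler p unfolding u2_kaehler_def by blast
  note inv = pos_def_matrix_inv[OF this]
  have inv1: "(\<Sum>k\<in>UNIV. ?U $ i $ k * matrix_inv ?U $ k $ j) = (if i = j then 1 else 0)"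
    "(\<Sum>k\<in>UNIV. matrix_inv ?U $ i $ k * ?U $ k $ j) = (if i = j then 1 else 0)" for i j
    using arg_cong[OF inv(1), of "\<lambda>M. M $ i $ j"] arg_cong[OF inv(2), of "\<lambda>M. M $ i $ j"]
    by (simp_all add: matrix_matrix_mult_def mat_def)
  have "?g ** (\<chi> i j. ?g $ sw i $ sw j) = mat 1"
  proof -
    have "(?g ** (\<chi> i j. ?g $ sw i $ sw j)) $ i $ j = mat 1 $ i $ j" for i j
      by (cases i; cases j)
         (simp_all add: matrix_matrix_mult_def sum_Plus_UNIV toric_metric_def inv1 mat_def)
    then show ?thesis by (simp add: vec_eq_iff)
  qed
  then have "det ?g * det ?g = 1" by (metis det_I det_mul det_swap)
  then show ?thesis using nn by (metis abs_of_nonneg abs_1 abs_square_eq_1 power2_eq_square)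
qed

text \<open>The volume density is 1 in these coordinates, and the fundamental domain lies in a
  rectangle with sides 2 pi and 4 pi, whence the factor 8 pi^2.\<close>

lemma riem_vol_le:
  assumes "0 \<le> \<rho>" and S: "\<And>p. p \<in> S \<Longrightarrow> act p \<in> int_polygon a b \<Longrightarrow> rr p \<le> \<rho>"
  shows "riem_vol m a b h S \<le> ennreal (8 * pi^2 * \<rho>^2)"
proof -
  let ?B = "cbox (mkp 0 0 0 0) (mkp \<rho> \<rho> (2 * pi) (4 * pi))"
  have "riem_vol m a b h S \<le> (\<integral>\<^sup>+ p. indicator ?B p \<partial>lborel)"
    unfolding riem_vol_def
  proof (rule nn_integral_mono)
    fix p :: action_angle
    show "ennreal (sqrt (det (toric_metric h p))) * indicator {p \<in> S. act p \<in> int_polygon a b \<and> ang p \<in> fund_domain m} p \<le> indicator ?B p"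
    proof (cases "p \<in> S \<and> act p \<in> int_polygon a b \<and> ang p \<in> fund_domain m")
      case True
      have "p \<in> ?B"
        using True S[of p] fund_domain_subset[of "ang p" m] m_pos
        by (auto simp: mem_box_cart all_action_angle act_in_int_polygon rr_def ang_def)
      then show ?thesis using True by (simp add: det_toric_metric)
    qed simp
  qed
  also have "\<dots> = ennreal ((\<rho> - 0) * (\<rho> - 0) * ((2 * pi - 0) * (4 * pi - 0)))"
    using assms(1) by (simp add: emeasure_action_angle_box)
  finally show ?thesis by (simp add: power2_eq_square mult_ac)
qed

text \<open>The volume of the box in \<open>riem_vol_ge\<close> divided by \<rho>^2; the sides are
  \<rho>/4, \<rho>/4, pi/m and pi/2.\<close>

definition vol_const :: real where
  "vol_const = pi^2 / (32 * m)"

lemma vol_const_pos: "0 < vol_const"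
  using m_pos by (simp add: vol_const_def)

text \<open>In the box each action coordinate is between \<rho>/4 and \<rho>/2, so r is between
  \<rho>/2 and \<rho>; the assumption on \<rho> makes \<rho>/2 exceed a.\<close>

lemma riem_vol_ge:
  assumes \<rho>: "2 * a < \<rho>" "ereal \<rho> < b"
    and S: "\<And>p. \<rho> / 4 \<le> p $ Inl 1 \<Longrightarrow> p $ Inl 1 \<le> \<rho> / 2 \<Longrightarrow> \<rho> / 4 \<le> p $ Inl 2 \<Longrightarrow> p $ Inl 2 \<le> \<rho> / 2 \<Longrightarrow>
      0 \<le> p $ Inr 1 \<Longrightarrow> p $ Inr 1 \<le> 4 * pi \<Longrightarrow> 0 \<le> p $ Inr 2 \<Longrightarrow> p $ Inr 2 \<le> 4 * pi \<Longrightarrow> p \<in> S"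
  shows "ennreal (vol_const * \<rho>^2) \<le> riem_vol m a b h S"
proof -
  let ?B = "cbox (mkp (\<rho>/4) (\<rho>/4) 0 pi) (mkp (\<rho>/2) (\<rho>/2) (pi / m) (3 / 2 * pi))"
  have pm: "pi / m \<le> pi" "0 \<le> pi / m" using m_pos by (auto simp: field_simps)
  have "(\<integral>\<^sup>+ p. indicator ?B p \<partial>lborel) \<le> riem_vol m a b h S"
    unfolding riem_vol_def
  proof (rule nn_integral_mono)
    fix p :: action_angle
    show "indicator ?B p \<le> ennreal (sqrt (det (toric_metric h p))) * indicator {p \<in> S. act p \<in> int_polygon a b \<and> ang p \<in> fund_domain m} p"
    proof (cases "p \<in> ?B")
      case True
      then have c: "\<rho> / 4 \<le> p $ Inl 1" "p $ Inl 1 \<le> \<rho> / 2" "\<rho> / 4 \<le> p $ Inl 2" "p $ Inl 2 \<le> \<rho> / 2"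
        "0 \<le> p $ Inr 1" "p $ Inr 1 \<le> pi / m" "pi \<le> p $ Inr 2" "p $ Inr 2 \<le> 3 / 2 * pi"
        by (simp_all add: mem_box_cart all_action_angle)
      have rle: "rr p \<le> \<rho>" using c by (simp add: rr_def)
      have "act p \<in> int_polygon a b"
        unfolding act_in_int_polygon using c \<rho> a_pos ereal_less_if_le_max[of "rr p" \<rho> \<rho> b] rle by (simp add: rr_def)
      moreover have "ang p \<in> fund_domain m"
        using c m_pos by (intro fund_domain_contains) (simp_all add: ang_def)
      moreover have "p \<in> S" using c pm pi_gt_zero by (intro S) linarith+
      ultimately show ?thesis using True by (simp add: det_toric_metric)
    qed simp
  qed
  moreover have "(\<integral>\<^sup>+ p. indicator ?B p \<partial>lborel) = ennreal ((\<rho>/2 - \<rho>/4) * (\<rho>/2 - \<rho>/4) * ((pi / m - 0) * (3 / 2 * pi - pi)))"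
    using \<rho> a_pos pm by (simp add: emeasure_action_angle_box)
  moreover have "(\<rho>/2 - \<rho>/4) * (\<rho>/2 - \<rho>/4) * ((pi / m - 0) * (3 / 2 * pi - pi)) = vol_const * \<rho>^2"
    by (simp add: vol_const_def power2_eq_square field_simps)
  ultimately show ?thesis by simp
qed

lemma finite_volumeI:
  assumes "b = ereal c"
  shows "finite_volume m a b h"
proof -
  have "riem_vol m a b h {p. act p \<in> polygon a b} \<le> ennreal (8 * pi^2 * c^2)"
    using data(1) a_pos by (intro riem_vol_le) (auto simp: assms act_in_int_polygon)
  then show ?thesis unfolding finite_volume_def by (auto simp: le_less_trans)
qed

lemma ball_volume_le:
  assumes T: "minorant T" and p: "act p \<in> polygon a b" and "0 \<le> \<rho>"
    and le: "\<And>r. a \<le> r \<Longrightarrow> ereal r < b \<Longrightarrow> \<bar>T r - T (rr p)\<bar> < R \<Longrightarrow> r \<le> \<rho>"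
  shows "riem_vol m a b h (riem_ball m a b h p R) \<le> ennreal (8 * pi^2 * \<rho>^2)"
proof (rule riem_vol_le[OF assms(3)])
  fix q assume "q \<in> riem_ball m a b h p R"
  then have q: "act q \<in> polygon a b" "rdist p q < R" by (auto simp: riem_ball_def)
  obtain L where "join p q L" using join_exists[OF p q(1)] by blast
  from rdist_lower_bound[OF T this] show "rr q \<le> \<rho>"
    using q by (intro le) (auto simp: act_in_polygon)
qed

text \<open>Every q of the box is reached from p by a fixed path to the level r0, a rotation and a
  segment inside that level, and a ray outwards. All but the ray costs at most a constant
  independent of q and \<rho>.\<close>

lemma ball_volume_ge:
  assumes p: "act p \<in> polygon a b" and r0: "r0 \<in> ival a b"
    and G: "\<And>r. r0 \<le> r \<Longrightarrow> ereal r < b \<Longrightarrow> (G has_real_derivative G' r) (at r)"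
      "\<And>r. r0 \<le> r \<Longrightarrow> ereal r < b \<Longrightarrow> stretch r \<le> G' r"
  obtains A where "\<And>\<rho> R. 2 * r0 < \<rho> \<Longrightarrow> ereal \<rho> < b \<Longrightarrow> A + G \<rho> < R \<Longrightarrow>
    ennreal (vol_const * \<rho>^2) \<le> riem_vol m a b h (riem_ball m a b h p R)"
proof -
  have r0': "a < r0" "ereal r0 < b" using r0 by auto
  let ?o = "mkp (r0 / 2) (r0 / 2) 0 0"
  have o: "act ?o \<in> int_polygon a b" using r0' a_pos by (simp add: act_in_int_polygon)
  then have o': "act ?o \<in> polygon a b" using int_polygon_subset by blast
  obtain L0 where L0: "join p ?o L0" using join_exists[OF p o'] by blast
  obtain C where C: "0 \<le> C" "\<And>r. a < r \<Longrightarrow> r \<le> r0 \<Longrightarrow> (deriv ^^ 2) h r \<le> C / (r - a)"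
    using pole_bound[OF r0] by blast
  \<comment> \<open>The rotation moves two angles by at most 4 pi each, whence 8 pi.\<close>
  define K where "K = sqrt (2 / r0 * (profile h r0 + r0^2)) * (8 * pi)"
  define A where "A = L0 + K + 4 * sqrt 2 * sqrt r0 - G r0"
  show thesis
  proof (rule that[of A])
    fix \<rho> R assume \<rho>: "2 * r0 < \<rho>" "ereal \<rho> < b" and R: "A + G \<rho> < R"
    show "ennreal (vol_const * \<rho>^2) \<le> riem_vol m a b h (riem_ball m a b h p R)"
    proof (rule riem_vol_ge)
      show "2 * a < \<rho>" "ereal \<rho> < b" using \<rho> r0' by auto
      fix q :: action_angle
      assume q: "\<rho> / 4 \<le> q $ Inl 1" "q $ Inl 1 \<le> \<rho> / 2" "\<rho> / 4 \<le> q $ Inl 2" "q $ Inl 2 \<le> \<rho> / 2"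
        "0 \<le> q $ Inr 1" "q $ Inr 1 \<le> 4 * pi" "0 \<le> q $ Inr 2" "q $ Inr 2 \<le> 4 * pi"
      have \<rho>0: "0 < \<rho>" "0 < r0" using \<rho> r0' a_pos by auto
      have rq: "r0 < rr q" "rr q \<le> \<rho>" using q \<rho> by (auto simp: rr_def)
      \<comment> \<open>Division by \<open>l\<close> projects q along its ray to the level r =
        r0.\<close>
      define l where "l = rr q / r0"
      have l: "0 < l" using rq \<rho>0 by (simp add: l_def)
      have rqb: "ereal r < b" if "r \<le> \<rho>" for r using that \<rho>(2) ereal_less_if_le_max[of r \<rho> \<rho> b] by simp
      let ?o1 = "mkp (r0 / 2) (r0 / 2) (q $ Inr 1) (q $ Inr 2)"
      let ?q1 = "mkp (q $ Inl 1 / l) (q $ Inl 2 / l) (q $ Inr 1) (q $ Inr 2)"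
      have "rr ?q1 = rr q / l" by (simp add: rr_def add_divide_distrib)
      then have rq1: "rr ?q1 = r0" using rq \<rho>0 by (simp add: l_def)
      have qi: "act q \<in> int_polygon a b" using q \<rho>0 rq r0' rqb[of "rr q"] by (simp add: act_in_int_polygon)
      have o1: "act ?o1 \<in> int_polygon a b" using r0' a_pos by (simp add: act_in_int_polygon)
      have q1: "act ?q1 \<in> int_polygon a b"
        unfolding act_in_int_polygon rq1 using q l \<rho>0 r0' by simp
      have pol: "act ?o1 \<in> polygon a b" "act ?q1 \<in> polygon a b" "act q \<in> polygon a b"
        using o1 q1 qi int_polygon_subset by blast+
      obtain L1 where L1: "L1 \<le> ang_cost (rr ?o) ?o ?o1" "join ?o ?o1 L1"
        using ang_join[OF o, of ?o1] by (auto simp: act_eq_iff)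
      have "\<exists>L. L \<le> seg_cost a C ?o1 ?q1 \<and> join ?o1 ?q1 L"
        by (rule seg_join[OF pol(1,2) _ _ _ _ _ C]) (use o1 rq1 in auto)
      then obtain L2 where L2: "L2 \<le> seg_cost a C ?o1 ?q1" "join ?o1 ?q1 L2" by blast
      have "\<exists>L. 0 \<le> L \<and> L \<le> sgn (rr q - rr ?q1) * (G (rr q) - G (rr ?q1)) \<and> join ?q1 q L"
      proof (rule radial_join[OF q1 qi, where G' = G' and l = l])
        fix r assume "min (rr ?q1) (rr q) \<le> r" "r \<le> max (rr ?q1) (rr q)"
        then have "r0 \<le> r" "r \<le> \<rho>" using rq unfolding rq1 by auto
        then show "(G has_real_derivative G' r) (at r)" "stretch r \<le> G' r" using G rqb by auto
      qed (use l in auto)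
      then obtain L3 where L3: "L3 \<le> G (rr q) - G r0" "join ?q1 q L3" using rq unfolding rq1 by auto
      have G_mono: "G (rr q) \<le> G \<rho>"
      proof (rule DERIV_nonneg_imp_nondecreasing[OF rq(2)])
        fix r assume r: "rr q \<le> r" "r \<le> \<rho>"
        have "0 \<le> stretch r" using r rq \<rho>0 r0' profile_positive[of r] rqb[of r] by (simp add: stretch_def)
        then show "\<exists>y. (G has_real_derivative y) (at r) \<and> 0 \<le> y"
          using G[of r] r rq rqb[of r] by (intro exI[of _ "G' r"]) auto
      qed
      have K: "ang_cost (rr ?o) ?o ?o1 \<le> K"
        unfolding ang_cost_def K_def using q profile_positive[OF r0] \<rho>0 by (intro mult_mono) auto
      have seg: "seg_cost a C ?o1 ?q1 \<le> 4 * sqrt 2 * sqrt r0"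
      proof -
        have "\<bar>sqrt x - sqrt y\<bar> \<le> 2 * sqrt r0" if "0 \<le> x" "x \<le> r0" "0 \<le> y" "y \<le> r0" for x y
          using that real_sqrt_le_mono[of x r0] real_sqrt_le_mono[of y r0] real_sqrt_ge_zero[of x] real_sqrt_ge_zero[of y] by linarith
        moreover have "0 \<le> q $ Inl 1 / l" "0 \<le> q $ Inl 2 / l" "q $ Inl 1 / l + q $ Inl 2 / l = r0"
          using q l \<rho>0 rq1 by auto
        ultimately have "\<bar>sqrt (q $ Inl 1 / l) - sqrt (r0 / 2)\<bar> \<le> 2 * sqrt r0" "\<bar>sqrt (q $ Inl 2 / l) - sqrt (r0 / 2)\<bar> \<le> 2 * sqrt r0"
          using \<rho>0 by auto
        then have "sqrt 2 * (\<bar>sqrt (q $ Inl 1 / l) - sqrt (r0 / 2)\<bar> + \<bar>sqrt (q $ Inl 2 / l) - sqrt (r0 / 2)\<bar>) \<le> sqrt 2 * (4 * sqrt r0)"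
          by (intro mult_left_mono) auto
        then show ?thesis unfolding seg_cost_def rq1 by simp
      qed
      have "join p q (L0 + L1 + L2 + L3)"
        by (rule join_trans[OF L3(2) join_trans[OF L2(2) join_trans[OF L1(2) L0]]])
      then have "rdist p q < R"
        using rdist_le[of p q "L0 + L1 + L2 + L3"] L1(1) L2(1) L3(1) K seg G_mono R unfolding A_def by linarith
      then show "q \<in> riem_ball m a b h p R" using pol(3) by (simp add: riem_ball_def)
    qed
  qed
qed

end

context u2_metric
begin

section \<open>Asymptotics of the momentum profile and global behaviour\<close>

lemma stretch_ge: "r \<in> ival a b \<Longrightarrow> x^2 * (2 * profile h r) \<le> r \<Longrightarrow> x \<le> stretch r"
  unfolding stretch_def using profile_positive[of r] by (intro real_le_rsqrt) (simp add: pos_le_divide_eq)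

lemma stretch_le: "r \<in> ival a b \<Longrightarrow> 0 \<le> x \<Longrightarrow> r \<le> x^2 * (2 * profile h r) \<Longrightarrow> stretch r \<le> x"
  unfolding stretch_def using profile_positive[of r] by (intro real_le_lsqrt) (auto simp: pos_divide_le_eq)

lemma minorantI:
  assumes "\<And>r. a \<le> r \<Longrightarrow> ereal r < b \<Longrightarrow> (T has_real_derivative T' r) (at r)"
    and "\<And>r. r \<in> ival a b \<Longrightarrow> 0 \<le> T' r \<and> (T' r)^2 * (2 * profile h r) \<le> r"
  shows "minorant T"
  unfolding minorant_def
proof (intro conjI exI[of _ T'] ballI)
  show "continuous_on {r. a \<le> r \<and> ereal r < b} T"
    using assms(1) by (intro continuous_at_imp_continuous_on) (auto intro: DERIV_isCont)
  fix r assume r: "r \<in> ival a b"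
  show "(T has_real_derivative T' r) (at r)" using assms(1)[of r] r by auto
  show "\<bar>T' r\<bar> \<le> stretch r" using assms(2)[OF r] stretch_ge[OF r, of "T' r"] by simp
qed

text \<open>For Q of order r^2 the length element is of order r^(-1/2), so the level r is at
  distance of order sqrt r. The volume up to that level is of order r^2, the fourth power of the
  distance.\<close>

lemma quartic_case:
  assumes b: "b = \<infinity>" and c: "0 < c1" "0 < c2" and r0: "a < r0"
    and up: "\<And>r. a < r \<Longrightarrow> profile h r \<le> c1 * r^2"
    and low: "\<And>r. r0 \<le> r \<Longrightarrow> c2 * r^2 \<le> profile h r"
  shows "complete_metric m a b h" "quartic_volume_growth m a b h"
proof -
  \<comment> \<open>For T = \<kappa> sqrt r this is the value at which the bound Q \<le> c1 r^2
    gives exactly T' \<le> \<open>stretch\<close>; K comes in the same way from the lower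
    bound.\<close>
  define \<kappa> where "\<kappa> = sqrt (2 / c1)"
  define K where "K = sqrt (2 / c2)"
  have pos: "0 < \<kappa>" "0 < K" and sq: "\<kappa>^2 = 2 / c1" "K^2 = 2 / c2"
    using c by (simp_all add: \<kappa>_def K_def)
  let ?T = "\<lambda>r. \<kappa> * sqrt r" and ?G = "\<lambda>r. K * sqrt r"
  have D: "((\<lambda>r. k * sqrt r) has_real_derivative k / (2 * sqrt r)) (at r)" if "0 < r" for k r
    using that by (auto intro!: derivative_eq_intros simp: field_simps)
  have S: "(k / (2 * sqrt r))^2 * (2 * Q) = k^2 * Q / (2 * r)" if "0 < r" for k r Q :: real
    using that by (simp add: power_divide power_mult_distrib)
  have T: "minorant ?T"
  proof (rule minorantI)
    fix r assume r: "r \<in> ival a b"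
    then have r': "a < r" "0 < r" using a_pos by auto
    have "\<kappa>^2 * profile h r \<le> \<kappa>^2 * (c1 * r^2)" using up[OF r'(1)] by (intro mult_left_mono) auto
    also have "\<dots> = r * (2 * r)" unfolding sq using c by (simp add: power2_eq_square)
    finally show "0 \<le> \<kappa> / (2 * sqrt r) \<and> (\<kappa> / (2 * sqrt r))^2 * (2 * profile h r) \<le> r"
      unfolding S[OF r'(2)] using r' pos by (simp add: divide_le_eq)
  qed (use a_pos in \<open>auto intro!: D\<close>)
  show "complete_metric m a b h"
  proof (rule complete_metricI[OF T])
    fix M
    show "\<exists>r1. ereal r1 < b \<and> (\<forall>r. a \<le> r \<and> ereal r < b \<and> \<bar>?T r\<bar> \<le> M \<longrightarrow> r \<le> r1)"
    proof (intro exI[of _ "(M / \<kappa>)^2"] conjI allI impI)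
      fix r assume r: "a \<le> r \<and> ereal r < b \<and> \<bar>?T r\<bar> \<le> M"
      then have "?T r \<le> M" by linarith
      then have "sqrt r \<le> M / \<kappa>" using pos by (simp add: pos_le_divide_eq mult.commute)
      then show "r \<le> (M / \<kappa>)^2" by (rule sqrt_le_D)
    qed (simp add: b)
  qed
  show "quartic_volume_growth m a b h"
    unfolding quartic_volume_growth_def
  proof (intro allI impI)
    fix p assume p: "act p \<in> polygon a b"
    define t where "t = \<kappa> * sqrt (rr p)"
    have t: "0 \<le> t" using pos p a_pos by (auto simp: t_def act_in_polygon)
    have r0': "r0 \<in> ival a b" using r0 b by simp
    obtain A where A: "\<And>\<rho> R. 2 * r0 < \<rho> \<Longrightarrow> ereal \<rho> < b \<Longrightarrow> A + ?G \<rho> < R \<Longrightarrow>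
      ennreal (vol_const * \<rho>^2) \<le> riem_vol m a b h (riem_ball m a b h p R)"
    proof (rule ball_volume_ge[OF p r0', of ?G "\<lambda>r. K / (2 * sqrt r)"])
      fix r assume r: "r0 \<le> r"
      then have r': "0 < r" using r0 a_pos by simp
      show "(?G has_real_derivative K / (2 * sqrt r)) (at r)" by (rule D[OF r'])
      have "r * (2 * r) = K^2 * (c2 * r^2)" unfolding sq using c by (simp add: power2_eq_square)
      also have "\<dots> \<le> K^2 * profile h r" using low[OF r] by (intro mult_left_mono) auto
      finally show "stretch r \<le> K / (2 * sqrt r)"
        using r r' r0 pos b by (intro stretch_le) (simp_all add: S le_divide_eq)
    qed blast
    show "\<exists>C1>0. \<exists>C2>0. \<exists>R0. \<forall>R\<ge>R0.
          ennreal (C1 * R ^ 4) \<le> riem_vol m a b h (riem_ball m a b h p R) \<and>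
          riem_vol m a b h (riem_ball m a b h p R) \<le> ennreal (C2 * R ^ 4)"
    \<comment> \<open>One half of R pays for the ray, the other absorbs A, whence R/(2 K). The
      threshold with r0 makes the square of this number exceed 2 r0, and R \<ge> t turns a
      difference of T below R into T \<le> 2 R.\<close>
    proof (rule exI[of _ "vol_const / (2 * K)^4"], rule conjI, (use pos vol_const_pos in simp),
        rule exI[of _ "8 * pi^2 * (2 / \<kappa>)^4"], rule conjI, (use pos in simp),
        rule exI[of _ "max (2 * K * (2 * r0 + 1)) (max t (2 * \<bar>A\<bar> + 1))"], intro allI impI conjI)
      fix R assume "max (2 * K * (2 * r0 + 1)) (max t (2 * \<bar>A\<bar> + 1)) \<le> R"
      then have R: "2 * K * (2 * r0 + 1) \<le> R" "t \<le> R" "2 * \<bar>A\<bar> + 1 \<le> R" by auto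
      then have R0: "0 < R" by simp
      let ?\<rho> = "(R / (2 * K))^2"
      have x: "2 * r0 + 1 \<le> R / (2 * K)" using R(1) pos by (simp add: pos_le_divide_eq mult.commute)
      then have "2 * r0 + 1 \<le> (R / (2 * K)) * 1" by simp
      also have "\<dots> \<le> (R / (2 * K)) * (R / (2 * K))" using x r0 a_pos by (intro mult_left_mono) auto
      finally have "2 * r0 < ?\<rho>" by (simp add: power2_eq_square)
      moreover have "A + ?G ?\<rho> < R" using R pos R0 by simp
      ultimately have "ennreal (vol_const * ?\<rho>^2) \<le> riem_vol m a b h (riem_ball m a b h p R)"
        by (intro A) (simp_all add: b)
      moreover have "vol_const * ?\<rho>^2 = vol_const / (2 * K)^4 * R^4" by (simp add: power_divide flip: power_mult)
      ultimately show "ennreal (vol_const / (2 * K)^4 * R^4) \<le> riem_vol m a b h (riem_ball m a b h p R)" by simp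
      have "riem_vol m a b h (riem_ball m a b h p R) \<le> ennreal (8 * pi^2 * ((2 * R / \<kappa>)^2)^2)"
      proof (rule ball_volume_le[OF T p])
        fix r assume r: "a \<le> r" "\<bar>?T r - ?T (rr p)\<bar> < R"
        then have "\<kappa> * sqrt r \<le> 2 * R" using R(2) by (simp add: t_def)
        then have "sqrt r \<le> 2 * R / \<kappa>" using pos by (simp add: pos_le_divide_eq mult.commute)
        then show "r \<le> (2 * R / \<kappa>)^2" by (rule sqrt_le_D)
      qed simp
      also have "8 * pi^2 * ((2 * R / \<kappa>)^2)^2 = 8 * pi^2 * (2 / \<kappa>)^4 * R^4"
        by (simp add: power_divide power_mult_distrib flip: power_mult)
      finally show "riem_vol m a b h (riem_ball m a b h p R) \<le> ennreal (8 * pi^2 * (2 / \<kappa>)^4 * R^4)" .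
    qed
  qed
qed

text \<open>For Q of order r^3 the length element is of order 1/r, so the distance is logarithmic in
  r and the volume, of order r^2, is exponential in the distance.\<close>

lemma exponential_case:
  assumes b: "b = \<infinity>" and c: "0 < c1" "0 < c2" and r0: "a < r0"
    and up: "\<And>r. a < r \<Longrightarrow> profile h r \<le> c1 * r^3"
    and low: "\<And>r. r0 \<le> r \<Longrightarrow> c2 * r^3 \<le> profile h r"
  shows "complete_metric m a b h" "exponential_volume_growth m a b h"
proof -
  define \<kappa> where "\<kappa> = sqrt (1 / (2 * c1))"
  define K where "K = sqrt (1 / (2 * c2))"
  have pos: "0 < \<kappa>" "0 < K" and sq: "\<kappa>^2 = 1 / (2 * c1)" "K^2 = 1 / (2 * c2)"
    using c by (simp_all add: \<kappa>_def K_def)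
  let ?T = "\<lambda>r. \<kappa> * ln r" and ?G = "\<lambda>r. K * ln r"
  have D: "((\<lambda>r. k * ln r) has_real_derivative k / r) (at r)" if "0 < r" for k r
    using that by (auto intro!: derivative_eq_intros)
  have T: "minorant ?T"
  proof (rule minorantI)
    fix r assume r: "r \<in> ival a b"
    then have r': "a < r" "0 < r" using a_pos by auto
    have "\<kappa>^2 * (2 * profile h r) \<le> \<kappa>^2 * (2 * (c1 * r^3))" using up[OF r'(1)] by (intro mult_left_mono) auto
    also have "\<dots> = r * r^2" unfolding sq using c by (simp add: power2_eq_square power3_eq_cube)
    finally show "0 \<le> \<kappa> / r \<and> (\<kappa> / r)^2 * (2 * profile h r) \<le> r"
      using r' pos by (simp add: power_divide divide_le_eq)
  qed (use a_pos in \<open>auto intro!: D\<close>)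
  show "complete_metric m a b h"
  proof (rule complete_metricI[OF T])
    fix M
    show "\<exists>r1. ereal r1 < b \<and> (\<forall>r. a \<le> r \<and> ereal r < b \<and> \<bar>?T r\<bar> \<le> M \<longrightarrow> r \<le> r1)"
    proof (intro exI[of _ "exp (M / \<kappa>)"] conjI allI impI)
      fix r assume r: "a \<le> r \<and> ereal r < b \<and> \<bar>?T r\<bar> \<le> M"
      then have "?T r \<le> M" by linarith
      then have "ln r \<le> M / \<kappa>" using pos by (simp add: pos_le_divide_eq mult.commute)
      then show "r \<le> exp (M / \<kappa>)" using r a_pos ln_le_cancel_iff[of r "exp (M / \<kappa>)"] by simp
    qed (simp add: b)
  qed
  show "exponential_volume_growth m a b h"
    unfolding exponential_volume_growth_def
  proof (intro allI impI)
    fix p assume p: "act p \<in> polygon a b"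
    then have rp: "0 < rr p" using a_pos by (auto simp: act_in_polygon)
    have r0': "r0 \<in> ival a b" using r0 b by simp
    obtain A where A: "\<And>\<rho> R. 2 * r0 < \<rho> \<Longrightarrow> ereal \<rho> < b \<Longrightarrow> A + ?G \<rho> < R \<Longrightarrow>
      ennreal (vol_const * \<rho>^2) \<le> riem_vol m a b h (riem_ball m a b h p R)"
    proof (rule ball_volume_ge[OF p r0', of ?G "\<lambda>r. K / r"])
      fix r assume r: "r0 \<le> r"
      then have r': "0 < r" using r0 a_pos by simp
      show "(?G has_real_derivative K / r) (at r)" by (rule D[OF r'])
      have "r * r^2 = K^2 * (2 * (c2 * r^3))" unfolding sq using c by (simp add: power2_eq_square power3_eq_cube)
      also have "\<dots> \<le> K^2 * (2 * profile h r)" using low[OF r] by (intro mult_left_mono) auto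
      finally show "stretch r \<le> K / r"
        using r r' r0 pos b by (intro stretch_le) (simp_all add: power_divide le_divide_eq)
    qed blast
    show "\<exists>C1>0. \<exists>C2>0. \<exists>c1>0. \<exists>c2>0. \<exists>R0. \<forall>R\<ge>R0.
          ennreal (C1 * exp (c1 * R)) \<le> riem_vol m a b h (riem_ball m a b h p R) \<and>
          riem_vol m a b h (riem_ball m a b h p R) \<le> ennreal (C2 * exp (c2 * R))"
    proof (rule exI[of _ vol_const], rule conjI, rule vol_const_pos,
        rule exI[of _ "8 * pi^2 * (rr p)^2"], rule conjI, (use rp in simp),
        rule exI[of _ "1 / K"], rule conjI, (use pos in simp),
        rule exI[of _ "2 / \<kappa>"], rule conjI, (use pos in simp),
        rule exI[of _ "max (2 * K * (2 * r0)) (2 * \<bar>A\<bar> + 1)"], intro allI impI conjI)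
      fix R assume "max (2 * K * (2 * r0)) (2 * \<bar>A\<bar> + 1) \<le> R"
      then have R: "2 * K * (2 * r0) \<le> R" "2 * \<bar>A\<bar> + 1 \<le> R" by auto
      let ?\<rho> = "exp (R / (2 * K))"
      have "2 * r0 \<le> R / (2 * K)" using R(1) pos by (simp add: pos_le_divide_eq mult.commute)
      also have "\<dots> < ?\<rho>" using exp_ge_add_one_self[of "R / (2 * K)"] by linarith
      finally have "2 * r0 < ?\<rho>" .
      moreover have "A + ?G ?\<rho> < R" using R pos by simp
      ultimately have "ennreal (vol_const * ?\<rho>^2) \<le> riem_vol m a b h (riem_ball m a b h p R)"
        by (intro A) (simp_all add: b)
      moreover have "?\<rho>^2 = exp (1 / K * R)" using pos by (simp add: exp_double[symmetric])
      ultimately show "ennreal (vol_const * exp (1 / K * R)) \<le> riem_vol m a b h (riem_ball m a b h p R)" by simp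
      have "riem_vol m a b h (riem_ball m a b h p R) \<le> ennreal (8 * pi^2 * (rr p * exp (R / \<kappa>))^2)"
      proof (rule ball_volume_le[OF T p])
        show "0 \<le> rr p * exp (R / \<kappa>)" using rp by simp
        fix r assume r: "a \<le> r" "\<bar>?T r - ?T (rr p)\<bar> < R"
        then have r': "0 < r" using a_pos by simp
        have "\<kappa> * ln r \<le> \<kappa> * ln (rr p) + R" using r by linarith
        then have "ln r \<le> (\<kappa> * ln (rr p) + R) / \<kappa>" using pos by (simp add: pos_le_divide_eq mult.commute)
        also have "\<dots> = ln (rr p * exp (R / \<kappa>))" using pos rp by (simp add: ln_mult add_divide_distrib)
        finally show "r \<le> rr p * exp (R / \<kappa>)" using r' rp by simp
      qed
      also have "8 * pi^2 * (rr p * exp (R / \<kappa>))^2 = 8 * pi^2 * (rr p)^2 * exp (2 / \<kappa> * R)"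
        by (simp add: power_mult_distrib exp_double[symmetric])
      finally show "riem_vol m a b h (riem_ball m a b h p R) \<le> ennreal (8 * pi^2 * (rr p)^2 * exp (2 / \<kappa> * R))" .
    qed
  qed
qed

text \<open>For Q of order r^4 the length element is of order r^(-3/2), which is integrable at
  infinity: the end is at finite distance.\<close>

lemma incomplete_infinite_case:
  assumes b: "b = \<infinity>" and c: "0 < c1" "0 < c2" and r0: "a < r0"
    and up: "\<And>r. a < r \<Longrightarrow> profile h r \<le> c1 * r^4"
    and low: "\<And>r. r0 \<le> r \<Longrightarrow> c2 * r^4 \<le> profile h r"
  shows "\<not> complete_metric m a b h"
proof -
  define \<kappa> where "\<kappa> = sqrt (2 / c1)"
  define K where "K = sqrt (2 / c2)"
  have pos: "0 < \<kappa>" "0 < K" and sq: "\<kappa>^2 = 2 / c1" "K^2 = 2 / c2"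
    using c by (simp_all add: \<kappa>_def K_def)
  let ?T = "\<lambda>r. - \<kappa> / sqrt r" and ?G = "\<lambda>r. - K / sqrt r"
  have D: "((\<lambda>r. - k / sqrt r) has_real_derivative k / (2 * (r * sqrt r))) (at r)" if "0 < r" for k r
    using that by (auto intro!: derivative_eq_intros simp: field_simps)
  have S: "(k / (2 * (r * sqrt r)))^2 * (2 * Q) = k^2 * Q / (2 * r^3)" if "0 < r" for k r Q :: real
    using that by (simp add: power_divide power_mult_distrib power3_eq_cube power2_eq_square mult_ac)
  have T: "minorant ?T"
  proof (rule minorantI)
    fix r assume r: "r \<in> ival a b"
    then have r': "a < r" "0 < r" using a_pos by auto
    have "\<kappa>^2 * profile h r \<le> \<kappa>^2 * (c1 * r^4)" using up[OF r'(1)] by (intro mult_left_mono) auto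
    also have "\<dots> = r * (2 * r^3)" unfolding sq using c by (simp add: eval_nat_numeral)
    finally show "0 \<le> \<kappa> / (2 * (r * sqrt r)) \<and> (\<kappa> / (2 * (r * sqrt r)))^2 * (2 * profile h r) \<le> r"
      unfolding S[OF r'(2)] using r' pos by (simp add: divide_le_eq)
  qed (rule D, use a_pos in simp)
  show ?thesis
  proof (rule not_complete_metricI[OF T, of r0 ?G "\<lambda>r. K / (2 * (r * sqrt r))" 0])
    show "?T r < ?T r'" if "a \<le> r" "r < r'" for r r'
      using that a_pos pos by (simp add: divide_strict_left_mono)
    show "r0 \<in> ival a b" using r0 b by simp
    fix r assume r: "r0 \<le> r"
    then have r': "0 < r" using r0 a_pos by simp
    show "(?G has_real_derivative K / (2 * (r * sqrt r))) (at r)" by (rule D[OF r'])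
    have "r * (2 * r^3) = K^2 * (c2 * r^4)" unfolding sq using c by (simp add: eval_nat_numeral)
    also have "\<dots> \<le> K^2 * profile h r" using low[OF r] by (intro mult_left_mono) auto
    finally show "stretch r \<le> K / (2 * (r * sqrt r))"
      using r r' r0 pos b by (intro stretch_le) (simp_all add: S le_divide_eq)
    show "?G r \<le> 0" using pos r' by simp
  qed
qed

text \<open>At a double zero the length element is at least a multiple of 1/(c - r), so the
  logarithm of c - r supplies a proper minorant.\<close>

lemma complete_finite_case:
  assumes b: "b = ereal c" and c1: "0 < c1"
    and up: "\<And>r. a < r \<Longrightarrow> r < c \<Longrightarrow> profile h r \<le> c1 * (c - r)^2"
  shows "complete_metric m a b h"
proof -
  define \<kappa> where "\<kappa> = sqrt (a / (2 * c1))"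
  have pos: "0 < \<kappa>" and sq: "\<kappa>^2 = a / (2 * c1)"
    using c1 a_pos by (simp_all add: \<kappa>_def)
  let ?T = "\<lambda>r. - \<kappa> * ln (c - r)"
  have T: "minorant ?T"
  proof (rule minorantI)
    show "(?T has_real_derivative \<kappa> / (c - r)) (at r)" if "ereal r < b" for r
      using that by (auto simp: b intro!: derivative_eq_intros)
    fix r assume "r \<in> ival a b"
    then have r: "a < r" "r < c" by (auto simp: b)
    have "\<kappa>^2 * (2 * profile h r) \<le> \<kappa>^2 * (2 * (c1 * (c - r)^2))" using up[OF r] by (intro mult_left_mono) auto
    also have "\<dots> = a * (c - r)^2" using c1 by (simp add: sq)
    also have "\<dots> \<le> r * (c - r)^2" using r by (intro mult_right_mono) auto
    finally show "0 \<le> \<kappa> / (c - r) \<and> (\<kappa> / (c - r))^2 * (2 * profile h r) \<le> r"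
      using r pos by (simp add: power_divide divide_le_eq)
  qed
  show "complete_metric m a b h"
  proof (rule complete_metricI[OF T])
    fix M
    show "\<exists>r1. ereal r1 < b \<and> (\<forall>r. a \<le> r \<and> ereal r < b \<and> \<bar>?T r\<bar> \<le> M \<longrightarrow> r \<le> r1)"
    proof (intro exI[of _ "c - exp (- M / \<kappa>)"] conjI allI impI)
      fix r assume r: "a \<le> r \<and> ereal r < b \<and> \<bar>?T r\<bar> \<le> M"
      then have "?T r \<le> M" by linarith
      then have "- M / \<kappa> \<le> ln (c - r)" using pos by (simp add: field_simps)
      then show "r \<le> c - exp (- M / \<kappa>)" using r ln_ge_iff[of "c - r" "- M / \<kappa>"] by (simp add: b)
    qed (simp add: b)
  qed
qed

text \<open>Under a linear lower bound on Q the length element is at most a multiple of (c -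
  r)^(-1/2), integrable up to c. The upper bound on Q yields the linear minorant that separates the
  end from interior levels.\<close>

lemma incomplete_finite_case:
  assumes b: "b = ereal c" and c: "0 < c1" "0 < c2" and r0: "a < r0" "r0 < c"
    and up: "\<And>r. a < r \<Longrightarrow> r < c \<Longrightarrow> profile h r \<le> c1"
    and low: "\<And>r. r0 \<le> r \<Longrightarrow> r < c \<Longrightarrow> c2 * (c - r) \<le> profile h r"
  shows "\<not> complete_metric m a b h"
proof -
  define \<kappa> where "\<kappa> = sqrt (a / (2 * c1))"
  define K where "K = sqrt (2 * c / c2)"
  have cp: "0 < c" using r0 a_pos by simp
  have pos: "0 < \<kappa>" "0 < K" and sq: "\<kappa>^2 = a / (2 * c1)" "K^2 = 2 * c / c2"
    using c cp a_pos by (simp_all add: \<kappa>_def K_def)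
  have T: "minorant (\<lambda>r. \<kappa> * r)"
  proof (rule minorantI)
    show "((\<lambda>r. \<kappa> * r) has_real_derivative \<kappa>) (at r)" for r by (auto intro!: derivative_eq_intros)
    fix r assume "r \<in> ival a b"
    then have r: "a < r" "r < c" by (auto simp: b)
    have "\<kappa>^2 * (2 * profile h r) \<le> \<kappa>^2 * (2 * c1)" using up[OF r] by (intro mult_left_mono) auto
    also have "\<dots> = a" using c by (simp add: sq)
    finally show "0 \<le> \<kappa> \<and> \<kappa>^2 * (2 * profile h r) \<le> r" using r pos by simp
  qed
  show ?thesis
  proof (rule not_complete_metricI[OF T, of r0 "\<lambda>r. - K * sqrt (c - r)" "\<lambda>r. K / (2 * sqrt (c - r))" 0])
    show "\<kappa> * r < \<kappa> * r'" if "r < r'" for r r' using that pos by simp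
    show "r0 \<in> ival a b" using r0 b by simp
    fix r assume "r0 \<le> r" "ereal r < b"
    then have r: "r0 \<le> r" "r < c" "0 < r" using r0 a_pos by (auto simp: b)
    show "((\<lambda>r. - K * sqrt (c - r)) has_real_derivative K / (2 * sqrt (c - r))) (at r)"
      using r by (auto intro!: derivative_eq_intros simp: field_simps)
    have "r * (2 * (c - r)) \<le> c * (2 * (c - r))" using r by (intro mult_right_mono) auto
    also have "\<dots> = K^2 * (c2 * (c - r))" using c by (simp add: sq)
    also have "\<dots> \<le> K^2 * profile h r" using low[OF r(1,2)] by (intro mult_left_mono) auto
    finally have "r \<le> K^2 * profile h r / (2 * (c - r))" using r by (simp add: le_divide_eq)
    also have "\<dots> = (K / (2 * sqrt (c - r)))^2 * (2 * profile h r)"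
    proof -
      have "(K / (2 * x))^2 * (2 * Q) = K^2 * Q / (2 * x^2)" for x Q
        by (simp add: power_divide power_mult_distrib)
      then show ?thesis using r by simp
    qed
    finally show "stretch r \<le> K / (2 * sqrt (c - r))"
      using r r0 pos b by (intro stretch_le) simp_all
    show "- K * sqrt (c - r) \<le> 0" using pos r by simp
  qed
qed

end

section \<open>The members of the family\<close>

locale family_metric =
  fixes m :: nat and a t :: real and h :: "real \<Rightarrow> real"
  assumes m1: "m \<ge> 1" and a0: "0 < a" and member: "family_member m a t h"
begin

sublocale u2_metric m a "fam_end m a t" h
  using family_u2_kaehler[OF m1 a0 member] a0 m1 by unfold_locales

lemma profile_family: "r \<in> ival a (fam_end m a t) \<Longrightarrow> profile h r = a^2 * fam_poly m t (r / a)"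
  using member a0 by (intro fam_profile) (auto simp: family_member_def)

abbreviation "\<alpha> \<equiv> fam_\<alpha> m t"

definition lower_sum :: real where
  "lower_sum = \<bar>fam_\<beta> m t\<bar> + 1 + \<bar>fam_\<gamma> m t\<bar> + \<bar>fam_\<delta> m t\<bar>"

lemma lower_sum_pos: "0 < lower_sum"
  by (simp add: lower_sum_def add_nonneg_pos add_pos_nonneg)

lemma fam_poly_leading:
  assumes \<rho>: "1 \<le> \<rho>"
  shows "\<bar>fam_poly m t \<rho> - \<alpha> * \<rho>^4\<bar> \<le> lower_sum * \<rho>^3"
proof -
  have p: "\<rho>^2 \<le> \<rho>^3" "\<rho> \<le> \<rho>^3" "1 \<le> \<rho>^3"
    using \<rho> power_increasing[of 2 3 \<rho>] power_increasing[of 1 3 \<rho>] by simp_all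
  have "fam_poly m t \<rho> - \<alpha> * \<rho>^4 = fam_\<beta> m t * \<rho>^3 + \<rho>^2 + fam_\<gamma> m t * \<rho> + fam_\<delta> m t"
    by (simp add: fam_poly_quartic quartic_def)
  also have "\<bar>\<dots>\<bar> \<le> \<bar>fam_\<beta> m t * \<rho>^3\<bar> + \<bar>\<rho>^2\<bar> + \<bar>fam_\<gamma> m t * \<rho>\<bar> + \<bar>fam_\<delta> m t\<bar>"
    by linarith
  also have "\<dots> = \<bar>fam_\<beta> m t\<bar> * \<rho>^3 + 1 * \<rho>^2 + \<bar>fam_\<gamma> m t\<bar> * \<rho> + \<bar>fam_\<delta> m t\<bar> * 1"
    using \<rho> by (simp add: abs_mult)
  also have "\<dots> \<le> \<bar>fam_\<beta> m t\<bar> * \<rho>^3 + 1 * \<rho>^3 + \<bar>fam_\<gamma> m t\<bar> * \<rho>^3 + \<bar>fam_\<delta> m t\<bar> * \<rho>^3"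
    by (intro add_mono mult_left_mono p) auto
  finally show ?thesis by (simp add: lower_sum_def algebra_simps)
qed

text \<open>A negative leading coefficient would make the polynomial negative far out, while before
  the end it is positive.\<close>

lemma alpha_nonneg:
  assumes inf: "fam_end m a t = \<infinity>"
  shows "0 \<le> \<alpha>"
proof (rule ccontr)
  assume "\<not> 0 \<le> \<alpha>"
  then have neg: "\<alpha> < 0" by simp
  \<comment> \<open>Chosen so that \<alpha> \<rho> + \<open>lower_sum\<close> equals \<alpha>: here
    the leading term already outweighs all others.\<close>
  define \<rho> where "\<rho> = 1 + lower_sum / (- \<alpha>)"
  have \<rho>: "1 < \<rho>" using neg lower_sum_pos by (simp add: \<rho>_def divide_pos_neg)
  have "0 < fam_poly m t (a * \<rho> / a)"
    using \<rho> a0 by (intro fam_poly_pos[OF m1 a0]) (simp add: inf)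
  then have "0 < fam_poly m t \<rho>" using a0 by simp
  also have "\<dots> \<le> \<alpha> * \<rho>^4 + lower_sum * \<rho>^3" using fam_poly_leading[of \<rho>] \<rho> by linarith
  also have "\<dots> = \<rho>^3 * (\<alpha> * \<rho> + lower_sum)" by (simp add: algebra_simps eval_nat_numeral)
  also have "\<alpha> * \<rho> + lower_sum = \<alpha>" using neg by (simp add: \<rho>_def field_simps)
  finally show False using neg \<rho> by (simp add: zero_less_mult_iff)
qed

lemma incomplete_if_alpha_pos:
  assumes inf: "fam_end m a t = \<infinity>" and pos: "0 < \<alpha>"
  shows "\<not> complete_metric m a (fam_end m a t) h"
\<comment> \<open>Beyond the last value the terms of lower degree amount to at most half of the
  leading term, which explains the factor 2 in the lower constant.\<close>
proof (rule incomplete_infinite_case[OF inf, of "(\<alpha> + lower_sum) / a^2" "\<alpha> / (2 * a^2)" "a * max 2 (2 * lower_sum / \<alpha>)"])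
  show "0 < (\<alpha> + lower_sum) / a^2" "0 < \<alpha> / (2 * a^2)" using pos lower_sum_pos a0 by simp_all
  have "a * 1 < a * max 2 (2 * lower_sum / \<alpha>)" using a0 by (intro mult_strict_left_mono) auto
  then show g: "a < a * max 2 (2 * lower_sum / \<alpha>)" by simp
  have prof: "profile h r = a^2 * fam_poly m t (r / a)" if "a < r" for r
    using that by (intro profile_family) (simp add: inf)
  show "profile h r \<le> (\<alpha> + lower_sum) / a^2 * r^4" if r: "a < r" for r
  proof -
    have \<rho>: "1 \<le> r / a" using r a0 by simp
    have "(r / a)^3 \<le> (r / a)^4" using \<rho> by (intro power_increasing) auto
    then have "lower_sum * (r / a)^3 \<le> lower_sum * (r / a)^4" using lower_sum_pos by (intro mult_left_mono) auto
    then have "fam_poly m t (r / a) \<le> (\<alpha> + lower_sum) * (r / a)^4"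
      using fam_poly_leading[OF \<rho>] by (simp add: algebra_simps)
    then have "a^2 * fam_poly m t (r / a) \<le> a^2 * ((\<alpha> + lower_sum) * (r / a)^4)" by (intro mult_left_mono) auto
    then show ?thesis using a0 unfolding prof[OF r] by (simp add: power_divide eval_nat_numeral)
  qed
  show "\<alpha> / (2 * a^2) * r^4 \<le> profile h r" if r: "a * max 2 (2 * lower_sum / \<alpha>) \<le> r" for r
  proof -
    have ar: "a < r" using g r by simp
    have \<rho>: "1 \<le> r / a" using ar a0 by simp
    have "max 2 (2 * lower_sum / \<alpha>) * a \<le> r" using r by (simp only: mult.commute)
    then have "max 2 (2 * lower_sum / \<alpha>) \<le> r / a" by (simp only: pos_le_divide_eq[OF a0])
    then have "2 * lower_sum / \<alpha> \<le> r / a" by simp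
    moreover have "lower_sum \<le> \<alpha> / 2 * y" if "2 * lower_sum / \<alpha> \<le> y" for y
      using that pos by (simp add: field_simps)
    ultimately have "lower_sum \<le> \<alpha> / 2 * (r / a)" by blast
    moreover have "\<alpha> / 2 * y^4 \<le> fam_poly m t y" if y: "1 \<le> y" "lower_sum \<le> \<alpha> / 2 * y" for y
    proof -
      have "lower_sum * y^3 \<le> \<alpha> / 2 * y * y^3" using y by (intro mult_right_mono) auto
      also have "\<dots> = \<alpha> / 2 * y^4" by (simp add: eval_nat_numeral)
      finally have "lower_sum * y^3 \<le> \<alpha> / 2 * y^4" .
      moreover have "\<alpha> * y^4 = \<alpha> / 2 * y^4 + \<alpha> / 2 * y^4" by simp
      ultimately show ?thesis using fam_poly_leading[OF y(1)] by linarith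
    qed
    ultimately have "\<alpha> / 2 * (r / a)^4 \<le> fam_poly m t (r / a)" using \<rho> by blast
    then have "a^2 * (\<alpha> / 2 * (r / a)^4) \<le> a^2 * fam_poly m t (r / a)" by (intro mult_left_mono) auto
    then show ?thesis using a0 unfolding prof[OF ar] by (simp add: power_divide eval_nat_numeral)
  qed
qed

text \<open>Here \<alpha> = \<beta> = 0, the scalar-flat member, with Q = (r - a) (r + (m - 1) a).
  For m = 2 this is the Eguchi-Hanson metric.\<close>

lemma parameter_zero:
  assumes t: "t = 0"
  shows "complete_metric m a (fam_end m a t) h" "quartic_volume_growth m a (fam_end m a t) h"
proof -
  have m: "real m \<ge> 1" using m1 by simp
  have C: "fam_cubic m t \<rho> = \<rho> + (real m - 1)" for \<rho>
    using m by (simp add: t fam_cubic_def fam_coeff_defs)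
  have inf: "fam_end m a t = \<infinity>"
  proof (rule fam_end_cases[OF m1 a0, of t])
    fix c assume "a < c" "fam_cubic m t (c / a) = 0"
    then show ?thesis unfolding C using m a0 by (simp add: add_pos_nonneg less_imp_neq[symmetric])
  qed
  have prof: "profile h r = (r - a) * (r + (real m - 1) * a)" if r: "a < r" for r
  proof -
    have "r \<in> ival a (fam_end m a t)" using r by (simp add: inf)
    then have "profile h r = a^2 * ((r / a - 1) * (r / a + (real m - 1)))"
      by (simp add: profile_family fam_poly_factor[OF m1] C)
    also have "\<dots> = (a * (r / a - 1)) * (a * (r / a + (real m - 1)))" by (simp add: power2_eq_square)
    finally have *: "profile h r = (a * (r / a - 1)) * (a * (r / a + (real m - 1)))" .
    have "a * (r / a - 1) = r - a" "a * (r / a + (real m - 1)) = r + (real m - 1) * a"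
      using a0 by (simp_all add: field_simps)
    then show ?thesis using * by simp
  qed
  have up: "profile h r \<le> real m * r^2" if r: "a < r" for r
  proof -
    have "(r - a) * (r + (real m - 1) * a) \<le> r * (r + (real m - 1) * r)"
      using r a0 m by (intro mult_mono add_mono mult_left_mono) auto
    then show ?thesis unfolding prof[OF r] by (simp add: algebra_simps power2_eq_square)
  qed
  have low: "1 / 2 * r^2 \<le> profile h r" if r: "2 * a \<le> r" for r
  proof -
    have "r / 2 * r \<le> (r - a) * (r + (real m - 1) * a)" using r a0 m by (intro mult_mono) auto
    then show ?thesis using r a0 by (simp add: prof power2_eq_square)
  qed
  have "0 < real m" "a < 2 * a" using m a0 by auto
  note Q = quartic_case[OF inf this(1) _ this(2) up low]
  show "complete_metric m a (fam_end m a t) h" "quartic_volume_growth m a (fam_end m a t) h"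
    using Q by simp_all
qed

text \<open>The nonzero root of \<alpha> = 0 in t. There \<gamma> vanishes too, and the metric is
  Kaehler-Einstein with scalar curvature - 12 t/a < 0.\<close>

lemma parameter_exponential:
  assumes t: "3 * t = real m - 2" and tpos: "0 < t"
  shows "complete_metric m a (fam_end m a t) h" "exponential_volume_growth m a (fam_end m a t) h"
proof -
  have m: "real m = 3 * t + 2" using t by simp
  have P: "fam_poly m t \<rho> = t * \<rho>^3 + \<rho>^2 - (1 + t)" for \<rho>
  proof -
    have "\<alpha> = 0" by (simp add: fam_\<alpha>_def m power2_eq_square)
    then have "fam_\<beta> m t = t" "fam_\<gamma> m t = 0" "fam_\<delta> m t = - (1 + t)"
      using fam_coeffs(1-3)[of "real m" t] m1 m by simp_all
    then show ?thesis using \<open>\<alpha> = 0\<close> by (simp add: fam_poly_quartic quartic_def)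
  qed
  have pos: "0 < fam_poly m t \<rho>" if \<rho>: "1 < \<rho>" for \<rho>
  proof -
    have "1 < \<rho>^2" "1 < \<rho>^3" using \<rho> by (simp_all add: one_less_power)
    then have "t * 1 < t * \<rho>^3" "1 < \<rho>^2" using tpos by (simp_all only: mult_less_cancel_left_pos)
    then show ?thesis unfolding P by linarith
  qed
  have inf: "fam_end m a t = \<infinity>"
  proof (rule fam_end_cases[OF m1 a0, of t])
    fix c assume c: "a < c" "fam_cubic m t (c / a) = 0"
    then show ?thesis using pos[of "c / a"] a0 by (simp add: fam_poly_factor[OF m1])
  qed
  have prof: "profile h r = a^2 * fam_poly m t (r / a)" if "a < r" for r
    using that by (intro profile_family) (simp add: inf)
  have up: "profile h r \<le> (1 + t) / a * r^3" if r: "a < r" for r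
  proof -
    have \<rho>: "1 \<le> r / a" using r a0 by simp
    have "(r / a)^2 \<le> (r / a)^3" using \<rho> by (intro power_increasing) auto
    then have "fam_poly m t (r / a) \<le> (1 + t) * (r / a)^3" unfolding P using tpos by (simp add: algebra_simps)
    then have "a^2 * fam_poly m t (r / a) \<le> a^2 * ((1 + t) * (r / a)^3)" by (intro mult_left_mono) auto
    then show ?thesis using a0 unfolding prof[OF r] by (simp add: power_divide eval_nat_numeral)
  qed
  have g: "a < a * (1 + t)" using a0 tpos by (simp add: algebra_simps)
  have low: "t / a * r^3 \<le> profile h r" if r: "a * (1 + t) \<le> r" for r
  proof -
    have ar: "a < r" using r g by simp
    have \<rho>: "1 + t \<le> r / a" using r a0 by (simp add: pos_le_divide_eq mult.commute)
    then have "(1 + t) * 1 \<le> r / a * (r / a)" using tpos by (intro mult_mono) auto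
    then have "t * (r / a)^3 \<le> fam_poly m t (r / a)" unfolding P by (simp add: power2_eq_square)
    then have "a^2 * (t * (r / a)^3) \<le> a^2 * fam_poly m t (r / a)" by (intro mult_left_mono) auto
    then show ?thesis using a0 unfolding prof[OF ar] by (simp add: power_divide eval_nat_numeral)
  qed
  have "0 < (1 + t) / a" "0 < t / a" using tpos a0 by simp_all
  note E = exponential_case[OF inf this g up low]
  show "complete_metric m a (fam_end m a t) h" "exponential_volume_growth m a (fam_end m a t) h"
    using E by simp_all
qed

text \<open>A finite end bounds r and hence the volume. At an infinite end completeness leaves only
  \<alpha> = 0, an equation in t with roots 0 and (m - 2)/3; the latter is negative only for m = 1,
  where the end is in fact finite.\<close>

lemma complete_cases:
  assumes "complete_metric m a (fam_end m a t) h"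
  shows "exponential_volume_growth m a (fam_end m a t) h \<or> quartic_volume_growth m a (fam_end m a t) h
    \<or> finite_volume m a (fam_end m a t) h"
proof (cases "fam_end m a t")
  case (real c)
  then show ?thesis using finite_volumeI by blast
next
  case PInf
  then have inf: "fam_end m a t = \<infinity>" by simp
  have "\<alpha> = 0" using alpha_nonneg[OF inf] incomplete_if_alpha_pos[OF inf] assms by fastforce
  then have "t * (3 * t - (real m - 2)) = 0"
    using m1 by (simp add: fam_\<alpha>_def power2_eq_square algebra_simps)
  then consider "t = 0" | "3 * t = real m - 2" by auto
  then show ?thesis
  proof cases
    case 1
    then show ?thesis using parameter_zero by blast
  next
    case 2
    consider "0 < t" | "t = 0" | "t < 0" by linarith
    then show ?thesis
    proof cases
      case 1
      then show ?thesis using parameter_exponential 2 by blast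
    next
      case 2
      then show ?thesis using parameter_zero by blast
    next
      case 3
      then have m: "m = 1" using 2 m1 by linarith
      then have t: "t = - (1 / 3)" using 2 by simp
      \<comment> \<open>For m = 1 and t = - 1/3 the polynomial is - \<rho>^3/3 + \<rho>^2 - 2/3,
        which is negative at 3, so the end cannot be infinite.\<close>
      have "0 < fam_cubic m t (3 * a / a)" using a0 by (intro fam_cubic_pos[OF m1 a0]) (simp_all add: inf)
      then show ?thesis using a0 by (simp add: fam_cubic_def fam_coeff_defs m t power2_eq_square)
    qed
  qed
next
  case MInf
  then show ?thesis using fam_end_greater[OF m1 a0, of t] by simp
qed

text \<open>The sign conditions leave one change of sign among the coefficients of the cubic. It is
  thus (k - \<rho>) times a quadratic with nonnegative coefficients and positive constant term: the
  zero is simple and h'' has a simple pole at c.\<close>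

lemma cone_case:
  assumes c: "fam_end m a t = ereal c" "a < c" "fam_cubic m t (c / a) = 0"
    and coeffs: "\<alpha> \<le> 0" "0 \<le> \<alpha> + fam_\<beta> m t + 1" "fam_\<delta> m t < 0"
  shows "\<not> complete_metric m a (fam_end m a t) h" "\<exists>p>0. cone_extension m a (fam_end m a t) h p"
proof -
  define k where "k = c / a"
  have k: "1 < k" "c = a * k" using c(2) a0 by (simp_all add: k_def)
  \<comment> \<open>Coefficients of the quotient of the cubic by k - \<rho>, found by division from
    the constant term upwards.\<close>
  define e0 where "e0 = - fam_\<delta> m t / k"
  define e1 where "e1 = (\<alpha> + fam_\<beta> m t + 1 + e0) / k"
  define e2 where "e2 = - \<alpha>"
  have e: "0 < e0" "0 \<le> e2" using coeffs k by (simp_all add: e0_def e2_def divide_neg_pos)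
  have "0 \<le> \<alpha> + fam_\<beta> m t + 1 + e0" using coeffs(2) e(1) by linarith
  then have e': "0 \<le> e1" using k by (simp add: e1_def)
  note e = e(1) e' e(2)
  define R where "R \<rho> = e2 * \<rho>^2 + e1 * \<rho> + e0" for \<rho>
  have ke: "k * e0 = - fam_\<delta> m t" "k * e1 = \<alpha> + fam_\<beta> m t + 1 + e0"
    using k by (simp_all add: e0_def e1_def)
  have root: "\<alpha> * k^3 + (\<alpha> + fam_\<beta> m t) * k^2 + (\<alpha> + fam_\<beta> m t + 1) * k - fam_\<delta> m t = 0"
    using c(3) by (simp add: fam_cubic_def k_def)
  have "k * (k * (\<alpha> * k + (\<alpha> + fam_\<beta> m t) + e1)) = 0"
  proof -
    have "k * (k * (\<alpha> * k + (\<alpha> + fam_\<beta> m t) + e1)) = \<alpha> * k^3 + (\<alpha> + fam_\<beta> m t) * k^2 + k * (k * e1)"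
      by (simp add: algebra_simps eval_nat_numeral)
    also have "k * (k * e1) = (\<alpha> + fam_\<beta> m t + 1) * k + k * e0" unfolding ke(2) by (simp add: algebra_simps)
    finally show ?thesis using root unfolding ke(1) by simp
  qed
  then have "\<alpha> * k + (\<alpha> + fam_\<beta> m t) + e1 = 0" using k(1) by (simp only: mult_eq_0_iff) auto
  then have e1': "\<alpha> + fam_\<beta> m t = k * e2 - e1" by (simp add: e2_def mult.commute)
  have CR: "fam_cubic m t \<rho> = (k - \<rho>) * R \<rho>" for \<rho>
  proof -
    have 1: "\<alpha> = - e2" "\<alpha> + fam_\<beta> m t + 1 = k * e1 - e0" "fam_\<delta> m t = - (k * e0)"
      using ke by (simp_all add: e2_def)
    show ?thesis unfolding fam_cubic_def 1(2,3) unfolding e1' unfolding 1(1) R_def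
      by (simp add: algebra_simps eval_nat_numeral)
  qed
  have R_ge: "e0 \<le> R \<rho>" if "0 \<le> \<rho>" for \<rho> using that e by (simp add: R_def)
  have R_le: "R \<rho> \<le> R k" if "0 \<le> \<rho>" "\<rho> \<le> k" for \<rho>
    unfolding R_def using that e by (intro add_mono mult_left_mono power_mono) auto
  have prof: "profile h r = (r - a) * ((c - r) * R (r / a))" if r: "a < r" "r < c" for r
  proof -
    have "profile h r = a^2 * ((r / a - 1) * ((k - r / a) * R (r / a)))"
      using r by (simp add: profile_family c(1) fam_poly_factor[OF m1] CR)
    also have "\<dots> = (a * (r / a - 1)) * ((a * (k - r / a)) * R (r / a))" by (simp add: power2_eq_square)
    finally have *: "profile h r = (a * (r / a - 1)) * ((a * (k - r / a)) * R (r / a))" .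
    have "a * (r / a - 1) = r - a" "a * (k - r / a) = c - r" using a0 by (simp_all add: k(2) field_simps)
    then show ?thesis using * by simp
  qed
  show "\<not> complete_metric m a (fam_end m a t) h"
  proof (rule incomplete_finite_case[OF c(1), of "c * (c * R k)" "(c - a) / 2 * e0" "(a + c) / 2"])
    have "0 < R k" using R_ge[of k] e k by simp
    then show "0 < c * (c * R k)" using c(2) a0 by simp
    show "0 < (c - a) / 2 * e0" "a < (a + c) / 2" "(a + c) / 2 < c" using c(2) e by simp_all
    fix r assume r: "a < r" "r < c"
    have "0 \<le> r / a" "r / a \<le> k" using r a0 by (simp_all add: k_def divide_right_mono)
    then show "profile h r \<le> c * (c * R k)"
      unfolding prof[OF r] using r a0 R_le[of "r / a"] R_ge[of "r / a"] e by (intro mult_mono mult_nonneg_nonneg) auto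
  next
    fix r assume r: "(a + c) / 2 \<le> r" "r < c"
    have ar: "a < r" using r c(2) by simp
    have "(c - a) / 2 * ((c - r) * e0) \<le> (r - a) * ((c - r) * R (r / a))"
      using r ar a0 e R_ge[of "r / a"] by (intro mult_mono mult_left_mono) auto
    then show "(c - a) / 2 * e0 * (c - r) \<le> profile h r"
      unfolding prof[OF ar r(2)] by (simp add: mult_ac)
  qed
  have m: "0 < real m" using m1 by simp
  have Rk: "0 < R k" using R_ge[of k] e k by simp
  \<comment> \<open>Dictated by the pole at the far end: the coefficient of 1/(c - r) in h'' is
    k/((k - 1) R k) and has to be p/m.\<close>
  define p where "p = m * k / ((k - 1) * R k)"
  have p: "0 < p" "R k * (p * (k - 1)) = m * k" using m k Rk by (simp_all add: p_def)
  have R1: "R 1 * (k - 1) = m" using fam_cubic_1[OF m1, of t] CR[of 1] by (simp add: mult.commute)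
  \<comment> \<open>The linear quotient in \<open>N\<close>, read off from the two highest powers of
    \<rho>.\<close>
  define n1 where "n1 = e2 * (p - 1)"
  define n0 where "n0 = n1 * (k + 1) + (e2 * (k - p) + e1 * (p - 1))"
  have N: "m * \<rho> - R \<rho> * ((k - \<rho>) + p * (\<rho> - 1)) = (\<rho> - 1) * (k - \<rho>) * (n1 * \<rho> + n0)" for \<rho> :: real
  proof -
    \<comment> \<open>The choice of n1 and n0 makes F affine in \<rho>. It vanishes at 1, because R
      1 (k - 1) = m, and at k, by the choice of p; so it is zero.\<close>
    define F where "F \<rho> = m * \<rho> - R \<rho> * ((k - \<rho>) + p * (\<rho> - 1)) - (\<rho> - 1) * (k - \<rho>) * (n1 * \<rho> + n0)" for \<rho> :: real
    define f1 where "f1 = F 1 - F 0"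
    have lin: "F \<rho> = f1 * \<rho> + F 0" for \<rho>
      unfolding f1_def F_def R_def n0_def n1_def by (simp add: algebra_simps eval_nat_numeral)
    have "F 1 = 0" using R1 by (simp add: F_def)
    moreover have "F k = 0" using p(2) by (simp add: F_def)
    ultimately have z: "f1 + F 0 = 0" "f1 * k + F 0 = 0" using lin[of 1] lin[of k] by simp_all
    have "f1 * (k - 1) = (f1 * k + F 0) - (f1 + F 0)" by (simp add: algebra_simps)
    then have "f1 * (k - 1) = 0" using z by simp
    then have "f1 = 0" using k by simp
    with z(1) have "F \<rho> = 0" using lin[of \<rho>] by simp
    then show ?thesis by (simp add: F_def)
  qed
  define U where "U = {0<..} \<inter> {r. 0 < R (r / a)}"
  \<comment> \<open>What is left of h'' once both poles are removed; R is positive on the closed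
    interval, so the formula extends past both ends.\<close>
  define H where "H r = (n1 * (r * inverse a) + n0) / (a * m * R (r / a)) + - inverse r" for r
  have contR: "continuous_on UNIV (\<lambda>r. R (r / a))"
    unfolding R_def divide_inverse by (intro continuous_intros)
  have U: "open U"
    unfolding U_def by (intro open_Int open_greaterThan open_Collect_less contR continuous_intros)
  have smR: "smooth_on U (\<lambda>r. R (r / a))"
    unfolding R_def divide_inverse
    by (intro smooth_on_add smooth_on_mult smooth_on_power smooth_on_ident smooth_on_const U)
  have sm: "smooth_on U H"
  proof -
    have "smooth_on U (\<lambda>r. (n1 * (r * inverse a) + n0) / (a * m * R (r / a)) + - 1 * inverse r)"
      by (intro smooth_on_add smooth_on_mult smooth_on_divide smooth_on_inverse smR smooth_on_ident smooth_on_const U)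
         (use a0 m in \<open>auto simp: U_def\<close>)
    then show ?thesis by (simp add: H_def[abs_def])
  qed
  have "smooth_up_to {a..c} (\<lambda>r. (deriv ^^ 2) h r - 1 / real m * (1 / (r - a) + p / (c - r)))"
    unfolding smooth_up_to_def
  proof (intro exI conjI ballI)
    show "open U" by (rule U)
    show "smooth_on U H" by (rule sm)
    show "{a..c} \<subseteq> U"
    proof
      fix r assume "r \<in> {a..c}"
      then have "0 < r" "0 \<le> r / a" using a0 by auto
      then show "r \<in> U" using R_ge[of "r / a"] e by (simp add: U_def)
    qed
    fix r assume "r \<in> interior {a..c}"
    then have r: "a < r" "r < c" by (auto simp: interior_atLeastAtMost_real)
    define \<rho> where "\<rho> = r / a"
    have \<rho>: "1 < \<rho>" "\<rho> < k" "r = a * \<rho>" using r a0 by (simp_all add: \<rho>_def k_def divide_strict_right_mono)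
    have Rp: "0 < R \<rho>" using R_ge[of \<rho>] e \<rho> by simp
    have "(deriv ^^ 2) h r = fam_h2 m a t r" using member r by (auto simp: family_member_def c(1))
    also have "\<dots> = (\<rho>^2 / ((\<rho> - 1) * ((k - \<rho>) * R \<rho>)) - 1) / r"
      by (simp add: fam_h2_def \<rho>_def fam_poly_factor[OF m1] CR)
    also have "\<dots> = \<rho> / ((\<rho> - 1) * ((k - \<rho>) * R \<rho>)) / a - inverse r"
      using \<rho> a0 by (simp add: \<rho>(3) diff_divide_distrib power2_eq_square inverse_eq_divide)
    finally have h2: "(deriv ^^ 2) h r = \<rho> / ((\<rho> - 1) * ((k - \<rho>) * R \<rho>)) / a - inverse r" .
    have nz: "\<rho> - 1 \<noteq> 0" "k - \<rho> \<noteq> 0" "R \<rho> \<noteq> 0" "a \<noteq> 0" "real m \<noteq> 0" using \<rho> Rp a0 m by auto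
    have poles: "1 / (r - a) + p / (c - r) = ((k - \<rho>) + p * (\<rho> - 1)) / ((\<rho> - 1) * (k - \<rho>)) / a"
    proof -
      have "r - a = a * (\<rho> - 1)" "c - r = a * (k - \<rho>)" by (simp_all add: \<rho>(3) k(2) algebra_simps)
      then show ?thesis using nz by (simp add: divide_simps)
    qed
    define D where "D = (\<rho> - 1) * (k - \<rho>)"
    have D: "D \<noteq> 0" using nz by (simp add: D_def)
    define X where "X = (k - \<rho>) + p * (\<rho> - 1)"
    have NX: "m * \<rho> - R \<rho> * X = D * (n1 * \<rho> + n0)" using N[of \<rho>] by (simp add: X_def D_def)
    have "\<rho> / (D * R \<rho>) / a - 1 / m * (X / D / a) = (m * \<rho> - R \<rho> * X) / (D * (a * m * R \<rho>))"
      using nz D by (simp add: field_simps)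
    also have "\<dots> = (n1 * \<rho> + n0) / (a * m * R \<rho>)" unfolding NX using D by simp
    finally have main: "\<rho> / (D * R \<rho>) / a - 1 / m * (X / D / a) = (n1 * \<rho> + n0) / (a * m * R \<rho>)" .
    show "H r = (deriv ^^ 2) h r - 1 / real m * (1 / (r - a) + p / (c - r))"
      unfolding h2 poles using main by (simp add: H_def \<rho>_def D_def X_def divide_inverse mult.assoc)
  qed
  then show "\<exists>p>0. cone_extension m a (fam_end m a t) h p"
    unfolding cone_extension_def using c(1) p(1) by blast
qed

end

section \<open>Parameters that realise each behaviour\<close>

lemma exponential_witness:
  assumes "m \<ge> 3" "0 < a"
  shows "\<exists>t h. family_member m a t h \<and> complete_metric m a (fam_end m a t) h \<and>
    exponential_volume_growth m a (fam_end m a t) h"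
proof -
  let ?t = "(real m - 2) / 3"
  obtain h where h: "family_member m a ?t h" using family_member_exists[of m a ?t] assms by auto
  then interpret family_metric m a ?t h using assms by unfold_locales auto
  have "3 * ?t = real m - 2" "0 < ?t" using assms by auto
  then show ?thesis using parameter_exponential h by blast
qed

lemma quartic_witness:
  assumes "m \<ge> 1" "0 < a"
  shows "\<exists>t h. family_member m a t h \<and> complete_metric m a (fam_end m a t) h \<and>
    quartic_volume_growth m a (fam_end m a t) h"
proof -
  obtain h where h: "family_member m a 0 h" using family_member_exists assms by blast
  then interpret family_metric m a 0 h using assms by unfold_locales auto
  show ?thesis using parameter_zero h by blast
qed

text \<open>For m = 1 this parameter gives the cubic a double zero at \<rho> = 3, which puts the end
  at finite r and infinite distance.\<close>

lemma finite_volume_witness: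
  assumes "0 < a"
  shows "\<exists>t h. family_member 1 a t h \<and> complete_metric 1 a (fam_end 1 a t) h \<and>
    finite_volume 1 a (fam_end 1 a t) h"
proof -
  let ?t = "- 1 / 2 :: real"
  obtain h where h: "family_member 1 a ?t h" using family_member_exists[of 1 a ?t] assms by auto
  then interpret family_metric 1 a ?t h using assms by unfold_locales auto
  have C: "fam_cubic (real 1) ?t \<rho> = (\<rho> - 3)^2 * (\<rho> + 1) / 8" for \<rho>
    by (simp add: fam_cubic_def fam_coeff_defs field_simps eval_nat_numeral)
  have end_eq: "fam_end 1 a ?t = ereal (3 * a)"
  proof (rule fam_end_cases[OF m1 a0, of ?t])
    assume "\<And>r. a \<le> r \<Longrightarrow> 0 < fam_cubic (real 1) ?t (r / a)"
    from this[of "3 * a"] show ?thesis unfolding C using a0 by simp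
  next
    fix c assume c: "fam_end 1 a ?t = ereal c" "a < c" "fam_cubic (real 1) ?t (c / a) = 0"
    have "c / a + 1 \<noteq> 0" using c(2) a0 by (simp add: add_pos_pos less_imp_neq[symmetric])
    then have "c / a = 3" using c(3) unfolding C by simp
    then show ?thesis using c(1) a0 by (simp add: field_simps)
  qed
  have "complete_metric 1 a (fam_end 1 a ?t) h"
  proof (rule complete_finite_case[OF end_eq, of 1])
    fix r assume r: "a < r" "r < 3 * a"
    define \<rho> where "\<rho> = r / a"
    have \<rho>: "1 < \<rho>" "\<rho> < 3" "r = a * \<rho>" using r a0 by (simp_all add: \<rho>_def divide_less_eq)
    \<comment> \<open>On 1 < \<rho> < 3 the cofactor (\<rho> - 1) (\<rho> + 1)/8 of the squared
      factor is at most 1, the constant passed to \<open>complete_finite_case\<close>.\<close>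
    have "(\<rho> - 1) * (\<rho> + 1) \<le> 2 * 4" using \<rho> by (intro mult_mono) auto
    then have "(\<rho> - 1) * (\<rho> + 1) / 8 * (a * (3 - \<rho>))^2 \<le> 1 * (a * (3 - \<rho>))^2"
      by (intro mult_right_mono) auto
    moreover have "profile h r = a^2 * ((\<rho> - 1) * ((\<rho> - 3)^2 * (\<rho> + 1) / 8))"
    proof -
      have "r \<in> ival a (fam_end 1 a ?t)" unfolding end_eq using r by simp
      then have "profile h r = a^2 * fam_poly 1 ?t \<rho>" unfolding \<rho>_def by (rule profile_family)
      then show ?thesis unfolding fam_poly_factor[OF m1] C .
    qed
    moreover have "a^2 * ((\<rho> - 1) * ((\<rho> - 3)^2 * (\<rho> + 1) / 8)) = (\<rho> - 1) * (\<rho> + 1) / 8 * (a * (3 - \<rho>))^2"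
      unfolding power2_commute[of \<rho> 3] by (simp add: power_mult_distrib)
    moreover have "3 * a - r = a * (3 - \<rho>)" by (simp add: \<rho>(3) algebra_simps)
    ultimately show "profile h r \<le> 1 * (3 * a - r)^2" by (simp only:)
  qed simp
  then show ?thesis using h finite_volumeI[OF end_eq] by blast
qed

text \<open>For m \<ge> 3 the parameter (m - 2)/6 minimises \<alpha>, which is negative there. For m
  = 1 the parameter - 1/3 has \<alpha> = 0 and \<beta> = - 1/3. Either way the end is finite and
  \<open>cone_case\<close> applies. For m = 2 the coefficient \<alpha> = 3 t^2/4 is never
  negative.\<close>

lemma cone_witness:
  assumes m: "m \<ge> 1" "m \<noteq> 2" and a: "0 < a"
  shows "\<exists>t h. family_member m a t h \<and> \<not> complete_metric m a (fam_end m a t) h \<and>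
    (\<exists>p>0. cone_extension m a (fam_end m a t) h p)"
proof -
  let ?t = "if m = 1 then - 1 / 3 else (real m - 2) / 6"
  obtain h where h: "family_member m a ?t h" using family_member_exists[of m a ?t] m a by auto
  then interpret family_metric m a ?t h using m a by unfold_locales auto
  have "\<alpha> \<le> 0 \<and> 0 \<le> \<alpha> + fam_\<beta> m ?t + 1 \<and> fam_\<delta> m ?t < 0 \<and> fam_end m a ?t \<noteq> \<infinity>"
  proof (cases "m = 1")
    case True
    have "fam_end m a ?t \<noteq> \<infinity>"
    proof
      assume "fam_end m a ?t = \<infinity>"
      then have "0 < fam_cubic m ?t (3 * a / a)" using a0 by (intro fam_cubic_pos[OF m1 a0]) simp_all
      then show False using a0 by (simp add: fam_cubic_def fam_coeff_defs True power2_eq_square)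
    qed
    then show ?thesis by (simp add: True fam_coeff_defs power2_eq_square)
  next
    case False
    define s where "s = (real m - 2) / 6"
    have t: "?t = s" using False by (simp add: s_def)
    have ms: "real m = 6 * s + 2" unfolding s_def by (simp add: diff_divide_distrib)
    have s: "0 < s" using False m by (simp add: s_def)
    have \<alpha>: "fam_\<alpha> m s = - (3 * s^2) / (12 * s + 4)"
      unfolding fam_\<alpha>_def ms by (simp add: power2_eq_square)
    have neg: "fam_\<alpha> m s < 0" unfolding \<alpha> using s by (intro divide_neg_pos) (simp_all add: add_pos_pos)
    have "fam_\<beta> m s = s - 2 * fam_\<alpha> m s" using fam_coeffs(1)[of "real m" s] m1 by simp
    moreover have "fam_\<delta> m s = 2 * s + 1 - real m - fam_\<alpha> m s"
      using fam_coeffs(1-3)[of "real m" s] m1 by simp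
    moreover have "- fam_\<alpha> m s \<le> s"
      unfolding \<alpha> using s by (simp add: pos_divide_le_eq power2_eq_square algebra_simps)
    ultimately show ?thesis unfolding t using neg s alpha_nonneg unfolding t by (auto simp: ms)
  qed
  then have *: "\<alpha> \<le> 0" "0 \<le> \<alpha> + fam_\<beta> m ?t + 1" "fam_\<delta> m ?t < 0" "fam_end m a ?t \<noteq> \<infinity>" by auto
  show ?thesis
  proof (rule fam_end_cases[OF m1 a0, of ?t])
    fix c assume "fam_end m a ?t = ereal c" "a < c" "fam_cubic m ?t (c / a) = 0"
    from cone_case[OF this *(1-3)] show ?thesis using h by blast
  qed (use *(4) in blast)
qed

text \<open>At t = m both \<gamma> and \<delta> vanish and the cubic is \<rho>^2 ((m + 1) \<rho> -
  1), without zeros beyond 1. The end is infinite with \<alpha> = m + 1 > 0, hence at finite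
  distance, and there is no finite edge to carry a cone angle.\<close>

lemma other_singular_witness:
  assumes "m \<ge> 1" "0 < a"
  shows "\<exists>t h. family_member m a t h \<and> other_singular_behaviour m a (fam_end m a t) h"
proof -
  obtain h where h: "family_member m a (real m) h" using family_member_exists assms by blast
  then interpret family_metric m a "real m" h using assms by unfold_locales auto
  have m: "real m \<ge> 1" using m1 by simp
  have \<alpha>: "\<alpha> = real m + 1" using m by (simp add: fam_\<alpha>_def power2_eq_square field_simps)
  have \<beta>: "fam_\<beta> m m = - real m - 2" and \<delta>: "fam_\<delta> m m = 0"
    using fam_coeffs(1-3)[of "real m" "real m"] m \<alpha> by simp_all
  have C: "fam_cubic m m \<rho> = \<rho>^2 * ((real m + 1) * \<rho> - 1)" for \<rho>
    unfolding fam_cubic_def \<alpha> \<beta> \<delta> by (simp add: algebra_simps eval_nat_numeral)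
  have inf: "fam_end m a m = \<infinity>"
  proof (rule fam_end_cases[OF m1 a0, of "real m"])
    fix c assume c: "a < c" "fam_cubic m m (c / a) = 0"
    then have \<rho>: "1 < c / a" using a0 by simp
    then have "1 * 1 < (real m + 1) * (c / a)" using m by (intro mult_strict_mono) auto
    then show ?thesis using c(2) \<rho> unfolding C by auto
  qed
  have "\<not> complete_metric m a (fam_end m a m) h" by (rule incomplete_if_alpha_pos[OF inf]) (simp add: \<alpha>)
  then have "other_singular_behaviour m a (fam_end m a m) h"
    by (simp add: other_singular_behaviour_def cone_extension_def inf)
  then show ?thesis using h by blast
qed

theorem theorem1p1:
  fixes m :: nat and a :: real
  assumes "m \<ge> 1" and "a > 0"
  shows
    \<comment> \<open>every parameter gives Bach-flat Kaehler metrics on their maximal domain, with the stated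
        alternatives\<close>
    "(\<forall>t. (\<exists>h. family_member m a t h) \<and>
       (\<forall>h. family_member m a t h \<longrightarrow>
          u2_kaehler_maximal m a (fam_end m a t) h \<and>
          bach_flat a (fam_end m a t) h \<and>
          (complete_metric m a (fam_end m a t) h \<longrightarrow>
             exponential_volume_growth m a (fam_end m a t) h \<or>
             quartic_volume_growth m a (fam_end m a t) h \<or>
             finite_volume m a (fam_end m a t) h) \<and>
          (\<not> complete_metric m a (fam_end m a t) h \<longrightarrow>
             (\<exists>p>0. cone_extension m a (fam_end m a t) h p) \<or>
             other_singular_behaviour m a (fam_end m a t) h)))
     \<and>
     \<comment> \<open>changing \<open>a\<close> amounts to scaling the metric\<close>
     (\<forall>t c h h'. c > 0 \<and> family_member m a t h \<and> family_member m (c * a) t h' \<longrightarrow>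
        fam_end m (c * a) t = ereal c * fam_end m a t \<and>
        (\<forall>p v w. act p \<in> int_polygon a (fam_end m a t) \<longrightarrow>
           dilation c v \<bullet> (toric_metric h' (dilation c p) *v dilation c w)
             = c * (v \<bullet> (toric_metric h p *v w))))
     \<and>
     \<comment> \<open>every U(2)-invariant Bach-flat Kaehler metric belongs to the family\<close>
     (\<forall>b h. u2_kaehler m a b h \<and> bach_flat a b h \<longrightarrow>
        (\<exists>!t. b \<le> fam_end m a t \<and>
              (\<forall>r. a < r \<and> ereal r < b \<longrightarrow> (deriv ^^ 2) h r = fam_h2 m a t r) \<and>
              (u2_kaehler_maximal m a b h \<longrightarrow> b = fam_end m a t \<and> family_member m a t h)))
     \<and>
     \<comment> \<open>all behaviours occur as \<open>m\<close> ranges over the positive integers\<close>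
     (m \<ge> 3 \<longrightarrow>
        (\<exists>t h. family_member m a t h \<and> complete_metric m a (fam_end m a t) h \<and>
               exponential_volume_growth m a (fam_end m a t) h))
     \<and>
     (\<exists>t h. family_member m a t h \<and> complete_metric m a (fam_end m a t) h \<and>
            quartic_volume_growth m a (fam_end m a t) h)
     \<and>
     (m = 1 \<longrightarrow>
        (\<exists>t h. family_member m a t h \<and> complete_metric m a (fam_end m a t) h \<and>
               finite_volume m a (fam_end m a t) h))
     \<and>
     (m \<noteq> 2 \<longrightarrow>
        (\<exists>t h. family_member m a t h \<and> \<not> complete_metric m a (fam_end m a t) h \<and>
               (\<exists>p>0. cone_extension m a (fam_end m a t) h p)))
     \<and>
     (\<exists>t h. family_member m a t h \<and> other_singular_behaviour m a (fam_end m a t) h)"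
proof -
  have fm: "family_metric m a t h" if "family_member m a t h" for t h
    using that assms by unfold_locales
  have part1: "(\<exists>h. family_member m a t h) \<and>
       (\<forall>h. family_member m a t h \<longrightarrow>
          u2_kaehler_maximal m a (fam_end m a t) h \<and>
          bach_flat a (fam_end m a t) h \<and>
          (complete_metric m a (fam_end m a t) h \<longrightarrow>
             exponential_volume_growth m a (fam_end m a t) h \<or>
             quartic_volume_growth m a (fam_end m a t) h \<or>
             finite_volume m a (fam_end m a t) h) \<and>
          (\<not> complete_metric m a (fam_end m a t) h \<longrightarrow>
             (\<exists>p>0. cone_extension m a (fam_end m a t) h p) \<or>
             other_singular_behaviour m a (fam_end m a t) h))" for t
  proof (intro conjI allI impI)
    show "\<exists>h. family_member m a t h" by (rule family_member_exists[OF assms])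
    fix h assume h: "family_member m a t h"
    show "u2_kaehler_maximal m a (fam_end m a t) h" by (rule family_maximal[OF assms h])
    show "bach_flat a (fam_end m a t) h" by (rule family_bach_flat[OF assms h])
    show "exponential_volume_growth m a (fam_end m a t) h \<or> quartic_volume_growth m a (fam_end m a t) h \<or>
        finite_volume m a (fam_end m a t) h" if "complete_metric m a (fam_end m a t) h"
      by (rule family_metric.complete_cases[OF fm[OF h] that])
    \<comment> \<open>\<open>other_singular_behaviour\<close> is by definition the complement of the
      cone case among incomplete metrics; that it occurs is the content of
      \<open>other_singular_witness\<close>.\<close>
    show "(\<exists>p>0. cone_extension m a (fam_end m a t) h p) \<or> other_singular_behaviour m a (fam_end m a t) h"
      if "\<not> complete_metric m a (fam_end m a t) h"
      using that by (auto simp: other_singular_behaviour_def)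
  qed
  have part2: "fam_end m (c * a) t = ereal c * fam_end m a t \<and>
        (\<forall>p v w. act p \<in> int_polygon a (fam_end m a t) \<longrightarrow>
           dilation c v \<bullet> (toric_metric h' (dilation c p) *v dilation c w)
             = c * (v \<bullet> (toric_metric h p *v w)))"
    if "c > 0 \<and> family_member m a t h \<and> family_member m (c * a) t h'" for t c h h'
    using that fam_end_scale[OF assms, of c t] family_dilation[OF assms, of c t h h'] by simp
  have part4: "m = 1 \<longrightarrow> (\<exists>t h. family_member m a t h \<and> complete_metric m a (fam_end m a t) h \<and>
      finite_volume m a (fam_end m a t) h)"
    using finite_volume_witness[OF assms(2)] by (intro impI) (simp only:)
  show ?thesis
    by (intro conjI part4;
        (intro impI, rule exponential_witness[OF _ assms(2)], assumption)?;
        (intro impI, rule cone_witness[OF assms(1) _ assms(2)], assumption)?;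
        (rule quartic_witness[OF assms])?;
        (rule other_singular_witness[OF assms])?;
        (intro allI impI, rule bach_flat_in_family[OF assms], erule conjunct1, erule conjunct2)?;
        (intro allI, rule part1)?;
        (intro allI impI, rule part2, assumption)?)
qed

end
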